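(* Let $\Omega_0\subset\mathbb{R}^2$ be a bounded, smooth domain, and let the spatial step $h>0$ and the time step $\tau>0$ be related by $h=C\tau^{\gamma}$, where $C>0$ and $\gamma>1$ are fixed constants. Let $\{u_k^{m,n}\}_{k\ge 0,\,(m,n)\in\mathbb{Z}^2}$ be the sequence produced from $\Omega_0$ by the space-time discrete thresholding scheme with steps $h,\tau$ (described in the context). For $x\in\mathbb{R}^2$, $t>0$ define $$\underline{u}(x,t)=\liminf_{h\to0,\ k\tau\to t,\ (mh,nh)\to x}u_k^{m,n},\qquad \bar{u}(x,t)=\limsup_{h\to0,\ k\tau\to t,\ (mh,nh)\to x}u_k^{m,n}.$$ Then $\bar u$ is a viscosity subsolution and $\underline u$ is a viscosity supersolution of the mean curvature equation $$\frac{\partial u}{\partial t}=\Delta u-\frac{(D^2u\,Du\,|\,Du)}{|Du|^2}\qquad\text{in }\mathbb{R}^2\times(0,\infty).$$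
   Context: Discretization: $\Omega_0^h=\{(m,n)\in\mathbb{Z}^2:\ \mathrm{dist}[(mh,nh),\Omega_0]\le h\}$. Scheme: $u_0^{m,n}=1$ if $(m,n)\in\Omega_0^h$ and $u_0^{m,n}=-1$ otherwise. Given $u_k=\{u_k^{m,n}\}$, let $w^{m,n}(t)$, $0\le t\le\tau$, be the bounded solution of the semi-discrete heat equation $$\frac{d}{dt}w^{m,n}=\frac1{h^2}\left[w^{m+1,n}+w^{m-1,n}+w^{m,n+1}+w^{m,n-1}-4w^{m,n}\right],\qquad w^{m,n}(0)=u_k^{m,n},\qquad (m,n)\in\mathbb{Z}^2,$$ and set $u_{k+1}^{m,n}=\mathrm{sign}(w^{m,n}(\tau))$. Here $\mathrm{sign}(r)=1$ for $r>0$, $\mathrm{sign}(r)=-1$ for $r<0$, and $\mathrm{sign}(0)\in\{-1,1\}$ is a fixed convention, so that $u_k^{m,n}\in\{-1,1\}$. In the limits defining $\underline u,\bar u$, $\tau=(h/C)^{1/\gamma}\to0$ as $h\to0$. Viscosity solutions: a locally bounded upper semicontinuous function $u$ is a viscosity subsolution if for every $\phi\in C^2(\mathbb{R}^2\times(0,\infty))$ and every local maximum point $(x,t)\in\mathbb{R}^2\times(0,\infty)$ of $u-\phi$ one has, at $(x,t)$, $$\phi_t-\Delta\phi+\frac{(D^2\phi D\phi|D\phi)}{|D\phi|^2}\le0\ \text{ if }D\phi(x,t)\ne0,\qquad \phi_t-\Delta\phi+\lambda_{\min}(D^2\phi)\le0\ \text{ if }D\phi(x,t)=0,$$ where $\lambda_{\min}$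 is the least eigenvalue. A locally bounded lower semicontinuous function $u$ is a viscosity supersolution if for every $\phi\in C^2(\mathbb{R}^2\times(0,\infty))$ and every local minimum point $(x,t)\in\mathbb{R}^2\times(0,\infty)$ of $u-\phi$ one has, at $(x,t)$, $$\phi_t-\Delta\phi+\frac{(D^2\phi D\phi|D\phi)}{|D\phi|^2}\ge0\ \text{ if }D\phi(x,t)\ne0,\qquad \phi_t-\Delta\phi+\lambda_{\max}(D^2\phi)\ge0\ \text{ if }D\phi(x,t)=0,$$ where $\lambda_{\max}$ is the largest eigenvalue. Here $D$ and $D^2$ denote the spatial gradient and Hessian. *)

theory Defs
  imports "HOL-Analysis.Analysis"
begin

section \<open>Differential calculus\<close>

(* C^k via iterated directional derivatives; for open S in a finite-dimensional space
   this is the usual notion. *)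
fun Ck_on :: "nat \<Rightarrow> 'a::real_normed_vector set \<Rightarrow> ('a \<Rightarrow> real) \<Rightarrow> bool" where
  "Ck_on 0 S f \<longleftrightarrow> continuous_on S f"
| "Ck_on (Suc k) S f \<longleftrightarrow>
     (\<forall>x\<in>S. f differentiable (at x)) \<and>
     (\<forall>v. Ck_on k S (\<lambda>x. frechet_derivative f (at x) v))"

definition grad :: "(real^2 \<Rightarrow> real) \<Rightarrow> real^2 \<Rightarrow> real^2" where
  "grad f x = (THE D. GDERIV f x :> D)"

definition hessian :: "(real^2 \<Rightarrow> real) \<Rightarrow> real^2 \<Rightarrow> real^2^2" where
  "hessian f x = jacobian (grad f) (at x)"

definition laplacian :: "(real^2 \<Rightarrow> real) \<Rightarrow> real^2 \<Rightarrow> real" where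
  "laplacian f x = trace (hessian f x)"

definition eigenvalues :: "real^2^2 \<Rightarrow> real set" where
  "eigenvalues M = {l. \<exists>v. v \<noteq> 0 \<and> M *v v = l *\<^sub>R v}"

(* Only applied to Hessians of C^2 functions, which are symmetric, so that the set of
   eigenvalues is finite and nonempty. *)
definition lambda_min :: "real^2^2 \<Rightarrow> real" where
  "lambda_min M = Min (eigenvalues M)"

definition lambda_max :: "real^2^2 \<Rightarrow> real" where
  "lambda_max M = Max (eigenvalues M)"


section \<open>Smooth bounded domains\<close>

(* Near each boundary point the domain is a strict sublevel set of a C-infinity function
   with nonvanishing gradient; in particular it lies on one side of its boundary. *)
definition smooth_bounded_domain :: "(real^2) set \<Rightarrow> bool" where
  "smooth_bounded_domain \<Omega> \<longleftrightarrow>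
     open \<Omega> \<and> connected \<Omega> \<and> \<Omega> \<noteq> {} \<and> bounded \<Omega> \<and>
     (\<forall>p\<in>frontier \<Omega>. \<exists>U \<rho>. open U \<and> p \<in> U \<and> (\<forall>k. Ck_on k U \<rho>) \<and>
        (\<forall>x\<in>U. grad \<rho> x \<noteq> 0) \<and> \<Omega> \<inter> U = {x\<in>U. \<rho> x < 0})"


section \<open>The thresholding scheme\<close>

definition grid_point :: "real \<Rightarrow> int \<Rightarrow> int \<Rightarrow> real^2" where
  "grid_point h m n = vector [of_int m * h, of_int n * h]"

definition discrete_domain :: "(real^2) set \<Rightarrow> real \<Rightarrow> (int \<times> int) set" where
  "discrete_domain \<Omega> h = {(m, n). infdist (grid_point h m n) \<Omega> \<le> h}"

definition bounded_heat_solution ::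
  "real \<Rightarrow> real \<Rightarrow> (int \<Rightarrow> int \<Rightarrow> real) \<Rightarrow> (int \<Rightarrow> int \<Rightarrow> real \<Rightarrow> real) \<Rightarrow> bool" where
  "bounded_heat_solution h \<tau> u w \<longleftrightarrow>
     (\<exists>B. \<forall>m n. \<forall>t\<in>{0..\<tau>}. \<bar>w m n t\<bar> \<le> B) \<and>
     (\<forall>m n. w m n 0 = u m n) \<and>
     (\<forall>m n. \<forall>t\<in>{0..\<tau>}.
        (w m n has_real_derivative
           (1 / h\<^sup>2) * (w (m + 1) n t + w (m - 1) n t + w m (n + 1) t + w m (n - 1) t
                       - 4 * w m n t))
        (at t within {0..\<tau>}))"

definition sign_conv :: "real \<Rightarrow> real \<Rightarrow> real" where
  "sign_conv s0 r = (if r = 0 then s0 else sgn r)"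

(* Bounded solutions are unique on {0..\<tau>} (their values elsewhere are irrelevant), so at most
   one u satisfies this. *)
definition thresholding_scheme ::
  "real \<Rightarrow> (real^2) set \<Rightarrow> real \<Rightarrow> real \<Rightarrow> (nat \<Rightarrow> int \<Rightarrow> int \<Rightarrow> real) \<Rightarrow> bool" where
  "thresholding_scheme s0 \<Omega> h \<tau> u \<longleftrightarrow>
     (\<forall>m n. u 0 m n = (if (m, n) \<in> discrete_domain \<Omega> h then 1 else -1)) \<and>
     (\<forall>k. \<exists>w. bounded_heat_solution h \<tau> (u k) w \<and>
          (\<forall>m n. u (Suc k) m n = sign_conv s0 (w m n \<tau>)))"


section \<open>Relaxed limits\<close>

(* The filter on tuples (h, k, m, n) expressing h -> 0+, k \<tau>(h) -> t, (m h, n h) -> x. *)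
definition grid_filter ::
  "(real \<Rightarrow> real) \<Rightarrow> real^2 \<Rightarrow> real \<Rightarrow> (real \<times> nat \<times> int \<times> int) filter" where
  "grid_filter \<tau> x t =
     filtercomap (\<lambda>(h, k, m, n). (h, of_nat k * \<tau> h, grid_point h m n))
       (at_right 0 \<times>\<^sub>F (nhds t \<times>\<^sub>F nhds x))"

(* Taken in ereal, a complete lattice; for values in {-1, 1} the limits are finite. *)
definition lower_limit ::
  "(real \<Rightarrow> real) \<Rightarrow> (real \<Rightarrow> nat \<Rightarrow> int \<Rightarrow> int \<Rightarrow> real) \<Rightarrow> (real^2) \<times> real \<Rightarrow> real" where
  "lower_limit \<tau> u = (\<lambda>(x, t).
     real_of_ereal (Liminf (grid_filter \<tau> x t) (\<lambda>(h, k, m, n). ereal (u h k m n))))"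

definition upper_limit ::
  "(real \<Rightarrow> real) \<Rightarrow> (real \<Rightarrow> nat \<Rightarrow> int \<Rightarrow> int \<Rightarrow> real) \<Rightarrow> (real^2) \<times> real \<Rightarrow> real" where
  "upper_limit \<tau> u = (\<lambda>(x, t).
     real_of_ereal (Limsup (grid_filter \<tau> x t) (\<lambda>(h, k, m, n). ereal (u h k m n))))"


section \<open>Viscosity solutions of the mean curvature equation\<close>

definition space_time :: "((real^2) \<times> real) set" where
  "space_time = UNIV \<times> {0<..}"

definition locally_bounded_on :: "'a::topological_space set \<Rightarrow> ('a \<Rightarrow> real) \<Rightarrow> bool" where
  "locally_bounded_on S u \<longleftrightarrow> (\<forall>z\<in>S. \<exists>B. \<forall>\<^sub>F y in nhds z. y \<in> S \<longrightarrow> \<bar>u y\<bar> \<le> B)"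

definition usc_on :: "'a::topological_space set \<Rightarrow> ('a \<Rightarrow> real) \<Rightarrow> bool" where
  "usc_on S u \<longleftrightarrow> (\<forall>z\<in>S. \<forall>c>u z. \<forall>\<^sub>F y in at z within S. u y < c)"

definition lsc_on :: "'a::topological_space set \<Rightarrow> ('a \<Rightarrow> real) \<Rightarrow> bool" where
  "lsc_on S u \<longleftrightarrow> (\<forall>z\<in>S. \<forall>c<u z. \<forall>\<^sub>F y in at z within S. c < u y)"

definition time_deriv :: "((real^2) \<times> real \<Rightarrow> real) \<Rightarrow> real^2 \<Rightarrow> real \<Rightarrow> real" where
  "time_deriv \<phi> x t = deriv (\<lambda>s. \<phi> (x, s)) t"

definition space_grad :: "((real^2) \<times> real \<Rightarrow> real) \<Rightarrow> real^2 \<Rightarrow> real \<Rightarrow> real^2" where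
  "space_grad \<phi> x t = grad (\<lambda>y. \<phi> (y, t)) x"

definition space_hessian :: "((real^2) \<times> real \<Rightarrow> real) \<Rightarrow> real^2 \<Rightarrow> real \<Rightarrow> real^2^2" where
  "space_hessian \<phi> x t = hessian (\<lambda>y. \<phi> (y, t)) x"

definition space_laplacian :: "((real^2) \<times> real \<Rightarrow> real) \<Rightarrow> real^2 \<Rightarrow> real \<Rightarrow> real" where
  "space_laplacian \<phi> x t = laplacian (\<lambda>y. \<phi> (y, t)) x"

definition viscosity_subsolution :: "((real^2) \<times> real \<Rightarrow> real) \<Rightarrow> bool" where
  "viscosity_subsolution u \<longleftrightarrow>
     locally_bounded_on space_time u \<and> usc_on space_time u \<and>
     (\<forall>\<phi> x t. Ck_on 2 space_time \<phi> \<and> t > 0 \<and>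
        (\<forall>\<^sub>F z in nhds (x, t). u z - \<phi> z \<le> u (x, t) - \<phi> (x, t)) \<longrightarrow>
        (let p = space_grad \<phi> x t; H = space_hessian \<phi> x t in
          (p \<noteq> 0 \<longrightarrow>
             time_deriv \<phi> x t - space_laplacian \<phi> x t + ((H *v p) \<bullet> p) / (norm p)\<^sup>2 \<le> 0) \<and>
          (p = 0 \<longrightarrow>
             time_deriv \<phi> x t - space_laplacian \<phi> x t + lambda_min H \<le> 0)))"

definition viscosity_supersolution :: "((real^2) \<times> real \<Rightarrow> real) \<Rightarrow> bool" where
  "viscosity_supersolution u \<longleftrightarrow>
     locally_bounded_on space_time u \<and> lsc_on space_time u \<and>
     (\<forall>\<phi> x t. Ck_on 2 space_time \<phi> \<and> t > 0 \<and>
        (\<forall>\<^sub>F z in nhds (x, t). u z - \<phi> z \<ge> u (x, t) - \<phi> (x, t)) \<longrightarrow>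
        (let p = space_grad \<phi> x t; H = space_hessian \<phi> x t in
          (p \<noteq> 0 \<longrightarrow>
             time_deriv \<phi> x t - space_laplacian \<phi> x t + ((H *v p) \<bullet> p) / (norm p)\<^sup>2 \<ge> 0) \<and>
          (p = 0 \<longrightarrow>
             time_deriv \<phi> x t - space_laplacian \<phi> x t + lambda_max H \<ge> 0)))"

end

theory Submission
  imports Defs "HOL-Probability.Probability" "HOL-Real_Asymp.Real_Asymp"
begin

text \<open>
  One step of the scheme replaces the set \<open>{u = 1}\<close> by the set of points from which the random
  walk solving the semi-discrete heat equation hits it with probability at least \<open>1/2\<close>. If a smooth
  function touches the relaxed limit at a point where its gradient \<open>p\<close> does not vanish, then at a
  nearby grid maximum \<open>{u = 1}\<close> lies, one step earlier, in a curved half space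
  \<open>p \<bullet> z + \<surd>\<tau> q z \<ge> 0\<close> in units of \<open>\<surd>\<tau>\<close>. By the symmetry of the walk the half
  space \<open>p \<bullet> z \<ge> 0\<close> carries probability \<open>1/2\<close> up to \<open>P(p \<bullet> z = 0) / 2\<close>, so the sign of the
  \<open>\<surd>\<tau>\<close>-correction is that of the Gaussian average of \<open>q\<close> over the tangent line, which is the
  mean curvature operator; since \<open>h = o(\<tau>)\<close> the strip between the two sets is many lattice spacings
  wide and a local central limit theorem evaluates its probability.
\<close>

section \<open>Random walk representation of the semi-discrete heat flow\<close>

text \<open>The delicate regime is a test function whose gradient vanishes at the touching point.
  The discrete extrema then sit at nearby points whose gradients tend to 0 at an unknown rate. After
  division by the length of the gradient, the curvature correction has size sqrt \<tau> divided by
  that length, which may or may not be small, and the limiting direction is uncontrolled. The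
  inequality therefore survives directly only for a vanishing Hessian, and the general case is
  recovered by doubling the variable. The relation between h and \<tau> enters by comparing two
  lengths in units of sqrt \<tau>: the lattice spacing h / sqrt \<tau>, and the strip width, of
  order sqrt \<tau>. Their ratio h / \<tau> tends to 0 precisely because \<gamma> > 1. The scheme is
  used only through a weak inequality: a new point of a phase sees the old phase with probability at
  least 1/2. This holds for both phases and for either value of sign(0), so one argument proves the
  subsolution property for u and for -u, and the supersolution property follows by
  reflection.\<close>

definition step_pmf :: "(int \<times> int) pmf" where
  "step_pmf = pmf_of_set {(1, 0), (-1, 0), (0, 1), (0, -1)}"

primrec walk_pmf :: "nat \<Rightarrow> (int \<times> int) pmf" where
  "walk_pmf 0 = return_pmf (0, 0)"
| "walk_pmf (Suc n) = bind_pmf step_pmf (\<lambda>e. map_pmf ((+) e) (walk_pmf n))"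

text \<open>The continuous-time walk at time \<open>a\<close>, jumping at rate 1 to each of the four
  neighbours. Its generator is the unscaled five-point Laplacian, so physical time t corresponds to
  a = t / h^2.\<close>

definition heat_pmf :: "real \<Rightarrow> (int \<times> int) pmf" where
  "heat_pmf a = bind_pmf (poisson_pmf (4 * a)) walk_pmf"

lemma expectation_bind_pmf:
  fixes f :: "'b \<Rightarrow> real"
  assumes "\<And>x. \<bar>f x\<bar> \<le> B"
  shows "measure_pmf.expectation (bind_pmf M N) f =
    measure_pmf.expectation M (\<lambda>x. measure_pmf.expectation (N x) f)"
  unfolding measure_pmf_bind
  using measurable_measure_pmf[of N] assms
  by (intro integral_bind[where B = B and K="count_space UNIV" and B'=1])
    (auto simp: measure_pmf.finite_measure_axioms)

lemma expectation_step: "measure_pmf.expectation step_pmf f = (f (1,0) + f (-1,0) + f (0,1) + f (0,-1)) / (4::real)"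
  unfolding step_pmf_def by (subst integral_pmf_of_set) auto

lemma nn_expectation_step: "(\<integral>\<^sup>+x. f x \<partial>step_pmf) = (f (1,0) + f (-1,0) + f (0,1) + f (0,-1)) / (4::ennreal)"
  unfolding step_pmf_def by (subst nn_integral_pmf_of_set) (auto simp: add.assoc)

lemma integrable_measure_pmf_bounded:
  fixes f :: "'a \<Rightarrow> real"
  assumes "\<And>x. \<bar>f x\<bar> \<le> B"
  shows "integrable (measure_pmf M) f"
  using assms by (intro measure_pmf.integrable_const_bound[where B = B]) auto

lemma abs_expectation_pmf_le:
  fixes f :: "'a \<Rightarrow> real"
  assumes "\<And>x. \<bar>f x\<bar> \<le> B"
  shows "\<bar>measure_pmf.expectation M f\<bar> \<le> B"
proof -
  have "measure_pmf.expectation M f \<le> measure_pmf.expectation M (\<lambda>_. B)"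
    using assms by (intro integral_mono) (auto intro: integrable_measure_pmf_bounded[OF assms] abs_le_D1)
  moreover have "measure_pmf.expectation M (\<lambda>_. - B) \<le> measure_pmf.expectation M f"
    using assms by (intro integral_mono) (auto simp: abs_le_iff minus_le_iff intro: integrable_measure_pmf_bounded[OF assms])
  ultimately show ?thesis by simp
qed

definition walk_mean :: "(int \<times> int \<Rightarrow> real) \<Rightarrow> int \<times> int \<Rightarrow> nat \<Rightarrow> real" where
  "walk_mean u z n = measure_pmf.expectation (walk_pmf n) (\<lambda>e. u (z + e))"

lemma walk_mean_0: "walk_mean u z 0 = u z"
  by (simp add: walk_mean_def flip: zero_prod_def)

lemma walk_mean_Suc:
  assumes "\<And>z. \<bar>u z\<bar> \<le> B"
  shows "walk_mean u z (Suc n) = (walk_mean u (z + (1,0)) n + walk_mean u (z + (-1,0)) n +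
     walk_mean u (z + (0,1)) n + walk_mean u (z + (0,-1)) n) / 4"
  unfolding walk_mean_def walk_pmf.simps
  by (subst expectation_bind_pmf[where B = B]) (auto simp: assms expectation_step add.assoc)

lemma abs_walk_mean_le:
  assumes "\<And>z. \<bar>u z\<bar> \<le> B"
  shows "\<bar>walk_mean u z n\<bar> \<le> B"
  unfolding walk_mean_def by (rule abs_expectation_pmf_le) (use assms in auto)

text \<open>This is exp (a L) for L = 4 (S - 1), where S averages over the neighbours. The power
  series, unlike the expectation under \<open>heat_pmf\<close>, makes sense for every real
  \<open>a\<close> and can be differentiated term by term, also at a = 0.\<close>

definition heat_flow :: "(int \<times> int \<Rightarrow> real) \<Rightarrow> int \<times> int \<Rightarrow> real \<Rightarrow> real" where
  "heat_flow u z a = exp (- 4 * a) * (\<Sum>n. walk_mean u z n / fact n * (4 * a) ^ n)"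

lemma summable_bounded_exp:
  fixes c :: "nat \<Rightarrow> real"
  assumes "\<And>n. \<bar>c n\<bar> \<le> B"
  shows "summable (\<lambda>n. c n / fact n * x ^ n)"
proof (rule summable_comparison_test')
  show "summable (\<lambda>n. B * (inverse (fact n) * \<bar>x\<bar> ^ n))"
    by (intro summable_mult summable_exp)
  show "norm (c n / fact n * x ^ n) \<le> B * (inverse (fact n) * \<bar>x\<bar> ^ n)" for n
    using mult_right_mono[OF assms[of n], of "inverse (fact n) * \<bar>x\<bar> ^ n"]
    by (simp add: abs_mult divide_inverse power_abs mult.assoc)
qed

text \<open>Writing the coefficients as \<open>c n / fact n\<close> turns \<open>diffs\<close> into
  the shift of \<open>c\<close>, which for \<open>walk_mean\<close> is one more step of the
  walk.\<close>

lemma DERIV_exp_series: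
  fixes c :: "nat \<Rightarrow> real"
  assumes "\<And>n. \<bar>c n\<bar> \<le> B"
  shows "((\<lambda>x. \<Sum>n. c n / fact n * x ^ n) has_field_derivative (\<Sum>n. c (Suc n) / fact n * x ^ n)) (at x)"
proof -
  have "diffs (\<lambda>n. c n / fact n) = (\<lambda>n. c (Suc n) / fact n)"
    by (auto simp: diffs_def fun_eq_iff divide_simps)
  then show ?thesis
    using termdiffs_strong_converges_everywhere[of "\<lambda>n. c n / fact n" x] summable_bounded_exp[of c, OF assms]
    by simp
qed

lemma heat_flow_0: "heat_flow u z 0 = u z"
  using powser_zero[of "\<lambda>n. walk_mean u z n / fact n"] by (simp add: heat_flow_def walk_mean_0)

lemma heat_flow_derivative:
  assumes "\<And>z. \<bar>u z\<bar> \<le> B"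
  shows "(heat_flow u z has_real_derivative
     heat_flow u (z + (1,0)) a + heat_flow u (z + (-1,0)) a + heat_flow u (z + (0,1)) a +
     heat_flow u (z + (0,-1)) a - 4 * heat_flow u z a) (at a)"
proof -
  let ?s = "\<lambda>z a. \<Sum>n. walk_mean u z n / fact n * (4 * a) ^ n"
  have b: "\<bar>walk_mean u z n\<bar> \<le> B" for z n
    by (rule abs_walk_mean_le[OF assms])
  have "((\<lambda>a. 4 * a) has_real_derivative 4) (at a)"
    by (auto intro!: derivative_eq_intros)
  from DERIV_chain2[OF DERIV_exp_series[of "walk_mean u z", OF b] this]
  have "((\<lambda>a. \<Sum>n. walk_mean u z n / fact n * (4 * a) ^ n) has_real_derivative
     (\<Sum>n. walk_mean u z (Suc n) / fact n * (4 * a) ^ n) * 4) (at a)" .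
  also have "(\<Sum>n. walk_mean u z (Suc n) / fact n * (4 * a) ^ n) * 4 =
     ?s (z + (1,0)) a + ?s (z + (-1,0)) a + ?s (z + (0,1)) a + ?s (z + (0,-1)) a"
  proof -
    note s = summable_bounded_exp[of "walk_mean u z" for z, OF b]
    have "(\<Sum>n. walk_mean u z (Suc n) / fact n * (4 * a) ^ n) * 4 =
      (\<Sum>n. walk_mean u z (Suc n) / fact n * (4 * a) ^ n * 4)"
      by (rule suminf_mult2[OF summable_bounded_exp[of "\<lambda>n. walk_mean u z (Suc n)", OF b]])
    also have "\<dots> = (\<Sum>n. walk_mean u (z + (1,0)) n / fact n * (4 * a) ^ n + walk_mean u (z + (-1,0)) n / fact n * (4 * a) ^ n
       + walk_mean u (z + (0,1)) n / fact n * (4 * a) ^ n + walk_mean u (z + (0,-1)) n / fact n * (4 * a) ^ n)"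
      by (simp add: walk_mean_Suc[OF assms] add_divide_distrib algebra_simps)
    also have "\<dots> = ?s (z + (1,0)) a + ?s (z + (-1,0)) a + ?s (z + (0,1)) a + ?s (z + (0,-1)) a"
      by (simp only: suminf_add[symmetric] summable_add s)
    finally show ?thesis .
  qed
  finally have d: "(?s z has_real_derivative
     ?s (z + (1,0)) a + ?s (z + (-1,0)) a + ?s (z + (0,1)) a + ?s (z + (0,-1)) a) (at a)" .
  have "((\<lambda>a. exp (- 4 * a) * ?s z a) has_real_derivative (exp (- 4 * a) * (- 4)) * ?s z a
     + (?s (z + (1,0)) a + ?s (z + (-1,0)) a + ?s (z + (0,1)) a + ?s (z + (0,-1)) a) * exp (- 4 * a)) (at a)"
    by (rule DERIV_mult[OF _ d]) (auto intro!: derivative_eq_intros)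
  then show ?thesis
    unfolding heat_flow_def by (simp add: algebra_simps)
qed

lemma expectation_poisson:
  assumes "\<And>n. \<bar>c n\<bar> \<le> B" "r > 0"
  shows "measure_pmf.expectation (poisson_pmf r) c = exp (- r) * (\<Sum>n. c n / fact n * r ^ n)"
proof -
  have eq: "(\<lambda>n. pmf (poisson_pmf r) n * c n) = (\<lambda>n. exp (- r) * (c n / fact n * r ^ n))"
    using assms by (auto simp: fun_eq_iff)
  have "summable (\<lambda>n. norm (exp (- r) * (c n / fact n * r ^ n)))"
    using summable_mult[OF summable_bounded_exp[of "\<lambda>n. \<bar>c n\<bar>", where x = r and B = B], of "exp (-r)"] assms
    by (simp add: abs_mult)
  then have int: "integrable (count_space UNIV) (\<lambda>n. exp (- r) * (c n / fact n * r ^ n))"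
    by (simp add: integrable_count_space_nat_iff)
  have "measure_pmf.expectation (poisson_pmf r) c = (LINT n|count_space UNIV. pmf (poisson_pmf r) n * c n)"
    by (simp add: measure_pmf_eq_density integral_density del: pmf_poisson)
  also have "\<dots> = (\<Sum>n. exp (- r) * (c n / fact n * r ^ n))"
    unfolding eq by (rule integral_count_space_nat[OF int])
  also have "\<dots> = exp (- r) * (\<Sum>n. c n / fact n * r ^ n)"
    by (rule suminf_mult[OF summable_bounded_exp[of c, OF assms(1)]])
  finally show ?thesis .
qed

lemma heat_flow_eq_expectation:
  assumes "\<And>z. \<bar>u z\<bar> \<le> B" "a > 0"
  shows "heat_flow u z a = measure_pmf.expectation (heat_pmf a) (\<lambda>e. u (z + e))"
proof -
  have "measure_pmf.expectation (heat_pmf a) (\<lambda>e. u (z + e)) =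
     measure_pmf.expectation (poisson_pmf (4 * a)) (walk_mean u z)"
    unfolding heat_pmf_def by (subst expectation_bind_pmf[where B = B]) (auto simp: assms walk_mean_def[abs_def])
  also have "\<dots> = heat_flow u z a"
    using expectation_poisson[of "walk_mean u z", OF abs_walk_mean_le[OF assms(1)], of "4 * a"] assms(2)
    by (simp add: heat_flow_def)
  finally show ?thesis by simp
qed

section \<open>Second moments of the walk\<close>

lemma nn_moment_walk: "(\<integral>\<^sup>+e. ennreal ((real_of_int (fst e))\<^sup>2) \<partial>walk_pmf n) = ennreal (real n / 2)"
proof -
  \<comment> \<open>The induction needs an arbitrary shift \<open>c\<close>, because the first step
    of the walk changes the starting point. Each step adds 1/2, since only half of the steps move
    the first coordinate.\<close>
  have *: "(\<integral>\<^sup>+e. ennreal ((real_of_int (fst e + c))\<^sup>2) \<partial>walk_pmf n) = ennreal (real n / 2 + (real_of_int c)\<^sup>2)" for c :: int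
  proof (induction n arbitrary: c)
    case (Suc n)
    have "(\<integral>\<^sup>+e. ennreal ((real_of_int (fst e + c))\<^sup>2) \<partial>walk_pmf (Suc n)) =
      (ennreal (real n / 2 + (1 + real_of_int c)\<^sup>2) + ennreal (real n / 2 + (real_of_int c - 1)\<^sup>2) + ennreal (real n / 2 + (real_of_int c)\<^sup>2) + ennreal (real n / 2 + (real_of_int c)\<^sup>2)) / 4"
      using Suc[of "1 + c"] Suc[of "c - 1"] Suc[of "c"] by (simp add: nn_expectation_step algebra_simps)
    also have "\<dots> = ennreal (real n / 2 + (1 + real_of_int c)\<^sup>2 + (real n / 2 + (real_of_int c - 1)\<^sup>2) + (real n / 2 + (real_of_int c)\<^sup>2) + (real n / 2 + (real_of_int c)\<^sup>2)) / ennreal 4"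
      by (simp add: ennreal_plus[symmetric] del: ennreal_plus)
    also have "\<dots> = ennreal (real (Suc n) / 2 + (real_of_int c)\<^sup>2)"
      by (subst divide_ennreal) (auto simp: power2_eq_square field_simps)
    finally show ?case .
  qed simp
  show ?thesis using *[of 0] by simp
qed

lemma nn_mean_poisson:
  assumes "r > 0" shows "(\<integral>\<^sup>+n. ennreal (real n) \<partial>poisson_pmf r) = ennreal r"
proof -
  \<comment> \<open>The factor n cancels one factor of the factorial, leaving the exponential series
    shifted by one with an empty term at n = 0.\<close>
  have "(\<lambda>n. (if n = 0 then 0 else r * (exp (- r) * (r ^ (n - 1) / fact (n - 1))))) sums (r * (exp (- r) * exp r))"
    using sums_mult[OF sums_mult[OF exp_converges[of r]], of r "exp (- r)"]
    by (intro sums_Suc_iff[where s = "r * (exp (- r) * exp r)" and f = "\<lambda>n. if n = 0 then 0 else r * (exp (- r) * (r ^ (n - 1) / fact (n - 1)))", simplified, THEN iffD1]) (simp add: divide_inverse mult_ac)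
  moreover have "(if n = 0 then 0 else r * (exp (- r) * (r ^ (n - 1) / fact (n - 1)))) = r ^ n / fact n * exp (- r) * real n" for n
    by (cases n) (auto simp: divide_simps)
  ultimately have s: "(\<lambda>n. r ^ n / fact n * exp (- r) * real n) sums r"
    by (simp add: exp_minus)
  have "(\<integral>\<^sup>+n. ennreal (real n) \<partial>poisson_pmf r) = (\<Sum>n. ennreal (r ^ n / fact n * exp (- r) * real n))"
    using assms by (simp add: measure_pmf_eq_density nn_integral_density nn_integral_count_space_nat ennreal_mult'[symmetric])
  also have "\<dots> = ennreal r"
    using assms by (subst suminf_ennreal2) (use sums_unique[OF s] sums_summable[OF s] in \<open>auto simp del: times_divide_eq_left\<close>)
  finally show ?thesis .
qed

lemma nn_moment_heat_pmf:
  assumes "a > 0" shows "(\<integral>\<^sup>+e. ennreal ((real_of_int (fst e))\<^sup>2) \<partial>heat_pmf a) = ennreal (2 * a)"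
proof -
  have "(\<integral>\<^sup>+e. ennreal ((real_of_int (fst e))\<^sup>2) \<partial>heat_pmf a) = (\<integral>\<^sup>+n. ennreal (1/2) * ennreal (real n) \<partial>poisson_pmf (4 * a))"
    unfolding heat_pmf_def nn_integral_bind_pmf nn_moment_walk
    by (intro nn_integral_cong) (simp add: ennreal_mult'[symmetric] del: ennreal_half)
  also have "\<dots> = ennreal (2 * a)"
    using assms by (subst nn_integral_cmult) (auto simp: nn_mean_poisson ennreal_mult'[symmetric] simp del: ennreal_half)
  finally show ?thesis .
qed

section \<open>Uniqueness of bounded solutions\<close>

text \<open>Iterated Gronwall: the difference starts at 0, and its derivative is at most 8 / h^2
  times its supremum (four neighbours plus four times the centre). Integrating the bound k times
  produces the k-th exponential term; boundedness of both solutions is the case k = 0. As k grows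
  the bound tends to 0, which gives uniqueness.\<close>

lemma heat_solution_difference_bound:
  assumes w1: "bounded_heat_solution h \<tau> u w1" and w2: "bounded_heat_solution h \<tau> u w2"
  obtains B where "\<And>k m n t. t \<in> {0..\<tau>} \<Longrightarrow> \<bar>w1 m n t - w2 m n t\<bar> \<le> B * (8 / h\<^sup>2 * t) ^ k / fact k"
proof -
  obtain B1 B2 where B: "\<And>m n t. t \<in> {0..\<tau>} \<Longrightarrow> \<bar>w1 m n t\<bar> \<le> B1" "\<And>m n t. t \<in> {0..\<tau>} \<Longrightarrow> \<bar>w2 m n t\<bar> \<le> B2"
    using w1 w2 unfolding bounded_heat_solution_def by metis
  define d where "d m n t = w1 m n t - w2 m n t" for m n t
  define L where "L = 8 / h\<^sup>2"
  define B where "B = B1 + B2"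
  have L: "L \<ge> 0" by (simp add: L_def)
  have d0: "d m n 0 = 0" for m n
    using w1 w2 by (simp add: bounded_heat_solution_def d_def)
  have dd: "(d m n has_real_derivative (1 / h\<^sup>2) * (d (m + 1) n t + d (m - 1) n t + d m (n + 1) t + d m (n - 1) t - 4 * d m n t))
        (at t within {0..\<tau>})" if "t \<in> {0..\<tau>}" for m n t
  proof -
    have "((\<lambda>t. w1 m n t - w2 m n t) has_real_derivative (1 / h\<^sup>2) * (w1 (m + 1) n t + w1 (m - 1) n t + w1 m (n + 1) t + w1 m (n - 1) t - 4 * w1 m n t)
      - (1 / h\<^sup>2) * (w2 (m + 1) n t + w2 (m - 1) n t + w2 m (n + 1) t + w2 m (n - 1) t - 4 * w2 m n t)) (at t within {0..\<tau>})"
      using w1 w2 that unfolding bounded_heat_solution_def by (intro DERIV_diff) auto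
    then show ?thesis unfolding d_def by (simp add: algebra_simps)
  qed
  have "\<bar>d m n t\<bar> \<le> B * (L * t) ^ k / fact k" if "t \<in> {0..\<tau>}" for k m n t
    using that
  proof (induction k arbitrary: m n t)
    case 0
    then show ?case using B(1)[OF 0, of m n] B(2)[OF 0, of m n] by (simp add: d_def B_def)
  next
    case (Suc k)
    let ?b = "\<lambda>t. B * (L * t) ^ Suc k / fact (Suc k)"
    let ?d' = "\<lambda>x. (1 / h\<^sup>2) * (d (m + 1) n x + d (m - 1) n x + d m (n + 1) x + d m (n - 1) x - 4 * d m n x)"
    have b': "(?b has_real_derivative L * (B * (L * x) ^ k / fact k)) (at x within S)" for x S
    proof -
      have "((\<lambda>t. B / fact (Suc k) * (L * t) ^ Suc k) has_real_derivative B / fact (Suc k) * (real (Suc k) * (L * x) ^ k * L)) (at x within S)"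
        by (intro DERIV_cmult) (auto intro!: derivative_eq_intros simp del: power_Suc)
      then show ?thesis by (simp add: divide_simps mult_ac del: power_Suc of_nat_Suc)
    qed
    have bound: "\<bar>?d' x\<bar> \<le> L * (B * (L * x) ^ k / fact k)" if x: "x \<in> {0..\<tau>}" for x
    proof -
      let ?C = "B * (L * x) ^ k / fact k"
      have "\<bar>d (m + 1) n x + d (m - 1) n x + d m (n + 1) x + d m (n - 1) x - 4 * d m n x\<bar> \<le> 8 * ?C"
        using Suc.IH[OF x, of "m+1" n] Suc.IH[OF x, of "m-1" n] Suc.IH[OF x, of m "n+1"] Suc.IH[OF x, of m "n-1"] Suc.IH[OF x, of m n]
        by linarith
      then have "\<bar>1 / h\<^sup>2\<bar> * \<bar>d (m + 1) n x + d (m - 1) n x + d m (n + 1) x + d m (n - 1) x - 4 * d m n x\<bar> \<le> \<bar>1 / h\<^sup>2\<bar> * (8 * ?C)"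
        by (intro mult_left_mono) auto
      then show ?thesis by (simp add: L_def abs_mult)
    qed
    have "t \<ge> 0" "t \<le> \<tau>" using Suc.prems by auto
    have sub: "(f has_real_derivative f') (at x within {0..t})" if "(f has_real_derivative f') (at x within {0..\<tau>})" for f f' x
      using that by (rule DERIV_subset) (use \<open>t \<le> \<tau>\<close> in auto)
    \<comment> \<open>The upper and lower bounds are one statement: for both signs \<sigma>,
      \<open>?b - \<sigma> * d m n\<close> starts nonnegative and has nonnegative
      derivative.\<close>
    have mono: "\<sigma> * d m n t \<le> ?b t" if "\<bar>\<sigma>\<bar> = 1" for \<sigma>
    proof -
      have "?b 0 - \<sigma> * d m n 0 \<le> ?b t - \<sigma> * d m n t"
      proof (rule DERIV_nonneg_imp_increasing_open[OF \<open>0 \<le> t\<close>])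
        fix x assume x: "0 < x" "x < t"
        \<comment> \<open>At interior times the one-sided derivative of
          \<open>bounded_heat_solution\<close> is a genuine derivative.\<close>
        have "at x within {0..\<tau>} = at x"
          using x \<open>t \<le> \<tau>\<close> by (intro at_within_interior) auto
        then have "((\<lambda>x. ?b x - \<sigma> * d m n x) has_real_derivative L * (B * (L * x) ^ k / fact k) - \<sigma> * ?d' x) (at x)"
          using x \<open>t \<le> \<tau>\<close> dd[of x m n] by (intro DERIV_diff b' DERIV_cmult) auto
        moreover have "\<sigma> * ?d' x \<le> \<bar>?d' x\<bar>"
          by (metis abs_ge_self abs_mult mult_1 that)
        ultimately show "\<exists>y. ((\<lambda>x. ?b x - \<sigma> * d m n x) has_real_derivative y) (at x) \<and> 0 \<le> y"
          using bound[of x] x \<open>t \<le> \<tau>\<close> by (smt (verit) atLeastAtMost_iff)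
      next
        have "continuous_on {0..\<tau>} (d m n)"
          using dd by (rule DERIV_continuous_on)
        then show "continuous_on {0..t} (\<lambda>x. ?b x - \<sigma> * d m n x)"
          using \<open>t \<le> \<tau>\<close> by (intro continuous_intros) (auto intro: continuous_on_subset)
      qed
      then show ?thesis by (simp add: d0)
    qed
    show ?case using mono[of 1] mono[of "-1"] by (simp add: abs_le_iff)
  qed
  then show ?thesis using that[of B] by (simp add: d_def L_def)
qed

lemma bounded_heat_solution_unique:
  assumes "bounded_heat_solution h \<tau> u w1" and "bounded_heat_solution h \<tau> u w2" "t \<in> {0..\<tau>}"
  shows "w1 m n t = w2 m n t"
proof -
  obtain B where B: "\<And>k m n t. t \<in> {0..\<tau>} \<Longrightarrow> \<bar>w1 m n t - w2 m n t\<bar> \<le> B * (8 / h\<^sup>2 * t) ^ k / fact k"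
    using heat_solution_difference_bound[OF assms(1,2)] by metis
  have "(\<lambda>k. B * ((8 / h\<^sup>2 * t) ^ k / fact k)) \<longlonglongrightarrow> B * 0"
    using summable_LIMSEQ_zero[OF summable_exp[of "8 / h\<^sup>2 * t"]] by (intro tendsto_mult tendsto_const) (simp add: divide_inverse mult.commute)
  then have "\<bar>w1 m n t - w2 m n t\<bar> \<le> B * 0"
    using B[OF assms(3), of m n] by (intro LIMSEQ_le_const) (auto simp: algebra_simps)
  then show ?thesis by simp
qed

lemma bounded_heat_solution_heat_flow:
  assumes "\<And>m n. \<bar>u m n\<bar> \<le> B" "h > 0"
  shows "bounded_heat_solution h \<tau> u (\<lambda>m n t. heat_flow (case_prod u) (m, n) (t / h\<^sup>2))"
proof -
  have u: "\<bar>case_prod u z\<bar> \<le> B" for z using assms by (cases z) auto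
  have "\<bar>heat_flow (case_prod u) z a\<bar> \<le> B" if "a \<ge> 0" for z a
  proof (cases "a = 0")
    case True then show ?thesis using u by (simp add: heat_flow_0)
  next
    case False
    then show ?thesis using that u
      using abs_expectation_pmf_le[of "\<lambda>e. case_prod u (z + e)", OF u] by (simp add: heat_flow_eq_expectation[OF u])
  qed
  moreover have "((\<lambda>t. heat_flow (case_prod u) (m, n) (t / h\<^sup>2)) has_real_derivative (1 / h\<^sup>2) *
     (heat_flow (case_prod u) (m + 1, n) (t / h\<^sup>2) + heat_flow (case_prod u) (m - 1, n) (t / h\<^sup>2)
      + heat_flow (case_prod u) (m, n + 1) (t / h\<^sup>2) + heat_flow (case_prod u) (m, n - 1) (t / h\<^sup>2)
      - 4 * heat_flow (case_prod u) (m, n) (t / h\<^sup>2))) (at t within {0..\<tau>})" for m n t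
  proof -
    have d: "((\<lambda>t. t / h\<^sup>2) has_real_derivative 1 / h\<^sup>2) (at t within {0..\<tau>})"
      by (intro DERIV_cdivide DERIV_ident)
    show ?thesis
      using DERIV_chain2[OF heat_flow_derivative[where u = "case_prod u" and z = "(m, n)" and a = "t / h\<^sup>2", OF u] d]
      by (simp add: mult.commute del: times_divide_eq_left times_divide_eq_right)
  qed
  ultimately show ?thesis
    unfolding bounded_heat_solution_def using assms(2) by (auto simp: heat_flow_0 intro!: exI[of _ B])
qed

lemma bounded_heat_solution_expectation:
  assumes "bounded_heat_solution h \<tau> u w" "\<And>m n. \<bar>u m n\<bar> \<le> B" "h > 0" "\<tau> > 0"
  shows "w m n \<tau> = measure_pmf.expectation (heat_pmf (\<tau> / h\<^sup>2)) (\<lambda>(i, j). u (m + i) (n + j))"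
proof -
  have u: "\<bar>case_prod u z\<bar> \<le> B" for z using assms by (cases z) auto
  have "w m n \<tau> = heat_flow (case_prod u) (m, n) (\<tau> / h\<^sup>2)"
    using assms by (intro bounded_heat_solution_unique[OF assms(1) bounded_heat_solution_heat_flow]) auto
  also have "\<dots> = measure_pmf.expectation (heat_pmf (\<tau> / h\<^sup>2)) (\<lambda>e. case_prod u ((m, n) + e))"
    using assms by (intro heat_flow_eq_expectation[OF u]) auto
  finally show ?thesis by (simp add: case_prod_unfold)
qed

section \<open>The local central limit theorem\<close>

text \<open>The one-dimensional lattice heat kernel exp(-2a) I_j(2a), with I_j the modified Bessel
  function, written as a Fourier integral: exp(-2a(1 - cos \<theta>)) is the symbol of the lattice
  heat semigroup.\<close>

definition lattice_kernel :: "real \<Rightarrow> int \<Rightarrow> real" where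
  "lattice_kernel a j = integral {-pi..pi} (\<lambda>\<theta>. exp (- 2 * a * (1 - cos \<theta>)) * cos (of_int j * \<theta>)) / (2 * pi)"

lemma lattice_kernel_uminus: "lattice_kernel a (- j) = lattice_kernel a j"
  by (simp add: lattice_kernel_def)

lemma lattice_kernel_integrable:
  "(\<lambda>\<theta>. exp (- 2 * a * (1 - cos \<theta>)) * cos (of_int j * \<theta>)) integrable_on {-pi..pi}"
  by (intro integrable_continuous_real continuous_intros)

lemma abs_lattice_kernel_le:
  assumes "a \<ge> 0"
  shows "\<bar>lattice_kernel a j\<bar> \<le> 1"
proof -
  have "norm (integral {-pi..pi} (\<lambda>\<theta>. exp (- 2 * a * (1 - cos \<theta>)) * cos (of_int j * \<theta>))) \<le> 1 * (pi - (-pi))"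
  proof (rule integral_bound)
    show "norm (exp (- 2 * a * (1 - cos \<theta>)) * cos (of_int j * \<theta>)) \<le> 1" for \<theta>
      using assms by (auto simp: abs_mult intro!: mult_le_one)
  qed (auto intro!: continuous_intros)
  then show ?thesis
    by (simp add: lattice_kernel_def divide_simps)
qed

lemma lattice_kernel_derivative:
  "((\<lambda>a. lattice_kernel a j) has_real_derivative
     lattice_kernel a (j + 1) + lattice_kernel a (j - 1) - 2 * lattice_kernel a j) (at a within U)"
proof -
  let ?F = "\<lambda>a \<theta>. exp (- 2 * a * (1 - cos \<theta>)) * cos (of_int j * \<theta>)"
  let ?F' = "\<lambda>a \<theta>. - 2 * (1 - cos \<theta>) * exp (- 2 * a * (1 - cos \<theta>)) * cos (of_int j * \<theta>)"
  have "((\<lambda>a. integral (cbox (-pi) pi) (?F a)) has_real_derivative integral (cbox (-pi) pi) (?F' a)) (at a within UNIV)"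
    by (rule leibniz_rule_field_derivative)
      (auto intro!: derivative_eq_intros integrable_continuous_real continuous_intros simp: case_prod_unfold)
  then have d: "((\<lambda>a. integral {-pi..pi} (?F a) / (2 * pi)) has_real_derivative integral {-pi..pi} (?F' a) / (2 * pi)) (at a)"
    by (intro DERIV_cdivide) simp
  \<comment> \<open>The product formula for 2 cos \<theta> cos(j \<theta>) turns multiplication by
    the symbol into the discrete Laplacian in j.\<close>
  have "?F' a \<theta> = exp (- 2 * a * (1 - cos \<theta>)) * cos (of_int (j + 1) * \<theta>) +
     exp (- 2 * a * (1 - cos \<theta>)) * cos (of_int (j - 1) * \<theta>) - 2 * ?F a \<theta>" for \<theta>
    by (simp add: cos_add cos_diff algebra_simps)
  then have "integral {-pi..pi} (?F' a) = integral {-pi..pi} (\<lambda>\<theta>. exp (- 2 * a * (1 - cos \<theta>)) * cos (of_int (j + 1) * \<theta>) +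
     exp (- 2 * a * (1 - cos \<theta>)) * cos (of_int (j - 1) * \<theta>) - 2 * ?F a \<theta>)"
    by (simp only:)
  also have "\<dots> = integral {-pi..pi} (\<lambda>\<theta>. exp (- 2 * a * (1 - cos \<theta>)) * cos (of_int (j + 1) * \<theta>)) +
     integral {-pi..pi} (\<lambda>\<theta>. exp (- 2 * a * (1 - cos \<theta>)) * cos (of_int (j - 1) * \<theta>)) - 2 * integral {-pi..pi} (?F a)"
    by (simp only: integral_diff integral_add integrable_add lattice_kernel_integrable
        integrable_on_mult_right_iff integrable_on_mult_right integral_mult_right)
  finally show ?thesis
    using has_field_derivative_at_within[OF d, of U]
    by (simp add: lattice_kernel_def add_divide_distrib diff_divide_distrib)
qed

lemma lattice_kernel_at_0: "lattice_kernel 0 j = (if j = 0 then 1 else 0)"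
proof (cases "j = 0")
  case True
  then show ?thesis by (simp add: lattice_kernel_def)
next
  case False
  have "((\<lambda>\<theta>. cos (of_int j * \<theta>)) has_integral (sin (of_int j * pi) / of_int j - sin (of_int j * (-pi)) / of_int j)) {-pi..pi}"
    using False
    by (intro fundamental_theorem_of_calculus)
      (auto intro!: derivative_eq_intros simp: has_real_derivative_iff_has_vector_derivative[symmetric])
  then show ?thesis
    using False by (simp add: lattice_kernel_def integral_unique sin_integer_2pi mult.commute[of _ pi])
qed

text \<open>A product of two one-dimensional kernels solves the planar equation and starts from a
  unit mass at the origin, so uniqueness of bounded solutions identifies it with the law of the
  walk. This yields independence of the coordinates although each jump moves only one of
  them.\<close>

lemma pmf_heat_pmf:
  assumes "a > 0"
  shows "pmf (heat_pmf a) (i, j) = lattice_kernel a i * lattice_kernel a j"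
proof -
  define \<delta> :: "int \<Rightarrow> int \<Rightarrow> real" where "\<delta> m n = (if (m, n) = (0, 0) then 1 else 0)" for m n
  have bd: "\<bar>\<delta> m n\<bar> \<le> 1" for m n by (simp add: \<delta>_def)
  have "bounded_heat_solution 1 a \<delta> (\<lambda>m n t. lattice_kernel t m * lattice_kernel t n)"
    unfolding bounded_heat_solution_def
  proof (intro conjI allI ballI)
    show "\<exists>B. \<forall>m n. \<forall>t\<in>{0..a}. \<bar>lattice_kernel t m * lattice_kernel t n\<bar> \<le> B"
      by (intro exI[of _ 1]) (auto simp: abs_mult abs_lattice_kernel_le intro!: mult_le_one)
    show "((\<lambda>t. lattice_kernel t m * lattice_kernel t n) has_real_derivative
      1 / 1\<^sup>2 * (lattice_kernel t (m + 1) * lattice_kernel t n + lattice_kernel t (m - 1) * lattice_kernel t n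
       + lattice_kernel t m * lattice_kernel t (n + 1) + lattice_kernel t m * lattice_kernel t (n - 1)
       - 4 * (lattice_kernel t m * lattice_kernel t n))) (at t within {0..a})" for m n t
      by (rule DERIV_cong[OF DERIV_mult[OF lattice_kernel_derivative lattice_kernel_derivative]]) (simp add: algebra_simps)
  qed (auto simp: \<delta>_def lattice_kernel_at_0)
  \<comment> \<open>Started at (-i, -j), the walk is at the origin exactly when its displacement is
    (i, j); evenness of the kernel removes the signs.\<close>
  from bounded_heat_solution_expectation[OF this bd, of "-i" "-j"] assms
  have "lattice_kernel a i * lattice_kernel a j = measure_pmf.expectation (heat_pmf a) (\<lambda>(k, l). \<delta> (- i + k) (- j + l))"
    by (simp add: lattice_kernel_uminus)
  also have "(\<lambda>(k, l). \<delta> (- i + k) (- j + l)) = indicator {(i, j)}"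
    by (auto simp: \<delta>_def indicator_def fun_eq_iff)
  finally show ?thesis by (simp add: measure_pmf_single)
qed

lemma lattice_kernel_0_pos:
  assumes "a \<ge> 0" shows "lattice_kernel a 0 > 0"
proof -
  have "integral {-pi..pi} (\<lambda>\<theta>. exp (- 4 * a)) \<le> integral {-pi..pi} (\<lambda>\<theta>. exp (- 2 * a * (1 - cos \<theta>)) * cos (of_int 0 * \<theta>))"
  proof (rule integral_le)
    fix \<theta> :: real
    have "a * (1 - cos \<theta>) \<le> a * 2" using assms using cos_ge_minus_one[of \<theta>] by (intro mult_left_mono) linarith+
    then show "exp (- 4 * a) \<le> exp (- 2 * a * (1 - cos \<theta>)) * cos (of_int 0 * \<theta>)" by simp
  qed (use lattice_kernel_integrable[of a 0] in auto)
  moreover have "0 < integral {-pi..pi} (\<lambda>\<theta>. exp (- 4 * a))" by simp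
  ultimately show ?thesis unfolding lattice_kernel_def using pi_gt_zero by (intro divide_pos_pos) linarith+
qed

text \<open>The sign is invisible in the oscillating integral. It is read off from the probability
  of (j, 0), in which the other factor is the positive value at 0.\<close>

lemma lattice_kernel_nonneg:
  assumes "a > 0" shows "lattice_kernel a j \<ge> 0"
  using pmf_heat_pmf[OF assms, of j 0] lattice_kernel_0_pos[of a] assms pmf_nonneg[of "heat_pmf a" "(j, 0)"]
  by (simp add: zero_le_mult_iff)

definition marginal_pmf :: "real \<Rightarrow> int pmf" where
  "marginal_pmf a = map_pmf fst (heat_pmf a)"

text \<open>Summing the product formula over the second coordinate gives the kernel times its total
  mass S. Since the marginal itself has mass 1, S * S = 1, so no Fourier series has to be
  summed.\<close>

lemma pmf_marginal_pmf:
  assumes "a > 0"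
  shows "pmf (marginal_pmf a) i = lattice_kernel a i"
proof -
  define S where "S = (\<integral>\<^sup>+j. ennreal (lattice_kernel a j) \<partial>count_space UNIV)"
  have m: "ennreal (pmf (marginal_pmf a) i) = ennreal (lattice_kernel a i) * S" for i
  proof -
    have bij: "bij_betw (Pair i) UNIV (fst -` {i} :: (int \<times> int) set)"
      by (auto simp: bij_betw_def inj_on_def)
    have "ennreal (pmf (marginal_pmf a) i) = emeasure (heat_pmf a) (fst -` {i})"
      by (simp add: marginal_pmf_def pmf_map measure_pmf.emeasure_eq_measure)
    also have "\<dots> = (\<integral>\<^sup>+x. pmf (heat_pmf a) x \<partial>count_space (fst -` {i}))"
      by (simp add: nn_integral_pmf)
    also have "\<dots> = (\<integral>\<^sup>+j. pmf (heat_pmf a) (i, j) \<partial>count_space UNIV)"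
      by (rule nn_integral_bij_count_space[OF bij, symmetric])
    also have "\<dots> = (\<integral>\<^sup>+j. ennreal (lattice_kernel a i) * ennreal (lattice_kernel a j) \<partial>count_space UNIV)"
      using assms by (simp add: pmf_heat_pmf ennreal_mult lattice_kernel_nonneg)
    also have "\<dots> = ennreal (lattice_kernel a i) * S"
      by (simp add: nn_integral_cmult S_def)
    finally show ?thesis .
  qed
  have "1 = (\<integral>\<^sup>+i. ennreal (pmf (marginal_pmf a) i) \<partial>count_space UNIV)"
    by (simp add: nn_integral_pmf)
  also have "\<dots> = S * S"
    unfolding m by (simp add: nn_integral_multc S_def)
  finally have SS: "S * S = 1" ..
  then have "S \<noteq> top" by (auto simp: ennreal_top_mult)
  then obtain s where s: "S = ennreal s" "s \<ge> 0" by (cases S) auto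
  with SS have "s * s = 1" by (simp add: ennreal_mult'[symmetric] ennreal_eq_1)
  with s have "s = 1" by (simp add: power2_eq_1_iff flip: power2_eq_square)
  then show ?thesis using m[of i] s lattice_kernel_nonneg[OF assms] by simp
qed

lemma heat_pmf_eq_pair:
  assumes "a > 0"
  shows "heat_pmf a = pair_pmf (marginal_pmf a) (marginal_pmf a)"
  by (rule pmf_eqI) (auto simp: pmf_pair pmf_heat_pmf pmf_marginal_pmf assms)

lemma map_uminus_marginal_pmf:
  assumes "a > 0"
  shows "map_pmf uminus (marginal_pmf a) = marginal_pmf a"
proof (rule pmf_eqI)
  fix i
  have "pmf (map_pmf uminus (marginal_pmf a)) (- (- i)) = pmf (marginal_pmf a) (- i)"
    by (rule pmf_map_inj') (auto simp: inj_def)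
  then show "pmf (map_pmf uminus (marginal_pmf a)) i = pmf (marginal_pmf a) i"
    using assms by (simp add: pmf_marginal_pmf lattice_kernel_uminus)
qed

lemma nn_moment_marginal_pmf:
  assumes "a > 0"
  shows "(\<integral>\<^sup>+i. ennreal ((real_of_int i)\<^sup>2) \<partial>marginal_pmf a) = ennreal (2 * a)"
  using nn_moment_heat_pmf[OF assms] by (simp add: marginal_pmf_def)

section \<open>Comparison of the lattice symbol with the Gaussian\<close>

lemma gaussian_fourier:
  "(\<integral>\<xi>. exp (- \<xi>\<^sup>2) * cos (y * \<xi>) \<partial>lborel) = 2 * pi * normal_density 0 (sqrt 2) y"
proof -
  \<comment> \<open>The substitution x = sqrt 2 * \<xi> in the characteristic function of the
    standard normal law turns exp(-x^2 / 2) into exp(-\<xi>^2).\<close>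
  define t where "t = y / sqrt 2"
  have "Re (char std_normal_distribution t) = (\<integral>x. std_normal_density x * cos (t * x) \<partial>lborel)"
  proof -
    have "char std_normal_distribution t = (CLINT x|lborel. std_normal_density x *\<^sub>R iexp (t * x))"
      unfolding char_def by (subst integral_density) auto
    also have "Re \<dots> = (\<integral>x. Re (std_normal_density x *\<^sub>R iexp (t * x)) \<partial>lborel)"
    proof (rule integral_Re[symmetric])
      show "complex_integrable lborel (\<lambda>x. std_normal_density x *\<^sub>R iexp (t * x))"
        by (rule Bochner_Integration.integrable_bound[OF integrable_normal_density[of 1 0]]) (auto simp: norm_mult)
    qed
    also have "(\<lambda>x. Re (std_normal_density x *\<^sub>R iexp (t * x))) = (\<lambda>x. std_normal_density x * cos (t * x))"
      by (auto simp: fun_eq_iff Re_exp)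
    finally show ?thesis .
  qed
  also have "\<dots> = sqrt 2 * (\<integral>\<xi>. std_normal_density (0 + sqrt 2 * \<xi>) * cos (t * (0 + sqrt 2 * \<xi>)) \<partial>lborel)"
    by (subst lborel_integral_real_affine[where c = "sqrt 2" and t = 0]) auto
  also have "(\<lambda>\<xi>. std_normal_density (0 + sqrt 2 * \<xi>) * cos (t * (0 + sqrt 2 * \<xi>))) = (\<lambda>\<xi>. 1 / sqrt (2 * pi) * (exp (- \<xi>\<^sup>2) * cos (y * \<xi>)))"
    by (auto simp: fun_eq_iff std_normal_density_def t_def power_mult_distrib)
  finally have "exp (- t\<^sup>2 / 2) = sqrt 2 * (1 / sqrt (2 * pi) * (\<integral>\<xi>. exp (- \<xi>\<^sup>2) * cos (y * \<xi>) \<partial>lborel))"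
    by (simp add: char_std_normal_distribution)
  then have "(\<integral>\<xi>. exp (- \<xi>\<^sup>2) * cos (y * \<xi>) \<partial>lborel) = sqrt pi * exp (- y\<^sup>2 / 4)"
    by (simp add: t_def power_divide real_sqrt_mult field_simps)
  moreover have "sqrt pi * sqrt pi = pi" by simp
  ultimately show ?thesis
    by (simp add: normal_density_def real_sqrt_mult field_simps del: real_sqrt_mult_self)
qed

lemma sin_ge_linear:
  assumes "0 \<le> x" "x \<le> pi / 2"
  shows "2 / 5 * x \<le> sin x"
\<comment> \<open>The constant 2/5 is below the sharp 2/\<pi>, which leaves slack for a crude split:
  up to \<pi>/3 the derivative cos x is at least 1/2, and beyond it sin x is at least 4/5 while x is
  at most 2.\<close>
proof (cases "x \<le> pi / 3")
  case True
  have "sin 0 - 2 / 5 * 0 \<le> sin x - 2 / 5 * x"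
  proof (rule DERIV_nonneg_imp_nondecreasing[OF assms(1)])
    fix y assume "0 \<le> y" "y \<le> x"
    then have "cos (pi / 3) \<le> cos y" using True by (intro cos_monotone_0_pi_le) auto
    then show "\<exists>d. ((\<lambda>x. sin x - 2 / 5 * x) has_real_derivative d) (at y) \<and> 0 \<le> d"
      by (intro exI[of _ "cos y - 2/5"]) (auto intro!: derivative_eq_intros simp: cos_60)
  qed
  then show ?thesis by simp
next
  case False
  then have "sin (pi / 3) \<le> sin x" using assms by (intro sin_monotone_2pi_le) auto
  moreover have "(4/5)\<^sup>2 \<le> (sqrt 3 / 2)\<^sup>2" by (simp add: power2_eq_square)
  then have "4/5 \<le> sqrt 3 / 2" by (rule power2_le_imp_le) auto
  ultimately have "4/5 \<le> sin x" by (simp add: sin_60)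
  moreover have "x \<le> 2" using assms pi_less_4 by linarith
  ultimately show ?thesis by linarith
qed

text \<open>From 1 - cos x = 2 sin^2(x/2). With x = \<xi> / sqrt a, the lattice symbol is dominated
  by exp(-(4/25) \<xi>^2) uniformly in \<open>a\<close>; this is the integrable majorant used
  below.\<close>

lemma one_minus_cos_ge:
  assumes "\<bar>x\<bar> \<le> pi"
  shows "2 / 25 * x\<^sup>2 \<le> 1 - cos x"
proof -
  have "2 / 5 * \<bar>x / 2\<bar> \<le> sin \<bar>x / 2\<bar>" using assms by (intro sin_ge_linear) auto
  then have "(2 / 5 * \<bar>x / 2\<bar>)\<^sup>2 \<le> (sin \<bar>x / 2\<bar>)\<^sup>2" by (intro power_mono) auto
  also have "(sin \<bar>x / 2\<bar>)\<^sup>2 = (sin (x / 2))\<^sup>2" by (cases "x \<ge> 0") auto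
  finally have "x\<^sup>2 / 25 \<le> (sin (x / 2))\<^sup>2" by (simp add: power_mult_distrib power_divide)
  moreover have "cos x = 1 - 2 * (sin (x / 2))\<^sup>2"
    using cos_double_sin[of "x / 2"] by simp
  ultimately show ?thesis by simp
qed

text \<open>The lattice symbol after the scaling \<theta> = \<xi> / sqrt a, cut off to one period,
  minus the Gaussian symbol. Its L^1 norm controls the local limit error for all lattice points at
  once.\<close>

definition kernel_defect :: "real \<Rightarrow> real \<Rightarrow> real" where
  "kernel_defect a \<xi> = indicator {-pi..pi} (\<xi> / sqrt a) * exp (- 2 * a * (1 - cos (\<xi> / sqrt a))) - exp (- \<xi>\<^sup>2)"

lemma kernel_defect_tendsto: "((\<lambda>a. kernel_defect a \<xi>) \<longlongrightarrow> 0) at_top"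
proof -
  have "((\<lambda>a::real. - 2 * a * (1 - cos (\<xi> / sqrt a))) \<longlongrightarrow> - (\<xi> * \<xi>)) at_top"
    by real_asymp
  then have "((\<lambda>a::real. exp (- 2 * a * (1 - cos (\<xi> / sqrt a))) - exp (- \<xi>\<^sup>2)) \<longlongrightarrow> exp (- \<xi>\<^sup>2) - exp (- \<xi>\<^sup>2)) at_top"
    by (intro tendsto_intros) (simp add: power2_eq_square)
  \<comment> \<open>For fixed \<xi> the cut-off is eventually inactive.\<close>
  moreover have "((\<lambda>a::real. \<xi> / sqrt a) \<longlongrightarrow> 0) at_top" by real_asymp
  then have "eventually (\<lambda>a. dist (\<xi> / sqrt a) 0 < pi) at_top"
    by (rule tendstoD) simp
  then have "eventually (\<lambda>a. exp (- 2 * a * (1 - cos (\<xi> / sqrt a))) - exp (- \<xi>\<^sup>2) = kernel_defect a \<xi>) at_top"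
    by eventually_elim (auto simp: kernel_defect_def indicator_def dist_real_def abs_less_iff simp del: abs_divide)
  ultimately show ?thesis using tendsto_cong by fastforce
qed

lemma exp_half_bound:
  assumes "a > 0"
  shows "indicator {-pi..pi} (\<xi> / sqrt a) * exp (- 2 * a * (1 - cos (\<xi> / sqrt a))) \<le> exp (- (4/25) * \<xi>\<^sup>2)"
proof (cases "\<bar>\<xi> / sqrt a\<bar> \<le> pi")
  case True
  then have "2 * a * (2 / 25 * (\<xi> / sqrt a)\<^sup>2) \<le> 2 * a * (1 - cos (\<xi> / sqrt a))"
    using assms by (intro mult_left_mono one_minus_cos_ge) auto
  then show ?thesis using assms True by (auto simp: indicator_def power_divide)
next
  case False
  then show ?thesis by (auto simp: indicator_def abs_le_iff)
qed

lemma integrable_gaussian: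
  assumes "c > 0" shows "integrable lborel (\<lambda>\<xi>::real. exp (- c * \<xi>\<^sup>2))"
proof -
  have "(\<lambda>\<xi>. sqrt (2 * pi * (1 / sqrt (2 * c))\<^sup>2) * normal_density 0 (1 / sqrt (2 * c)) \<xi>) = (\<lambda>\<xi>::real. exp (- c * \<xi>\<^sup>2))"
    using assms by (auto simp: normal_density_def fun_eq_iff power_divide mult.commute real_sqrt_divide)
  then show ?thesis
    using integrable_mult_right[OF integrable_normal_density[of "1 / sqrt (2 * c)" 0], of "sqrt (2 * pi * (1 / sqrt (2 * c))\<^sup>2)"] assms by simp
qed

lemma abs_kernel_defect_le:
  assumes "a > 0" shows "\<bar>kernel_defect a \<xi>\<bar> \<le> exp (- (4/25) * \<xi>\<^sup>2)"
proof -
  have "exp (- \<xi>\<^sup>2) \<le> exp (- (4/25) * \<xi>\<^sup>2)" by simp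
  moreover have "0 \<le> indicator {-pi..pi} (\<xi> / sqrt a) * exp (- 2 * a * (1 - cos (\<xi> / sqrt a)))"
    by simp
  ultimately show ?thesis using exp_half_bound[OF assms, of \<xi>] exp_gt_zero[of "- \<xi>\<^sup>2"]
    unfolding kernel_defect_def by linarith
qed

lemma measurable_kernel_defect [measurable]: "kernel_defect a \<in> borel_measurable lborel"
  unfolding kernel_defect_def[abs_def] by measurable

lemma integrable_kernel_defect:
  assumes "a > 0" shows "integrable lborel (kernel_defect a)"
  by (rule Bochner_Integration.integrable_bound[OF integrable_gaussian[of "4/25"]])
    (use abs_kernel_defect_le[OF assms] in auto)

lemma kernel_defect_integral_tendsto:
  "((\<lambda>a. \<integral>\<xi>. \<bar>kernel_defect a \<xi>\<bar> \<partial>lborel) \<longlongrightarrow> 0) at_top"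
proof -
  have "((\<lambda>a. \<integral>\<xi>. \<bar>kernel_defect a \<xi>\<bar> \<partial>lborel) \<longlongrightarrow> (\<integral>\<xi>. 0 \<partial>(lborel :: real measure))) at_top"
  proof (rule integral_dominated_convergence_at_top[where w = "\<lambda>\<xi>. exp (- (4/25) * \<xi>\<^sup>2)"])
    show "AE \<xi> in lborel. ((\<lambda>a. \<bar>kernel_defect a \<xi>\<bar>) \<longlongrightarrow> 0) at_top"
      by (intro AE_I2 tendsto_rabs_zero kernel_defect_tendsto)
    show "\<forall>\<^sub>F a in at_top. AE \<xi> in lborel. norm \<bar>kernel_defect a \<xi>\<bar> \<le> exp (- (4/25) * \<xi>\<^sup>2)"
      using eventually_gt_at_top[of 0] by eventually_elim (use abs_kernel_defect_le in auto)
  qed (use integrable_gaussian[of "4/25"] in auto)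
  then show ?thesis by simp
qed

text \<open>The heat kernel at time 1. It has variance 2, as does each coordinate of the walk at
  time 1 / \<eta>^2 scaled by \<eta>.\<close>

abbreviation heat_density :: "real \<Rightarrow> real" where
  "heat_density \<equiv> normal_density 0 (sqrt 2)"

lemma lattice_kernel_scaled:
  assumes "a > 0"
  shows "sqrt a * lattice_kernel a j - heat_density (of_int j / sqrt a) =
    (\<integral>\<xi>. kernel_defect a \<xi> * cos (of_int j / sqrt a * \<xi>) \<partial>lborel) / (2 * pi)"
proof -
  let ?f = "\<lambda>\<theta>. exp (- 2 * a * (1 - cos \<theta>)) * cos (of_int j * \<theta>)"
  have "continuous_on {-pi..pi} ?f" by (intro continuous_intros)
  then have "integral {-pi..pi} ?f = (\<integral>\<theta>. indicator {-pi..pi} \<theta> * ?f \<theta> \<partial>lborel)"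
    using set_borel_integral_eq_integral(2)[OF borel_integrable_atLeastAtMost'[of "-pi" pi ?f]]
    by (simp add: set_lebesgue_integral_def)
  also have "\<dots> = (1 / sqrt a) * (\<integral>\<xi>. indicator {-pi..pi} (0 + (1 / sqrt a) * \<xi>) * ?f (0 + (1 / sqrt a) * \<xi>) \<partial>lborel)"
    using assms by (subst lborel_integral_real_affine[where c = "1 / sqrt a" and t = 0]) auto
  finally have 1: "2 * pi * (sqrt a * lattice_kernel a j) = (\<integral>\<xi>. indicator {-pi..pi} (\<xi> / sqrt a) * ?f (\<xi> / sqrt a) \<partial>lborel)"
    using assms by (simp add: lattice_kernel_def)
  have 2: "2 * pi * heat_density (of_int j / sqrt a) = (\<integral>\<xi>. exp (- \<xi>\<^sup>2) * cos (of_int j / sqrt a * \<xi>) \<partial>lborel)"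
    by (rule gaussian_fourier[symmetric])
  have "(\<integral>\<xi>. kernel_defect a \<xi> * cos (of_int j / sqrt a * \<xi>) \<partial>lborel) =
    (\<integral>\<xi>. indicator {-pi..pi} (\<xi> / sqrt a) * ?f (\<xi> / sqrt a) - exp (- \<xi>\<^sup>2) * cos (of_int j / sqrt a * \<xi>) \<partial>lborel)"
    by (intro Bochner_Integration.integral_cong) (auto simp: kernel_defect_def algebra_simps)
  also have "\<dots> = 2 * pi * (sqrt a * lattice_kernel a j) - 2 * pi * heat_density (of_int j / sqrt a)"
    unfolding 1 2
  proof (rule Bochner_Integration.integral_diff)
    show "integrable lborel (\<lambda>\<xi>. indicator {-pi..pi} (\<xi> / sqrt a) * ?f (\<xi> / sqrt a))"
    proof (rule Bochner_Integration.integrable_bound[OF integrable_gaussian[of "4/25"]])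
      have "\<bar>indicator {-pi..pi} (\<xi> / sqrt a) * ?f (\<xi> / sqrt a)\<bar> \<le> exp (- (4/25) * \<xi>\<^sup>2)" for \<xi>
      proof -
        have "\<bar>indicator {-pi..pi} (\<xi> / sqrt a) * ?f (\<xi> / sqrt a)\<bar> =
          indicator {-pi..pi} (\<xi> / sqrt a) * exp (- 2 * a * (1 - cos (\<xi> / sqrt a))) * \<bar>cos (of_int j * (\<xi> / sqrt a))\<bar>"
          by (simp add: abs_mult)
        also have "\<dots> \<le> indicator {-pi..pi} (\<xi> / sqrt a) * exp (- 2 * a * (1 - cos (\<xi> / sqrt a))) * 1"
          by (intro mult_left_mono) auto
        finally show ?thesis using exp_half_bound[OF assms, of \<xi>] by linarith
      qed
      then show "AE \<xi> in lborel. norm (indicator {-pi..pi} (\<xi> / sqrt a) * ?f (\<xi> / sqrt a)) \<le> norm (exp (- (4/25) * \<xi>\<^sup>2))"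
        by simp
    qed auto
    show "integrable lborel (\<lambda>\<xi>. exp (- \<xi>\<^sup>2) * cos (of_int j / sqrt a * \<xi>))"
      by (rule Bochner_Integration.integrable_bound[OF integrable_gaussian[of 1]]) (auto simp: abs_mult)
  qed
  finally show ?thesis by (simp add: field_simps)
qed

text \<open>Uniformity in j comes from bounding the cosine by 1: the error is at most the L^1 norm
  of \<open>kernel_defect\<close>, which tends to 0 by dominated convergence.\<close>

lemma local_limit:
  assumes "\<epsilon> > 0"
  shows "\<forall>\<^sub>F a in at_top. \<forall>j. \<bar>sqrt a * lattice_kernel a j - heat_density (of_int j / sqrt a)\<bar> \<le> \<epsilon>"
proof -
  have "\<forall>\<^sub>F a in at_top. dist (\<integral>\<xi>. \<bar>kernel_defect a \<xi>\<bar> \<partial>lborel) 0 < \<epsilon>"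
    using kernel_defect_integral_tendsto assms by (rule tendstoD)
  then show ?thesis
    using eventually_gt_at_top[of 0]
  proof eventually_elim
    case (elim a)
    show ?case
    proof
      fix j
      have "\<bar>\<integral>\<xi>. kernel_defect a \<xi> * cos (of_int j / sqrt a * \<xi>) \<partial>lborel\<bar> \<le> (\<integral>\<xi>. \<bar>kernel_defect a \<xi>\<bar> \<partial>lborel)"
      proof (rule integral_abs_bound_integral)
        show "integrable lborel (\<lambda>\<xi>. kernel_defect a \<xi> * cos (of_int j / sqrt a * \<xi>))"
          using elim(2) by (intro Bochner_Integration.integrable_bound[OF integrable_kernel_defect[OF elim(2)]]) (auto simp: abs_mult intro!: mult_left_le)
        show "\<bar>kernel_defect a \<xi> * cos (of_int j / sqrt a * \<xi>)\<bar> \<le> \<bar>kernel_defect a \<xi>\<bar>" for \<xi>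
          by (auto simp: abs_mult intro!: mult_left_le)
      qed (use integrable_kernel_defect[OF elim(2)] in auto)
      also have "\<dots> \<le> \<epsilon>" using elim(1) by (auto simp: dist_real_def)
      also have "\<dots> \<le> \<epsilon> * (2 * pi)" using assms pi_ge_two by simp
      finally show "\<bar>sqrt a * lattice_kernel a j - heat_density (of_int j / sqrt a)\<bar> \<le> \<epsilon>"
        by (simp add: lattice_kernel_scaled[OF elim(2)] abs_divide divide_simps)
    qed
  qed
qed

lemma heat_density_le_1: "heat_density y \<le> 1"
proof -
  have "1 \<le> sqrt (2 * pi * (sqrt 2)\<^sup>2)" using pi_ge_two by simp
  then have "1 / sqrt (2 * pi * (sqrt 2)\<^sup>2) * exp (- (y\<^sup>2) / 4) \<le> 1 * 1"
    by (intro mult_mono) (auto simp: divide_simps)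
  then show ?thesis by (simp add: normal_density_def)
qed

section \<open>From lattice sums to Gaussian integrals\<close>

text \<open>A lattice sum becomes the integral of a step function on a fixed measure space, so
  convergence theorems apply while the mesh varies.\<close>

lemma nn_integral_floor:
  fixes f :: "int \<Rightarrow> ennreal"
  assumes "\<eta> > 0"
  shows "(\<integral>\<^sup>+y. f \<lfloor>y / \<eta>\<rfloor> \<partial>lborel) = ennreal \<eta> * (\<integral>\<^sup>+j. f j \<partial>count_space UNIV)"
proof -
  have m [measurable]: "(\<lambda>y. \<lfloor>y / \<eta>\<rfloor>) \<in> measurable lborel (count_space UNIV)"
    by measurable
  have "distr lborel (count_space UNIV) (\<lambda>y. \<lfloor>y / \<eta>\<rfloor>) = density (count_space UNIV) (\<lambda>_. ennreal \<eta>)"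
  proof (rule measure_eqI_countable)
    fix j :: int assume "j \<in> UNIV"
    have "(\<lambda>y. \<lfloor>y / \<eta>\<rfloor>) -` {j} \<inter> space lborel = {y. \<lfloor>y / \<eta>\<rfloor> = j}" by auto
    also have "\<dots> = {\<eta> * j..<\<eta> * (j + 1)}"
    proof (intro set_eqI)
      fix y
      have "\<lfloor>y / \<eta>\<rfloor> = j \<longleftrightarrow> of_int j \<le> y / \<eta> \<and> y / \<eta> < of_int j + 1" by (rule floor_eq_iff)
      then show "y \<in> {y. \<lfloor>y / \<eta>\<rfloor> = j} \<longleftrightarrow> y \<in> {\<eta> * j..<\<eta> * (j + 1)}"
        using assms by (simp add: pos_le_divide_eq pos_divide_less_eq mult.commute)
    qed
    finally have "emeasure (distr lborel (count_space UNIV) (\<lambda>y. \<lfloor>y / \<eta>\<rfloor>)) {j} = ennreal \<eta>"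
      using assms by (subst emeasure_distr) (auto simp: algebra_simps)
    then show "emeasure (distr lborel (count_space UNIV) (\<lambda>y. \<lfloor>y / \<eta>\<rfloor>)) {j} = emeasure (density (count_space UNIV) (\<lambda>_. ennreal \<eta>)) {j}"
      by (simp add: emeasure_density nn_integral_cmult_indicator)
  qed auto
  then have "(\<integral>\<^sup>+y. f \<lfloor>y / \<eta>\<rfloor> \<partial>lborel) = (\<integral>\<^sup>+j. f j \<partial>density (count_space UNIV) (\<lambda>_. ennreal \<eta>))"
    using nn_integral_distr[OF m, of f] by simp
  also have "\<dots> = ennreal \<eta> * (\<integral>\<^sup>+j. f j \<partial>count_space UNIV)"
    by (simp add: nn_integral_density nn_integral_cmult)
  finally show ?thesis .
qed

lemma heat_density_moment:
  "integrable lborel (\<lambda>y. heat_density y * (c + d * y\<^sup>2))"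
  "(\<integral>y. heat_density y * (c + d * y\<^sup>2) \<partial>lborel) = c + 2 * d"
proof -
  have 2: "integrable lborel (\<lambda>y. heat_density y * y\<^sup>2)"
    using integrable_normal_moment[of "sqrt 2" 0 2] by simp
  have 3: "(\<integral>y. heat_density y * y\<^sup>2 \<partial>lborel) = 2"
    using integral_normal_moment_even[of "sqrt 2" 0 1] by (simp add: fact_numeral)
  have e: "(\<lambda>y. heat_density y * (c + d * y\<^sup>2)) = (\<lambda>y. c * heat_density y + d * (heat_density y * y\<^sup>2))"
    by (auto simp: algebra_simps)
  have 1: "integrable lborel heat_density" by simp
  show "integrable lborel (\<lambda>y. heat_density y * (c + d * y\<^sup>2))"
    unfolding e by (intro Bochner_Integration.integrable_add integrable_mult_right 1 2)
  show "(\<integral>y. heat_density y * (c + d * y\<^sup>2) \<partial>lborel) = c + 2 * d"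
    unfolding e by (subst Bochner_Integration.integral_add) (auto simp: 1 2 3)
qed

lemma moment_marginal_pmf:
  assumes "\<eta> > 0"
  shows "integrable (marginal_pmf (1 / \<eta>\<^sup>2)) (\<lambda>j. c + d * (\<eta> * of_int j)\<^sup>2)"
    "measure_pmf.expectation (marginal_pmf (1 / \<eta>\<^sup>2)) (\<lambda>j. c + d * (\<eta> * of_int j)\<^sup>2) = c + 2 * d"
proof -
  have "(\<integral>\<^sup>+j. ennreal ((real_of_int j)\<^sup>2) \<partial>marginal_pmf (1 / \<eta>\<^sup>2)) = ennreal (2 * (1 / \<eta>\<^sup>2))"
    using assms by (intro nn_moment_marginal_pmf) auto
  then have b: "has_bochner_integral (marginal_pmf (1 / \<eta>\<^sup>2)) (\<lambda>j. (real_of_int j)\<^sup>2) (2 * (1 / \<eta>\<^sup>2))"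
    by (intro has_bochner_integral_nn_integral) auto
  have e: "(\<lambda>j. c + d * (\<eta> * real_of_int j)\<^sup>2) = (\<lambda>j. c + (d * \<eta>\<^sup>2) * (real_of_int j)\<^sup>2)"
    by (simp add: power_mult_distrib mult.assoc)
  show "integrable (marginal_pmf (1 / \<eta>\<^sup>2)) (\<lambda>j. c + d * (\<eta> * of_int j)\<^sup>2)"
    unfolding e using b by (intro Bochner_Integration.integrable_add integrable_mult_right) (auto simp: has_bochner_integral_iff)
  show "measure_pmf.expectation (marginal_pmf (1 / \<eta>\<^sup>2)) (\<lambda>j. c + d * (\<eta> * of_int j)\<^sup>2) = c + 2 * d"
    unfolding e using b assms
    by (subst Bochner_Integration.integral_add) (auto simp: has_bochner_integral_iff)
qed

lemma kernel_scaled_uniform: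
  assumes \<eta>: "\<And>n. \<eta> n > 0" "\<eta> \<longlonglongrightarrow> 0" and "e > 0"
  shows "\<forall>\<^sub>F n in sequentially. \<forall>j. \<bar>pmf (marginal_pmf (1 / (\<eta> n)\<^sup>2)) j / \<eta> n - heat_density (\<eta> n * of_int j)\<bar> \<le> e"
proof -
  let ?a = "\<lambda>n. 1 / (\<eta> n)\<^sup>2"
  have a: "sqrt (?a n) = 1 / \<eta> n" for n using \<eta>(1)[of n] by (simp add: real_sqrt_divide)
  have lim: "filterlim ?a at_top sequentially"
    unfolding inverse_eq_divide[symmetric]
  proof (rule filterlim_inverse_at_top)
    show "(\<lambda>n. (\<eta> n)\<^sup>2) \<longlonglongrightarrow> 0" using tendsto_power[OF \<eta>(2), of 2] by simp
    show "\<forall>\<^sub>F n in sequentially. 0 < (\<eta> n)\<^sup>2" by (intro always_eventually allI zero_less_power \<eta>(1))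
  qed
  have "\<forall>\<^sub>F n in sequentially. \<forall>i. \<bar>sqrt (?a n) * lattice_kernel (?a n) i - heat_density (of_int i / sqrt (?a n))\<bar> \<le> e"
    by (intro eventually_compose_filterlim[OF local_limit lim] assms)
  then show ?thesis
  proof eventually_elim
    case (elim n)
    have "?a n > 0" using \<eta>(1)[of n] by simp
    then have "pmf (marginal_pmf (?a n)) j = lattice_kernel (?a n) j" for j by (rule pmf_marginal_pmf)
    moreover have "of_int j / (1 / \<eta> n) = \<eta> n * of_int j" "1 / \<eta> n * x = x / \<eta> n" for j x by auto
    ultimately show ?case using elim by (simp only: a) simp
  qed
qed

lemma isCont_heat_density: "isCont heat_density y"
  unfolding normal_density_def by (intro continuous_intros) auto

lemma kernel_scaled_tendsto:
  assumes \<eta>: "\<And>n. \<eta> n > 0" "\<eta> \<longlonglongrightarrow> 0" and j: "(\<lambda>n. \<eta> n * of_int (j n)) \<longlonglongrightarrow> y"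
  shows "(\<lambda>n. pmf (marginal_pmf (1 / (\<eta> n)\<^sup>2)) (j n) / \<eta> n) \<longlonglongrightarrow> heat_density y"
proof -
  have "(\<lambda>n. pmf (marginal_pmf (1 / (\<eta> n)\<^sup>2)) (j n) / \<eta> n - heat_density (\<eta> n * of_int (j n))) \<longlonglongrightarrow> 0"
  proof (rule tendstoI)
    fix e :: real assume "e > 0"
    then have "\<forall>\<^sub>F n in sequentially. \<forall>j. \<bar>pmf (marginal_pmf (1 / (\<eta> n)\<^sup>2)) j / \<eta> n - heat_density (\<eta> n * of_int j)\<bar> \<le> e / 2"
      by (intro kernel_scaled_uniform[OF \<eta>]) auto
    then show "\<forall>\<^sub>F n in sequentially. dist (pmf (marginal_pmf (1 / (\<eta> n)\<^sup>2)) (j n) / \<eta> n - heat_density (\<eta> n * of_int (j n))) 0 < e"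
    proof eventually_elim
      case (elim n)
      show ?case using elim[rule_format, of "j n"] \<open>e > 0\<close> unfolding dist_real_def by linarith
    qed
  qed
  from tendsto_add[OF this isCont_tendsto_compose[OF isCont_heat_density j]] show ?thesis by simp
qed

text \<open>A reverse Fatou argument. Fatou applied to the nonnegative C (1 + y^2) - F bounds its
  expectations from below in the limit. The majorant has expectation exactly 3 C for every mesh,
  because the scaled walk has second moment exactly 2, the Gaussian value; subtracting it therefore
  costs nothing. Convergence of \<open>F\<close> is required along all converging lattice points,
  since the step function evaluates it at moving points.\<close>

lemma expectation_eventually_negative:
  fixes \<eta> :: "nat \<Rightarrow> real" and F :: "nat \<Rightarrow> int \<Rightarrow> real" and G :: "real \<Rightarrow> real"
  assumes \<eta>: "\<And>n. \<eta> n > 0" "\<eta> \<longlonglongrightarrow> 0"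
    and bound: "\<forall>\<^sub>F n in sequentially. \<forall>j. \<bar>F n j\<bar> \<le> C * (1 + (\<eta> n * of_int j)\<^sup>2)"
    and lim: "\<And>y j. (\<lambda>n. \<eta> n * of_int (j n)) \<longlonglongrightarrow> y \<Longrightarrow> (\<lambda>n. F n (j n)) \<longlonglongrightarrow> G y"
    and G [measurable]: "G \<in> borel_measurable borel"
    and neg: "(\<integral>y. heat_density y * G y \<partial>lborel) < 0"
  obtains m where "m > 0" "\<forall>\<^sub>F n in sequentially. measure_pmf.expectation (marginal_pmf (1 / (\<eta> n)\<^sup>2)) (F n) \<le> - m"
proof -
  define I where "I = (\<integral>y. heat_density y * G y \<partial>lborel)"
  let ?M = "\<lambda>n. marginal_pmf (1 / (\<eta> n)\<^sup>2)"
  define H where "H n j = C * (1 + (\<eta> n * of_int j)\<^sup>2) - F n j" for n j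
  \<comment> \<open>The step function whose integral is the expectation of \<open>H n\<close>;
    dividing the probability by the mesh \<open>\<eta> n\<close> turns it into a density.\<close>
  define u where "u n y = ennreal (pmf (?M n) \<lfloor>y / \<eta> n\<rfloor> / \<eta> n * H n \<lfloor>y / \<eta> n\<rfloor>)" for n y
  have fl: "(\<lambda>n. \<eta> n * of_int \<lfloor>y / \<eta> n\<rfloor>) \<longlonglongrightarrow> y" for y
  proof (rule real_tendsto_sandwich[of "\<lambda>n. y - \<eta> n" _ _ "\<lambda>n. y"])
    show "\<forall>\<^sub>F n in sequentially. y - \<eta> n \<le> \<eta> n * of_int \<lfloor>y / \<eta> n\<rfloor>"
    proof (intro always_eventually allI)
      fix n
      have "\<eta> n * (y / \<eta> n - 1) \<le> \<eta> n * of_int \<lfloor>y / \<eta> n\<rfloor>"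
        using \<eta>(1)[of n] by (intro mult_left_mono) linarith+
      then show "y - \<eta> n \<le> \<eta> n * of_int \<lfloor>y / \<eta> n\<rfloor>" using \<eta>(1)[of n] by (simp add: algebra_simps)
    qed
    show "\<forall>\<^sub>F n in sequentially. \<eta> n * of_int \<lfloor>y / \<eta> n\<rfloor> \<le> y"
    proof (intro always_eventually allI)
      fix n
      have "\<eta> n * of_int \<lfloor>y / \<eta> n\<rfloor> \<le> \<eta> n * (y / \<eta> n)"
        using \<eta>(1)[of n] by (intro mult_left_mono) linarith+
      then show "\<eta> n * of_int \<lfloor>y / \<eta> n\<rfloor> \<le> y" using \<eta>(1)[of n] by simp
    qed
    show "(\<lambda>n. y - \<eta> n) \<longlonglongrightarrow> y" using tendsto_diff[OF tendsto_const \<eta>(2), of y] by simp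
  qed auto
  have Gb: "\<bar>G y\<bar> \<le> C * (1 + y\<^sup>2)" for y
  proof (rule tendsto_le[OF sequentially_bot])
    show "(\<lambda>n. \<bar>F n \<lfloor>y / \<eta> n\<rfloor>\<bar>) \<longlonglongrightarrow> \<bar>G y\<bar>" by (intro tendsto_rabs lim fl)
    show "(\<lambda>n. C * (1 + (\<eta> n * of_int \<lfloor>y / \<eta> n\<rfloor>)\<^sup>2)) \<longlonglongrightarrow> C * (1 + y\<^sup>2)" by (intro tendsto_intros fl)
    show "\<forall>\<^sub>F n in sequentially. \<bar>F n \<lfloor>y / \<eta> n\<rfloor>\<bar> \<le> C * (1 + (\<eta> n * of_int \<lfloor>y / \<eta> n\<rfloor>)\<^sup>2)"
      using bound by eventually_elim auto
  qed
  have iG: "integrable lborel (\<lambda>y. heat_density y * G y)"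
  proof (rule Bochner_Integration.integrable_bound[OF heat_density_moment(1)[of C C]])
    have "norm (heat_density y * G y) \<le> norm (heat_density y * (C + C * y\<^sup>2))" for y
    proof -
      have "\<bar>G y\<bar> \<le> \<bar>C + C * y\<^sup>2\<bar>"
        using Gb[of y] abs_ge_self[of "C + C * y\<^sup>2"] unfolding distrib_left mult_1_right by (rule order_trans)
      then have "heat_density y * \<bar>G y\<bar> \<le> heat_density y * \<bar>C + C * y\<^sup>2\<bar>"
        by (rule mult_left_mono) (rule normal_density_nonneg)
      then show ?thesis unfolding real_norm_def abs_mult by (simp only: abs_of_nonneg normal_density_nonneg)
    qed
    then show "AE y in lborel. norm (heat_density y * G y) \<le> norm (heat_density y * (C + C * y\<^sup>2))" by simp
  qed auto
  have ulim: "(\<lambda>n. u n y) \<longlonglongrightarrow> ennreal (heat_density y * (C * (1 + y\<^sup>2) - G y))" for y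
    unfolding u_def H_def
    by (intro tendsto_ennrealI tendsto_intros kernel_scaled_tendsto \<eta> fl lim)
  have inn: "(\<integral>\<^sup>+y. u n y \<partial>lborel) = ennreal (3 * C - measure_pmf.expectation (?M n) (F n))"
    if b: "\<forall>j. \<bar>F n j\<bar> \<le> C * (1 + (\<eta> n * of_int j)\<^sup>2)" for n
  proof -
    have H: "H n j \<ge> 0" for j using b[rule_format, of j] unfolding H_def by linarith
    have iq: "integrable (?M n) (\<lambda>j. C * (1 + (\<eta> n * of_int j)\<^sup>2))"
      using moment_marginal_pmf(1)[OF \<eta>(1)[of n], of C C] by (simp add: algebra_simps)
    have iF: "integrable (?M n) (F n)"
      by (rule Bochner_Integration.integrable_bound[OF iq]) (use b in \<open>auto intro!: AE_I2 order_trans[OF _ abs_ge_self]\<close>)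
    have "(\<integral>\<^sup>+y. u n y \<partial>lborel) = ennreal (\<eta> n) * (\<integral>\<^sup>+j. ennreal (pmf (?M n) j / \<eta> n * H n j) \<partial>count_space UNIV)"
      unfolding u_def by (rule nn_integral_floor[OF \<eta>(1)])
    also have "\<dots> = (\<integral>\<^sup>+j. ennreal (\<eta> n) * ennreal (pmf (?M n) j / \<eta> n * H n j) \<partial>count_space UNIV)"
      by (simp add: nn_integral_cmult)
    also have "\<dots> = (\<integral>\<^sup>+j. ennreal (pmf (?M n) j) * ennreal (H n j) \<partial>count_space UNIV)"
      using H \<eta>(1)[of n] by (intro nn_integral_cong) (simp add: ennreal_mult'[symmetric])
    also have "\<dots> = (\<integral>\<^sup>+j. ennreal (H n j) \<partial>?M n)" by (simp add: nn_integral_measure_pmf)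
    also have "\<dots> = ennreal (measure_pmf.expectation (?M n) (H n))"
      using H iq iF unfolding H_def by (intro nn_integral_eq_integral) auto
    also have "measure_pmf.expectation (?M n) (H n) = 3 * C - measure_pmf.expectation (?M n) (F n)"
      unfolding H_def using moment_marginal_pmf(2)[OF \<eta>(1)[of n], of C C]
      by (subst Bochner_Integration.integral_diff[OF iq iF]) (simp add: algebra_simps)
    finally show ?thesis .
  qed
  have "(\<integral>\<^sup>+y. ennreal (heat_density y * (C * (1 + y\<^sup>2) - G y)) \<partial>lborel) = ennreal (3 * C - I)"
  proof -
    have "(\<integral>\<^sup>+y. ennreal (heat_density y * (C * (1 + y\<^sup>2) - G y)) \<partial>lborel) =
       ennreal (\<integral>y. heat_density y * (C + C * y\<^sup>2) - heat_density y * G y \<partial>lborel)"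
    proof (subst nn_integral_eq_integral[symmetric])
      show "integrable lborel (\<lambda>y. heat_density y * (C + C * y\<^sup>2) - heat_density y * G y)"
        by (intro Bochner_Integration.integrable_diff heat_density_moment iG)
      show "AE y in lborel. 0 \<le> heat_density y * (C + C * y\<^sup>2) - heat_density y * G y"
      proof (intro AE_I2)
        fix y :: real
        have "G y \<le> C + C * y\<^sup>2" using Gb[of y] by (simp add: algebra_simps)
        then show "0 \<le> heat_density y * (C + C * y\<^sup>2) - heat_density y * G y" by (simp add: mult_left_mono)
      qed
    qed (simp add: algebra_simps)
    also have "(\<integral>y. heat_density y * (C + C * y\<^sup>2) - heat_density y * G y \<partial>lborel) = 3 * C - I"
      using heat_density_moment(2)[of C C] by (simp add: Bochner_Integration.integral_diff heat_density_moment(1) iG I_def)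
    finally show ?thesis .
  qed
  moreover have "(\<integral>\<^sup>+y. ennreal (heat_density y * (C * (1 + y\<^sup>2) - G y)) \<partial>lborel) = (\<integral>\<^sup>+y. liminf (\<lambda>n. u n y) \<partial>lborel)"
    by (intro nn_integral_cong lim_imp_Liminf[symmetric] ulim) auto
  moreover have "\<dots> \<le> liminf (\<lambda>n. \<integral>\<^sup>+y. u n y \<partial>lborel)"
  proof (rule nn_integral_liminf)
    fix n
    show "u n \<in> borel_measurable lborel" unfolding u_def
      by (rule measurable_compose[where g = "\<lambda>j. ennreal (pmf (?M n) j / \<eta> n * H n j)" and f = "\<lambda>y. \<lfloor>y / \<eta> n\<rfloor>" and N = "count_space UNIV"]) measurable
  qed
  ultimately have le: "ennreal (3 * C - I) \<le> liminf (\<lambda>n. \<integral>\<^sup>+y. u n y \<partial>lborel)" by simp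
  \<comment> \<open>Nonnegativity of C keeps the \<open>ennreal\<close> conversions below
    faithful.\<close>
  have "0 \<le> C * (1 + 0\<^sup>2)" using Gb[of 0] abs_ge_zero[of "G 0"] by (metis order_trans)
  then have C: "C \<ge> 0" by simp
  have "I < 0" using neg by (simp add: I_def)
  \<comment> \<open>Half of the negative limit is given up to turn the liminf into an eventual
    bound.\<close>
  then have "ennreal (3 * C - I / 2) < ennreal (3 * C - I)" using C by (intro ennreal_lessI) auto
  then have "ennreal (3 * C - I / 2) < liminf (\<lambda>n. \<integral>\<^sup>+y. u n y \<partial>lborel)" using le by (rule less_le_trans)
  from less_LiminfD[OF this] have "\<forall>\<^sub>F n in sequentially. ennreal (3 * C - I / 2) < (\<integral>\<^sup>+y. u n y \<partial>lborel)" .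
  then have "\<forall>\<^sub>F n in sequentially. measure_pmf.expectation (?M n) (F n) \<le> - (- I / 2)"
    using bound
  proof eventually_elim
    case (elim n)
    have "ennreal (3 * C - I / 2) < ennreal (3 * C - measure_pmf.expectation (?M n) (F n))"
      using elim(1) inn[OF elim(2)] by simp
    then have "3 * C - I / 2 < 3 * C - measure_pmf.expectation (?M n) (F n)"
      using C \<open>I < 0\<close> by (subst (asm) ennreal_less_iff) auto
    then show ?case by simp
  qed
  then show ?thesis using \<open>I < 0\<close> by (intro that[of "- I / 2"]) auto
qed

section \<open>Lattice points in a thin strip\<close>

lemma card_ints_closed:
  fixes \<alpha> \<rho> :: real
  assumes "\<rho> \<ge> 0"
  shows "finite {i::int. \<bar>of_int i + \<alpha>\<bar> \<le> \<rho>}" "\<bar>real (card {i::int. \<bar>of_int i + \<alpha>\<bar> \<le> \<rho>}) - 2 * \<rho>\<bar> \<le> 1"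
proof -
  have "{i::int. \<bar>of_int i + \<alpha>\<bar> \<le> \<rho>} = {\<lceil>- \<alpha> - \<rho>\<rceil>..\<lfloor>- \<alpha> + \<rho>\<rfloor>}"
    by (auto simp: ceiling_le_iff le_floor_iff abs_le_iff)
  moreover have "real (nat (\<lfloor>- \<alpha> + \<rho>\<rfloor> + 1 - \<lceil>- \<alpha> - \<rho>\<rceil>)) - 2 * \<rho> \<le> 1 \<and> -1 \<le> real (nat (\<lfloor>- \<alpha> + \<rho>\<rfloor> + 1 - \<lceil>- \<alpha> - \<rho>\<rceil>)) - 2 * \<rho>"
    using assms by linarith
  ultimately show "finite {i::int. \<bar>of_int i + \<alpha>\<bar> \<le> \<rho>}" "\<bar>real (card {i::int. \<bar>of_int i + \<alpha>\<bar> \<le> \<rho>}) - 2 * \<rho>\<bar> \<le> 1"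
    by (auto simp: abs_le_iff)
qed

text \<open>Both versions are needed: a nonnegative offset adds a closed strip to the half plane, a
  negative one removes an open strip.\<close>

lemma card_ints_open:
  fixes \<alpha> \<rho> :: real
  assumes "\<rho> \<ge> 0"
  shows "finite {i::int. \<bar>of_int i + \<alpha>\<bar> < \<rho>}" "\<bar>real (card {i::int. \<bar>of_int i + \<alpha>\<bar> < \<rho>}) - 2 * \<rho>\<bar> \<le> 1"
proof -
  have "{i::int. \<bar>of_int i + \<alpha>\<bar> < \<rho>} = {\<lfloor>- \<alpha> - \<rho>\<rfloor> + 1..\<lceil>- \<alpha> + \<rho>\<rceil> - 1}"
    by (auto simp: abs_less_iff) linarith+
  moreover have "real (nat (\<lceil>- \<alpha> + \<rho>\<rceil> - 1 + 1 - (\<lfloor>- \<alpha> - \<rho>\<rfloor> + 1))) - 2 * \<rho> \<le> 1 \<and> -1 \<le> real (nat (\<lceil>- \<alpha> + \<rho>\<rceil> - 1 + 1 - (\<lfloor>- \<alpha> - \<rho>\<rfloor> + 1))) - 2 * \<rho>"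
    using assms by linarith
  ultimately show "finite {i::int. \<bar>of_int i + \<alpha>\<bar> < \<rho>}" "\<bar>real (card {i::int. \<bar>of_int i + \<alpha>\<bar> < \<rho>}) - 2 * \<rho>\<bar> \<le> 1"
    by (auto simp: abs_le_iff)
qed

lemma prob_pair_pmf:
  "measure_pmf.prob (pair_pmf M N) S = measure_pmf.expectation N (\<lambda>j. measure_pmf.prob M {i. (i, j) \<in> S})"
proof -
  have "pair_pmf M N = bind_pmf N (\<lambda>j. map_pmf (\<lambda>i. (i, j)) M)"
    unfolding pair_pmf_def map_pmf_def by (rule bind_commute_pmf)
  then have "measure_pmf.prob (pair_pmf M N) S = measure_pmf.expectation (bind_pmf N (\<lambda>j. map_pmf (\<lambda>i. (i, j)) M)) (indicator S)"
    by simp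
  also have "\<dots> = measure_pmf.expectation N (\<lambda>j. measure_pmf.prob M {i. (i, j) \<in> S})"
    by (subst expectation_bind_pmf[where B = 1]) (simp add: indicator_def, simp add: vimage_def)
  finally show ?thesis .
qed

lemma prob_uminus_marginal:
  assumes "a > 0"
  shows "measure_pmf.prob (marginal_pmf a) {i. P (- i)} = measure_pmf.prob (marginal_pmf a) {i. P i}"
proof -
  have "measure_pmf.prob (map_pmf uminus (marginal_pmf a)) {i. P i} = measure_pmf.prob (marginal_pmf a) (uminus -` {i. P i})"
    by simp
  then show ?thesis by (simp add: map_uminus_marginal_pmf assms vimage_def)
qed

lemma expectation_uminus_marginal:
  fixes f :: "int \<Rightarrow> real"
  assumes "a > 0"
  shows "measure_pmf.expectation (marginal_pmf a) (\<lambda>i. f (- i)) = measure_pmf.expectation (marginal_pmf a) f"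
proof -
  have "measure_pmf.expectation (map_pmf uminus (marginal_pmf a)) f = measure_pmf.expectation (marginal_pmf a) (\<lambda>i. f (- i))"
    by simp
  then show ?thesis by (simp add: map_uminus_marginal_pmf assms)
qed

text \<open>
  Averaging the event over the reflection of the second coordinate leaves only a thin strip:
  on each line the two half-lines \<open>s \<ge> - b\<close> and \<open>s \<le> b\<close> overlap in, or miss, \<open>\<bar>s\<bar> \<le> \<bar>b\<bar>\<close>.
\<close>

definition strip_excess :: "int pmf \<Rightarrow> (int \<Rightarrow> real) \<Rightarrow> real \<Rightarrow> real" where
  "strip_excess M s b = measure_pmf.prob M {i. - b \<le> s i} + measure_pmf.prob M {i. s i \<le> b} - 1"

lemma strip_excess_eq:
  "strip_excess M s b = (if b \<ge> 0 then measure_pmf.prob M {i. \<bar>s i\<bar> \<le> \<bar>b\<bar>} else - measure_pmf.prob M {i. \<bar>s i\<bar> < \<bar>b\<bar>})"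
proof (cases "b \<ge> 0")
  case True
  have "measure_pmf.prob M ({i. - b \<le> s i} \<union> {i. s i \<le> b}) =
     measure_pmf.prob M {i. - b \<le> s i} + measure_pmf.prob M {i. s i \<le> b} - measure_pmf.prob M ({i. - b \<le> s i} \<inter> {i. s i \<le> b})"
    by (simp add: measure_pmf.finite_measure_Union' measure_pmf.finite_measure_Diff' Int_commute)
  moreover have "{i. - b \<le> s i} \<union> {i. s i \<le> b} = UNIV" using True by auto
  moreover have "{i. - b \<le> s i} \<inter> {i. s i \<le> b} = {i. \<bar>s i\<bar> \<le> \<bar>b\<bar>}" using True by auto
  ultimately show ?thesis using True by (simp add: strip_excess_def)
next
  case False
  have "measure_pmf.prob M ({i. - b \<le> s i} \<union> {i. s i \<le> b}) =
     measure_pmf.prob M {i. - b \<le> s i} + measure_pmf.prob M {i. s i \<le> b}"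
    using False by (intro measure_pmf.finite_measure_Union) auto
  moreover have "{i. - b \<le> s i} \<union> {i. s i \<le> b} = UNIV - {i. \<bar>s i\<bar> < \<bar>b\<bar>}" using False by auto
  ultimately show ?thesis using False measure_pmf.prob_compl[of "{i. \<bar>s i\<bar> < \<bar>b\<bar>}" M] by (simp add: strip_excess_def)
qed

text \<open>The strip excess on line j pairs the lines j and -j. Evenness of \<open>b\<close> gives
  them the same offset, and reflecting i turns the event on the second line into the opposite
  half-line.\<close>

lemma prob_half_plane:
  fixes b :: "int \<Rightarrow> real"
  assumes "a > 0" and even: "\<And>j. b (- j) = b j"
  shows "measure_pmf.expectation (marginal_pmf a) (\<lambda>j. strip_excess (marginal_pmf a) (\<lambda>i. p * of_int i + q * of_int j) (b j)) =
    2 * measure_pmf.prob (heat_pmf a) {(i, j). 0 \<le> p * of_int i + q * of_int j + b j} - 1"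
proof -
  let ?M = "marginal_pmf a"
  let ?f = "\<lambda>j. measure_pmf.prob ?M {i. - b j \<le> p * of_int i + q * of_int j}"
  have P: "measure_pmf.prob (heat_pmf a) {(i, j). 0 \<le> p * of_int i + q * of_int j + b j} = measure_pmf.expectation ?M ?f"
  proof -
    have "{i. (i, j) \<in> {(i, j). 0 \<le> p * of_int i + q * of_int j + b j}} = {i. - b j \<le> p * of_int i + q * of_int j}" for j
      by auto
    then show ?thesis by (simp add: heat_pmf_eq_pair assms(1) prob_pair_pmf)
  qed
  have eq: "strip_excess ?M (\<lambda>i. p * of_int i + q * of_int j) (b j) = ?f j + ?f (- j) - 1" for j
  proof -
    have "?f (- j) = measure_pmf.prob ?M {i. - b j \<le> p * of_int (- i) + q * of_int (- j)}"
      using prob_uminus_marginal[OF assms(1), of "\<lambda>i. - b j \<le> p * of_int i + q * of_int (- j)"] by (simp add: even)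
    also have "{i. - b j \<le> p * of_int (- i) + q * of_int (- j)} = {i. p * of_int i + q * of_int j \<le> b j}" by auto
    finally show ?thesis by (simp add: strip_excess_def)
  qed
  have i: "integrable ?M g" if "\<And>j. g j = measure_pmf.prob ?M (A j)" for g A
    by (rule integrable_measure_pmf_bounded[where B = 1]) (simp add: that)
  have "measure_pmf.expectation ?M (\<lambda>j. ?f j + ?f (- j) - 1) = measure_pmf.expectation ?M ?f + measure_pmf.expectation ?M (\<lambda>j. ?f (- j)) - 1"
    by (subst Bochner_Integration.integral_diff Bochner_Integration.integral_add; (intro Bochner_Integration.integrable_add i[OF refl])?; simp)+
  then show ?thesis
    unfolding eq P expectation_uminus_marginal[OF assms(1), of ?f] by simp
qed

text \<open>\<open>x\<close> is the signed number of lattice points in the strip, scaled by \<eta> /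
  \<kappa>. Rounding the strip to the lattice costs at most one point, hence an error \<eta> /
  \<kappa> against the width 2 \<beta> / |p|; this vanishes when the strip is many spacings wide.
  The last property replaces the probabilities of these points by a common density
  \<open>g\<close>.\<close>

lemma strip_excess_count:
  assumes "p \<noteq> 0" "\<eta> > 0" "\<kappa> > 0"
  obtains I x where "finite I" "\<And>i. i \<in> I \<Longrightarrow> \<bar>p * (\<eta> * of_int i) + r\<bar> \<le> \<kappa> * \<bar>\<beta>\<bar>"
    "\<bar>x\<bar> = real (card I) * \<eta> / \<kappa>" "\<bar>x - 2 * \<beta> / \<bar>p\<bar>\<bar> \<le> \<eta> / \<kappa>"
    "\<And>g e. (\<And>i. i \<in> I \<Longrightarrow> \<bar>pmf M i / \<eta> - g\<bar> \<le> e) \<Longrightarrow>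
       \<bar>strip_excess M (\<lambda>i. p * (\<eta> * of_int i) + r) (\<kappa> * \<beta>) / \<kappa> - x * g\<bar> \<le> \<bar>x\<bar> * e"
proof -
  define \<rho> \<alpha> where "\<rho> = \<kappa> * \<bar>\<beta>\<bar> / (\<bar>p\<bar> * \<eta>)" and "\<alpha> = r / (p * \<eta>)"
  have \<rho>: "\<rho> \<ge> 0" using assms by (simp add: \<rho>_def)
  have s: "\<bar>p * (\<eta> * of_int i) + r\<bar> = \<bar>p\<bar> * \<eta> * \<bar>of_int i + \<alpha>\<bar>" for i :: int
  proof -
    have "p * (\<eta> * of_int i) + r = (p * \<eta>) * (of_int i + \<alpha>)" using assms by (simp add: \<alpha>_def field_simps)
    then show ?thesis using assms(2) by (simp only: abs_mult abs_of_pos)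
  qed
  have \<rho>': "\<bar>p\<bar> * \<eta> * \<rho> = \<kappa> * \<bar>\<beta>\<bar>" using assms by (simp add: \<rho>_def)
  have p\<eta>: "\<bar>p\<bar> * \<eta> > 0" using assms by simp
  define I where "I = (if \<beta> \<ge> 0 then {i::int. \<bar>of_int i + \<alpha>\<bar> \<le> \<rho>} else {i. \<bar>of_int i + \<alpha>\<bar> < \<rho>})"
  define \<sigma> :: real where "\<sigma> = (if \<beta> \<ge> 0 then 1 else -1)"
  have I: "finite I" "\<bar>real (card I) - 2 * \<rho>\<bar> \<le> 1"
    using card_ints_closed[OF \<rho>, of \<alpha>] card_ints_open[OF \<rho>, of \<alpha>] by (auto simp: I_def)
  have I_strip: "\<bar>p * (\<eta> * of_int i) + r\<bar> \<le> \<kappa> * \<bar>\<beta>\<bar>" if "i \<in> I" for i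
  proof -
    have "\<bar>of_int i + \<alpha>\<bar> \<le> \<rho>" using that by (auto simp: I_def split: if_splits)
    then show ?thesis unfolding s \<rho>'[symmetric] using assms by (intro mult_left_mono) auto
  qed
  have ex: "strip_excess M (\<lambda>i. p * (\<eta> * of_int i) + r) (\<kappa> * \<beta>) = \<sigma> * measure_pmf.prob M I"
  proof -
    have "\<bar>of_int i + \<alpha>\<bar> \<le> \<rho> \<longleftrightarrow> \<bar>p * (\<eta> * of_int i) + r\<bar> \<le> \<bar>\<kappa> * \<beta>\<bar>"
      "\<bar>of_int i + \<alpha>\<bar> < \<rho> \<longleftrightarrow> \<bar>p * (\<eta> * of_int i) + r\<bar> < \<bar>\<kappa> * \<beta>\<bar>" for i :: int
      using assms(3) unfolding s abs_mult abs_of_pos[OF assms(3)] \<rho>'[symmetric] mult_le_cancel_left_pos[OF p\<eta>] mult_less_cancel_left_pos[OF p\<eta>]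
      by simp_all
    then show ?thesis using assms by (simp add: strip_excess_eq I_def \<sigma>_def zero_le_mult_iff)
  qed
  define x where "x = \<sigma> * (real (card I) * \<eta> / \<kappa>)"
  have \<sigma>: "\<bar>\<sigma>\<bar> = 1" "\<sigma> * \<bar>\<beta>\<bar> = \<beta>" by (auto simp: \<sigma>_def)
  have x: "\<bar>x\<bar> = real (card I) * \<eta> / \<kappa>" using assms by (simp add: x_def abs_mult \<sigma>)
  have "x - 2 * \<beta> / \<bar>p\<bar> = \<sigma> * (\<eta> / \<kappa>) * (real (card I) - 2 * \<rho>)"
    using assms \<sigma>(2) by (simp add: x_def \<rho>_def field_simps)
  then have "\<bar>x - 2 * \<beta> / \<bar>p\<bar>\<bar> = (\<eta> / \<kappa>) * \<bar>real (card I) - 2 * \<rho>\<bar>"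
    using assms by (simp add: abs_mult \<sigma>)
  also have "\<dots> \<le> (\<eta> / \<kappa>) * 1" using I assms by (intro mult_left_mono) auto
  finally have x2: "\<bar>x - 2 * \<beta> / \<bar>p\<bar>\<bar> \<le> \<eta> / \<kappa>" by simp
  have "\<bar>strip_excess M (\<lambda>i. p * (\<eta> * of_int i) + r) (\<kappa> * \<beta>) / \<kappa> - x * g\<bar> \<le> \<bar>x\<bar> * e"
    if g: "\<And>i. i \<in> I \<Longrightarrow> \<bar>pmf M i / \<eta> - g\<bar> \<le> e" for g e
  proof -
    have "measure_pmf.prob M I = (\<Sum>i\<in>I. pmf M i)" by (rule measure_measure_pmf_finite[OF I(1)])
    then have "(\<Sum>i\<in>I. pmf M i / \<eta> - g) = measure_pmf.prob M I / \<eta> - real (card I) * g"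
      by (simp add: sum_subtractf sum_divide_distrib)
    then have "strip_excess M (\<lambda>i. p * (\<eta> * of_int i) + r) (\<kappa> * \<beta>) / \<kappa> - x * g = \<sigma> * (\<eta> / \<kappa>) * (\<Sum>i\<in>I. pmf M i / \<eta> - g)"
      unfolding ex x_def \<open>(\<Sum>i\<in>I. pmf M i / \<eta> - g) = _\<close> using assms by (simp add: field_simps)
    then have "\<bar>strip_excess M (\<lambda>i. p * (\<eta> * of_int i) + r) (\<kappa> * \<beta>) / \<kappa> - x * g\<bar> = (\<eta> / \<kappa>) * \<bar>\<Sum>i\<in>I. pmf M i / \<eta> - g\<bar>"
      using assms by (simp add: abs_mult \<sigma>)
    also have "\<dots> \<le> (\<eta> / \<kappa>) * (\<Sum>i\<in>I. \<bar>pmf M i / \<eta> - g\<bar>)" using assms by (intro mult_left_mono sum_abs) auto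
    also have "\<dots> \<le> (\<eta> / \<kappa>) * (\<Sum>i\<in>I. e)" using assms g by (intro mult_left_mono sum_mono) auto
    finally show ?thesis by (simp add: x mult_ac)
  qed
  then show ?thesis using that[OF I(1) I_strip x x2] by blast
qed

text \<open>The product of the two densities is the planar Gaussian on the line p x + q y = 0,
  parametrised by y. Up to a constant it is a normal density of variance 2 / (1 + (q / p)^2), whose
  second moment produces the weight of \<open>d\<close>.\<close>

lemma gaussian_strip_integral:
  "(\<integral>y. heat_density y * (2 * (c + d * y\<^sup>2) / \<bar>p\<bar> * heat_density (q / p * y)) \<partial>lborel) =
    (c + 2 * d / (1 + (q / p)\<^sup>2)) * (1 / (\<bar>p\<bar> * (sqrt pi * sqrt (1 + (q / p)\<^sup>2))))"
proof -
  define v where "v = 1 + (q / p)\<^sup>2"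
  have v: "v > 0" unfolding v_def by (rule add_pos_nonneg) auto
  let ?g = "normal_density 0 (sqrt (2 / v))"
  have pr: "heat_density y * heat_density (q / p * y) = 1 / (2 * (sqrt pi * sqrt v)) * ?g y" for y
  proof -
    have "heat_density y * heat_density (q / p * y) = exp (- y\<^sup>2 / 4 - (q / p * y)\<^sup>2 / 4) / (4 * pi)"
      by (simp add: normal_density_def mult_exp_exp real_sqrt_mult field_simps)
    also have "- y\<^sup>2 / 4 - (q / p * y)\<^sup>2 / 4 = - v * y\<^sup>2 / 4" by (simp add: v_def field_simps power_mult_distrib power_divide)
    also have "exp \<dots> / (4 * pi) = 1 / (2 * (sqrt pi * sqrt v)) * ?g y"
    proof -
      have "?g y = 1 / sqrt (4 * pi / v) * exp (- v * y\<^sup>2 / 4)" using v by (simp add: normal_density_def)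
      also have "1 / sqrt (4 * pi / v) = sqrt v / (2 * sqrt pi)" using v by (simp add: real_sqrt_divide real_sqrt_mult)
      finally have g: "?g y = sqrt v / (2 * sqrt pi) * exp (- v * y\<^sup>2 / 4)" .
      have "4 * pi = 2 * sqrt pi * (2 * sqrt pi)" by simp
      then show ?thesis unfolding g using v by simp
    qed
    finally show ?thesis .
  qed
  have "heat_density y * (2 * (c + d * y\<^sup>2) / \<bar>p\<bar> * heat_density (q / p * y)) = 1 / (\<bar>p\<bar> * (sqrt pi * sqrt v)) * (c * ?g y + d * (?g y * y\<^sup>2))" for y
  proof -
    have "heat_density y * (2 * (c + d * y\<^sup>2) / \<bar>p\<bar> * heat_density (q / p * y)) = 2 * (c + d * y\<^sup>2) / \<bar>p\<bar> * (heat_density y * heat_density (q / p * y))"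
      by (simp add: mult_ac)
    also have "\<dots> = 1 / (\<bar>p\<bar> * (sqrt pi * sqrt v)) * ((c + d * y\<^sup>2) * ?g y)"
      unfolding pr by (cases "p = 0") (simp_all add: divide_simps)
    also have "(c + d * y\<^sup>2) * ?g y = c * ?g y + d * (?g y * y\<^sup>2)" by (simp add: algebra_simps)
    finally show ?thesis .
  qed
  then have "(\<integral>y. heat_density y * (2 * (c + d * y\<^sup>2) / \<bar>p\<bar> * heat_density (q / p * y)) \<partial>lborel) =
     1 / (\<bar>p\<bar> * (sqrt pi * sqrt v)) * (\<integral>y. c * ?g y + d * (?g y * y\<^sup>2) \<partial>lborel)"
    by simp
  also have "(\<integral>y. c * ?g y + d * (?g y * y\<^sup>2) \<partial>lborel) = c + d * (2 / v)"
  proof -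
    have "integrable lborel (\<lambda>y. ?g y * y\<^sup>2)"
      using integrable_normal_moment[of "sqrt (2 / v)" 0 2] v by simp
    moreover have "(\<integral>y. ?g y * y\<^sup>2 \<partial>lborel) = 2 / v"
      using integral_normal_moment_even[of "sqrt (2 / v)" 0 1] v by (simp add: fact_numeral)
    moreover have "integrable lborel ?g" "(\<integral>y. ?g y \<partial>lborel) = 1" using v by auto
    ultimately show ?thesis by (subst Bochner_Integration.integral_add) auto
  qed
  finally show ?thesis by (simp add: v_def)
qed

text \<open>The half plane through the origin accounts for 1/2. The correction, divided by \<kappa>,
  tends to a positive multiple of the Gaussian average of c + d y^2 over the line E1 x + E2 y = 0.
  On that line y^2 has mean 2 E1^2 / (E1^2 + E2^2), so \<open>neg\<close> states that the average is
  negative. E1 must not vanish because the strip is measured along the first coordinate.\<close>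

lemma half_plane_estimate:
  fixes \<eta> \<kappa> e1 e2 :: "nat \<Rightarrow> real"
  assumes \<eta>: "\<And>n. \<eta> n > 0" "\<eta> \<longlonglongrightarrow> 0"
    and \<kappa>: "\<And>n. \<kappa> n > 0" "\<kappa> \<longlonglongrightarrow> 0" "(\<lambda>n. \<eta> n / \<kappa> n) \<longlonglongrightarrow> 0"
    and e: "e1 \<longlonglongrightarrow> E1" "e2 \<longlonglongrightarrow> E2" "E1 \<noteq> 0"
    and neg: "c * (E1\<^sup>2 + E2\<^sup>2) + 2 * d * E1\<^sup>2 < 0"
  obtains m where "m > 0" "\<forall>\<^sub>F n in sequentially. measure_pmf.prob (heat_pmf (1 / (\<eta> n)\<^sup>2))
     {(i, j). 0 \<le> e1 n * (\<eta> n * of_int i) + e2 n * (\<eta> n * of_int j) + \<kappa> n * (c + d * (\<eta> n * of_int j)\<^sup>2)} \<le> 1 / 2 - m * \<kappa> n"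
proof -
  let ?M = "\<lambda>n. marginal_pmf (1 / (\<eta> n)\<^sup>2)"
  define \<beta> where "\<beta> y = c + d * y\<^sup>2" for y :: real
  define s where "s n j i = e1 n * (\<eta> n * of_int i) + e2 n * (\<eta> n * of_int j)" for n and j i :: int
  define F where "F n j = strip_excess (?M n) (s n j) (\<kappa> n * \<beta> (\<eta> n * of_int j)) / \<kappa> n" for n j
  \<comment> \<open>Limiting strip width at height y times the density at the point -(E2 / E1) y
    where the line crosses that height; the density is even.\<close>
  define G where "G y = 2 * (c + d * y\<^sup>2) / \<bar>E1\<bar> * heat_density (E2 / E1 * y)" for y
  have e1ev: "\<forall>\<^sub>F n in sequentially. \<bar>E1\<bar> / 2 < \<bar>e1 n\<bar>"
    using e(3) by (intro order_tendstoD(1)[OF tendsto_rabs[OF e(1)]]) simp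
  have unif: "\<forall>\<^sub>F n in sequentially. \<forall>j. \<bar>pmf (?M n) j / \<eta> n - heat_density (\<eta> n * of_int j)\<bar> \<le> \<epsilon>" if "\<epsilon> > 0" for \<epsilon>
    using that by (rule kernel_scaled_uniform[OF \<eta>])
  define C where "C = (8 * (\<bar>c\<bar> + \<bar>d\<bar>) / \<bar>E1\<bar> + 2)"
  have bound: "\<forall>\<^sub>F n in sequentially. \<forall>j. \<bar>F n j\<bar> \<le> C * (1 + (\<eta> n * of_int j)\<^sup>2)"
    using e1ev unif[OF zero_less_one] order_tendstoD(2)[OF \<kappa>(3), of 1, OF zero_less_one]
  proof eventually_elim
    case (elim n)
    show ?case
    proof
      fix j :: int
      let ?y = "\<eta> n * of_int j"
      have "e1 n \<noteq> 0" using elim(1) e(3) by auto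
      from strip_excess_count[OF this \<eta>(1)[of n] \<kappa>(1)[of n], where r = "e2 n * ?y" and \<beta> = "\<beta> ?y" and M = "?M n"] obtain I x where Ix:
        "\<bar>x - 2 * \<beta> ?y / \<bar>e1 n\<bar>\<bar> \<le> \<eta> n / \<kappa> n"
        "\<And>g e. (\<And>i. i \<in> I \<Longrightarrow> \<bar>pmf (?M n) i / \<eta> n - g\<bar> \<le> e) \<Longrightarrow> \<bar>F n j - x * g\<bar> \<le> \<bar>x\<bar> * e"
        unfolding F_def s_def by metis
      \<comment> \<open>The Gaussian density is at most 1, and the local limit error has been taken
        to be at most 1.\<close>
      have "\<bar>pmf (?M n) i / \<eta> n - 0\<bar> \<le> 2" for i
        using elim(2)[rule_format, of i] heat_density_le_1[of "\<eta> n * of_int i"] \<eta>(1)[of n] normal_density_nonneg[of 0 "sqrt 2" "\<eta> n * of_int i"]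
        unfolding abs_le_iff by linarith
      from Ix(2)[OF this] have F: "\<bar>F n j\<bar> \<le> 2 * \<bar>x\<bar>" by simp
      have "\<bar>\<beta> ?y\<bar> \<le> \<bar>c\<bar> + \<bar>d\<bar> * ?y\<^sup>2"
        unfolding \<beta>_def by (metis abs_triangle_ineq abs_mult abs_power2)
      also have "\<dots> \<le> (\<bar>c\<bar> + \<bar>d\<bar>) * (1 + ?y\<^sup>2)" by (simp add: algebra_simps)
      finally have \<beta>: "\<bar>\<beta> ?y\<bar> \<le> (\<bar>c\<bar> + \<bar>d\<bar>) * (1 + ?y\<^sup>2)" .
      have "\<bar>2 * \<beta> ?y / \<bar>e1 n\<bar>\<bar> \<le> 2 * ((\<bar>c\<bar> + \<bar>d\<bar>) * (1 + ?y\<^sup>2)) / (\<bar>E1\<bar> / 2)"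
        unfolding abs_divide abs_mult using elim(1) \<beta> e(3) by (intro frac_le mult_mono) auto
      also have "\<dots> = (4 * (\<bar>c\<bar> + \<bar>d\<bar>) / \<bar>E1\<bar>) * (1 + ?y\<^sup>2)" by simp
      finally have x: "\<bar>2 * \<beta> ?y / \<bar>e1 n\<bar>\<bar> \<le> (4 * (\<bar>c\<bar> + \<bar>d\<bar>) / \<bar>E1\<bar>) * (1 + ?y\<^sup>2)" .
      define T where "T = (4 * (\<bar>c\<bar> + \<bar>d\<bar>) / \<bar>E1\<bar>) * (1 + ?y\<^sup>2)"
      have "\<bar>x\<bar> \<le> T + 1" using x Ix(1) elim(3) unfolding T_def[symmetric] by linarith
      then have "\<bar>F n j\<bar> \<le> 2 * (T + 1)" by (intro order_trans[OF F]) simp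
      also have "\<dots> \<le> 2 * (T + (1 + ?y\<^sup>2))" by simp
      finally have "\<bar>F n j\<bar> \<le> 2 * (T + (1 + ?y\<^sup>2))" .
      then have "\<bar>F n j\<bar> \<le> 2 * ((4 * (\<bar>c\<bar> + \<bar>d\<bar>) / \<bar>E1\<bar>) * (1 + ?y\<^sup>2) + 1 * (1 + ?y\<^sup>2))"
        by (simp add: T_def)
      then show "\<bar>F n j\<bar> \<le> C * (1 + ?y\<^sup>2)" by (simp add: C_def algebra_simps)
    qed
  qed
  have lim: "(\<lambda>n. F n (j n)) \<longlonglongrightarrow> G y" if j: "(\<lambda>n. \<eta> n * of_int (j n)) \<longlonglongrightarrow> y" for y j
  proof -
    let ?y = "\<lambda>n. \<eta> n * of_int (j n)"
    define g where "g = heat_density (E2 / E1 * y)"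
    have "\<exists>x I. e1 n \<noteq> 0 \<longrightarrow> (\<forall>i\<in>I. \<bar>s n (j n) i\<bar> \<le> \<kappa> n * \<bar>\<beta> (?y n)\<bar>) \<and> \<bar>x - 2 * \<beta> (?y n) / \<bar>e1 n\<bar>\<bar> \<le> \<eta> n / \<kappa> n \<and>
      (\<forall>g e. (\<forall>i\<in>I. \<bar>pmf (?M n) i / \<eta> n - g\<bar> \<le> e) \<longrightarrow> \<bar>F n (j n) - x * g\<bar> \<le> \<bar>x\<bar> * e)" for n
      using strip_excess_count[OF _ \<eta>(1)[of n] \<kappa>(1)[of n], where p = "e1 n" and r = "e2 n * ?y n" and \<beta> = "\<beta> (?y n)" and M = "?M n"] unfolding F_def s_def by metis
    then obtain x I where xI: "\<And>n i. e1 n \<noteq> 0 \<Longrightarrow> i \<in> I n \<Longrightarrow> \<bar>s n (j n) i\<bar> \<le> \<kappa> n * \<bar>\<beta> (?y n)\<bar>"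
      "\<And>n. e1 n \<noteq> 0 \<Longrightarrow> \<bar>x n - 2 * \<beta> (?y n) / \<bar>e1 n\<bar>\<bar> \<le> \<eta> n / \<kappa> n"
      "\<And>n g e. e1 n \<noteq> 0 \<Longrightarrow> (\<And>i. i \<in> I n \<Longrightarrow> \<bar>pmf (?M n) i / \<eta> n - g\<bar> \<le> e) \<Longrightarrow> \<bar>F n (j n) - x n * g\<bar> \<le> \<bar>x n\<bar> * e"
      by metis
    have e1nz: "\<forall>\<^sub>F n in sequentially. e1 n \<noteq> 0" using e1ev e(3) by (auto elim!: eventually_mono)
    have \<beta>lim: "(\<lambda>n. \<beta> (?y n)) \<longlonglongrightarrow> \<beta> y" unfolding \<beta>_def by (intro tendsto_intros j)
    have "(\<lambda>n. 2 * \<beta> (?y n) / \<bar>e1 n\<bar>) \<longlonglongrightarrow> 2 * \<beta> y / \<bar>E1\<bar>"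
      using e(3) by (intro tendsto_intros \<beta>lim e(1)) auto
    moreover have "(\<lambda>n. x n - 2 * \<beta> (?y n) / \<bar>e1 n\<bar>) \<longlonglongrightarrow> 0"
      by (rule Lim_null_comparison[OF _ \<kappa>(3)]) (use e1nz xI(2) in \<open>auto elim!: eventually_mono\<close>)
    ultimately have "(\<lambda>n. (x n - 2 * \<beta> (?y n) / \<bar>e1 n\<bar>) + 2 * \<beta> (?y n) / \<bar>e1 n\<bar>) \<longlonglongrightarrow> 0 + 2 * \<beta> y / \<bar>E1\<bar>"
      by (intro tendsto_add)
    then have xlim: "x \<longlonglongrightarrow> 2 * \<beta> y / \<bar>E1\<bar>" by simp
    have "(\<lambda>n. F n (j n) - x n * g) \<longlonglongrightarrow> 0"
    proof (rule tendstoI)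
      fix \<epsilon> :: real assume \<epsilon>: "\<epsilon> > 0"
      \<comment> \<open>\<open>X\<close> eventually bounds \<open>x n\<close>. Two errors of size
        \<open>\<epsilon>'\<close> occur, one from the local limit and one from continuity of the
        density, and 2 X \<open>\<epsilon>'\<close> = 2 \<epsilon> / 3.\<close>
      define X where "X = \<bar>2 * \<beta> y / \<bar>E1\<bar>\<bar> + 1"
      have X: "X > 0" by (simp add: X_def add_nonneg_pos)
      define \<epsilon>' where "\<epsilon>' = \<epsilon> / (3 * X)"
      have \<epsilon>': "\<epsilon>' > 0" using \<epsilon> X by (simp add: \<epsilon>'_def)
      \<comment> \<open>The strip shrinks to a point as \<kappa> tends to 0, so the density is
        constant on it up to an error.\<close>
      have "isCont heat_density (- (E2 / E1 * y))" by (rule isCont_heat_density)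
      then obtain \<delta> where \<delta>: "\<delta> > 0" "\<And>z. \<bar>z + E2 / E1 * y\<bar> < \<delta> \<Longrightarrow> \<bar>heat_density z - g\<bar> < \<epsilon>'"
        unfolding continuous_at_eps_delta using \<epsilon>' by (force simp: dist_real_def g_def normal_density_def)
      have l1: "(\<lambda>n. \<kappa> n * \<bar>\<beta> (?y n)\<bar> / \<bar>e1 n\<bar> + \<bar>E2 / E1 * y - e2 n / e1 n * ?y n\<bar>) \<longlonglongrightarrow> 0 * \<bar>\<beta> y\<bar> / \<bar>E1\<bar> + \<bar>E2 / E1 * y - E2 / E1 * y\<bar>"
        using e(3) by (intro tendsto_intros \<kappa>(2) \<beta>lim e j) auto
      have "\<forall>\<^sub>F n in sequentially. \<kappa> n * \<bar>\<beta> (?y n)\<bar> / \<bar>e1 n\<bar> + \<bar>E2 / E1 * y - e2 n / e1 n * ?y n\<bar> < \<delta>"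
        using l1 \<delta>(1) by (intro order_tendstoD(2)[OF l1]) simp
      moreover have "\<forall>\<^sub>F n in sequentially. \<bar>x n\<bar> < X"
        using tendsto_rabs[OF xlim] by (rule order_tendstoD) (simp add: X_def)
      ultimately show "\<forall>\<^sub>F n in sequentially. dist (F n (j n) - x n * g) 0 < \<epsilon>"
        using e1nz unif[OF \<epsilon>']
      proof eventually_elim
        case (elim n)
        have "\<bar>pmf (?M n) i / \<eta> n - g\<bar> \<le> 2 * \<epsilon>'" if i: "i \<in> I n" for i
        proof -
          have "\<eta> n * of_int i + e2 n / e1 n * ?y n = s n (j n) i / e1 n"
            using elim(3) by (simp add: s_def field_simps)
          then have "\<bar>\<eta> n * of_int i + e2 n / e1 n * ?y n\<bar> = \<bar>s n (j n) i\<bar> / \<bar>e1 n\<bar>" by (simp add: abs_divide)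
          also have "\<dots> \<le> \<kappa> n * \<bar>\<beta> (?y n)\<bar> / \<bar>e1 n\<bar>"
            using xI(1)[OF elim(3) i] by (intro divide_right_mono) auto
          finally have le: "\<bar>\<eta> n * of_int i + e2 n / e1 n * ?y n\<bar> \<le> \<kappa> n * \<bar>\<beta> (?y n)\<bar> / \<bar>e1 n\<bar>" .
          have tri: "\<bar>a + c\<bar> \<le> \<bar>a + b\<bar> + \<bar>c - b\<bar>" for a b c :: real by linarith
          have "\<bar>\<eta> n * of_int i + E2 / E1 * y\<bar> < \<delta>"
            by (rule le_less_trans[OF order_trans[OF tri add_right_mono[OF le]] elim(1)])
          from \<delta>(2)[OF this] elim(4)[rule_format, of i] show ?thesis by linarith
        qed
        from xI(3)[OF elim(3) this] have "\<bar>F n (j n) - x n * g\<bar> \<le> \<bar>x n\<bar> * (2 * \<epsilon>')" by blast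
        also have "\<dots> \<le> X * (2 * \<epsilon>')" using elim(2) \<epsilon>' by (intro mult_right_mono) auto
        also have "\<dots> < \<epsilon>" using X \<epsilon> by (simp add: \<epsilon>'_def field_simps)
        finally show ?case by (simp add: dist_real_def)
      qed
    qed
    then have "(\<lambda>n. (F n (j n) - x n * g) + x n * g) \<longlonglongrightarrow> 0 + 2 * \<beta> y / \<bar>E1\<bar> * g"
      by (intro tendsto_intros xlim)
    then show ?thesis by (simp add: G_def g_def \<beta>_def)
  qed
  have "c + 2 * d / (1 + (E2 / E1)\<^sup>2) < 0"
  proof -
    have v: "E1\<^sup>2 + E2\<^sup>2 > 0" using e(3) by (simp add: add_pos_nonneg)
    have "1 + (E2 / E1)\<^sup>2 = (E1\<^sup>2 + E2\<^sup>2) / E1\<^sup>2" using e(3) by (simp add: power_divide field_simps)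
    moreover have "c + x / V = (c * V + x) / V" if "V > 0" for x V :: real
      using that by (simp add: field_simps)
    from this[OF v, of "2 * d * E1\<^sup>2"] have "c + 2 * d * E1\<^sup>2 / (E1\<^sup>2 + E2\<^sup>2) = (c * (E1\<^sup>2 + E2\<^sup>2) + 2 * d * E1\<^sup>2) / (E1\<^sup>2 + E2\<^sup>2)" .
    ultimately have "c + 2 * d / (1 + (E2 / E1)\<^sup>2) = (c * (E1\<^sup>2 + E2\<^sup>2) + 2 * d * E1\<^sup>2) / (E1\<^sup>2 + E2\<^sup>2)"
      by simp
    then show ?thesis using neg v by (simp add: divide_neg_pos)
  qed
  moreover have "1 / (\<bar>E1\<bar> * (sqrt pi * sqrt (1 + (E2 / E1)\<^sup>2))) > 0"
    using e(3) by (intro divide_pos_pos mult_pos_pos) (auto intro: add_pos_nonneg)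
  ultimately have neg_int: "(\<integral>y. heat_density y * G y \<partial>lborel) < 0"
    unfolding G_def gaussian_strip_integral by (rule mult_neg_pos)
  have "G \<in> borel_measurable borel" unfolding G_def by measurable
  from expectation_eventually_negative[OF \<eta> bound lim this neg_int] obtain m where m: "m > 0" "\<forall>\<^sub>F n in sequentially. measure_pmf.expectation (?M n) (F n) \<le> - m"
    by blast
  from m(2) have "\<forall>\<^sub>F n in sequentially. measure_pmf.prob (heat_pmf (1 / (\<eta> n)\<^sup>2))
     {(i, j). 0 \<le> e1 n * (\<eta> n * of_int i) + e2 n * (\<eta> n * of_int j) + \<kappa> n * (c + d * (\<eta> n * of_int j)\<^sup>2)} \<le> 1 / 2 - (m / 2) * \<kappa> n"
  proof eventually_elim
    case (elim n)
    have a: "1 / (\<eta> n)\<^sup>2 > 0" using \<eta>(1)[of n] by simp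
    have "\<kappa> n * measure_pmf.expectation (?M n) (F n) = measure_pmf.expectation (?M n) (\<lambda>j. \<kappa> n * F n j)" by simp
    also have "(\<lambda>j. \<kappa> n * F n j) = (\<lambda>j. strip_excess (?M n) (\<lambda>i. (e1 n * \<eta> n) * of_int i + (e2 n * \<eta> n) * of_int j) (\<kappa> n * (c + d * (\<eta> n * of_int j)\<^sup>2)))"
      using \<kappa>(1)[of n] by (simp add: F_def s_def[abs_def] \<beta>_def mult.assoc)
    also have "measure_pmf.expectation (?M n) \<dots> = 2 * measure_pmf.prob (heat_pmf (1 / (\<eta> n)\<^sup>2))
     {(i, j). 0 \<le> (e1 n * \<eta> n) * of_int i + (e2 n * \<eta> n) * of_int j + \<kappa> n * (c + d * (\<eta> n * of_int j)\<^sup>2)} - 1"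
      by (rule prob_half_plane[OF a]) simp
    finally have eq: "\<kappa> n * measure_pmf.expectation (?M n) (F n) = 2 * measure_pmf.prob (heat_pmf (1 / (\<eta> n)\<^sup>2))
     {(i, j). 0 \<le> e1 n * (\<eta> n * of_int i) + e2 n * (\<eta> n * of_int j) + \<kappa> n * (c + d * (\<eta> n * of_int j)\<^sup>2)} - 1"
      by (simp add: mult.assoc)
    have "\<kappa> n * measure_pmf.expectation (?M n) (F n) \<le> \<kappa> n * (- m)"
      using elim \<kappa>(1)[of n] by (intro mult_left_mono) auto
    then show ?case unfolding eq by (simp add: mult.commute)
  qed
  then show ?thesis using m(1) by (intro that[of "m / 2"]) auto
qed

text \<open>The factor 1 + \<kappa> B differs from 1 by at most \<omega> and is at least 1/2.
  Dividing by it therefore changes Q by at most 2 \<omega> |Q|.\<close>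

lemma linear_perturbation:
  fixes s \<kappa> B Q \<omega> :: real
  assumes "0 \<le> s * (1 + \<kappa> * B) + \<kappa> * Q" "\<bar>\<kappa> * B\<bar> \<le> \<omega>" "\<omega> \<le> 1 / 2" "\<kappa> > 0"
  shows "0 \<le> s + \<kappa> * (Q + 2 * \<omega> * \<bar>Q\<bar>)"
proof -
  define \<theta> where "\<theta> = 1 + \<kappa> * B"
  have \<theta>: "\<theta> \<ge> 1 / 2" "\<bar>\<theta> - 1\<bar> \<le> \<omega>" using assms unfolding \<theta>_def by linarith+
  have "\<bar>Q * (1 - \<theta>)\<bar> \<le> \<bar>Q\<bar> * \<omega>"
    unfolding abs_mult using \<theta> by (intro mult_left_mono) (auto simp: abs_minus_commute)
  also have "\<dots> \<le> (2 * \<omega> * \<bar>Q\<bar>) * \<theta>"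
    using mult_left_mono[OF \<theta>(1), of "2 * \<omega> * \<bar>Q\<bar>"] \<theta>(2) by (simp add: mult_ac)
  finally have "Q \<le> (Q + 2 * \<omega> * \<bar>Q\<bar>) * \<theta>" by (simp add: algebra_simps abs_le_iff)
  then have "\<kappa> * Q \<le> \<kappa> * ((Q + 2 * \<omega> * \<bar>Q\<bar>) * \<theta>)" using assms(4) by (intro mult_left_mono) auto
  then have "0 \<le> s * \<theta> + \<kappa> * ((Q + 2 * \<omega> * \<bar>Q\<bar>) * \<theta>)" using assms(1) by (simp add: \<theta>_def)
  also have "\<dots> = (s + \<kappa> * (Q + 2 * \<omega> * \<bar>Q\<bar>)) * \<theta>" by (simp add: algebra_simps)
  finally show ?thesis using \<theta>(1) by (simp add: zero_le_mult_iff)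
qed

text \<open>Division with remainder: modulo the linear form S = e1 x + e2 y, every quadratic form
  equals a multiple of y^2, namely its value at (-e2 / e1, 1) on the kernel of S. The remaining part
  S * B merely multiplies S by 1 + \<kappa> B. This factor is near 1 only while \<kappa> (|x| + |y|)
  is small, which explains the window \<open>s\<close>.\<close>

lemma perturbed_half_plane_estimate_fst:
  fixes \<eta> \<kappa> e1 e2 :: "nat \<Rightarrow> real"
  assumes \<eta>: "\<And>n. \<eta> n > 0" "\<eta> \<longlonglongrightarrow> 0"
    and \<kappa>: "\<And>n. \<kappa> n > 0" "\<kappa> \<longlonglongrightarrow> 0" "(\<lambda>n. \<eta> n / \<kappa> n) \<longlonglongrightarrow> 0"
    and e: "e1 \<longlonglongrightarrow> E1" "e2 \<longlonglongrightarrow> E2" "E1 \<noteq> 0"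
    and neg: "c * (E1\<^sup>2 + E2\<^sup>2) + 2 * (\<alpha> * E2\<^sup>2 - \<beta> * E1 * E2 + \<gamma> * E1\<^sup>2) < 0"
  obtains m s where "m > 0" "s > 0" "\<forall>\<^sub>F n in sequentially. measure_pmf.prob (heat_pmf (1 / (\<eta> n)\<^sup>2))
     {(i, j). \<kappa> n * (\<bar>\<eta> n * of_int i\<bar> + \<bar>\<eta> n * of_int j\<bar>) \<le> s \<and>
        0 \<le> e1 n * (\<eta> n * of_int i) + e2 n * (\<eta> n * of_int j) + \<kappa> n * (c + \<alpha> * (\<eta> n * of_int i)\<^sup>2 +
          \<beta> * (\<eta> n * of_int i) * (\<eta> n * of_int j) + \<gamma> * (\<eta> n * of_int j)\<^sup>2)} \<le> 1 / 2 - m * \<kappa> n"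
proof -
  define r where "r n = e2 n / e1 n" for n
  define \<rho> where "\<rho> = E2 / E1"
  define d where "d = \<alpha> * \<rho>\<^sup>2 - \<beta> * \<rho> + \<gamma>"
  define V where "V = E1\<^sup>2 + E2\<^sup>2"
  have dE: "d * E1\<^sup>2 = \<alpha> * E2\<^sup>2 - \<beta> * E1 * E2 + \<gamma> * E1\<^sup>2"
    using e(3) by (simp add: d_def \<rho>_def power2_eq_square field_simps)
  define D where "D = c * V + 2 * d * E1\<^sup>2"
  have D: "D < 0" using neg dE by (simp add: D_def V_def)
  define W where "W = 2 * \<bar>c\<bar> * V + 2 * (2 * \<bar>d\<bar> + 3) * E1\<^sup>2"
  have W: "W \<ge> 0" by (simp add: W_def V_def)
  \<comment> \<open>\<open>W\<close> is the change of \<open>D\<close> per unit of \<omega> caused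
    by passing to \<open>c'\<close> and \<open>d'\<close>; the choice keeps D + \<omega> W
    negative.\<close>
  define \<omega> where "\<omega> = min (1 / 2) (- D / (2 * (W + 1)))"
  have \<omega>: "\<omega> > 0" "\<omega> \<le> 1 / 2" "\<omega> \<le> - D / (2 * (W + 1))"
  proof -
    have "- D / (2 * (W + 1)) > 0" using D W by (intro divide_pos_pos) auto
    then show "\<omega> > 0" unfolding \<omega>_def by (simp only: min_less_iff_conj) simp
  qed (simp_all only: \<omega>_def min.cobounded1 min.cobounded2)
  have "\<omega> * W \<le> - D / (2 * (W + 1)) * (W + 1)" using \<omega> W by (intro mult_mono) auto
  also have "\<dots> = - D / 2"
  proof -
    have "x / (2 * k) * k = x / 2" if "k > 0" for x k :: real using that by simp
    from this[of "W + 1" "- D"] show ?thesis using W by linarith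
  qed
  finally have \<omega>W: "\<omega> * W < - D" using D by linarith
  define c' where "c' = c + 2 * \<omega> * \<bar>c\<bar>"
  define d' where "d' = d + \<omega> * (2 * \<bar>d\<bar> + 3)"
  have "c' * (E1\<^sup>2 + E2\<^sup>2) + 2 * d' * E1\<^sup>2 = D + \<omega> * W"
    unfolding c'_def d'_def D_def W_def V_def by (simp add: algebra_simps)
  then have neg': "c' * (E1\<^sup>2 + E2\<^sup>2) + 2 * d' * E1\<^sup>2 < 0" using \<omega>W by simp
  obtain m where m: "m > 0" "\<forall>\<^sub>F n in sequentially. measure_pmf.prob (heat_pmf (1 / (\<eta> n)\<^sup>2))
     {(i, j). 0 \<le> e1 n * (\<eta> n * of_int i) + e2 n * (\<eta> n * of_int j) + \<kappa> n * (c' + d' * (\<eta> n * of_int j)\<^sup>2)} \<le> 1 / 2 - m * \<kappa> n"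
    by (rule half_plane_estimate[OF \<eta> \<kappa> e neg'])
  \<comment> \<open>Eventually |B| is at most K (|x| + |y|), so the window s = \<omega> / K forces
    \<kappa> |B| to be at most \<omega>.\<close>
  define K where "K = (\<bar>\<alpha>\<bar> + (\<bar>\<beta>\<bar> + \<bar>\<alpha>\<bar> * (\<bar>\<rho>\<bar> + 1))) / (\<bar>E1\<bar> / 2) + 1"
  have K: "K > 0" using e(3) by (auto simp: K_def intro!: add_nonneg_pos divide_nonneg_pos add_nonneg_nonneg)
  define s where "s = \<omega> / K"
  have s: "s > 0" using \<omega> K by (simp add: s_def)
  have rlim: "r \<longlonglongrightarrow> \<rho>" unfolding r_def \<rho>_def using e by (intro tendsto_intros)
  have "\<forall>\<^sub>F n in sequentially. \<bar>r n\<bar> < \<bar>\<rho>\<bar> + 1"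
    by (intro order_tendstoD(2)[OF tendsto_rabs[OF rlim]]) simp
  moreover have "\<forall>\<^sub>F n in sequentially. \<bar>E1\<bar> / 2 < \<bar>e1 n\<bar>"
    using e(3) by (intro order_tendstoD(1)[OF tendsto_rabs[OF e(1)]]) simp
  moreover have "(\<lambda>n. \<bar>(\<alpha> * (r n)\<^sup>2 - \<beta> * r n + \<gamma>) - d\<bar>) \<longlonglongrightarrow> \<bar>d - d\<bar>"
    unfolding d_def by (intro tendsto_intros rlim)
  then have "\<forall>\<^sub>F n in sequentially. \<bar>(\<alpha> * (r n)\<^sup>2 - \<beta> * r n + \<gamma>) - d\<bar> < \<omega>"
    by (rule order_tendstoD) (use \<omega> in simp)
  ultimately have "\<forall>\<^sub>F n in sequentially. measure_pmf.prob (heat_pmf (1 / (\<eta> n)\<^sup>2))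
     {(i, j). \<kappa> n * (\<bar>\<eta> n * of_int i\<bar> + \<bar>\<eta> n * of_int j\<bar>) \<le> s \<and>
        0 \<le> e1 n * (\<eta> n * of_int i) + e2 n * (\<eta> n * of_int j) + \<kappa> n * (c + \<alpha> * (\<eta> n * of_int i)\<^sup>2 +
          \<beta> * (\<eta> n * of_int i) * (\<eta> n * of_int j) + \<gamma> * (\<eta> n * of_int j)\<^sup>2)} \<le> 1 / 2 - m * \<kappa> n"
    using m(2)
  proof eventually_elim
    case (elim n)
    have e1: "e1 n \<noteq> 0" using elim(2) by auto
    have "0 \<le> e1 n * x + e2 n * y + \<kappa> n * (c' + d' * y\<^sup>2)"
      if le: "\<kappa> n * (\<bar>x\<bar> + \<bar>y\<bar>) \<le> s" and pos: "0 \<le> e1 n * x + e2 n * y + \<kappa> n * (c + \<alpha> * x\<^sup>2 + \<beta> * x * y + \<gamma> * y\<^sup>2)" for x y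
    proof -
      define S where "S = e1 n * x + e2 n * y"
      define dn where "dn = \<alpha> * (r n)\<^sup>2 - \<beta> * r n + \<gamma>"
      define B where "B = (\<alpha> * x + (\<beta> - \<alpha> * r n) * y) / e1 n"
      define Q where "Q = c + dn * y\<^sup>2"
      have Sx: "S / e1 n = x + r n * y" using e1 by (simp add: S_def r_def field_simps)
      have "S * B = (x + r n * y) * (\<alpha> * x + (\<beta> - \<alpha> * r n) * y)"
        unfolding Sx[symmetric] B_def by simp
      then have "c + \<alpha> * x\<^sup>2 + \<beta> * x * y + \<gamma> * y\<^sup>2 = Q + S * B"
        unfolding Q_def dn_def by (simp add: algebra_simps power2_eq_square)
      with pos have "0 \<le> S + \<kappa> n * (Q + S * B)" by (simp only: S_def)
      then have 1: "0 \<le> S * (1 + \<kappa> n * B) + \<kappa> n * Q" by (simp add: algebra_simps)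
      have "\<bar>\<alpha> * x + (\<beta> - \<alpha> * r n) * y\<bar> \<le> \<bar>\<alpha> * x\<bar> + \<bar>(\<beta> - \<alpha> * r n) * y\<bar>" by (rule abs_triangle_ineq)
      also have "\<dots> \<le> (\<bar>\<alpha>\<bar> + (\<bar>\<beta>\<bar> + \<bar>\<alpha>\<bar> * (\<bar>\<rho>\<bar> + 1))) * \<bar>x\<bar> + (\<bar>\<alpha>\<bar> + (\<bar>\<beta>\<bar> + \<bar>\<alpha>\<bar> * (\<bar>\<rho>\<bar> + 1))) * \<bar>y\<bar>"
        unfolding abs_mult
      proof (intro add_mono mult_right_mono)
        have "\<bar>\<beta> - \<alpha> * r n\<bar> \<le> \<bar>\<beta>\<bar> + \<bar>\<alpha>\<bar> * \<bar>r n\<bar>" by (metis abs_triangle_ineq4 abs_mult)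
        also have "\<dots> \<le> \<bar>\<beta>\<bar> + \<bar>\<alpha>\<bar> * (\<bar>\<rho>\<bar> + 1)" using elim(1) by (intro add_mono mult_left_mono) auto
        finally show "\<bar>\<beta> - \<alpha> * r n\<bar> \<le> \<bar>\<alpha>\<bar> + (\<bar>\<beta>\<bar> + \<bar>\<alpha>\<bar> * (\<bar>\<rho>\<bar> + 1))" by simp
      qed auto
      finally have "\<bar>\<alpha> * x + (\<beta> - \<alpha> * r n) * y\<bar> \<le> (\<bar>\<alpha>\<bar> + (\<bar>\<beta>\<bar> + \<bar>\<alpha>\<bar> * (\<bar>\<rho>\<bar> + 1))) * (\<bar>x\<bar> + \<bar>y\<bar>)"
        by (simp add: algebra_simps)
      then have "\<bar>B\<bar> \<le> ((\<bar>\<alpha>\<bar> + (\<bar>\<beta>\<bar> + \<bar>\<alpha>\<bar> * (\<bar>\<rho>\<bar> + 1))) * (\<bar>x\<bar> + \<bar>y\<bar>)) / (\<bar>E1\<bar> / 2)"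
        unfolding B_def abs_divide using elim(2) e(3) by (intro frac_le) auto
      also have "\<dots> = ((\<bar>\<alpha>\<bar> + (\<bar>\<beta>\<bar> + \<bar>\<alpha>\<bar> * (\<bar>\<rho>\<bar> + 1))) / (\<bar>E1\<bar> / 2)) * (\<bar>x\<bar> + \<bar>y\<bar>)" by simp
      also have "\<dots> \<le> K * (\<bar>x\<bar> + \<bar>y\<bar>)" unfolding K_def by (intro mult_right_mono) auto
      finally have "\<kappa> n * \<bar>B\<bar> \<le> \<kappa> n * (K * (\<bar>x\<bar> + \<bar>y\<bar>))" using \<kappa>(1)[of n] by (intro mult_left_mono) auto
      also have "\<dots> = K * (\<kappa> n * (\<bar>x\<bar> + \<bar>y\<bar>))" by simp
      also have "\<dots> \<le> K * s" using le K by (intro mult_left_mono) auto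
      also have "\<dots> = \<omega>" using K by (simp add: s_def)
      finally have 2: "\<bar>\<kappa> n * B\<bar> \<le> \<omega>" using \<kappa>(1)[of n] by (simp add: abs_mult)
      have 3: "0 \<le> S + \<kappa> n * (Q + 2 * \<omega> * \<bar>Q\<bar>)"
        using linear_perturbation[OF 1 2 \<omega>(2) \<kappa>(1)] .
      have dn: "dn + 2 * \<omega> * \<bar>dn\<bar> \<le> d'"
      proof -
        have "\<bar>dn - d\<bar> \<le> \<omega>" using elim(3) by (simp add: dn_def)
        then have "dn \<le> d + \<omega>" "\<bar>dn\<bar> \<le> \<bar>d\<bar> + 1" using \<omega>(2) by linarith+
        then have "dn + 2 * \<omega> * \<bar>dn\<bar> \<le> (d + \<omega>) + 2 * \<omega> * (\<bar>d\<bar> + 1)" using \<omega>(1) by (intro add_mono mult_left_mono) auto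
        then show ?thesis by (simp add: d'_def algebra_simps)
      qed
      have "\<bar>Q\<bar> \<le> \<bar>c\<bar> + \<bar>dn\<bar> * y\<^sup>2" unfolding Q_def by (metis abs_triangle_ineq abs_mult abs_power2)
      then have "2 * \<omega> * \<bar>Q\<bar> \<le> 2 * \<omega> * (\<bar>c\<bar> + \<bar>dn\<bar> * y\<^sup>2)" using \<omega>(1) by (intro mult_left_mono) auto
      then have "Q + 2 * \<omega> * \<bar>Q\<bar> \<le> c' + (dn + 2 * \<omega> * \<bar>dn\<bar>) * y\<^sup>2" by (simp add: Q_def c'_def algebra_simps)
      also have "\<dots> \<le> c' + d' * y\<^sup>2" using dn by (intro add_left_mono mult_right_mono) auto
      finally have "\<kappa> n * (Q + 2 * \<omega> * \<bar>Q\<bar>) \<le> \<kappa> n * (c' + d' * y\<^sup>2)" using \<kappa>(1)[of n] by (intro mult_left_mono) auto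
      then show ?thesis using 3 by (simp add: S_def)
    qed
    then have "measure_pmf.prob (heat_pmf (1 / (\<eta> n)\<^sup>2))
     {(i, j). \<kappa> n * (\<bar>\<eta> n * of_int i\<bar> + \<bar>\<eta> n * of_int j\<bar>) \<le> s \<and>
        0 \<le> e1 n * (\<eta> n * of_int i) + e2 n * (\<eta> n * of_int j) + \<kappa> n * (c + \<alpha> * (\<eta> n * of_int i)\<^sup>2 +
          \<beta> * (\<eta> n * of_int i) * (\<eta> n * of_int j) + \<gamma> * (\<eta> n * of_int j)\<^sup>2)} \<le> measure_pmf.prob (heat_pmf (1 / (\<eta> n)\<^sup>2))
     {(i, j). 0 \<le> e1 n * (\<eta> n * of_int i) + e2 n * (\<eta> n * of_int j) + \<kappa> n * (c' + d' * (\<eta> n * of_int j)\<^sup>2)}"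
      by (intro measure_pmf.finite_measure_mono) (blast, simp)
    then show ?case using elim(4) by linarith
  qed
  then show ?thesis using that[OF m(1) s] by blast
qed

lemma map_swap_heat_pmf:
  assumes "a > 0"
  shows "map_pmf prod.swap (heat_pmf a) = heat_pmf a"
proof (rule pmf_eqI)
  fix z
  have "pmf (map_pmf prod.swap (heat_pmf a)) (prod.swap (prod.swap z)) = pmf (heat_pmf a) (prod.swap z)"
    by (rule pmf_map_inj') simp
  then show "pmf (map_pmf prod.swap (heat_pmf a)) z = pmf (heat_pmf a) z"
    by (cases z) (simp add: pmf_heat_pmf assms mult.commute)
qed

lemma prob_swap_heat_pmf:
  assumes "a > 0"
  shows "measure_pmf.prob (heat_pmf a) {(i, j). P j i} = measure_pmf.prob (heat_pmf a) {(i, j). P i j}"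
proof -
  have "measure_pmf.prob (map_pmf prod.swap (heat_pmf a)) {(i, j). P i j} = measure_pmf.prob (heat_pmf a) (prod.swap -` {(i, j). P i j})"
    by simp
  moreover have "prod.swap -` {(i, j). P i j} = {(i, j). P j i}" by auto
  ultimately show ?thesis by (simp add: map_swap_heat_pmf assms)
qed

text \<open>If E1 vanishes, the coordinates are exchanged, under which the law of the walk is
  invariant.\<close>

lemma perturbed_half_plane_estimate:
  fixes \<eta> \<kappa> e1 e2 :: "nat \<Rightarrow> real"
  assumes \<eta>: "\<And>n. \<eta> n > 0" "\<eta> \<longlonglongrightarrow> 0"
    and \<kappa>: "\<And>n. \<kappa> n > 0" "\<kappa> \<longlonglongrightarrow> 0" "(\<lambda>n. \<eta> n / \<kappa> n) \<longlonglongrightarrow> 0"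
    and e: "e1 \<longlonglongrightarrow> E1" "e2 \<longlonglongrightarrow> E2" "E1 \<noteq> 0 \<or> E2 \<noteq> 0"
    and neg: "c * (E1\<^sup>2 + E2\<^sup>2) + 2 * (\<alpha> * E2\<^sup>2 - \<beta> * E1 * E2 + \<gamma> * E1\<^sup>2) < 0"
  obtains m s where "m > 0" "s > 0" "\<forall>\<^sub>F n in sequentially. measure_pmf.prob (heat_pmf (1 / (\<eta> n)\<^sup>2))
     {(i, j). \<kappa> n * (\<bar>\<eta> n * of_int i\<bar> + \<bar>\<eta> n * of_int j\<bar>) \<le> s \<and>
        0 \<le> e1 n * (\<eta> n * of_int i) + e2 n * (\<eta> n * of_int j) + \<kappa> n * (c + \<alpha> * (\<eta> n * of_int i)\<^sup>2 +
          \<beta> * (\<eta> n * of_int i) * (\<eta> n * of_int j) + \<gamma> * (\<eta> n * of_int j)\<^sup>2)} \<le> 1 / 2 - m * \<kappa> n"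
proof (cases "E1 = 0")
  case False
  show ?thesis
    by (rule perturbed_half_plane_estimate_fst[OF \<eta> \<kappa> e(1,2) False neg]) (rule that)
next
  case True
  with e(3) have E2: "E2 \<noteq> 0" by simp
  have neg': "c * (E2\<^sup>2 + E1\<^sup>2) + 2 * (\<gamma> * E1\<^sup>2 - \<beta> * E2 * E1 + \<alpha> * E2\<^sup>2) < 0"
    using neg by (simp add: algebra_simps)
  obtain m s where ms: "m > 0" "s > 0" "\<forall>\<^sub>F n in sequentially. measure_pmf.prob (heat_pmf (1 / (\<eta> n)\<^sup>2))
     {(i, j). \<kappa> n * (\<bar>\<eta> n * of_int i\<bar> + \<bar>\<eta> n * of_int j\<bar>) \<le> s \<and>
        0 \<le> e2 n * (\<eta> n * of_int i) + e1 n * (\<eta> n * of_int j) + \<kappa> n * (c + \<gamma> * (\<eta> n * of_int i)\<^sup>2 +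
          \<beta> * (\<eta> n * of_int i) * (\<eta> n * of_int j) + \<alpha> * (\<eta> n * of_int j)\<^sup>2)} \<le> 1 / 2 - m * \<kappa> n"
    by (rule perturbed_half_plane_estimate_fst[OF \<eta> \<kappa> e(2,1) E2 neg'])
  show ?thesis
  proof (rule that[OF ms(1,2)])
    show "\<forall>\<^sub>F n in sequentially. measure_pmf.prob (heat_pmf (1 / (\<eta> n)\<^sup>2))
     {(i, j). \<kappa> n * (\<bar>\<eta> n * of_int i\<bar> + \<bar>\<eta> n * of_int j\<bar>) \<le> s \<and>
        0 \<le> e1 n * (\<eta> n * of_int i) + e2 n * (\<eta> n * of_int j) + \<kappa> n * (c + \<alpha> * (\<eta> n * of_int i)\<^sup>2 +
          \<beta> * (\<eta> n * of_int i) * (\<eta> n * of_int j) + \<gamma> * (\<eta> n * of_int j)\<^sup>2)} \<le> 1 / 2 - m * \<kappa> n"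
      using ms(3)
    proof eventually_elim
      case (elim n)
      have a: "1 / (\<eta> n)\<^sup>2 > 0" using \<eta>(1)[of n] by simp
      show ?case
        using elim by (subst (asm) prob_swap_heat_pmf[OF a, symmetric]) (simp add: algebra_simps)
    qed
  qed
qed

section \<open>Tail and concentration bounds\<close>

lemma nn_moment_heat_pmf_snd:
  assumes "a > 0" shows "(\<integral>\<^sup>+e. ennreal ((real_of_int (snd e))\<^sup>2) \<partial>heat_pmf a) = ennreal (2 * a)"
  using nn_moment_heat_pmf[OF assms] map_swap_heat_pmf[OF assms]
  by (metis (no_types, lifting) nn_integral_cong nn_integral_map_pmf snd_swap)

text \<open>Markov's inequality for 2 (x^2 + y^2), which dominates (|x| + |y|)^2. Each scaled
  coordinate has second moment 2, hence the constant 8 for every mesh.\<close>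

lemma prob_heat_pmf_tail:
  assumes "\<eta> > 0" "r > 0"
  shows "measure_pmf.prob (heat_pmf (1 / \<eta>\<^sup>2)) {(i, j). r \<le> \<bar>\<eta> * of_int i\<bar> + \<bar>\<eta> * of_int j\<bar>} \<le> 8 / r\<^sup>2"
proof -
  let ?M = "heat_pmf (1 / \<eta>\<^sup>2)"
  let ?f = "\<lambda>e :: int \<times> int. 2 * \<eta>\<^sup>2 * ((real_of_int (fst e))\<^sup>2 + (real_of_int (snd e))\<^sup>2)"
  have a: "1 / \<eta>\<^sup>2 > 0" using assms by simp
  have m: "has_bochner_integral ?M (\<lambda>e. (real_of_int (fst e))\<^sup>2) (2 * (1 / \<eta>\<^sup>2))" "has_bochner_integral ?M (\<lambda>e. (real_of_int (snd e))\<^sup>2) (2 * (1 / \<eta>\<^sup>2))"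
    using nn_moment_heat_pmf[OF a] nn_moment_heat_pmf_snd[OF a] by (auto intro!: has_bochner_integral_nn_integral)
  have "has_bochner_integral ?M ?f (2 * \<eta>\<^sup>2 * (2 * (1 / \<eta>\<^sup>2) + 2 * (1 / \<eta>\<^sup>2)))"
    by (intro has_bochner_integral_mult_right has_bochner_integral_add m)
  then have f: "integrable ?M ?f" "measure_pmf.expectation ?M ?f = 8"
    using assms by (auto simp: has_bochner_integral_iff)
  have "measure_pmf.prob ?M {(i, j). r \<le> \<bar>\<eta> * of_int i\<bar> + \<bar>\<eta> * of_int j\<bar>} \<le> measure_pmf.prob ?M {e. r\<^sup>2 \<le> ?f e}"
  proof (intro measure_pmf.finite_measure_mono subsetI)
    fix e :: "int \<times> int" assume "e \<in> {(i, j). r \<le> \<bar>\<eta> * of_int i\<bar> + \<bar>\<eta> * of_int j\<bar>}"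
    then have "r \<le> \<bar>\<eta> * of_int (fst e)\<bar> + \<bar>\<eta> * of_int (snd e)\<bar>" by (auto simp: case_prod_unfold)
    then have "r\<^sup>2 \<le> (\<bar>\<eta> * of_int (fst e)\<bar> + \<bar>\<eta> * of_int (snd e)\<bar>)\<^sup>2" using assms by (intro power_mono) auto
    also have "\<dots> \<le> 2 * (\<bar>\<eta> * of_int (fst e)\<bar>\<^sup>2 + \<bar>\<eta> * of_int (snd e)\<bar>\<^sup>2)"
    proof -
      have "(x + y)\<^sup>2 \<le> 2 * (x\<^sup>2 + y\<^sup>2)" for x y :: real using sum_squares_bound[of x y] by (simp add: power2_sum)
      then show ?thesis .
    qed
    also have "\<dots> = ?f e" by (simp add: power_mult_distrib algebra_simps)
    finally show "e \<in> {e. r\<^sup>2 \<le> ?f e}" by simp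
  qed simp
  also have "\<dots> \<le> measure_pmf.expectation ?M ?f / r\<^sup>2"
    using integral_Markov_inequality_measure[OF f(1), of "{}" "r\<^sup>2"] assms by simp
  finally show ?thesis unfolding f(2) .
qed

text \<open>The indicator of an interval is discontinuous, so a tent function below it is used; its
  negative is an admissible limit \<open>G\<close> with negative Gaussian integral.\<close>

lemma marginal_concentration:
  fixes \<eta> :: "nat \<Rightarrow> real"
  assumes \<eta>: "\<And>n. \<eta> n > 0" "\<eta> \<longlonglongrightarrow> 0" and "\<rho> > 0"
  obtains m where "m > 0" "\<forall>\<^sub>F n in sequentially. m \<le> measure_pmf.prob (marginal_pmf (1 / (\<eta> n)\<^sup>2)) {j. \<bar>\<eta> n * of_int j\<bar> < \<rho>}"
proof -
  define G where "G y = - max 0 (1 - \<bar>y\<bar> / \<rho>)" for y :: real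
  have Gb: "\<bar>G y\<bar> \<le> 1" for y using assms(3) by (auto simp: G_def)
  have meas: "G \<in> borel_measurable borel" unfolding G_def by measurable
  have "(\<integral>y. heat_density y * - G y \<partial>lborel) \<ge> (\<integral>y. (heat_density (\<rho> / 2) / 2) * indicator {- (\<rho> / 2)..\<rho> / 2} y \<partial>lborel)"
  proof (rule integral_mono)
    show "integrable lborel (\<lambda>y. (heat_density (\<rho> / 2) / 2) * indicator {- (\<rho> / 2)..\<rho> / 2} y :: real)"
      by (intro integrable_mult_right integrable_real_indicator) (auto simp: emeasure_lborel_Icc_eq)
    show "integrable lborel (\<lambda>y. heat_density y * - G y)"
      by (rule Bochner_Integration.integrable_bound[OF integrable_normal_density[of "sqrt 2" 0]])
        (use meas Gb in \<open>auto simp: abs_mult intro!: mult_left_le\<close>)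
    fix y :: real
    show "(heat_density (\<rho> / 2) / 2) * indicator {- (\<rho> / 2)..\<rho> / 2} y \<le> heat_density y * - G y"
    proof (cases "\<bar>y\<bar> \<le> \<rho> / 2")
      case True
      then have "y\<^sup>2 \<le> (\<rho> / 2)\<^sup>2" by (metis abs_ge_zero power2_abs power_mono)
      then have "heat_density (\<rho> / 2) \<le> heat_density y" by (simp add: normal_density_def divide_right_mono)
      moreover have "1 / 2 \<le> - G y" using True assms(3) by (auto simp: G_def field_simps)
      ultimately have "heat_density (\<rho> / 2) * (1 / 2) \<le> heat_density y * - G y"
        by (intro mult_mono) auto
      then show ?thesis using True by (auto simp: indicator_def)
    next
      case False
      then have "indicator {- (\<rho> / 2)..\<rho> / 2} y = (0::real)" by (auto simp: indicator_def)
      moreover have "heat_density y * - G y \<ge> 0" by (intro mult_nonneg_nonneg) (auto simp: G_def)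
      ultimately show ?thesis by simp
    qed
  qed
  moreover have "(\<integral>y. (heat_density (\<rho> / 2) / 2) * indicator {- (\<rho> / 2)..\<rho> / 2} y \<partial>lborel) > 0"
    using assms(3) by (simp add: normal_density_pos)
  ultimately have neg: "(\<integral>y. heat_density y * G y \<partial>lborel) < 0" by simp
  have b: "\<forall>\<^sub>F n in sequentially. \<forall>j. \<bar>G (\<eta> n * of_int j)\<bar> \<le> 1 * (1 + (\<eta> n * of_int j)\<^sup>2)"
    using Gb by (auto intro!: always_eventually order_trans[OF Gb])
  have lim: "(\<lambda>n. G (\<eta> n * of_int (j n))) \<longlonglongrightarrow> G y" if "(\<lambda>n. \<eta> n * of_int (j n)) \<longlonglongrightarrow> y" for y j
    unfolding G_def using that assms(3) by (intro tendsto_intros) auto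
  from expectation_eventually_negative[OF \<eta> b lim meas neg] obtain m where m: "m > 0"
    "\<forall>\<^sub>F n in sequentially. measure_pmf.expectation (marginal_pmf (1 / (\<eta> n)\<^sup>2)) (\<lambda>j. G (\<eta> n * of_int j)) \<le> - m" by blast
  from m(2) have "\<forall>\<^sub>F n in sequentially. m \<le> measure_pmf.prob (marginal_pmf (1 / (\<eta> n)\<^sup>2)) {j. \<bar>\<eta> n * of_int j\<bar> < \<rho>}"
  proof eventually_elim
    case (elim n)
    let ?M = "marginal_pmf (1 / (\<eta> n)\<^sup>2)"
    have "measure_pmf.expectation ?M (\<lambda>j. - indicator {j. \<bar>\<eta> n * of_int j\<bar> < \<rho>} j) \<le> measure_pmf.expectation ?M (\<lambda>j. G (\<eta> n * of_int j))"
    proof (rule integral_mono)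
      show "integrable ?M (\<lambda>j. - indicator {j. \<bar>\<eta> n * of_int j\<bar> < \<rho>} j :: real)"
        by (rule integrable_measure_pmf_bounded[where B = 1]) (auto simp: indicator_def)
      show "integrable ?M (\<lambda>j. G (\<eta> n * of_int j))"
        by (rule integrable_measure_pmf_bounded[OF Gb])
      show "- indicator {j. \<bar>\<eta> n * of_int j\<bar> < \<rho>} j \<le> G (\<eta> n * of_int j)" for j
        using Gb[of "\<eta> n * of_int j"] assms(3) by (auto simp: indicator_def G_def)
    qed
    then show ?case using elim by simp
  qed
  then show ?thesis using that m(1) by blast
qed

lemma prob_uminus_heat_pmf:
  assumes "a > 0"
  shows "measure_pmf.prob (heat_pmf a) {(i, j). P (- i) (- j)} = measure_pmf.prob (heat_pmf a) {(i, j). P i j}"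
proof -
  have inv: "map_pmf (\<lambda>(i, j). (- i, - j)) (heat_pmf a) = heat_pmf a"
  proof (rule pmf_eqI)
    fix z
    have "pmf (map_pmf (\<lambda>(i, j). (- i, - j)) (heat_pmf a)) ((\<lambda>(i, j). (- i, - j)) (- fst z, - snd z)) = pmf (heat_pmf a) (- fst z, - snd z)"
      by (rule pmf_map_inj') (auto simp: inj_def)
    then show "pmf (map_pmf (\<lambda>(i, j). (- i, - j)) (heat_pmf a)) z = pmf (heat_pmf a) z"
      by (cases z) (simp add: pmf_heat_pmf assms lattice_kernel_uminus)
  qed
  have "measure_pmf.prob (map_pmf (\<lambda>(i, j). (- i, - j)) (heat_pmf a)) {(i, j). P i j} =
      measure_pmf.prob (heat_pmf a) ((\<lambda>(i, j). (- i, - j)) -` {(i, j). P i j})" by simp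
  moreover have "(\<lambda>(i, j). (- i, - j)) -` {(i, j). P i j} = {(i, j). P (- i) (- j)}" by auto
  ultimately show ?thesis by (simp add: inv)
qed

lemma prob_heat_pmf_Times:
  assumes "a > 0"
  shows "measure_pmf.prob (heat_pmf a) (A \<times> B) = measure_pmf.prob (marginal_pmf a) A * measure_pmf.prob (marginal_pmf a) B"
proof -
  have "{i. (i, j) \<in> A \<times> B} = (if j \<in> B then A else {})" for j by auto
  then have "measure_pmf.prob (heat_pmf a) (A \<times> B) = measure_pmf.expectation (marginal_pmf a) (\<lambda>j. measure_pmf.prob (marginal_pmf a) A * indicator B j)"
    unfolding heat_pmf_eq_pair[OF assms] prob_pair_pmf
    by (intro Bochner_Integration.integral_cong) (auto simp: indicator_def)
  then show ?thesis by simp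
qed

text \<open>The half plane at level b and its reflection are disjoint and equally likely, and the
  band between them has probability bounded below because the slopes are bounded. The coefficients
  need not converge.\<close>

lemma flat_estimate:
  fixes \<eta> e1 e2 :: "nat \<Rightarrow> real"
  assumes \<eta>: "\<And>n. \<eta> n > 0" "\<eta> \<longlonglongrightarrow> 0" and e: "\<And>n. \<bar>e1 n\<bar> \<le> L" "\<And>n. \<bar>e2 n\<bar> \<le> L" and "b > 0"
  obtains m where "m > 0" "\<forall>\<^sub>F n in sequentially. measure_pmf.prob (heat_pmf (1 / (\<eta> n)\<^sup>2))
     {(i, j). b \<le> e1 n * (\<eta> n * of_int i) + e2 n * (\<eta> n * of_int j)} \<le> 1 / 2 - m"
proof -
  have L: "L \<ge> 0" using e(1)[of 0] by linarith
  \<comment> \<open>On the square of half-side \<rho> the linear form is at most 2 L \<rho>, which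
    is less than b.\<close>
  define \<rho> where "\<rho> = b / (2 * (L + 1))"
  have \<rho>: "\<rho> > 0" using assms L by (simp add: \<rho>_def)
  obtain m where m: "m > 0" "\<forall>\<^sub>F n in sequentially. m \<le> measure_pmf.prob (marginal_pmf (1 / (\<eta> n)\<^sup>2)) {j. \<bar>\<eta> n * of_int j\<bar> < \<rho>}"
    by (rule marginal_concentration[OF \<eta> \<rho>])
  from m(2) have "\<forall>\<^sub>F n in sequentially. measure_pmf.prob (heat_pmf (1 / (\<eta> n)\<^sup>2))
     {(i, j). b \<le> e1 n * (\<eta> n * of_int i) + e2 n * (\<eta> n * of_int j)} \<le> 1 / 2 - m\<^sup>2 / 2"
  proof eventually_elim
    case (elim n)
    have a: "1 / (\<eta> n)\<^sup>2 > 0" using \<eta>(1)[of n] by simp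
    let ?M = "heat_pmf (1 / (\<eta> n)\<^sup>2)"
    let ?s = "\<lambda>i j. e1 n * (\<eta> n * of_int i) + e2 n * (\<eta> n * of_int j)"
    let ?J = "{j :: int. \<bar>\<eta> n * of_int j\<bar> < \<rho>}"
    have "m * m \<le> measure_pmf.prob ?M (?J \<times> ?J)"
      unfolding prob_heat_pmf_Times[OF a] using elim m(1) by (intro mult_mono) auto
    also have "\<dots> \<le> measure_pmf.prob ?M {(i, j). \<bar>?s i j\<bar> < b}"
    proof (intro measure_pmf.finite_measure_mono subsetI)
      fix z assume "z \<in> ?J \<times> ?J"
      then obtain i j where z: "z = (i, j)" "\<bar>\<eta> n * of_int i\<bar> < \<rho>" "\<bar>\<eta> n * of_int j\<bar> < \<rho>" by auto
      have "\<bar>?s i j\<bar> \<le> \<bar>e1 n\<bar> * \<bar>\<eta> n * of_int i\<bar> + \<bar>e2 n\<bar> * \<bar>\<eta> n * of_int j\<bar>"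
        by (metis abs_mult abs_triangle_ineq)
      also have "\<dots> \<le> L * \<rho> + L * \<rho>" using e[of n] z L by (intro add_mono mult_mono) auto
      also have "\<dots> < (L + 1) * \<rho> + (L + 1) * \<rho>" using \<rho> by (simp add: algebra_simps)
      also have "\<dots> = 2 * ((L + 1) * \<rho>)" by simp
      also have "\<dots> = b"
      proof -
        have "2 * (k * (b / (2 * k))) = b" if "k > 0" for k using that by simp
        from this[of "L + 1"] show ?thesis using L unfolding \<rho>_def by linarith
      qed
      finally show "z \<in> {(i, j). \<bar>?s i j\<bar> < b}" by (simp add: z(1))
    qed simp
    finally have 1: "m\<^sup>2 \<le> measure_pmf.prob ?M {(i, j). \<bar>?s i j\<bar> < b}" by (simp add: power2_eq_square)
    have 2: "measure_pmf.prob ?M {(i, j). b \<le> ?s (- i) (- j)} = measure_pmf.prob ?M {(i, j). b \<le> ?s i j}"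
      by (rule prob_uminus_heat_pmf[OF a])
    define A B D where "A = {(i, j). b \<le> ?s (- i) (- j)}" and "B = {(i, j). b \<le> ?s i j}" and "D = {(i, j). \<bar>?s i j\<bar> < b}"
    have neg: "?s (- i) (- j) = - ?s i j" for i j by (simp add: algebra_simps)
    have "measure_pmf.prob ?M (A \<union> B \<union> D) = measure_pmf.prob ?M (A \<union> B) + measure_pmf.prob ?M D"
      by (rule measure_pmf.finite_measure_Union) (use assms(5) in \<open>auto simp: A_def B_def D_def neg\<close>)
    also have "measure_pmf.prob ?M (A \<union> B) = measure_pmf.prob ?M A + measure_pmf.prob ?M B"
      by (rule measure_pmf.finite_measure_Union) (use assms(5) in \<open>auto simp: A_def B_def neg\<close>)
    finally have "2 * measure_pmf.prob ?M B + measure_pmf.prob ?M D \<le> 1"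
      using 2 measure_pmf.prob_le_1[of ?M "A \<union> B \<union> D"] unfolding A_def[symmetric] B_def[symmetric] by linarith
    then show ?case using 1 unfolding B_def D_def by linarith
  qed
  then show ?thesis using m(1) by (intro that[of "m\<^sup>2 / 2"]) auto
qed

section \<open>Consistency at a touching point\<close>

abbreviation quad :: "real \<Rightarrow> real \<Rightarrow> real \<Rightarrow> real \<Rightarrow> real \<Rightarrow> real" where
  "quad \<alpha> \<beta> \<gamma> x y \<equiv> \<alpha> * x\<^sup>2 + \<beta> * x * y + \<gamma> * y\<^sup>2"

text \<open>One time step in units of sqrt \<tau>: (e1, e2) is the gradient at the touching point,
  \<kappa> is sqrt \<tau>, and c carries minus the time derivative because the step goes back in
  time. The radius R restricts to the region where the Taylor expansion is valid.\<close>

definition step_event :: "real \<Rightarrow> real \<Rightarrow> real \<Rightarrow> real \<Rightarrow> real \<Rightarrow> real \<Rightarrow> real \<Rightarrow> real \<Rightarrow> real \<Rightarrow> (int \<times> int) set" where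
  "step_event \<eta> R e1 e2 \<kappa> c \<alpha> \<beta> \<gamma> = {(i, j). \<bar>\<eta> * of_int i\<bar> + \<bar>\<eta> * of_int j\<bar> \<le> R \<and>
     0 \<le> e1 * (\<eta> * of_int i) + e2 * (\<eta> * of_int j) + \<kappa> * (c + quad \<alpha> \<beta> \<gamma> (\<eta> * of_int i) (\<eta> * of_int j))}"

text \<open>Dividing by \<open>v\<close> makes the gradient converge and gives the curvature term
  the weight \<kappa> = sqrt T / v. If the conclusion failed, the probability would drop below 1/2
  by at least m \<kappa>. Truncating at a radius of order 1 / \<kappa> costs only 8 / R^2, of order
  \<kappa>^2, which cannot make up for the loss.\<close>

lemma touching_steep:
  fixes T \<eta> v e1 e2 P1 P2 :: "nat \<Rightarrow> real"
  assumes T: "\<And>n. T n > 0" and \<eta>: "\<And>n. \<eta> n > 0" "\<eta> \<longlonglongrightarrow> 0"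
    and v: "\<And>n. v n > 0" "\<And>n. v n \<le> vmax"
    and \<kappa>: "(\<lambda>n. sqrt (T n) / v n) \<longlonglongrightarrow> 0" "(\<lambda>n. \<eta> n / (sqrt (T n) / v n)) \<longlonglongrightarrow> 0"
    and e: "(\<lambda>n. P1 n / v n) \<longlonglongrightarrow> E1" "(\<lambda>n. P2 n / v n) \<longlonglongrightarrow> E2" "E1 \<noteq> 0 \<or> E2 \<noteq> 0"
    and step: "\<And>\<epsilon>. \<epsilon> > 0 \<Longrightarrow> \<exists>r>0. \<forall>\<^sub>F n in sequentially. \<forall>R>0. sqrt (T n) * R \<le> r \<longrightarrow>
      1 / 2 \<le> measure_pmf.prob (heat_pmf (1 / (\<eta> n)\<^sup>2)) (step_event (\<eta> n) R (P1 n) (P2 n) (sqrt (T n)) (\<epsilon> - b) (\<alpha> + \<epsilon>) \<beta> (\<gamma> + \<epsilon>)) + 8 / R\<^sup>2"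
  shows "2 * (\<alpha> * E2\<^sup>2 - \<beta> * E1 * E2 + \<gamma> * E1\<^sup>2) \<ge> b * (E1\<^sup>2 + E2\<^sup>2)"
proof (rule ccontr)
  assume not: "\<not> ?thesis"
  define V where "V = E1\<^sup>2 + E2\<^sup>2"
  have V: "V > 0" using e(3) by (simp add: V_def sum_power2_gt_zero_iff)
  define D where "D = b * V - 2 * (\<alpha> * E2\<^sup>2 - \<beta> * E1 * E2 + \<gamma> * E1\<^sup>2)"
  have D: "D > 0" using not by (simp add: D_def V_def)
  \<comment> \<open>The errors in c, \<alpha> and \<gamma> add 3 \<epsilon> V in total, which is 3/4
    of the available gap D.\<close>
  define \<epsilon> where "\<epsilon> = D / (4 * V)"
  have \<epsilon>: "\<epsilon> > 0" using D V by (simp add: \<epsilon>_def)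
  have "(\<epsilon> - b) * V + 2 * ((\<alpha> + \<epsilon>) * E2\<^sup>2 - \<beta> * E1 * E2 + (\<gamma> + \<epsilon>) * E1\<^sup>2) = 3 * (\<epsilon> * V) - D"
    by (simp add: D_def V_def algebra_simps)
  also have "\<epsilon> * V = D / 4" using V by (simp add: \<epsilon>_def)
  finally have neg: "(\<epsilon> - b) * (E1\<^sup>2 + E2\<^sup>2) + 2 * ((\<alpha> + \<epsilon>) * E2\<^sup>2 - \<beta> * E1 * E2 + (\<gamma> + \<epsilon>) * E1\<^sup>2) < 0"
    using D by (simp add: V_def)
  define \<kappa> where "\<kappa> = (\<lambda>n. sqrt (T n) / v n)"
  have \<kappa>0: "\<kappa> n > 0" for n using T[of n] v(1)[of n] by (simp add: \<kappa>_def)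
  have \<kappa>1: "\<kappa> \<longlonglongrightarrow> 0" "(\<lambda>n. \<eta> n / \<kappa> n) \<longlonglongrightarrow> 0" using \<kappa> unfolding \<kappa>_def by (simp_all only:)
  from perturbed_half_plane_estimate[OF \<eta> \<kappa>0 \<kappa>1 e neg] obtain m s where ms: "m > 0" "s > 0" "\<forall>\<^sub>F n in sequentially. measure_pmf.prob (heat_pmf (1 / (\<eta> n)\<^sup>2))
     {(i, j). \<kappa> n * (\<bar>\<eta> n * of_int i\<bar> + \<bar>\<eta> n * of_int j\<bar>) \<le> s \<and>
        0 \<le> P1 n / v n * (\<eta> n * of_int i) + P2 n / v n * (\<eta> n * of_int j) + \<kappa> n * (\<epsilon> - b + (\<alpha> + \<epsilon>) * (\<eta> n * of_int i)\<^sup>2 +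
          \<beta> * (\<eta> n * of_int i) * (\<eta> n * of_int j) + (\<gamma> + \<epsilon>) * (\<eta> n * of_int j)\<^sup>2)} \<le> 1 / 2 - m * \<kappa> n"
    by blast
  obtain r where r: "r > 0" "\<forall>\<^sub>F n in sequentially. \<forall>R>0. sqrt (T n) * R \<le> r \<longrightarrow>
      1 / 2 \<le> measure_pmf.prob (heat_pmf (1 / (\<eta> n)\<^sup>2)) (step_event (\<eta> n) R (P1 n) (P2 n) (sqrt (T n)) (\<epsilon> - b) (\<alpha> + \<epsilon>) \<beta> (\<gamma> + \<epsilon>)) + 8 / R\<^sup>2"
    using step[OF \<epsilon>] by blast
  have vmax: "vmax > 0" using v[of 0] by linarith
  \<comment> \<open>R = s' / \<kappa> must stay inside the window of the half plane estimate, and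
    sqrt T * R = v s' inside the radius r of the expansion.\<close>
  define s' where "s' = min s (r / vmax)"
  have s': "s' > 0" "s' \<le> s" "s' \<le> r / vmax" using ms(2) r(1) vmax by (auto simp: s'_def)
  have "\<forall>\<^sub>F n in sequentially. m \<le> 8 * \<kappa> n / s'\<^sup>2"
    using ms(3) r(2)
  proof eventually_elim
    case (elim n)
    define R where "R = s' / \<kappa> n"
    have R: "R > 0" using s' \<kappa>0[of n] by (simp add: R_def)
    have "sqrt (T n) * R = v n * s'" using T[of n] v(1)[of n] by (simp add: R_def \<kappa>_def)
    also have "\<dots> \<le> vmax * (r / vmax)" using v[of n] s' vmax by (intro mult_mono) auto
    finally have "sqrt (T n) * R \<le> r" using vmax by simp
    with elim(2) R have "1 / 2 \<le> measure_pmf.prob (heat_pmf (1 / (\<eta> n)\<^sup>2)) (step_event (\<eta> n) R (P1 n) (P2 n) (sqrt (T n)) (\<epsilon> - b) (\<alpha> + \<epsilon>) \<beta> (\<gamma> + \<epsilon>)) + 8 / R\<^sup>2"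
      by blast
    also have "measure_pmf.prob (heat_pmf (1 / (\<eta> n)\<^sup>2)) (step_event (\<eta> n) R (P1 n) (P2 n) (sqrt (T n)) (\<epsilon> - b) (\<alpha> + \<epsilon>) \<beta> (\<gamma> + \<epsilon>)) \<le> 1 / 2 - m * \<kappa> n"
    proof (rule order_trans[OF measure_pmf.finite_measure_mono elim(1)])
      show "step_event (\<eta> n) R (P1 n) (P2 n) (sqrt (T n)) (\<epsilon> - b) (\<alpha> + \<epsilon>) \<beta> (\<gamma> + \<epsilon>) \<subseteq> {(i, j). \<kappa> n * (\<bar>\<eta> n * of_int i\<bar> + \<bar>\<eta> n * of_int j\<bar>) \<le> s \<and>
        0 \<le> P1 n / v n * (\<eta> n * of_int i) + P2 n / v n * (\<eta> n * of_int j) + \<kappa> n * (\<epsilon> - b + (\<alpha> + \<epsilon>) * (\<eta> n * of_int i)\<^sup>2 +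
          \<beta> * (\<eta> n * of_int i) * (\<eta> n * of_int j) + (\<gamma> + \<epsilon>) * (\<eta> n * of_int j)\<^sup>2)}"
      proof (clarsimp simp only: step_event_def mem_Collect_eq case_prod_conv, intro conjI)
        fix i j :: int
        let ?x = "\<eta> n * of_int i" and ?y = "\<eta> n * of_int j"
        assume a: "\<bar>?x\<bar> + \<bar>?y\<bar> \<le> R" and b: "0 \<le> P1 n * ?x + P2 n * ?y + sqrt (T n) * (\<epsilon> - b + quad (\<alpha> + \<epsilon>) \<beta> (\<gamma> + \<epsilon>) ?x ?y)"
        have "\<kappa> n * (\<bar>?x\<bar> + \<bar>?y\<bar>) \<le> \<kappa> n * R" using a \<kappa>0[of n] by (intro mult_left_mono) auto
        also have "\<dots> = s'" using \<kappa>0[of n] by (simp add: R_def)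
        finally show "\<kappa> n * (\<bar>?x\<bar> + \<bar>?y\<bar>) \<le> s" using s' by linarith
        have "0 \<le> (P1 n * ?x + P2 n * ?y + sqrt (T n) * (\<epsilon> - b + quad (\<alpha> + \<epsilon>) \<beta> (\<gamma> + \<epsilon>) ?x ?y)) / v n"
          using b v(1)[of n] by (intro divide_nonneg_pos)
        also have "\<dots> = P1 n / v n * ?x + P2 n / v n * ?y + \<kappa> n * (\<epsilon> - b + quad (\<alpha> + \<epsilon>) \<beta> (\<gamma> + \<epsilon>) ?x ?y)"
          by (simp add: \<kappa>_def add_divide_distrib)
        finally show "0 \<le> P1 n / v n * ?x + P2 n / v n * ?y + \<kappa> n * (\<epsilon> - b + (\<alpha> + \<epsilon>) * ?x\<^sup>2 + \<beta> * ?x * ?y + (\<gamma> + \<epsilon>) * ?y\<^sup>2)"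
          by (simp add: add.assoc)
      qed
    qed simp
    finally have "m * \<kappa> n \<le> 8 / R\<^sup>2" by simp
    also have "\<dots> = (8 * \<kappa> n / s'\<^sup>2) * \<kappa> n" by (simp add: R_def power_divide power2_eq_square)
    finally show ?case using \<kappa>0[of n] by (rule mult_right_le_imp_le)
  qed
  moreover have "(\<lambda>n. 8 * \<kappa> n / s'\<^sup>2) \<longlonglongrightarrow> 8 * 0 / s'\<^sup>2"
    unfolding \<kappa>_def using s' by (intro tendsto_intros \<kappa>) auto
  ultimately have "m \<le> 8 * 0 / s'\<^sup>2" using tendsto_lowerbound[OF _ _ sequentially_bot] by blast
  then show False using ms(1) by simp
qed

text \<open>When the gradient is at most of order sqrt T, the time derivative shifts the half plane
  by a distance of order 1. The loss of probability is then a fixed amount and no fine asymptotics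
  are needed.\<close>

lemma touching_flat:
  fixes T \<eta> P1 P2 :: "nat \<Rightarrow> real"
  assumes T: "\<And>n. T n > 0" "T \<longlonglongrightarrow> 0" and \<eta>: "\<And>n. \<eta> n > 0" "\<eta> \<longlonglongrightarrow> 0"
    and P: "\<And>n. \<bar>P1 n\<bar> \<le> L * sqrt (T n)" "\<And>n. \<bar>P2 n\<bar> \<le> L * sqrt (T n)"
    and step: "\<And>\<epsilon>. \<epsilon> > 0 \<Longrightarrow> \<exists>r>0. \<forall>\<^sub>F n in sequentially. \<forall>R>0. sqrt (T n) * R \<le> r \<longrightarrow>
      1 / 2 \<le> measure_pmf.prob (heat_pmf (1 / (\<eta> n)\<^sup>2)) (step_event (\<eta> n) R (P1 n) (P2 n) (sqrt (T n)) (\<epsilon> - b) \<epsilon> 0 \<epsilon>) + 8 / R\<^sup>2"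
  shows "b \<le> 0"
proof (rule ccontr)
  assume "\<not> b \<le> 0"
  then have b: "b > 0" by simp
  define e1 e2 where "e1 n = P1 n / sqrt (T n)" and "e2 n = P2 n / sqrt (T n)" for n
  have e: "\<bar>e1 n\<bar> \<le> L" "\<bar>e2 n\<bar> \<le> L" for n
    using P[of n] T(1)[of n] by (auto simp: e1_def e2_def abs_divide pos_divide_le_eq)
  have b2: "b / 2 > 0" using b by simp
  obtain m where m: "m > 0" "\<forall>\<^sub>F n in sequentially. measure_pmf.prob (heat_pmf (1 / (\<eta> n)\<^sup>2))
     {(i, j). b / 2 \<le> e1 n * (\<eta> n * of_int i) + e2 n * (\<eta> n * of_int j)} \<le> 1 / 2 - m"
    by (rule flat_estimate[where ?e1.0 = e1 and ?e2.0 = e2, OF \<eta> e b2])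
  \<comment> \<open>Within radius M, where M^2 = b / (4 \<epsilon>), the quadratic error is below b
    / 4; together with \<epsilon> at most b / 4 this leaves the level b / 2. Outside, the tail bound
    8 / M^2 = 32 \<epsilon> / b is at most m / 2.\<close>
  define \<epsilon> where "\<epsilon> = min (b / 4) (b * m / 64)"
  have \<epsilon>: "\<epsilon> > 0" "\<epsilon> \<le> b / 4" "\<epsilon> \<le> b * m / 64" using b m(1) by (auto simp: \<epsilon>_def)
  obtain r where r: "r > 0" "\<forall>\<^sub>F n in sequentially. \<forall>R>0. sqrt (T n) * R \<le> r \<longrightarrow>
      1 / 2 \<le> measure_pmf.prob (heat_pmf (1 / (\<eta> n)\<^sup>2)) (step_event (\<eta> n) R (P1 n) (P2 n) (sqrt (T n)) (\<epsilon> - b) \<epsilon> 0 \<epsilon>) + 8 / R\<^sup>2"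
    using step[OF \<epsilon>(1)] by blast
  define M where "M = sqrt (b / (4 * \<epsilon>))"
  have M: "M > 0" "M\<^sup>2 = b / (4 * \<epsilon>)" using b \<epsilon> by (auto simp: M_def)
  have "\<forall>\<^sub>F n in sequentially. m / 2 \<le> 8 * T n / r\<^sup>2"
    using m(2) r(2)
  proof eventually_elim
    case (elim n)
    let ?M = "heat_pmf (1 / (\<eta> n)\<^sup>2)"
    define R where "R = r / sqrt (T n)"
    have R: "R > 0" "sqrt (T n) * R \<le> r" using r(1) T(1)[of n] by (auto simp: R_def)
    let ?A = "{(i, j). b / 2 \<le> e1 n * (\<eta> n * of_int i) + e2 n * (\<eta> n * of_int j)}"
    let ?B = "{(i, j). M \<le> \<bar>\<eta> n * of_int i\<bar> + \<bar>\<eta> n * of_int j\<bar>}"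
    have sub: "step_event (\<eta> n) R (P1 n) (P2 n) (sqrt (T n)) (\<epsilon> - b) \<epsilon> 0 \<epsilon> \<subseteq> ?A \<union> ?B"
    proof
      fix z assume "z \<in> step_event (\<eta> n) R (P1 n) (P2 n) (sqrt (T n)) (\<epsilon> - b) \<epsilon> 0 \<epsilon>"
      then obtain i j where z: "z = (i, j)" and ge: "0 \<le> P1 n * (\<eta> n * of_int i) + P2 n * (\<eta> n * of_int j)
          + sqrt (T n) * (\<epsilon> - b + quad \<epsilon> 0 \<epsilon> (\<eta> n * of_int i) (\<eta> n * of_int j))"
        by (auto simp: step_event_def)
      let ?x = "\<eta> n * of_int i" and ?y = "\<eta> n * of_int j"
      have "0 \<le> (P1 n * ?x + P2 n * ?y + sqrt (T n) * (\<epsilon> - b + quad \<epsilon> 0 \<epsilon> ?x ?y)) / sqrt (T n)"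
        using ge T(1)[of n] by (intro divide_nonneg_pos) auto
      also have "\<dots> = e1 n * ?x + e2 n * ?y + (\<epsilon> - b + quad \<epsilon> 0 \<epsilon> ?x ?y)"
        using T(1)[of n] by (simp add: e1_def e2_def add_divide_distrib)
      finally have ge': "0 \<le> e1 n * ?x + e2 n * ?y + \<epsilon> - b + \<epsilon> * (?x\<^sup>2 + ?y\<^sup>2)" by (simp add: algebra_simps)
      show "z \<in> ?A \<union> ?B"
      proof (rule ccontr)
        assume "z \<notin> ?A \<union> ?B"
        then have n: "e1 n * ?x + e2 n * ?y < b / 2" "\<bar>?x\<bar> + \<bar>?y\<bar> < M" by (auto simp: z)
        have "?x\<^sup>2 + ?y\<^sup>2 \<le> (\<bar>?x\<bar> + \<bar>?y\<bar>)\<^sup>2" by (simp add: power2_sum)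
        also have "\<dots> < M\<^sup>2" using n(2) by (intro power_strict_mono) auto
        finally have "\<epsilon> * (?x\<^sup>2 + ?y\<^sup>2) < \<epsilon> * M\<^sup>2" using \<epsilon>(1) by simp
        also have "\<dots> = b / 4" using \<epsilon>(1) by (simp add: M(2))
        finally show False using ge' n(1) \<epsilon>(2) by linarith
      qed
    qed
    have "1 / 2 \<le> measure_pmf.prob ?M (step_event (\<eta> n) R (P1 n) (P2 n) (sqrt (T n)) (\<epsilon> - b) \<epsilon> 0 \<epsilon>) + 8 / R\<^sup>2"
      using elim(2) R by blast
    moreover have "measure_pmf.prob ?M (step_event (\<eta> n) R (P1 n) (P2 n) (sqrt (T n)) (\<epsilon> - b) \<epsilon> 0 \<epsilon>) \<le> measure_pmf.prob ?M ?A + measure_pmf.prob ?M ?B"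
      by (rule order_trans[OF measure_pmf.finite_measure_mono[OF sub] measure_Un_le]) auto
    moreover have "measure_pmf.prob ?M ?B \<le> 8 / M\<^sup>2" by (rule prob_heat_pmf_tail[OF \<eta>(1) M(1)])
    moreover have "8 / M\<^sup>2 = 32 * \<epsilon> / b" unfolding M(2) using b \<epsilon> by simp
    moreover have "32 * \<epsilon> / b \<le> m / 2" using \<epsilon>(3) b by (simp add: pos_divide_le_eq mult.commute)
    moreover have "8 / R\<^sup>2 = 8 * T n / r\<^sup>2" using T(1)[of n] by (simp add: R_def power_divide)
    ultimately show ?case using elim(1) by linarith
  qed
  moreover have "(\<lambda>n. 8 * T n / r\<^sup>2) \<longlonglongrightarrow> 8 * 0 / r\<^sup>2"
    using r(1) by (intro tendsto_intros T) auto
  ultimately have "m / 2 \<le> 8 * 0 / r\<^sup>2" using tendsto_lowerbound[OF _ _ sequentially_bot] by blast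
  then show False using m(1) by simp
qed

text \<open>For a nonzero limit the steep case applies with v = 1. For a zero limit, along a
  subsequence either the gradients are of order sqrt T, which is the flat case, or they dominate
  sqrt T and their directions converge by compactness, which is the steep case. That limiting
  direction is arbitrary, so b \<le> 0 follows only because the quadratic form vanishes in every
  direction.\<close>

lemma touching_limit:
  fixes T \<eta> P1 P2 :: "nat \<Rightarrow> real"
  assumes T: "\<And>n. T n > 0" "T \<longlonglongrightarrow> 0" and \<eta>: "\<And>n. \<eta> n > 0" "\<eta> \<longlonglongrightarrow> 0" "(\<lambda>n. \<eta> n / sqrt (T n)) \<longlonglongrightarrow> 0"
    and P: "P1 \<longlonglongrightarrow> p1" "P2 \<longlonglongrightarrow> p2"
    and step: "\<And>\<epsilon>. \<epsilon> > 0 \<Longrightarrow> \<exists>r>0. \<forall>\<^sub>F n in sequentially. \<forall>R>0. sqrt (T n) * R \<le> r \<longrightarrow>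
      1 / 2 \<le> measure_pmf.prob (heat_pmf (1 / (\<eta> n)\<^sup>2)) (step_event (\<eta> n) R (P1 n) (P2 n) (sqrt (T n)) (\<epsilon> - b) (\<alpha> + \<epsilon>) \<beta> (\<gamma> + \<epsilon>)) + 8 / R\<^sup>2"
  shows "p1 \<noteq> 0 \<or> p2 \<noteq> 0 \<Longrightarrow> b * (p1\<^sup>2 + p2\<^sup>2) \<le> 2 * (\<alpha> * p2\<^sup>2 - \<beta> * p1 * p2 + \<gamma> * p1\<^sup>2)"
    and "p1 = 0 \<Longrightarrow> p2 = 0 \<Longrightarrow> \<alpha> = 0 \<Longrightarrow> \<beta> = 0 \<Longrightarrow> \<gamma> = 0 \<Longrightarrow> b \<le> 0"
proof -
  have sT: "(\<lambda>n. sqrt (T n)) \<longlonglongrightarrow> 0" using tendsto_real_sqrt[OF T(2)] by simp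
  show "b * (p1\<^sup>2 + p2\<^sup>2) \<le> 2 * (\<alpha> * p2\<^sup>2 - \<beta> * p1 * p2 + \<gamma> * p1\<^sup>2)" if nz: "p1 \<noteq> 0 \<or> p2 \<noteq> 0"
  proof (rule touching_steep[where v = "\<lambda>_. 1" and vmax = 1, OF T(1) \<eta>(1,2) _ _ _ _ _ _ nz step])
  qed (use P sT \<eta> in auto)
  assume z: "p1 = 0" "p2 = 0" "\<alpha> = 0" "\<beta> = 0" "\<gamma> = 0"
  have sub: "\<exists>r>0. \<forall>\<^sub>F n in sequentially. \<forall>R>0. sqrt (T (f n)) * R \<le> r \<longrightarrow>
      1 / 2 \<le> measure_pmf.prob (heat_pmf (1 / (\<eta> (f n))\<^sup>2)) (step_event (\<eta> (f n)) R (P1 (f n)) (P2 (f n)) (sqrt (T (f n))) (\<epsilon> - b) (\<alpha> + \<epsilon>) \<beta> (\<gamma> + \<epsilon>)) + 8 / R\<^sup>2"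
    if "\<epsilon> > 0" "strict_mono f" for \<epsilon> f
    using step[OF that(1)] eventually_subseq[OF that(2)] by (fast elim: eventually_mono)
  define v where "v n = sqrt ((P1 n)\<^sup>2 + (P2 n)\<^sup>2)" for n
  have vP: "\<bar>P1 n\<bar> \<le> v n" "\<bar>P2 n\<bar> \<le> v n" for n
    unfolding v_def by (auto intro: real_le_rsqrt simp: power2_abs)
  have vlim: "v \<longlonglongrightarrow> sqrt (0\<^sup>2 + 0\<^sup>2)" unfolding v_def using P z by (intro tendsto_intros) auto
  show "b \<le> 0"
  \<comment> \<open>The negation says that v / sqrt T tends to infinity, so the weight sqrt T / v of
    the curvature term tends to 0.\<close>
  proof (cases "\<exists>L. \<exists>\<^sub>F n in sequentially. v n \<le> L * sqrt (T n)")
    case True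
    then obtain L where "\<exists>\<^sub>F n in sequentially. v n \<le> L * sqrt (T n)" by blast
    then obtain f :: "nat \<Rightarrow> nat" where f: "strict_mono f" "\<And>n. v (f n) \<le> L * sqrt (T (f n))"
      using infinite_enumerate[of "{n. v n \<le> L * sqrt (T n)}"] by (auto simp: INFM_iff_infinite simp flip: cofinite_eq_sequentially)
    show ?thesis
    proof (rule touching_flat[where T = "T \<circ> f" and \<eta> = "\<eta> \<circ> f" and ?P1.0 = "P1 \<circ> f" and ?P2.0 = "P2 \<circ> f" and L = L])
      show "(T \<circ> f) \<longlonglongrightarrow> 0" "(\<eta> \<circ> f) \<longlonglongrightarrow> 0"
        using T \<eta> f(1) by (auto intro: LIMSEQ_subseq_LIMSEQ)
      show "\<bar>(P1 \<circ> f) n\<bar> \<le> L * sqrt ((T \<circ> f) n)" "\<bar>(P2 \<circ> f) n\<bar> \<le> L * sqrt ((T \<circ> f) n)" for n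
        using vP[of "f n"] f(2)[of n] by auto
    qed (use T \<eta> sub[OF _ f(1)] z in auto)
  next
    case False
    then have ev: "\<forall>\<^sub>F n in sequentially. L * sqrt (T n) < v n" for L
      by (auto simp: not_frequently not_le)
    then obtain N where N: "\<And>n. n \<ge> N \<Longrightarrow> 0 < v n"
      using ev[of 0] by (auto simp: eventually_sequentially)
    \<comment> \<open>Unit directions. The shift by \<open>N\<close> skips the indices at which the
      gradient might vanish.\<close>
    define g where "g n = (P1 (n + N) / v (n + N), P2 (n + N) / v (n + N))" for n
    have norm_g: "(fst (g n))\<^sup>2 + (snd (g n))\<^sup>2 = 1" for n
    proof -
      have "(v (n + N))\<^sup>2 = (P1 (n + N))\<^sup>2 + (P2 (n + N))\<^sup>2" by (simp add: v_def)
      moreover have "(v (n + N))\<^sup>2 \<noteq> 0" using N[of "n + N"] by simp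
      ultimately show ?thesis by (simp add: g_def power_divide flip: add_divide_distrib)
    qed
    then have "g n \<in> cball 0 1" for n by (simp add: dist_norm norm_prod_def)
    then obtain l f where lf: "strict_mono f" "(g \<circ> f) \<longlonglongrightarrow> l"
      using compact_cball[of "0 :: real \<times> real" 1] unfolding compact_def by metis
    define F where "F n = f n + N" for n
    have F: "strict_mono F" using lf(1) by (auto simp: F_def strict_mono_def)
    have l1: "(\<lambda>n. P1 (F n) / v (F n)) \<longlonglongrightarrow> fst l" and l2: "(\<lambda>n. P2 (F n) / v (F n)) \<longlonglongrightarrow> snd l"
      using tendsto_fst[OF lf(2)] tendsto_snd[OF lf(2)] by (auto simp: g_def F_def o_def)
    have "(\<lambda>n. (P1 (F n) / v (F n))\<^sup>2 + (P2 (F n) / v (F n))\<^sup>2) \<longlonglongrightarrow> (fst l)\<^sup>2 + (snd l)\<^sup>2"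
      by (intro tendsto_intros l1 l2)
    moreover have "(P1 (F n) / v (F n))\<^sup>2 + (P2 (F n) / v (F n))\<^sup>2 = 1" for n
      using norm_g[of "f n"] by (simp add: g_def F_def)
    ultimately have l: "(fst l)\<^sup>2 + (snd l)\<^sup>2 = 1" by (simp add: LIMSEQ_const_iff)
    have vF: "v (F n) > 0" for n using N by (simp add: F_def)
    have "Bseq v" using vlim by (intro convergent_imp_Bseq convergentI)
    then obtain vmax where vmax: "\<And>n. v n \<le> vmax" unfolding Bseq_def by (metis abs_le_D1 real_norm_def)
    have k1: "(\<lambda>n. sqrt (T n) / v n) \<longlonglongrightarrow> 0"
    proof (rule tendstoI)
      fix e :: real assume "e > 0"
      have "\<forall>\<^sub>F n in sequentially. 1 / e * sqrt (T n) < v n" by (rule ev)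
      then show "\<forall>\<^sub>F n in sequentially. dist (sqrt (T n) / v n) 0 < e"
      proof eventually_elim
        case (elim n)
        then have "0 < v n" using \<open>e > 0\<close> T(1)[of n] by (meson divide_pos_pos less_trans mult_pos_pos real_sqrt_gt_zero zero_less_one)
        then show ?case using elim \<open>e > 0\<close> T(1)[of n] by (simp add: field_simps)
      qed
    qed
    have "(\<lambda>n. \<eta> n / sqrt (T n) * v n) \<longlonglongrightarrow> 0 * sqrt (0\<^sup>2 + 0\<^sup>2)"
      by (intro tendsto_mult \<eta>(3) vlim)
    then have k2: "(\<lambda>n. \<eta> n / (sqrt (T n) / v n)) \<longlonglongrightarrow> 0" by simp
    have "2 * (\<alpha> * (snd l)\<^sup>2 - \<beta> * fst l * snd l + \<gamma> * (fst l)\<^sup>2) \<ge> b * ((fst l)\<^sup>2 + (snd l)\<^sup>2)"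
    proof (rule touching_steep[where T = "T \<circ> F" and \<eta> = "\<eta> \<circ> F" and ?P1.0 = "P1 \<circ> F" and ?P2.0 = "P2 \<circ> F" and v = "v \<circ> F" and vmax = vmax])
      show "(\<eta> \<circ> F) \<longlonglongrightarrow> 0" using \<eta> F by (auto intro: LIMSEQ_subseq_LIMSEQ)
      show "(\<lambda>n. sqrt ((T \<circ> F) n) / (v \<circ> F) n) \<longlonglongrightarrow> 0" using LIMSEQ_subseq_LIMSEQ[OF k1 F] by (simp add: o_def)
      show "(\<lambda>n. (\<eta> \<circ> F) n / (sqrt ((T \<circ> F) n) / (v \<circ> F) n)) \<longlonglongrightarrow> 0" using LIMSEQ_subseq_LIMSEQ[OF k2 F] by (simp add: o_def)
      show "fst l \<noteq> 0 \<or> snd l \<noteq> 0" using l by auto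
    qed (use T \<eta> vF vmax l1 l2 sub[OF _ F] in auto)
    then show ?thesis using l z by simp
  qed
qed

section \<open>Touching the relaxed limit by discrete maxima\<close>

text \<open>Only one implication and a weak inequality are kept. They hold for each of the two
  phases, for either convention at 0, and for the family that is true everywhere; all three
  instances occur below.\<close>

definition threshold_family :: "(real \<Rightarrow> real) \<Rightarrow> (real \<Rightarrow> nat \<Rightarrow> int \<Rightarrow> int \<Rightarrow> bool) \<Rightarrow> bool" where
  "threshold_family \<tau> U \<longleftrightarrow> (\<forall>h>0. \<forall>k m n. U h (Suc k) m n \<longrightarrow>
     1 / 2 \<le> measure_pmf.prob (heat_pmf (\<tau> h / h\<^sup>2)) {(i, j). U h k (m + i) (n + j)})"

text \<open>The upper Kuratowski limit of the grid sets: the points at which the upper relaxed limit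
  of a \<plusminus>1-valued u equals 1, where U is u = 1.\<close>

definition limit_set :: "(real \<Rightarrow> real) \<Rightarrow> (real \<Rightarrow> nat \<Rightarrow> int \<Rightarrow> int \<Rightarrow> bool) \<Rightarrow> ((real^2) \<times> real) set" where
  "limit_set \<tau> U = {(x, t). \<exists>\<^sub>F (h, k, m, n) in grid_filter \<tau> x t. U h k m n}"

abbreviation grid_event :: "(real \<Rightarrow> real) \<Rightarrow> real \<Rightarrow> nat \<Rightarrow> int \<Rightarrow> int \<Rightarrow> (real^2) \<times> real" where
  "grid_event \<tau> h k m n \<equiv> (grid_point h m n, of_nat k * \<tau> h)"

lemma eventually_grid_filter:
  "eventually Q (grid_filter \<tau> x t) \<longleftrightarrow>
     (\<exists>\<delta>>0. \<forall>h k m n. 0 < h \<and> h < \<delta> \<and> dist (grid_event \<tau> h k m n) (x, t) < \<delta> \<longrightarrow> Q (h, k, m, n))"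
  (is "?L \<longleftrightarrow> ?R")
proof
  assume ?L
  then obtain W where W: "eventually W (at_right 0 \<times>\<^sub>F (nhds t \<times>\<^sub>F nhds x))"
    "\<forall>z. W ((\<lambda>(h, k, m, n). (h, of_nat k * \<tau> h, grid_point h m n)) z) \<longrightarrow> Q z"
    unfolding grid_filter_def eventually_filtercomap by blast
  from W(1) obtain Pa Pb where P: "eventually Pa (at_right 0)" "eventually Pb (nhds t \<times>\<^sub>F nhds x)"
    and PW: "\<And>h w. Pa h \<Longrightarrow> Pb w \<Longrightarrow> W (h, w)"
    unfolding eventually_prod_filter by blast
  have Q: "Q (h, k, m, n)" if "Pa h" "Pb (of_nat k * \<tau> h, grid_point h m n)" for h k m n
    using W(2)[rule_format, of "(h, k, m, n)"] PW[OF that] by simp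
  from P(2) obtain Pc Pd where Pcd: "eventually Pc (nhds t)" "eventually Pd (nhds x)" "\<And>s y. Pc s \<Longrightarrow> Pd y \<Longrightarrow> Pb (s, y)"
    unfolding eventually_prod_filter by auto
  obtain d1 where d1: "d1 > 0" "\<And>h. 0 < h \<Longrightarrow> h < d1 \<Longrightarrow> Pa h" using P(1) unfolding eventually_at_right_field by auto
  obtain d2 where d2: "d2 > 0" "\<And>s. dist s t < d2 \<Longrightarrow> Pc s" using Pcd(1) unfolding eventually_nhds_metric by auto
  obtain d3 where d3: "d3 > 0" "\<And>y. dist y x < d3 \<Longrightarrow> Pd y" using Pcd(2) unfolding eventually_nhds_metric by auto
  show ?R
  proof (intro exI conjI allI impI)
    show "min d1 (min d2 d3) > 0" using d1 d2 d3 by simp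
    fix h k m n
    assume a: "0 < h \<and> h < min d1 (min d2 d3) \<and> dist (grid_event \<tau> h k m n) (x, t) < min d1 (min d2 d3)"
    have "dist (grid_point h m n) x \<le> dist (grid_event \<tau> h k m n) (x, t)" "dist (of_nat k * \<tau> h) t \<le> dist (grid_event \<tau> h k m n) (x, t)"
      using dist_fst_le[of "grid_event \<tau> h k m n" "(x, t)"] dist_snd_le[of "grid_event \<tau> h k m n" "(x, t)"] by auto
    then show "Q (h, k, m, n)" using a by (intro Q d1 Pcd d2 d3) linarith+
  qed
next
  assume ?R
  then obtain \<delta> where \<delta>: "\<delta> > 0" "\<And>h k m n. 0 < h \<and> h < \<delta> \<and> dist (grid_event \<tau> h k m n) (x, t) < \<delta> \<Longrightarrow> Q (h, k, m, n)" by blast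
  have 1: "eventually (\<lambda>h. 0 < h \<and> h < \<delta>) (at_right (0::real))"
    using \<delta>(1) unfolding eventually_at_right_field by auto
  have 2: "eventually (\<lambda>s. dist s t < \<delta> / 2) (nhds t)" "eventually (\<lambda>y. dist y x < \<delta> / 2) (nhds x)"
    using \<delta>(1) unfolding eventually_nhds_metric by (auto intro!: exI[of _ "\<delta> / 2"])
  have e3: "eventually (\<lambda>(h, s, y). (0 < h \<and> h < \<delta>) \<and> dist s t < \<delta> / 2 \<and> dist y x < \<delta> / 2) (at_right 0 \<times>\<^sub>F (nhds t \<times>\<^sub>F nhds x))"
    using eventually_prodI[OF 1 eventually_prodI[OF 2]] by (simp add: case_prod_unfold)
  show ?L unfolding grid_filter_def eventually_filtercomap
  proof (rule exI, rule conjI, rule e3, intro allI impI)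
    fix z :: "real \<times> nat \<times> int \<times> int"
    obtain h k m n where z: "z = (h, k, m, n)" by (cases z)
    assume "case case z of (h, k, m, n) \<Rightarrow> (h, of_nat k * \<tau> h, grid_point h m n) of (h, s, y) \<Rightarrow> (0 < h \<and> h < \<delta>) \<and> dist s t < \<delta> / 2 \<and> dist y x < \<delta> / 2"
    then have a: "0 < h" "h < \<delta>" "dist (of_nat k * \<tau> h) t < \<delta> / 2" "dist (grid_point h m n) x < \<delta> / 2" by (auto simp: z)
    have "dist (grid_event \<tau> h k m n) (x, t) \<le> dist (grid_point h m n) x + dist (of_nat k * \<tau> h) t"
      unfolding dist_Pair_Pair by (rule sqrt_sum_squares_le_sum) auto
    then show "Q z" unfolding z using a by (intro \<delta>(2)) auto
  qed
qed

lemma limit_set_iff: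
  "z \<in> limit_set \<tau> U \<longleftrightarrow> (\<forall>\<delta>>0. \<exists>h k m n. 0 < h \<and> h < \<delta> \<and> dist (grid_event \<tau> h k m n) z < \<delta> \<and> U h k m n)"
  by (cases z) (auto simp: limit_set_def frequently_def eventually_grid_filter)

lemma closed_limit_set: "closed (limit_set \<tau> U)"
  unfolding closed_limpt
proof (intro allI impI)
  fix z assume z: "z islimpt limit_set \<tau> U"
  show "z \<in> limit_set \<tau> U" unfolding limit_set_iff
  proof (intro allI impI)
    fix \<delta> :: real assume "\<delta> > 0"
    then obtain z' where z': "z' \<in> limit_set \<tau> U" "dist z' z < \<delta> / 2"
      using z unfolding islimpt_approachable by (metis half_gt_zero)
    then obtain h k m n where "0 < h" "h < \<delta> / 2" "dist (grid_event \<tau> h k m n) z' < \<delta> / 2" "U h k m n"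
      unfolding limit_set_iff using \<open>\<delta> > 0\<close> half_gt_zero by blast
    moreover have "dist (grid_event \<tau> h k m n) z < \<delta>"
      using dist_triangle_half_l[of "grid_event \<tau> h k m n" z' \<delta> z] calculation z'(2) by (simp add: dist_commute)
    ultimately show "\<exists>h k m n. 0 < h \<and> h < \<delta> \<and> dist (grid_event \<tau> h k m n) z < \<delta> \<and> U h k m n"
      using \<open>\<delta> > 0\<close> by (intro exI[of _ h] exI[of _ k] exI[of _ m] exI[of _ n]) auto
  qed
qed

lemma grid_point_nth [simp]: "grid_point h m n $ 1 = of_int m * h" "grid_point h m n $ 2 = of_int n * h"
  by (simp_all add: grid_point_def)

lemma finite_grid_events:
  assumes "h > 0" "\<tau> h > 0"
  shows "finite {(k, m, n). grid_event \<tau> h k m n \<in> cball z r}"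
proof -
  define M where "M = (norm z + \<bar>r\<bar>)"
  have "{(k, m, n). grid_event \<tau> h k m n \<in> cball z r} \<subseteq> {..nat \<lceil>M / \<tau> h\<rceil>} \<times> {- \<lceil>M / h\<rceil>..\<lceil>M / h\<rceil>} \<times> {- \<lceil>M / h\<rceil>..\<lceil>M / h\<rceil>}"
  proof
    fix w assume "w \<in> {(k, m, n). grid_event \<tau> h k m n \<in> cball z r}"
    then obtain k m n where w: "w = (k, m, n)" "grid_event \<tau> h k m n \<in> cball z r" by auto
    then have "norm (grid_event \<tau> h k m n) \<le> M"
      using norm_triangle_ineq2[of "grid_event \<tau> h k m n" z] by (simp add: M_def dist_norm norm_minus_commute)
    then have le: "norm (grid_point h m n) \<le> M" "\<bar>of_nat k * \<tau> h\<bar> \<le> M"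
      unfolding norm_Pair real_norm_def
      using real_sqrt_sum_squares_ge1[of "norm (grid_point h m n)" "\<bar>of_nat k * \<tau> h\<bar>"]
        real_sqrt_sum_squares_ge2[of "\<bar>of_nat k * \<tau> h\<bar>" "norm (grid_point h m n)"] by linarith+
    have "\<bar>of_int m * h\<bar> \<le> M" "\<bar>of_int n * h\<bar> \<le> M"
      using component_le_norm_cart[of "grid_point h m n" 1] component_le_norm_cart[of "grid_point h m n" 2] le by auto
    then have "\<bar>of_int m\<bar> \<le> M / h" "\<bar>of_int n\<bar> \<le> M / h" "of_nat k \<le> M / \<tau> h"
      using le(2) assms by (auto simp: pos_le_divide_eq abs_mult)
    then show "w \<in> {..nat \<lceil>M / \<tau> h\<rceil>} \<times> {- \<lceil>M / h\<rceil>..\<lceil>M / h\<rceil>} \<times> {- \<lceil>M / h\<rceil>..\<lceil>M / h\<rceil>}"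
      unfolding w mem_Times_iff fst_conv snd_conv atLeastAtMost_iff atMost_iff by linarith
  qed
  then show ?thesis by (rule finite_subset) auto
qed

text \<open>Stability of strict minima. Away from z, compactness gives all points of U with small h
  a value above \<Psi> z by a margin, since otherwise they would accumulate at a point of the limit
  set violating strictness. As z is itself a limit of points of U, a minimum over the finitely many
  grid points in the ball lies near z.\<close>

lemma discrete_touching:
  fixes \<Psi> :: "(real^2) \<times> real \<Rightarrow> real"
  assumes \<tau>: "\<And>h. h > 0 \<Longrightarrow> \<tau> h > 0" and z: "z \<in> limit_set \<tau> U" and r: "r > 0"
    and cont: "continuous_on (cball z r) \<Psi>"
    and strict: "\<And>w. w \<in> limit_set \<tau> U \<Longrightarrow> w \<in> cball z r \<Longrightarrow> w \<noteq> z \<Longrightarrow> \<Psi> z < \<Psi> w"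
    and "\<rho> > 0"
  obtains h k m n where "0 < h" "h < \<rho>" "dist (grid_event \<tau> h k m n) z < \<rho>" "U h k m n"
    "\<And>k' m' n'. grid_event \<tau> h k' m' n' \<in> cball z r \<Longrightarrow> U h k' m' n' \<Longrightarrow> \<Psi> (grid_event \<tau> h k m n) \<le> \<Psi> (grid_event \<tau> h k' m' n')"
proof -
  define K where "K = cball z r - ball z \<rho>"
  have K: "compact K" unfolding K_def by (intro compact_diff compact_cball open_ball)
  \<comment> \<open>A single \<delta> bounds the mesh and serves as the margin, so that its failure
    yields one sequence with both tending to 0.\<close>
  have "\<exists>\<delta>>0. \<forall>h k m n. 0 < h \<and> h < \<delta> \<and> grid_event \<tau> h k m n \<in> K \<and> U h k m n \<longrightarrow> \<Psi> z + \<delta> < \<Psi> (grid_event \<tau> h k m n)"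
  proof (rule ccontr)
    assume "\<not> ?thesis"
    then have "\<exists>h k m n. 0 < h \<and> h < \<delta> \<and> grid_event \<tau> h k m n \<in> K \<and> U h k m n \<and> \<Psi> (grid_event \<tau> h k m n) \<le> \<Psi> z + \<delta>" if "\<delta> > 0" for \<delta>
      using that by (force simp: not_less)
    then have "\<exists>h k m n. 0 < h \<and> h < inverse (real (Suc i)) \<and> grid_event \<tau> h k m n \<in> K \<and> U h k m n \<and> \<Psi> (grid_event \<tau> h k m n) \<le> \<Psi> z + inverse (real (Suc i))" for i
      by simp
    then obtain h k m n where s: "\<And>i. 0 < h i" "\<And>i. h i < inverse (real (Suc i))" "\<And>i. grid_event \<tau> (h i) (k i) (m i) (n i) \<in> K"
      "\<And>i. U (h i) (k i) (m i) (n i)" "\<And>i. \<Psi> (grid_event \<tau> (h i) (k i) (m i) (n i)) \<le> \<Psi> z + inverse (real (Suc i))"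
      by metis
    define Z where "Z i = grid_event \<tau> (h i) (k i) (m i) (n i)" for i
    obtain w f where wf: "w \<in> K" "strict_mono f" "(Z \<circ> f) \<longlonglongrightarrow> w"
      using K s(3) unfolding compact_def Z_def[symmetric] by metis
    have hl: "(\<lambda>i. h (f i)) \<longlonglongrightarrow> 0"
    proof -
      have "h \<longlonglongrightarrow> 0"
        by (rule Lim_null_comparison[OF _ LIMSEQ_inverse_real_of_nat]) (use s(1,2) in \<open>auto intro!: always_eventually simp: less_imp_le\<close>)
      from LIMSEQ_subseq_LIMSEQ[OF this wf(2)] show ?thesis by (simp add: o_def)
    qed
    have "w \<in> limit_set \<tau> U" unfolding limit_set_iff
    proof (intro allI impI)
      fix \<delta> :: real assume "\<delta> > 0"
      have "\<forall>\<^sub>F i in sequentially. dist (h (f i)) 0 < \<delta> \<and> dist ((Z \<circ> f) i) w < \<delta>"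
        using tendstoD[OF hl \<open>\<delta> > 0\<close>] tendstoD[OF wf(3) \<open>\<delta> > 0\<close>] by (rule eventually_conj)
      then obtain i where "dist (h (f i)) 0 < \<delta>" "dist ((Z \<circ> f) i) w < \<delta>" by (auto simp: eventually_sequentially)
      then show "\<exists>h k m n. 0 < h \<and> h < \<delta> \<and> dist (grid_event \<tau> h k m n) w < \<delta> \<and> U h k m n"
        using s(1,4)[of "f i"] by (intro exI[of _ "h (f i)"] exI[of _ "k (f i)"] exI[of _ "m (f i)"] exI[of _ "n (f i)"]) (auto simp: Z_def)
    qed
    moreover have "w \<in> cball z r" "w \<noteq> z" using wf(1) \<open>\<rho> > 0\<close> by (auto simp: K_def)
    ultimately have less: "\<Psi> z < \<Psi> w" by (rule strict)
    have lim1: "(\<lambda>i. \<Psi> (Z (f i))) \<longlonglongrightarrow> \<Psi> w"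
    proof (rule continuous_on_tendsto_compose[OF cont])
      show "(\<lambda>i. Z (f i)) \<longlonglongrightarrow> w" using wf(3) by (simp add: o_def)
      show "\<forall>\<^sub>F i in sequentially. Z (f i) \<in> cball z r" using s(3) by (auto simp: K_def Z_def)
    qed fact
    have lim2: "(\<lambda>i. \<Psi> z + inverse (real (Suc (f i)))) \<longlonglongrightarrow> \<Psi> z + 0"
      using LIMSEQ_subseq_LIMSEQ[OF LIMSEQ_inverse_real_of_nat wf(2)] by (intro tendsto_add tendsto_const) (simp add: o_def)
    have "\<Psi> (Z (f i)) \<le> \<Psi> z + inverse (real (Suc (f i)))" for i using s(5) by (simp add: Z_def)
    then have "\<Psi> w \<le> \<Psi> z + 0" by (intro LIMSEQ_le[OF lim1 lim2]) auto
    with less show False by simp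
  qed
  then obtain \<delta> where \<delta>: "\<delta> > 0" "\<And>h k m n. 0 < h \<Longrightarrow> h < \<delta> \<Longrightarrow> grid_event \<tau> h k m n \<in> K \<Longrightarrow> U h k m n \<Longrightarrow> \<Psi> z + \<delta> < \<Psi> (grid_event \<tau> h k m n)"
    by blast
  have "isCont \<Psi> z" using cont r by (intro continuous_on_interior[OF cont]) auto
  then obtain d where d: "d > 0" "\<And>w. dist w z < d \<Longrightarrow> dist (\<Psi> w) (\<Psi> z) < \<delta>"
    using \<delta>(1) unfolding continuous_at_eps_delta by metis
  define \<delta>' where "\<delta>' = min (min \<delta> \<rho>) (min d r)"
  have "\<delta>' > 0" using \<delta> d r \<open>\<rho> > 0\<close> by (simp add: \<delta>'_def)
  then obtain h k m n where hk: "0 < h" "h < \<delta>'" "dist (grid_event \<tau> h k m n) z < \<delta>'" "U h k m n"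
    using z unfolding limit_set_iff by blast
  let ?A = "{(k, m, n). grid_event \<tau> h k m n \<in> cball z r \<and> U h k m n}"
  let ?f = "\<lambda>(k, m, n). \<Psi> (grid_event \<tau> h k m n)"
  have fin: "finite ?A" by (rule finite_subset[OF _ finite_grid_events[of h \<tau> z r]]) (use hk(1) \<tau> in auto)
  have mem: "(k, m, n) \<in> ?A" using hk by (auto simp: \<delta>'_def dist_commute)
  obtain k0 m0 n0 where a: "((k0 :: nat), (m0 :: int), (n0 :: int)) \<in> ?A" "\<And>k' m' n'. (k', m', n') \<in> ?A \<Longrightarrow> ?f (k0, m0, n0) \<le> ?f (k', m', n')"
  proof -
    have "?A \<noteq> {}" using mem by blast
    then obtain a where "is_arg_min ?f (\<lambda>x. x \<in> ?A) a" using ex_is_arg_min_if_finite[OF fin] by blast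
    then have "a \<in> ?A" "\<And>b. b \<in> ?A \<Longrightarrow> ?f a \<le> ?f b" unfolding is_arg_min_linorder by blast+
    then show ?thesis using that[of "fst a" "fst (snd a)" "snd (snd a)"] by (simp only: prod.collapse)
  qed
  have "\<Psi> (grid_event \<tau> h k0 m0 n0) \<le> \<Psi> (grid_event \<tau> h k m n)" using a(2)[OF mem] by simp
  also have "\<dots> < \<Psi> z + \<delta>" using d(2)[of "grid_event \<tau> h k m n"] hk(3) by (auto simp: \<delta>'_def dist_real_def)
  finally have lt: "\<Psi> (grid_event \<tau> h k0 m0 n0) < \<Psi> z + \<delta>" .
  have "grid_event \<tau> h k0 m0 n0 \<notin> K"
  proof
    assume "grid_event \<tau> h k0 m0 n0 \<in> K"
    from \<delta>(2)[OF hk(1) _ this] show False using lt hk(2) a(1) by (auto simp: \<delta>'_def)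
  qed
  then have "dist (grid_event \<tau> h k0 m0 n0) z < \<rho>" using a(1) by (auto simp: K_def dist_commute)
  moreover have "h < \<rho>" using hk(2) by (simp add: \<delta>'_def)
  ultimately show ?thesis using hk(1) a by (intro that[of h m0 n0 k0]) auto
qed

text \<open>The expansion must hold around every base point near z, because discrete minima lie only
  near z. The gradient follows the base point; the time derivative and the quadratic part (half the
  Hessian) are frozen at z. The error is measured in parabolic scaling.\<close>

definition second_order_at :: "((real^2) \<times> real \<Rightarrow> real) \<Rightarrow> ((real^2) \<times> real \<Rightarrow> real^2) \<Rightarrow> real \<Rightarrow> real \<Rightarrow> real \<Rightarrow> real \<Rightarrow> (real^2) \<times> real \<Rightarrow> bool" where
  "second_order_at \<Psi> P b \<alpha> \<beta> \<gamma> z \<longleftrightarrow> isCont P z \<and> (\<forall>\<epsilon>>0. \<exists>r>0. \<forall>x t y s. dist (x, t) z < r \<and> dist (y, s) z < r \<longrightarrow>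
     \<bar>\<Psi> (y, s) - \<Psi> (x, t) - P (x, t) \<bullet> (y - x) - b * (s - t) - quad \<alpha> \<beta> \<gamma> ((y - x) $ 1) ((y - x) $ 2)\<bar> \<le> \<epsilon> * (\<bar>s - t\<bar> + (norm (y - x))\<^sup>2))"

lemma second_order_atE:
  assumes "second_order_at \<Psi> P b \<alpha> \<beta> \<gamma> z" "\<epsilon> > 0"
  obtains r where "r > 0" "\<forall>x t y s. dist (x, t) z < r \<longrightarrow> dist (y, s) z < r \<longrightarrow>
     \<bar>\<Psi> (y, s) - \<Psi> (x, t) - P (x, t) \<bullet> (y - x) - b * (s - t) - quad \<alpha> \<beta> \<gamma> ((y - x) $ 1) ((y - x) $ 2)\<bar> \<le> \<epsilon> * (\<bar>s - t\<bar> + (norm (y - x))\<^sup>2)"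
proof -
  from assms(1)[unfolded second_order_at_def, THEN conjunct2, rule_format, OF assms(2)]
  obtain r where r: "r > 0" "\<forall>x t y s. dist (x, t) z < r \<and> dist (y, s) z < r \<longrightarrow>
     \<bar>\<Psi> (y, s) - \<Psi> (x, t) - P (x, t) \<bullet> (y - x) - b * (s - t) - quad \<alpha> \<beta> \<gamma> ((y - x) $ 1) ((y - x) $ 2)\<bar> \<le> \<epsilon> * (\<bar>s - t\<bar> + (norm (y - x))\<^sup>2)"
    by (elim exE conjE)
  show ?thesis by (rule that[OF r(1)]) (intro allI impI r(2)[rule_format] conjI)
qed

lemma second_order_at_add:
  assumes "second_order_at \<Psi> P b \<alpha> \<beta> \<gamma> z" "second_order_at \<Psi>' P' b' \<alpha>' \<beta>' \<gamma>' z"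
  shows "second_order_at (\<lambda>w. \<Psi> w + \<Psi>' w) (\<lambda>w. P w + P' w) (b + b') (\<alpha> + \<alpha>') (\<beta> + \<beta>') (\<gamma> + \<gamma>') z"
  unfolding second_order_at_def
proof (intro conjI allI impI)
  show "isCont (\<lambda>w. P w + P' w) z" using assms by (auto simp: second_order_at_def)
  fix \<epsilon> :: real assume "\<epsilon> > 0"
  then have e: "\<epsilon> / 2 > 0" by simp
  obtain r where r: "r > 0" "\<forall>x t y s. dist (x, t) z < r \<longrightarrow> dist (y, s) z < r \<longrightarrow>
     \<bar>\<Psi> (y, s) - \<Psi> (x, t) - P (x, t) \<bullet> (y - x) - b * (s - t) - quad \<alpha> \<beta> \<gamma> ((y - x) $ 1) ((y - x) $ 2)\<bar> \<le> \<epsilon> / 2 * (\<bar>s - t\<bar> + (norm (y - x))\<^sup>2)"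
    by (rule second_order_atE[OF assms(1) e])
  obtain r' where r': "r' > 0" "\<forall>x t y s. dist (x, t) z < r' \<longrightarrow> dist (y, s) z < r' \<longrightarrow>
     \<bar>\<Psi>' (y, s) - \<Psi>' (x, t) - P' (x, t) \<bullet> (y - x) - b' * (s - t) - quad \<alpha>' \<beta>' \<gamma>' ((y - x) $ 1) ((y - x) $ 2)\<bar> \<le> \<epsilon> / 2 * (\<bar>s - t\<bar> + (norm (y - x))\<^sup>2)"
    by (rule second_order_atE[OF assms(2) e])
  show "\<exists>r>0. \<forall>x t y s. dist (x, t) z < r \<and> dist (y, s) z < r \<longrightarrow>
     \<bar>(\<Psi> (y, s) + \<Psi>' (y, s)) - (\<Psi> (x, t) + \<Psi>' (x, t)) - (P (x, t) + P' (x, t)) \<bullet> (y - x) - (b + b') * (s - t) - quad (\<alpha> + \<alpha>') (\<beta> + \<beta>') (\<gamma> + \<gamma>') ((y - x) $ 1) ((y - x) $ 2)\<bar> \<le> \<epsilon> * (\<bar>s - t\<bar> + (norm (y - x))\<^sup>2)"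
  proof (intro exI[of _ "min r r'"] conjI allI impI)
    fix x t y s assume a: "dist (x, t) z < min r r' \<and> dist (y, s) z < min r r'"
    define A where "A = \<Psi> (y, s) - \<Psi> (x, t) - P (x, t) \<bullet> (y - x) - b * (s - t) - quad \<alpha> \<beta> \<gamma> ((y - x) $ 1) ((y - x) $ 2)"
    define B where "B = \<Psi>' (y, s) - \<Psi>' (x, t) - P' (x, t) \<bullet> (y - x) - b' * (s - t) - quad \<alpha>' \<beta>' \<gamma>' ((y - x) $ 1) ((y - x) $ 2)"
    have "(\<Psi> (y, s) + \<Psi>' (y, s)) - (\<Psi> (x, t) + \<Psi>' (x, t)) - (P (x, t) + P' (x, t)) \<bullet> (y - x) - (b + b') * (s - t) - quad (\<alpha> + \<alpha>') (\<beta> + \<beta>') (\<gamma> + \<gamma>') ((y - x) $ 1) ((y - x) $ 2) = A + B"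
      by (simp add: A_def B_def inner_add_left algebra_simps del: vector_minus_component)
    moreover have "\<bar>A\<bar> \<le> \<epsilon> / 2 * (\<bar>s - t\<bar> + (norm (y - x))\<^sup>2)" "\<bar>B\<bar> \<le> \<epsilon> / 2 * (\<bar>s - t\<bar> + (norm (y - x))\<^sup>2)"
      unfolding A_def B_def using a by (intro r(2)[rule_format] r'(2)[rule_format]; simp)+
    then have "\<bar>A + B\<bar> \<le> \<epsilon> / 2 * (\<bar>s - t\<bar> + (norm (y - x))\<^sup>2) + \<epsilon> / 2 * (\<bar>s - t\<bar> + (norm (y - x))\<^sup>2)"
      by (intro order_trans[OF abs_triangle_ineq add_mono])
    ultimately show "\<bar>(\<Psi> (y, s) + \<Psi>' (y, s)) - (\<Psi> (x, t) + \<Psi>' (x, t)) - (P (x, t) + P' (x, t)) \<bullet> (y - x) - (b + b') * (s - t) - quad (\<alpha> + \<alpha>') (\<beta> + \<beta>') (\<gamma> + \<gamma>') ((y - x) $ 1) ((y - x) $ 2)\<bar> \<le> \<epsilon> * (\<bar>s - t\<bar> + (norm (y - x))\<^sup>2)"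
      by (simp only: distrib_right[symmetric] add_divide_distrib[symmetric]) simp
  qed (use r r' in auto)
qed

text \<open>A fourth power in space and a square in time: this makes a minimum strict without
  changing the gradient, Hessian or time derivative at the point itself.\<close>

lemma second_order_at_penalty:
  "second_order_at (\<lambda>z. norm (fst z - x0) ^ 4 + (snd z - t0)\<^sup>2) (\<lambda>z. (4 * (norm (fst z - x0))\<^sup>2) *\<^sub>R (fst z - x0)) 0 0 0 0 (x0, t0)"
  unfolding second_order_at_def
proof (intro conjI allI impI)
  show "isCont (\<lambda>z :: (real^2) \<times> real. (4 * (norm (fst z - x0))\<^sup>2) *\<^sub>R (fst z - x0)) (x0, t0)"
    by (intro continuous_intros)
  fix \<epsilon> :: real assume \<epsilon>: "\<epsilon> > 0"
  \<comment> \<open>The spatial error is (4 r)^2 + 2 r^2 = 18 r^2 times |y - x|^2, and the error in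
    time is 2 r times |s - t|.\<close>
  define r where "r = min 1 (\<epsilon> / 18)"
  have r: "r > 0" "r \<le> 1" "18 * r \<le> \<epsilon>" using \<epsilon> by (auto simp: r_def)
  have "18 * r * r \<le> 18 * r * 1" using r by (intro mult_left_mono) auto
  then have "18 * r * r \<le> \<epsilon>" using r by linarith
  then have r2: "18 * r\<^sup>2 \<le> \<epsilon>" by (simp add: power2_eq_square)
  have key: "\<bar>(norm (y - x0) ^ 4 + (s - t0)\<^sup>2) - (norm (x - x0) ^ 4 + (t - t0)\<^sup>2) - ((4 * (norm (x - x0))\<^sup>2) *\<^sub>R (x - x0)) \<bullet> (y - x)\<bar>
       \<le> \<epsilon> * (\<bar>s - t\<bar> + (norm (y - x))\<^sup>2)" if "dist (x, t) (x0, t0) < r" "dist (y, s) (x0, t0) < r" for x y :: "real^2" and s t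
  proof -
    define a d where "a = x - x0" and "d = y - x"
    have n: "norm a < r" "norm (a + d) < r" "\<bar>t - t0\<bar> < r" "\<bar>s - t0\<bar> < r"
      using that dist_fst_le[of "(x, t)" "(x0, t0)"] dist_fst_le[of "(y, s)" "(x0, t0)"] dist_snd_le[of "(x, t)" "(x0, t0)"] dist_snd_le[of "(y, s)" "(x0, t0)"]
      by (auto simp: a_def d_def dist_norm)
    have nd: "norm d \<le> 2 * r" using norm_triangle_ineq4[of "a + d" a] n by simp
    have e: "norm (a + d) ^ 4 = ((norm a)\<^sup>2 + 2 * (a \<bullet> d) + (norm d)\<^sup>2)\<^sup>2"
    proof -
      have "norm (a + d) ^ 4 = ((norm (a + d))\<^sup>2)\<^sup>2" by (simp flip: power_mult)
      also have "(norm (a + d))\<^sup>2 = (norm a)\<^sup>2 + 2 * (a \<bullet> d) + (norm d)\<^sup>2"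
        by (simp add: power2_norm_eq_inner inner_add_left inner_add_right inner_commute)
      finally show ?thesis .
    qed
    have "norm a ^ 4 = ((norm a)\<^sup>2)\<^sup>2" by (simp flip: power_mult)
    then have eq: "norm (a + d) ^ 4 - norm a ^ 4 - 4 * (norm a)\<^sup>2 * (a \<bullet> d) = (2 * (a \<bullet> d) + (norm d)\<^sup>2)\<^sup>2 + 2 * (norm a)\<^sup>2 * (norm d)\<^sup>2"
      unfolding e by (simp add: power2_eq_square algebra_simps)
    have "\<bar>norm (a + d) ^ 4 - norm a ^ 4 - 4 * (norm a)\<^sup>2 * (a \<bullet> d)\<bar> = (2 * (a \<bullet> d) + (norm d)\<^sup>2)\<^sup>2 + 2 * (norm a)\<^sup>2 * (norm d)\<^sup>2"
      unfolding eq by (rule abs_of_nonneg) (intro add_nonneg_nonneg mult_nonneg_nonneg; simp)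
    also have "\<dots> \<le> (4 * r * norm d)\<^sup>2 + 2 * r\<^sup>2 * (norm d)\<^sup>2"
    proof -
      have "\<bar>a \<bullet> d\<bar> \<le> norm a * norm d" by (rule Cauchy_Schwarz_ineq2)
      also have "\<dots> \<le> r * norm d" using n by (intro mult_right_mono) auto
      finally have 1: "\<bar>a \<bullet> d\<bar> \<le> r * norm d" .
      have 2: "(norm d)\<^sup>2 \<le> 2 * r * norm d" using mult_right_mono[OF nd, of "norm d"] by (simp add: power2_eq_square)
      have "(2 * (a \<bullet> d) + (norm d)\<^sup>2)\<^sup>2 = \<bar>2 * (a \<bullet> d) + (norm d)\<^sup>2\<bar>\<^sup>2" by simp
      also have "\<dots> \<le> (4 * r * norm d)\<^sup>2"
      proof (rule power_mono)
        have "\<bar>2 * (a \<bullet> d) + (norm d)\<^sup>2\<bar> \<le> 2 * \<bar>a \<bullet> d\<bar> + (norm d)\<^sup>2"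
          by (rule order_trans[OF abs_triangle_ineq]) (simp add: abs_mult)
        then show "\<bar>2 * (a \<bullet> d) + (norm d)\<^sup>2\<bar> \<le> 4 * r * norm d" using 1 2 by linarith
      qed simp
      finally have sq: "(2 * (a \<bullet> d) + (norm d)\<^sup>2)\<^sup>2 \<le> (4 * r * norm d)\<^sup>2" .
      have "2 * (norm a)\<^sup>2 * (norm d)\<^sup>2 \<le> 2 * r\<^sup>2 * (norm d)\<^sup>2"
        using n(1) by (intro mult_right_mono mult_left_mono power_mono) auto
      with sq show ?thesis by (rule add_mono)
    qed
    also have "\<dots> = 18 * r\<^sup>2 * (norm d)\<^sup>2" by (simp add: power_mult_distrib)
    also have "\<dots> \<le> \<epsilon> * (norm d)\<^sup>2" using r2 by (intro mult_right_mono) auto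
    finally have A: "\<bar>norm (a + d) ^ 4 - norm a ^ 4 - 4 * (norm a)\<^sup>2 * (a \<bullet> d)\<bar> \<le> \<epsilon> * (norm d)\<^sup>2" .
    have "(s - t0)\<^sup>2 - (t - t0)\<^sup>2 = ((s - t0) + (t - t0)) * (s - t)" by (simp add: power2_eq_square algebra_simps)
    then have "\<bar>(s - t0)\<^sup>2 - (t - t0)\<^sup>2\<bar> = \<bar>(s - t0) + (t - t0)\<bar> * \<bar>s - t\<bar>" by (simp add: abs_mult)
    also have "\<dots> \<le> \<epsilon> * \<bar>s - t\<bar>" using n r \<epsilon> by (intro mult_right_mono) linarith+
    finally have B: "\<bar>(s - t0)\<^sup>2 - (t - t0)\<^sup>2\<bar> \<le> \<epsilon> * \<bar>s - t\<bar>" .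
    have "(norm (y - x0) ^ 4 + (s - t0)\<^sup>2) - (norm (x - x0) ^ 4 + (t - t0)\<^sup>2) - ((4 * (norm (x - x0))\<^sup>2) *\<^sub>R (x - x0)) \<bullet> (y - x) =
       (norm (a + d) ^ 4 - norm a ^ 4 - 4 * (norm a)\<^sup>2 * (a \<bullet> d)) + ((s - t0)\<^sup>2 - (t - t0)\<^sup>2)"
      by (simp add: a_def d_def)
    also have "\<bar>\<dots>\<bar> \<le> \<epsilon> * (norm d)\<^sup>2 + \<epsilon> * \<bar>s - t\<bar>" by (rule order_trans[OF abs_triangle_ineq add_mono[OF A B]])
    finally show ?thesis by (simp add: d_def algebra_simps)
  qed
  then show "\<exists>r>0. \<forall>x t y s. dist (x, t) (x0, t0) < r \<and> dist (y, s) (x0, t0) < r \<longrightarrow>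
     \<bar>norm (fst (y, s) - x0) ^ 4 + (snd (y, s) - t0)\<^sup>2 - (norm (fst (x, t) - x0) ^ 4 + (snd (x, t) - t0)\<^sup>2) - (4 * (norm (fst (x, t) - x0))\<^sup>2) *\<^sub>R (fst (x, t) - x0) \<bullet> (y - x) - 0 * (s - t) - quad 0 0 0 ((y - x) $ 1) ((y - x) $ 2)\<bar> \<le> \<epsilon> * (\<bar>s - t\<bar> + (norm (y - x))\<^sup>2)"
    using r(1) by (intro exI[of _ r]) (simp add: algebra_simps)
qed

text \<open>Since h / \<tau> = C \<tau>^(\<gamma> - 1), the exponent \<gamma> > 1 is what makes the
  lattice spacing negligible against the strip width.\<close>

lemma time_step_asymptotics:
  fixes \<tau> :: "real \<Rightarrow> real"
  assumes "C > 0" "\<gamma> > 1" and \<tau>: "\<And>h. h > 0 \<Longrightarrow> \<tau> h > 0 \<and> h = C * \<tau> h powr \<gamma>"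
  shows "(\<tau> \<longlongrightarrow> 0) (at_right 0)" "((\<lambda>h. h / \<tau> h) \<longlongrightarrow> 0) (at_right 0)"
proof -
  have eq: "\<tau> h = (h / C) powr (1 / \<gamma>)" if "h > 0" for h
  proof -
    have "h / C = (C * \<tau> h powr \<gamma>) / C" using \<tau>[OF that] by (intro arg_cong[where f = "\<lambda>x. x / C"]) blast
    also have "\<dots> = \<tau> h powr \<gamma>" by (rule nonzero_mult_div_cancel_left) (use assms(1) in simp)
    finally have "h / C = \<tau> h powr \<gamma>" .
    then show ?thesis using \<tau>[OF that] assms(2) by (simp add: powr_powr)
  qed
  have ev: "\<forall>\<^sub>F h in at_right 0. (h :: real) > 0" by (simp add: eventually_at_right_less)
  have "((\<lambda>h. (h / C) powr (1 / \<gamma>)) \<longlongrightarrow> 0) (at_right 0)"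
  proof (rule tendsto_zero_powrI)
    show "((\<lambda>h. h / C) \<longlongrightarrow> 0) (at_right 0)"
      using tendsto_divide[OF tendsto_ident_at tendsto_const, of C 0 "{0<..}"] assms(1) by simp
    show "\<forall>\<^sub>F h in at_right 0. 0 \<le> h / C" using ev by eventually_elim (use assms(1) in auto)
  qed (use assms(2) in auto)
  then show 1: "(\<tau> \<longlongrightarrow> 0) (at_right 0)"
    by (rule Lim_transform_eventually) (use ev eq in \<open>auto elim!: eventually_mono\<close>)
  have "((\<lambda>h. C * \<tau> h powr (\<gamma> - 1)) \<longlongrightarrow> C * 0) (at_right 0)"
    by (intro tendsto_mult tendsto_const tendsto_zero_powrI[OF 1]) (use assms(2) ev \<tau> in \<open>auto elim!: eventually_mono simp: less_imp_le\<close>)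
  then have 2: "((\<lambda>h. C * \<tau> h powr (\<gamma> - 1)) \<longlongrightarrow> 0) (at_right 0)" by simp
  have "h / \<tau> h = C * \<tau> h powr (\<gamma> - 1)" if "h > 0" for h
  proof -
    have "h / \<tau> h = C * \<tau> h powr \<gamma> / \<tau> h" using \<tau>[OF that] by (intro arg_cong[where f = "\<lambda>x. x / \<tau> h"]) blast
    also have "\<dots> = C * \<tau> h powr (\<gamma> - 1)" using \<tau>[OF that] by (simp add: powr_diff)
    finally show ?thesis .
  qed
  then show "((\<lambda>h. h / \<tau> h) \<longlongrightarrow> 0) (at_right 0)"
    by (intro Lim_transform_eventually[OF 2]) (use ev in \<open>auto elim!: eventually_mono\<close>)
qed

text \<open>After the penalty has made the minimum strict, grid minima converge to the touching
  point. At such a minimum, every nearby point of U one step earlier has a larger value of the test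
  function, so its Taylor polynomial is nonnegative up to \<epsilon>. In units of sqrt \<tau> this
  is \<open>step_event\<close>, which the threshold property forces to have probability at least 1/2
  up to the tail.\<close>

lemma touching_test_function:
  fixes \<Psi> :: "(real^2) \<times> real \<Rightarrow> real" and x0 :: "real^2"
  assumes fam: "threshold_family \<tau> U"
    and par: "C > 0" "\<gamma>' > 1" and \<tau>: "\<And>h. h > 0 \<Longrightarrow> \<tau> h > 0 \<and> h = C * \<tau> h powr \<gamma>'"
    and z: "(x0, t0) \<in> limit_set \<tau> U" "t0 > 0" and r0: "r0 > 0"
    and cont: "continuous_on (cball (x0, t0) r0) \<Psi>"
    and min: "\<And>w. w \<in> limit_set \<tau> U \<Longrightarrow> w \<in> cball (x0, t0) r0 \<Longrightarrow> \<Psi> (x0, t0) \<le> \<Psi> w"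
    and so: "second_order_at \<Psi> P b \<alpha> \<beta> \<gamma> (x0, t0)"
    and p: "p = P (x0, t0)"
  shows "p \<noteq> 0 \<Longrightarrow> b * (norm p)\<^sup>2 \<le> 2 * (\<alpha> * (p $ 2)\<^sup>2 - \<beta> * (p $ 1) * (p $ 2) + \<gamma> * (p $ 1)\<^sup>2)"
    and "p = 0 \<Longrightarrow> \<alpha> = 0 \<Longrightarrow> \<beta> = 0 \<Longrightarrow> \<gamma> = 0 \<Longrightarrow> b \<le> 0"
proof -
  define pen where "pen z = norm (fst z - x0) ^ 4 + (snd z - t0)\<^sup>2" for z :: "(real^2) \<times> real"
  define \<Phi> where "\<Phi> z = \<Psi> z + pen z" for z
  define Q where "Q z = P z + (4 * (norm (fst z - x0))\<^sup>2) *\<^sub>R (fst z - x0)" for z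
  have so': "second_order_at \<Phi> Q b \<alpha> \<beta> \<gamma> (x0, t0)"
    using second_order_at_add[OF so second_order_at_penalty[of x0 t0]] by (simp add: \<Phi>_def[abs_def] Q_def[abs_def] pen_def)
  have \<tau>0: "\<tau> h > 0" if "h > 0" for h using \<tau> that by blast
  have cont': "continuous_on (cball (x0, t0) r0) \<Phi>"
    unfolding \<Phi>_def pen_def by (intro continuous_intros cont)
  have strict: "\<Phi> (x0, t0) < \<Phi> w" if "w \<in> limit_set \<tau> U" "w \<in> cball (x0, t0) r0" "w \<noteq> (x0, t0)" for w
  proof -
    have "pen w > 0"
    proof (cases "fst w = x0")
      case True
      then have "snd w \<noteq> t0" using that(3) by (cases w) auto
      then show ?thesis by (simp add: pen_def add_nonneg_pos)
    next
      case False
      then show ?thesis by (simp add: pen_def add_pos_nonneg)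
    qed
    moreover have "pen (x0, t0) = 0" by (simp add: pen_def)
    ultimately show ?thesis using min[OF that(1,2)] by (simp add: \<Phi>_def)
  qed
  have "\<exists>h k m n. 0 < h \<and> h < inverse (real (Suc i)) \<and> dist (grid_event \<tau> h k m n) (x0, t0) < min t0 (inverse (real (Suc i))) \<and> U h k m n \<and>
    (\<forall>k' m' n'. grid_event \<tau> h k' m' n' \<in> cball (x0, t0) r0 \<longrightarrow> U h k' m' n' \<longrightarrow> \<Phi> (grid_event \<tau> h k m n) \<le> \<Phi> (grid_event \<tau> h k' m' n'))" for i
  proof -
    \<comment> \<open>Distance less than t0 makes the time index positive, so an earlier time step
      exists.\<close>
    have "min t0 (inverse (real (Suc i))) > 0" using z(2) by simp
    from discrete_touching[OF \<tau>0 z(1) r0 cont' strict this] show ?thesis by (smt (verit) min_less_iff_conj)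
  qed
  then obtain h k m n where s: "\<And>i. 0 < h i" "\<And>i. h i < inverse (real (Suc i))"
    "\<And>i. dist (grid_event \<tau> (h i) (k i) (m i) (n i)) (x0, t0) < min t0 (inverse (real (Suc i)))" "\<And>i. U (h i) (k i) (m i) (n i)"
    "\<And>i k' m' n'. grid_event \<tau> (h i) k' m' n' \<in> cball (x0, t0) r0 \<Longrightarrow> U (h i) k' m' n' \<Longrightarrow> \<Phi> (grid_event \<tau> (h i) (k i) (m i) (n i)) \<le> \<Phi> (grid_event \<tau> (h i) k' m' n')"
    by metis
  define Z where "Z i = grid_event \<tau> (h i) (k i) (m i) (n i)" for i
  have Zlim: "Z \<longlonglongrightarrow> (x0, t0)"
  proof -
    have "(\<lambda>i. dist (Z i) (x0, t0)) \<longlonglongrightarrow> 0"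
      by (rule Lim_null_comparison[OF _ LIMSEQ_inverse_real_of_nat]) (use s(3) in \<open>auto intro!: always_eventually simp: less_imp_le Z_def\<close>)
    then show ?thesis by (rule tendsto_dist_iff[THEN iffD2])
  qed
  have hlim: "filterlim h (at_right 0) sequentially"
  proof -
    have "h \<longlonglongrightarrow> 0"
      by (rule Lim_null_comparison[OF _ LIMSEQ_inverse_real_of_nat]) (use s(1,2) in \<open>auto intro!: always_eventually simp: less_imp_le\<close>)
    moreover have "h i \<in> {0<..}" "h i \<noteq> 0" for i using s(1)[of i] by auto
    ultimately show ?thesis unfolding filterlim_at by simp
  qed
  define T where "T i = \<tau> (h i)" for i
  define \<eta> where "\<eta> i = h i / sqrt (T i)" for i
  have T: "T i > 0" for i using \<tau>0 s(1) by (simp add: T_def)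
  have Tlim: "T \<longlonglongrightarrow> 0"
    using filterlim_compose[OF time_step_asymptotics(1)[OF par \<tau>] hlim] by (simp add: T_def[abs_def])
  have hT: "(\<lambda>i. h i / T i) \<longlonglongrightarrow> 0"
    using filterlim_compose[OF time_step_asymptotics(2)[OF par \<tau>] hlim] by (simp add: T_def[abs_def])
  have \<eta>: "\<eta> i > 0" for i using s(1)[of i] T[of i] by (simp add: \<eta>_def)
  have \<eta>T: "\<eta> i / sqrt (T i) = h i / T i" for i
    using T[of i] by (simp add: \<eta>_def)
  have \<eta>Tlim: "(\<lambda>i. \<eta> i / sqrt (T i)) \<longlonglongrightarrow> 0" using hT by (simp only: \<eta>T)
  have "(\<lambda>i. (\<eta> i / sqrt (T i)) * sqrt (T i)) \<longlonglongrightarrow> 0 * sqrt 0" by (intro tendsto_intros \<eta>Tlim Tlim)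
  then have \<eta>lim: "\<eta> \<longlonglongrightarrow> 0" using T by (simp add: less_imp_neq[symmetric])
  have a: "1 / (\<eta> i)\<^sup>2 = \<tau> (h i) / (h i)\<^sup>2" for i using T[of i] by (simp add: \<eta>_def power_divide T_def[symmetric])
  have "isCont Q (x0, t0)" using so' by (simp add: second_order_at_def)
  then have Qlim: "(\<lambda>i. Q (Z i)) \<longlonglongrightarrow> p"
    using isCont_tendsto_compose[OF _ Zlim] by (force simp: Q_def p)
  have P: "(\<lambda>i. Q (Z i) $ 1) \<longlonglongrightarrow> p $ 1" "(\<lambda>i. Q (Z i) $ 2) \<longlonglongrightarrow> p $ 2"
    by (intro tendsto_vec_nth Qlim)+
  have step: "\<exists>r>0. \<forall>\<^sub>F i in sequentially. \<forall>R>0. sqrt (T i) * R \<le> r \<longrightarrow>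
      1 / 2 \<le> measure_pmf.prob (heat_pmf (1 / (\<eta> i)\<^sup>2)) (step_event (\<eta> i) R (Q (Z i) $ 1) (Q (Z i) $ 2) (sqrt (T i)) (\<epsilon> - b) (\<alpha> + \<epsilon>) \<beta> (\<gamma> + \<epsilon>)) + 8 / R\<^sup>2"
    if \<epsilon>: "\<epsilon> > 0" for \<epsilon>
  proof -
    obtain r1 where r1: "r1 > 0" "\<forall>x t y s. dist (x, t) (x0, t0) < r1 \<longrightarrow> dist (y, s) (x0, t0) < r1 \<longrightarrow>
     \<bar>\<Phi> (y, s) - \<Phi> (x, t) - Q (x, t) \<bullet> (y - x) - b * (s - t) - quad \<alpha> \<beta> \<gamma> ((y - x) $ 1) ((y - x) $ 2)\<bar> \<le> \<epsilon> * (\<bar>s - t\<bar> + (norm (y - x))\<^sup>2)"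
      by (rule second_order_atE[OF so' \<epsilon>])
    \<comment> \<open>The base point, the spatial displacement and the time step contribute at most
      r each, so the displaced point stays within 4 r of the touching point.\<close>
    define r where "r = min r0 r1 / 4"
    have r: "r > 0" "4 * r \<le> r0" "4 * r \<le> r1" using r0 r1(1) by (auto simp: r_def)
    have "\<forall>\<^sub>F i in sequentially. dist (Z i) (x0, t0) < r \<and> dist (T i) 0 < r"
      using tendstoD[OF Zlim r(1)] tendstoD[OF Tlim r(1)] by (rule eventually_conj)
    then have "\<forall>\<^sub>F i in sequentially. \<forall>R>0. sqrt (T i) * R \<le> r \<longrightarrow>
      1 / 2 \<le> measure_pmf.prob (heat_pmf (1 / (\<eta> i)\<^sup>2)) (step_event (\<eta> i) R (Q (Z i) $ 1) (Q (Z i) $ 2) (sqrt (T i)) (\<epsilon> - b) (\<alpha> + \<epsilon>) \<beta> (\<gamma> + \<epsilon>)) + 8 / R\<^sup>2"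
    proof eventually_elim
      case (elim l)
      show ?case
      proof (intro allI impI)
        fix R :: real assume R: "R > 0" "sqrt (T l) * R \<le> r"
        define x t where "x = grid_point (h l) (m l) (n l)" and "t = of_nat (k l) * T l"
        have Zl: "Z l = (x, t)" by (simp add: Z_def x_def t_def T_def)
        have "\<bar>t - t0\<bar> < t0"
          using s(3)[of l] dist_snd_le[of "Z l" "(x0, t0)"] by (simp add: Zl Z_def[symmetric] dist_real_def)
        then have "t > 0" by linarith
        then have "k l \<noteq> 0" unfolding t_def by (metis mult_zero_left of_nat_0 less_irrefl)
        then obtain k' where k': "k l = Suc k'" by (cases "k l") auto
        define s where "s = of_nat k' * T l"
        have st: "s - t = - T l" by (simp add: s_def t_def k' algebra_simps)
        let ?M = "heat_pmf (1 / (\<eta> l)\<^sup>2)"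
        let ?E = "step_event (\<eta> l) R (Q (Z l) $ 1) (Q (Z l) $ 2) (sqrt (T l)) (\<epsilon> - b) (\<alpha> + \<epsilon>) \<beta> (\<gamma> + \<epsilon>)"
        let ?B = "{(i, j). R \<le> \<bar>\<eta> l * of_int i\<bar> + \<bar>\<eta> l * of_int j\<bar>}"
        \<comment> \<open>Displacements within radius R are captured by minimality and Taylor
          expansion; the rest is left to the tail bound.\<close>
        have sub: "{(i, j). U (h l) k' (m l + i) (n l + j)} \<subseteq> ?E \<union> ?B"
        proof (rule subsetI, rule UnCI)
          fix w assume "w \<in> {(i, j). U (h l) k' (m l + i) (n l + j)}" "w \<notin> ?B"
          then obtain i j where w: "w = (i, j)" and Uij: "U (h l) k' (m l + i) (n l + j)"
            and nB: "\<not> R \<le> \<bar>\<eta> l * of_int i\<bar> + \<bar>\<eta> l * of_int j\<bar>" by auto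
          define y where "y = grid_point (h l) (m l + i) (n l + j)"
          define X Y where "X = \<eta> l * of_int i" and "Y = \<eta> l * of_int j"
          have yx: "(y - x) $ 1 = sqrt (T l) * X" "(y - x) $ 2 = sqrt (T l) * Y"
            using T[of l] by (simp_all add: y_def x_def X_def Y_def \<eta>_def algebra_simps)
          have XY: "\<bar>X\<bar> + \<bar>Y\<bar> < R" using nB by (simp add: X_def Y_def)
          have nyx: "(norm (y - x))\<^sup>2 = T l * (X\<^sup>2 + Y\<^sup>2)"
            using T[of l] by (simp only: power2_norm_eq_inner inner_vec_def sum_2 yx) (simp add: power2_eq_square algebra_simps)
          have "(norm (y - x))\<^sup>2 \<le> T l * (\<bar>X\<bar> + \<bar>Y\<bar>)\<^sup>2"
            unfolding nyx using T[of l] by (intro mult_left_mono) (auto simp: power2_sum)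
          also have "\<dots> = (sqrt (T l) * (\<bar>X\<bar> + \<bar>Y\<bar>))\<^sup>2" using T[of l] by (simp add: power_mult_distrib)
          finally have "norm (y - x) \<le> sqrt (T l) * (\<bar>X\<bar> + \<bar>Y\<bar>)" by (rule power2_le_imp_le) (use T[of l] in auto)
          also have "\<dots> \<le> sqrt (T l) * R" using XY T[of l] by (intro mult_left_mono) auto
          also have "\<dots> \<le> r" by (rule R(2))
          finally have "norm (y - x) \<le> r" .
          moreover have "dist (y, s) (x, t) \<le> norm (y - x) + \<bar>s - t\<bar>"
            unfolding dist_Pair_Pair by (rule order_trans[OF sqrt_sum_squares_le_sum]) (auto simp: dist_norm)
          moreover have "\<bar>s - t\<bar> < r" using elim T[of l] by (simp add: st)
          moreover have "dist (y, s) (x0, t0) \<le> dist (y, s) (x, t) + dist (x, t) (x0, t0)" by (rule dist_triangle)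
          ultimately have ds: "dist (y, s) (x0, t0) < 4 * r" "dist (x, t) (x0, t0) < 4 * r" using elim r(1) by (auto simp: Zl)
          have ys: "grid_event \<tau> (h l) k' (m l + i) (n l + j) = (y, s)" by (simp add: y_def s_def T_def)
          have "(y, s) \<in> cball (x0, t0) r0" using ds r(2) by (simp add: dist_commute)
          then have "\<Phi> (x, t) \<le> \<Phi> (y, s)" using \<open>\<And>i k' m' n'. grid_event \<tau> (h i) k' m' n' \<in> cball (x0, t0) r0 \<Longrightarrow> U (h i) k' m' n' \<Longrightarrow> _\<close>[of l "m l + i" "n l + j" k'] Uij
            by (simp only: ys Z_def[symmetric] Zl)
          moreover have "\<bar>\<Phi> (y, s) - \<Phi> (x, t) - Q (x, t) \<bullet> (y - x) - b * (s - t) - quad \<alpha> \<beta> \<gamma> ((y - x) $ 1) ((y - x) $ 2)\<bar> \<le> \<epsilon> * (\<bar>s - t\<bar> + (norm (y - x))\<^sup>2)"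
            using ds r(3) by (intro r1(2)[rule_format]) linarith+
          \<comment> \<open>Here s - t = - T l, so the time derivative enters with a minus sign and,
            with the error, becomes the coefficient \<epsilon> - b.\<close>
          ultimately have "0 \<le> Q (x, t) \<bullet> (y - x) + b * (s - t) + quad \<alpha> \<beta> \<gamma> ((y - x) $ 1) ((y - x) $ 2) + \<epsilon> * (\<bar>s - t\<bar> + (norm (y - x))\<^sup>2)"
            by linarith
          also have "Q (x, t) \<bullet> (y - x) = Q (x, t) $ 1 * (sqrt (T l) * X) + Q (x, t) $ 2 * (sqrt (T l) * Y)"
            by (simp only: inner_vec_def sum_2 yx inner_real_def)
          also have "quad \<alpha> \<beta> \<gamma> ((y - x) $ 1) ((y - x) $ 2) = T l * quad \<alpha> \<beta> \<gamma> X Y"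
            using T[of l] unfolding yx by (simp add: power2_eq_square algebra_simps)
          also have "Q (x, t) $ 1 * (sqrt (T l) * X) + Q (x, t) $ 2 * (sqrt (T l) * Y) + b * (s - t) + T l * quad \<alpha> \<beta> \<gamma> X Y + \<epsilon> * (\<bar>s - t\<bar> + (norm (y - x))\<^sup>2)
             = sqrt (T l) * (Q (x, t) $ 1 * X + Q (x, t) $ 2 * Y) + (sqrt (T l) * sqrt (T l)) * (\<epsilon> - b + quad (\<alpha> + \<epsilon>) \<beta> (\<gamma> + \<epsilon>) X Y)"
            unfolding nyx st using T[of l] by (simp add: algebra_simps)
          also have "\<dots> = sqrt (T l) * (Q (x, t) $ 1 * X + Q (x, t) $ 2 * Y + sqrt (T l) * (\<epsilon> - b + quad (\<alpha> + \<epsilon>) \<beta> (\<gamma> + \<epsilon>) X Y))"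
            by (simp only: distrib_left mult.assoc)
          finally have "0 \<le> Q (x, t) $ 1 * X + Q (x, t) $ 2 * Y + sqrt (T l) * (\<epsilon> - b + quad (\<alpha> + \<epsilon>) \<beta> (\<gamma> + \<epsilon>) X Y)"
            using T[of l] by (simp only: zero_le_mult_iff real_sqrt_gt_0_iff) auto
          then show "w \<in> ?E" using XY by (simp add: w step_event_def Zl X_def Y_def)
        qed
        have "1 / 2 \<le> measure_pmf.prob ?M {(i, j). U (h l) k' (m l + i) (n l + j)}"
          using fam \<open>\<And>i. 0 < h i\<close>[of l] \<open>\<And>i. U (h i) (k i) (m i) (n i)\<close>[of l] unfolding threshold_family_def a k' by blast
        also have "\<dots> \<le> measure_pmf.prob ?M ?E + measure_pmf.prob ?M ?B"
          by (rule order_trans[OF measure_pmf.finite_measure_mono[OF sub] measure_Un_le]) auto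
        also have "measure_pmf.prob ?M ?B \<le> 8 / R\<^sup>2" by (rule prob_heat_pmf_tail[OF \<eta> R(1)])
        finally show "1 / 2 \<le> measure_pmf.prob ?M ?E + 8 / R\<^sup>2" by simp
      qed
    qed
    then show ?thesis using r(1) by blast
  qed
  note lim = touching_limit[OF T Tlim \<eta> \<eta>lim \<eta>Tlim P, of b \<alpha> \<beta> \<gamma>, OF step]
  have np: "(norm p)\<^sup>2 = (p $ 1)\<^sup>2 + (p $ 2)\<^sup>2"
    by (simp only: power2_norm_eq_inner inner_vec_def sum_2) (simp add: power2_eq_square)
  show "b * (norm p)\<^sup>2 \<le> 2 * (\<alpha> * (p $ 2)\<^sup>2 - \<beta> * (p $ 1) * (p $ 2) + \<gamma> * (p $ 1)\<^sup>2)" if "p \<noteq> 0"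
  proof -
    have "p $ 1 \<noteq> 0 \<or> p $ 2 \<noteq> 0" using that by (auto simp: vec_eq_iff forall_2)
    then show ?thesis unfolding np by (intro lim(1))
  qed
  show "b \<le> 0" if "p = 0" "\<alpha> = 0" "\<beta> = 0" "\<gamma> = 0"
    by (rule lim(2)) (use that in auto)
qed

section \<open>Second-order Taylor expansion\<close>

definition dir1 :: "('a::euclidean_space \<Rightarrow> real) \<Rightarrow> 'a \<Rightarrow> 'a \<Rightarrow> real" where
  "dir1 f v z = frechet_derivative f (at z) v"

definition dir2 :: "('a::euclidean_space \<Rightarrow> real) \<Rightarrow> 'a \<Rightarrow> 'a \<Rightarrow> 'a \<Rightarrow> real" where
  "dir2 f u v z = frechet_derivative (dir1 f v) (at z) u"

context
  fixes f :: "'a::euclidean_space \<Rightarrow> real" and S :: "'a set"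
  assumes C2: "Ck_on 2 S f" and S: "open S"
begin

lemma C2_has_derivative: "z \<in> S \<Longrightarrow> (f has_derivative (\<lambda>v. dir1 f v z)) (at z)"
  unfolding dir1_def using C2 frechet_derivative_works[of f "at z"] by (simp add: numeral_2_eq_2)

lemma C2_has_derivative2: "z \<in> S \<Longrightarrow> (dir1 f v has_derivative (\<lambda>u. dir2 f u v z)) (at z)"
  unfolding dir2_def using C2 frechet_derivative_works[of "dir1 f v" "at z"] by (simp add: numeral_2_eq_2 dir1_def[abs_def])

lemma C2_continuous: "continuous_on S (dir2 f u v)"
  using C2 by (simp add: numeral_2_eq_2 dir1_def[abs_def] dir2_def[abs_def])

lemma C2_continuous1: "continuous_on S (dir1 f v)"
  using C2_has_derivative2 by (meson has_derivative_at_withinI has_derivative_continuous_on)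

lemma C2_linear1: "z \<in> S \<Longrightarrow> linear (\<lambda>v. dir1 f v z)"
  by (rule has_derivative_linear[OF C2_has_derivative])

lemma C2_linear2: "z \<in> S \<Longrightarrow> linear (\<lambda>u. dir2 f u v z)"
  by (rule has_derivative_linear[OF C2_has_derivative2])

text \<open>\<open>Ck_on\<close> speaks only of individual directional derivatives. Linearity in the
  direction taken first holds because \<open>dir1 f v\<close> is linear in \<open>v\<close> on the
  whole open set and its derivative inherits this.\<close>

lemma C2_linear2':
  assumes "z \<in> S" shows "linear (\<lambda>v. dir2 f u v z)"
proof (rule linearI)
  fix v w :: 'a and c :: real
  have "(dir1 f (v + w) has_derivative (\<lambda>u. dir2 f u v z + dir2 f u w z)) (at z)"
    by (rule has_derivative_transform_within_open[OF has_derivative_add[OF C2_has_derivative2 C2_has_derivative2] S])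
      (use assms in \<open>auto simp: linear_add[OF C2_linear1]\<close>)
  from has_derivative_unique[OF C2_has_derivative2[OF assms] this]
  show "dir2 f u (v + w) z = dir2 f u v z + dir2 f u w z" by (rule fun_cong)
  have "(dir1 f (c *\<^sub>R v) has_derivative (\<lambda>u. c *\<^sub>R dir2 f u v z)) (at z)"
    by (rule has_derivative_transform_within_open[OF has_derivative_scaleR_right[OF C2_has_derivative2] S])
      (use assms in \<open>auto simp: linear_cmul[OF C2_linear1]\<close>)
  from has_derivative_unique[OF C2_has_derivative2[OF assms] this]
  show "dir2 f u (c *\<^sub>R v) z = c *\<^sub>R dir2 f u v z" by (rule fun_cong)
qed

lemma C2_line_derivative:
  assumes "z + s *\<^sub>R d \<in> S"
  shows "((\<lambda>s. f (z + s *\<^sub>R d)) has_real_derivative dir1 f d (z + s *\<^sub>R d)) (at s)"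
    "((\<lambda>s. dir1 f v (z + s *\<^sub>R d)) has_real_derivative dir2 f d v (z + s *\<^sub>R d)) (at s)"
proof -
  have l: "((\<lambda>s. z + s *\<^sub>R d) has_derivative (\<lambda>s. s *\<^sub>R d)) (at s)"
    by (auto intro!: derivative_eq_intros)
  have "((\<lambda>s. f (z + s *\<^sub>R d)) has_derivative (\<lambda>r. dir1 f (r *\<^sub>R d) (z + s *\<^sub>R d))) (at s)"
    by (rule has_derivative_compose[OF l C2_has_derivative[OF assms]])
  then show "((\<lambda>s. f (z + s *\<^sub>R d)) has_real_derivative dir1 f d (z + s *\<^sub>R d)) (at s)"
    by (rule has_derivative_imp_has_field_derivative) (simp add: linear_cmul[OF C2_linear1[OF assms]])
  have "((\<lambda>s. dir1 f v (z + s *\<^sub>R d)) has_derivative (\<lambda>r. dir2 f (r *\<^sub>R d) v (z + s *\<^sub>R d))) (at s)"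
    by (rule has_derivative_compose[OF l C2_has_derivative2[OF assms]])
  then show "((\<lambda>s. dir1 f v (z + s *\<^sub>R d)) has_real_derivative dir2 f d v (z + s *\<^sub>R d)) (at s)"
    by (rule has_derivative_imp_has_field_derivative) (simp add: linear_cmul[OF C2_linear2[OF assms]])
qed

lemma C2_taylor:
  assumes "closed_segment z w \<subseteq> S"
  obtains \<xi> where "\<xi> \<in> closed_segment z w" "f w = f z + dir1 f (w - z) z + dir2 f (w - z) (w - z) \<xi> / 2"
proof -
  define d where "d = w - z"
  have seg: "z + s *\<^sub>R d \<in> closed_segment z w" if "0 \<le> s" "s \<le> 1" for s
    using that by (auto simp: closed_segment_def d_def algebra_simps intro!: exI[of _ s])
  define diff where "diff n = (if n = 0 then (\<lambda>s. f (z + s *\<^sub>R d)) else if n = 1 then (\<lambda>s. dir1 f d (z + s *\<^sub>R d)) else (\<lambda>s. dir2 f d d (z + s *\<^sub>R d)))" for n :: nat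
  have "\<exists>t::real>0. t < 1 \<and> f (z + 1 *\<^sub>R d) = (\<Sum>m<2. diff m 0 / fact m * 1 ^ m) + diff 2 t / fact 2 * 1 ^ 2"
  proof (rule Maclaurin)
    show "\<forall>m t. m < 2 \<and> 0 \<le> t \<and> t \<le> 1 \<longrightarrow> (diff m has_real_derivative diff (Suc m) t) (at t)"
    proof (intro allI impI)
      fix m :: nat and t :: real assume a: "m < 2 \<and> 0 \<le> t \<and> t \<le> 1"
      then have "z + t *\<^sub>R d \<in> S" using seg assms by auto
      note C2_line_derivative[OF this]
      moreover have "m = 0 \<or> m = 1" using a by auto
      ultimately show "(diff m has_real_derivative diff (Suc m) t) (at t)"
        by (auto simp: diff_def)
    qed
  qed (auto simp: diff_def)
  then obtain t where t: "0 < t" "t < 1" "f (z + 1 *\<^sub>R d) = (\<Sum>m<2. diff m 0 / fact m * 1 ^ m) + diff 2 t / fact 2 * 1 ^ 2"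
    by blast
  then have "f w = f z + dir1 f d z + dir2 f d d (z + t *\<^sub>R d) / 2"
    by (simp add: diff_def numeral_2_eq_2 d_def)
  then show ?thesis using that[of "z + t *\<^sub>R d"] seg[of t] t by (simp add: d_def)
qed

lemma C2_second_difference:
  assumes "\<And>a b. 0 \<le> a \<Longrightarrow> a \<le> s \<Longrightarrow> 0 \<le> b \<Longrightarrow> b \<le> s \<Longrightarrow> z + a *\<^sub>R u + b *\<^sub>R v \<in> S" "s > 0"
  obtains a b where "0 \<le> a" "a \<le> s" "0 \<le> b" "b \<le> s"
    "f (z + s *\<^sub>R u + s *\<^sub>R v) - f (z + s *\<^sub>R u) - f (z + s *\<^sub>R v) + f z = s\<^sup>2 * dir2 f v u (z + a *\<^sub>R u + b *\<^sub>R v)"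
proof -
  define g where "g a = f ((z + s *\<^sub>R v) + a *\<^sub>R u) - f (z + a *\<^sub>R u)" for a
  have g: "(g has_real_derivative (dir1 f u ((z + s *\<^sub>R v) + a *\<^sub>R u) - dir1 f u (z + a *\<^sub>R u))) (at a)" if "0 \<le> a" "a \<le> s" for a
    unfolding g_def
  proof (intro DERIV_diff C2_line_derivative)
    show "(z + s *\<^sub>R v) + a *\<^sub>R u \<in> S" using assms(1)[of a s] that assms(2) by (simp add: add_ac)
    show "z + a *\<^sub>R u \<in> S" using assms(1)[of a 0] that assms(2) by simp
  qed
  obtain a where a: "0 < a" "a < s" "g s - g 0 = (s - 0) * (dir1 f u ((z + s *\<^sub>R v) + a *\<^sub>R u) - dir1 f u (z + a *\<^sub>R u))"
    using MVT2[of 0 s g "\<lambda>a. dir1 f u ((z + s *\<^sub>R v) + a *\<^sub>R u) - dir1 f u (z + a *\<^sub>R u)"] assms(2) g by auto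
  have k: "((\<lambda>b. dir1 f u ((z + a *\<^sub>R u) + b *\<^sub>R v)) has_real_derivative dir2 f v u ((z + a *\<^sub>R u) + b *\<^sub>R v)) (at b)" if "0 \<le> b" "b \<le> s" for b
    by (rule C2_line_derivative(2)) (use assms(1)[of a b] that a in auto)
  obtain b where b: "0 < b" "b < s" "dir1 f u ((z + a *\<^sub>R u) + s *\<^sub>R v) - dir1 f u ((z + a *\<^sub>R u) + 0 *\<^sub>R v) = (s - 0) * dir2 f v u ((z + a *\<^sub>R u) + b *\<^sub>R v)"
    using MVT2[of 0 s "\<lambda>b. dir1 f u ((z + a *\<^sub>R u) + b *\<^sub>R v)" "\<lambda>b. dir2 f v u ((z + a *\<^sub>R u) + b *\<^sub>R v)"] assms(2) k by auto
  have "f (z + s *\<^sub>R u + s *\<^sub>R v) - f (z + s *\<^sub>R u) - f (z + s *\<^sub>R v) + f z = g s - g 0" by (simp add: g_def add_ac)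
  also have "\<dots> = s * (dir1 f u ((z + a *\<^sub>R u) + s *\<^sub>R v) - dir1 f u ((z + a *\<^sub>R u) + 0 *\<^sub>R v))"
    using a(3) by (simp add: add_ac)
  also have "\<dots> = s\<^sup>2 * dir2 f v u (z + a *\<^sub>R u + b *\<^sub>R v)" unfolding b(3) by (simp add: power2_eq_square)
  finally show ?thesis using a b by (intro that[of a b]) auto
qed

text \<open>Schwarz's theorem: the second difference over a small parallelogram is symmetric in u
  and v, and the mean value theorem, applied in either order, equates it with each mixed derivative
  at nearby points.\<close>

lemma C2_symmetric:
  assumes z: "z \<in> S"
  shows "dir2 f u v z = dir2 f v u z"
proof (rule ccontr)
  assume ne: "dir2 f u v z \<noteq> dir2 f v u z"
  define e where "e = \<bar>dir2 f u v z - dir2 f v u z\<bar> / 2"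
  have e: "e > 0" using ne by (simp add: e_def)
  have "isCont (dir2 f a b) z" for a b
    using C2_continuous[of a b] S z by (simp add: continuous_on_eq_continuous_at)
  then obtain d1 d2 where d: "d1 > 0" "\<And>w. dist w z < d1 \<Longrightarrow> dist (dir2 f u v w) (dir2 f u v z) < e"
    "d2 > 0" "\<And>w. dist w z < d2 \<Longrightarrow> dist (dir2 f v u w) (dir2 f v u z) < e"
    using e unfolding continuous_at_eps_delta by metis
  obtain d3 where d3: "d3 > 0" "ball z d3 \<subseteq> S" using S z open_contains_ball by metis
  define m where "m = min d1 (min d2 d3)"
  have m: "m > 0" using d d3 by (simp add: m_def)
  \<comment> \<open>Small enough that the whole parallelogram stays within distance m of z.\<close>
  define s where "s = m / (2 * (norm u + norm v + 1))"
  have N: "norm u + norm v + 1 > 0" by (intro add_nonneg_pos) auto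
  have s: "s > 0" using m N by (simp add: s_def)
  have near: "dist (z + a *\<^sub>R p + b *\<^sub>R q) z < m" if "0 \<le> a" "a \<le> s" "0 \<le> b" "b \<le> s" "norm p + norm q = norm u + norm v" for a b p q
  proof -
    have "dist (z + a *\<^sub>R p + b *\<^sub>R q) z \<le> a * norm p + b * norm q"
      using norm_triangle_ineq[of "a *\<^sub>R p" "b *\<^sub>R q"] that by (simp add: dist_norm add.assoc)
    also have "\<dots> \<le> s * norm p + s * norm q" using that by (intro add_mono mult_right_mono) auto
    also have "\<dots> = s * (norm u + norm v)" using that(5) by (simp flip: distrib_left)
    also have "\<dots> \<le> s * (norm u + norm v + 1)" using s by simp
    also have "\<dots> = m / 2"
    proof -
      have "m / (2 * k) * k = m / 2" if "k > 0" for k using that by simp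
      from this[OF N] show ?thesis by (simp only: s_def)
    qed
    finally show ?thesis using m by linarith
  qed
  obtain a b where ab: "0 \<le> a" "a \<le> s" "0 \<le> b" "b \<le> s"
    "f (z + s *\<^sub>R u + s *\<^sub>R v) - f (z + s *\<^sub>R u) - f (z + s *\<^sub>R v) + f z = s\<^sup>2 * dir2 f v u (z + a *\<^sub>R u + b *\<^sub>R v)"
  proof (rule C2_second_difference[of s z u v])
    show "z + a *\<^sub>R u + b *\<^sub>R v \<in> S" if "0 \<le> a" "a \<le> s" "0 \<le> b" "b \<le> s" for a b
      using near[of a b u v] that d3 by (auto simp: m_def dist_commute)
  qed (use s in auto)
  obtain a' b' where ab': "0 \<le> a'" "a' \<le> s" "0 \<le> b'" "b' \<le> s"
    "f (z + s *\<^sub>R v + s *\<^sub>R u) - f (z + s *\<^sub>R v) - f (z + s *\<^sub>R u) + f z = s\<^sup>2 * dir2 f u v (z + a' *\<^sub>R v + b' *\<^sub>R u)"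
  proof (rule C2_second_difference[of s z v u])
    show "z + a *\<^sub>R v + b *\<^sub>R u \<in> S" if "0 \<le> a" "a \<le> s" "0 \<le> b" "b \<le> s" for a b
      using near[of a b v u] that d3 by (auto simp: m_def dist_commute)
  qed (use s in auto)
  have "s\<^sup>2 * dir2 f v u (z + a *\<^sub>R u + b *\<^sub>R v) = s\<^sup>2 * dir2 f u v (z + a' *\<^sub>R v + b' *\<^sub>R u)"
    using ab(5) ab'(5) by (simp add: algebra_simps)
  then have "dir2 f v u (z + a *\<^sub>R u + b *\<^sub>R v) = dir2 f u v (z + a' *\<^sub>R v + b' *\<^sub>R u)" using s by simp
  moreover have "dist (dir2 f v u (z + a *\<^sub>R u + b *\<^sub>R v)) (dir2 f v u z) < e"
    using near[of a b u v] ab by (intro d) (auto simp: m_def)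
  moreover have "dist (dir2 f u v (z + a' *\<^sub>R v + b' *\<^sub>R u)) (dir2 f u v z) < e"
    using near[of a' b' v u] ab' by (intro d) (auto simp: m_def)
  ultimately have "dist (dir2 f u v z) (dir2 f v u z) < 2 * e"
    by (metis dist_commute dist_triangle_half_l mult_2 field_sum_of_halves mult.commute nonzero_mult_div_cancel_left zero_neq_numeral)
  then show False by (simp add: e_def dist_real_def)
qed

end

section \<open>Parabolic expansion in space-time coordinates\<close>

abbreviation X1 :: "(real^2) \<times> real" where "X1 \<equiv> (axis 1 1, 0)"
abbreviation X2 :: "(real^2) \<times> real" where "X2 \<equiv> (axis 2 1, 0)"
abbreviation X3 :: "(real^2) \<times> real" where "X3 \<equiv> (0, 1)"

lemma vec2_decomp: "(v :: real^2) = v $ 1 *\<^sub>R axis 1 1 + v $ 2 *\<^sub>R axis 2 1"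
  by (simp add: vec_eq_iff forall_2 axis_def)

lemma space_time_decomp: "(v, \<sigma>) = v $ 1 *\<^sub>R X1 + v $ 2 *\<^sub>R X2 + \<sigma> *\<^sub>R X3"
  using vec2_decomp[of v] by simp

lemma linear_space_time:
  assumes "linear (L :: (real^2) \<times> real \<Rightarrow> real)"
  shows "L (v, \<sigma>) = v $ 1 * L X1 + v $ 2 * L X2 + \<sigma> * L X3"
  unfolding space_time_decomp[of v \<sigma>] by (simp only: linear_add[OF assms] linear_cmul[OF assms] real_scaleR_def)

definition sgrad :: "((real^2) \<times> real \<Rightarrow> real) \<Rightarrow> (real^2) \<times> real \<Rightarrow> real^2" where
  "sgrad \<phi> z = dir1 \<phi> X1 z *\<^sub>R axis 1 1 + dir1 \<phi> X2 z *\<^sub>R axis 2 1"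

lemma sgrad_nth [simp]: "sgrad \<phi> z $ 1 = dir1 \<phi> X1 z" "sgrad \<phi> z $ 2 = dir1 \<phi> X2 z"
  by (simp_all add: sgrad_def axis_def)

lemma inner_sgrad: "sgrad \<phi> z \<bullet> v = v $ 1 * dir1 \<phi> X1 z + v $ 2 * dir1 \<phi> X2 z"
  by (simp add: inner_vec_def sum_2 mult.commute)

lemma open_space_time: "open space_time"
  unfolding space_time_def by (intro open_Times) auto

lemma space_time_iff: "(x, t) \<in> space_time \<longleftrightarrow> t > 0"
  by (simp add: space_time_def)

lemma quad_perturbation:
  fixes v :: "real^2"
  assumes "\<bar>h1 - k1\<bar> \<le> e" "\<bar>h2 - k2\<bar> \<le> e" "\<bar>h3 - k3\<bar> \<le> e"
  shows "\<bar>quad h1 h2 h3 (v $ 1) (v $ 2) / 2 - quad k1 k2 k3 (v $ 1) (v $ 2) / 2\<bar> \<le> e * (norm v)\<^sup>2"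
proof -
  let ?x = "v $ 1" and ?y = "v $ 2"
  have e: "e \<ge> 0" using assms(1) by linarith
  have "quad h1 h2 h3 ?x ?y - quad k1 k2 k3 ?x ?y = (h1 - k1) * ?x\<^sup>2 + (h2 - k2) * (?x * ?y) + (h3 - k3) * ?y\<^sup>2"
    by (simp add: algebra_simps)
  also have "\<bar>\<dots>\<bar> \<le> \<bar>(h1 - k1) * ?x\<^sup>2\<bar> + \<bar>(h2 - k2) * (?x * ?y)\<bar> + \<bar>(h3 - k3) * ?y\<^sup>2\<bar>"
    by (intro order_trans[OF abs_triangle_ineq] add_mono abs_triangle_ineq order_refl)
  also have "\<dots> \<le> e * ?x\<^sup>2 + e * \<bar>?x * ?y\<bar> + e * ?y\<^sup>2"
    unfolding abs_mult using assms by (intro add_mono mult_mono) auto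
  also have "\<dots> = e * (?x\<^sup>2 + \<bar>?x * ?y\<bar> + ?y\<^sup>2)" by (simp add: algebra_simps)
  also have "\<dots> \<le> e * (2 * (?x\<^sup>2 + ?y\<^sup>2))"
  proof (rule mult_left_mono[OF _ e])
    have "2 * \<bar>?x\<bar> * \<bar>?y\<bar> \<le> ?x\<^sup>2 + ?y\<^sup>2" using sum_squares_bound[of "\<bar>?x\<bar>" "\<bar>?y\<bar>"] by simp
    then have "2 * \<bar>?x * ?y\<bar> \<le> ?x\<^sup>2 + ?y\<^sup>2" by (simp add: abs_mult)
    moreover have "X + Z + Y \<le> 2 * (X + Y)" if "2 * Z \<le> X + Y" "0 \<le> X" "0 \<le> Y" for X Y Z :: real
      using that unfolding distrib_left by linarith
    ultimately show "?x\<^sup>2 + \<bar>?x * ?y\<bar> + ?y\<^sup>2 \<le> 2 * (?x\<^sup>2 + ?y\<^sup>2)" by simp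
  qed
  also have "?x\<^sup>2 + ?y\<^sup>2 = (norm v)\<^sup>2"
    by (simp only: power2_norm_eq_inner inner_vec_def sum_2) (simp add: power2_eq_square)
  finally have "\<bar>quad h1 h2 h3 ?x ?y - quad k1 k2 k3 ?x ?y\<bar> \<le> 2 * (e * (norm v)\<^sup>2)" by simp
  moreover have "p / 2 \<le> q" if "p \<le> 2 * q" for p q :: real using that by simp
  ultimately have "\<bar>quad h1 h2 h3 ?x ?y - quad k1 k2 k3 ?x ?y\<bar> / 2 \<le> e * (norm v)\<^sup>2" by blast
  moreover have "\<bar>p / 2 - q / 2\<bar> = \<bar>p - q\<bar> / 2" for p q :: real by (simp flip: diff_divide_distrib)
  ultimately show ?thesis by (simp only:)
qed

context
  fixes \<phi> :: "(real^2) \<times> real \<Rightarrow> real"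
  assumes C2: "Ck_on 2 space_time \<phi>"
begin

lemmas C2_d1 = C2_has_derivative[OF C2 open_space_time]
lemmas C2_d2 = C2_has_derivative2[OF C2 open_space_time]

lemma dir1_expand:
  assumes "z \<in> space_time"
  shows "dir1 \<phi> (v, \<sigma>) z = sgrad \<phi> z \<bullet> v + \<sigma> * dir1 \<phi> X3 z"
  by (subst linear_space_time[OF C2_linear1[OF C2 open_space_time assms]]) (simp add: inner_sgrad)

lemma dir2_expand:
  assumes "z \<in> space_time"
  shows "dir2 \<phi> (v, \<sigma>) (v, \<sigma>) z = dir2 \<phi> X1 X1 z * (v $ 1)\<^sup>2 + (dir2 \<phi> X1 X2 z + dir2 \<phi> X2 X1 z) * (v $ 1) * (v $ 2) + dir2 \<phi> X2 X2 z * (v $ 2)\<^sup>2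
    + \<sigma> * ((v $ 1) * (dir2 \<phi> X1 X3 z + dir2 \<phi> X3 X1 z) + (v $ 2) * (dir2 \<phi> X2 X3 z + dir2 \<phi> X3 X2 z)) + \<sigma>\<^sup>2 * dir2 \<phi> X3 X3 z"
proof -
  have l: "dir2 \<phi> (v, \<sigma>) w z = v $ 1 * dir2 \<phi> X1 w z + v $ 2 * dir2 \<phi> X2 w z + \<sigma> * dir2 \<phi> X3 w z" for w
    by (rule linear_space_time[OF C2_linear2[OF C2 open_space_time assms]])
  have r: "dir2 \<phi> u (v, \<sigma>) z = v $ 1 * dir2 \<phi> u X1 z + v $ 2 * dir2 \<phi> u X2 z + \<sigma> * dir2 \<phi> u X3 z" for u
    by (rule linear_space_time[OF C2_linear2'[OF C2 open_space_time assms]])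
  show ?thesis unfolding l r by (simp add: power2_eq_square algebra_simps)
qed

lemma isCont_dir2: "z \<in> space_time \<Longrightarrow> isCont (dir2 \<phi> u v) z"
  using C2_continuous[OF C2 open_space_time, of u v] open_space_time by (simp add: continuous_on_eq_continuous_at)

lemma isCont_dir1: "z \<in> space_time \<Longrightarrow> isCont (dir1 \<phi> v) z"
  using C2_continuous1[OF C2 open_space_time, of v] open_space_time by (simp add: continuous_on_eq_continuous_at)

text \<open>Second derivatives in space enter the limit and are controlled to within e. Those
  involving time are only bounded by M, since they multiply s - t and a further small increment and
  are thus of higher order in parabolic scaling. Both expansions below are drawn from this
  statement.\<close>

lemma C2_expansion:
  assumes z0: "z0 \<in> space_time"
  obtains M where "M > 0" "\<And>e. e > 0 \<Longrightarrow> \<exists>r>0. \<forall>x t y s. dist (x, t) z0 < r \<longrightarrow> dist (y, s) z0 < r \<longrightarrow>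
    (\<exists>h1 h2 h3 n1 n2 n3. \<bar>h1 - dir2 \<phi> X1 X1 z0\<bar> \<le> e \<and> \<bar>h2 - (dir2 \<phi> X1 X2 z0 + dir2 \<phi> X2 X1 z0)\<bar> \<le> e \<and> \<bar>h3 - dir2 \<phi> X2 X2 z0\<bar> \<le> e \<and>
       \<bar>n1\<bar> \<le> M \<and> \<bar>n2\<bar> \<le> M \<and> \<bar>n3\<bar> \<le> M \<and> \<bar>dir1 \<phi> X3 (x, t) - dir1 \<phi> X3 z0\<bar> \<le> e \<and>
       \<phi> (y, s) = \<phi> (x, t) + sgrad \<phi> (x, t) \<bullet> (y - x) + (s - t) * dir1 \<phi> X3 (x, t) + quad h1 h2 h3 ((y - x) $ 1) ((y - x) $ 2) / 2
         + (s - t) * ((y - x) $ 1 * n1 + (y - x) $ 2 * n2) / 2 + (s - t)\<^sup>2 * n3 / 2)"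
proof -
  define N1 where "N1 z = dir2 \<phi> X1 X3 z + dir2 \<phi> X3 X1 z" for z
  define N2 where "N2 z = dir2 \<phi> X2 X3 z + dir2 \<phi> X3 X2 z" for z
  define N3 where "N3 = dir2 \<phi> X3 X3"
  define H1 where "H1 = dir2 \<phi> X1 X1"
  define H2 where "H2 z = dir2 \<phi> X1 X2 z + dir2 \<phi> X2 X1 z" for z
  define H3 where "H3 = dir2 \<phi> X2 X2"
  define D3 where "D3 = dir1 \<phi> X3"
  define M where "M = \<bar>N1 z0\<bar> + \<bar>N2 z0\<bar> + \<bar>N3 z0\<bar> + 1"
  have cont: "isCont N1 z0" "isCont N2 z0" "isCont N3 z0" "isCont H1 z0" "isCont H2 z0" "isCont H3 z0" "isCont D3 z0"
    unfolding N1_def N2_def N3_def H1_def H2_def H3_def D3_def by (intro continuous_intros isCont_dir2 isCont_dir1 z0)+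
  show ?thesis
  proof (rule that[of M])
    show "M > 0" by (simp add: M_def add_nonneg_pos)
    fix e :: real assume e: "e > 0"
    have ev: "\<forall>\<^sub>F w in nhds z0. \<bar>g w - g z0\<bar> < d" if "isCont g z0" "d > 0" for g :: "(real^2) \<times> real \<Rightarrow> real" and d
      using that(1)[unfolded isCont_def tendsto_at_iff_tendsto_nhds, THEN tendstoD, OF that(2)] by (simp add: dist_real_def)
    have "\<forall>\<^sub>F w in nhds z0. w \<in> space_time" using open_space_time z0 by (rule eventually_nhds_in_open)
    moreover note ev[OF cont(1) zero_less_one] ev[OF cont(2) zero_less_one] ev[OF cont(3) zero_less_one]
      ev[OF cont(4) e] ev[OF cont(5) e] ev[OF cont(6) e] ev[OF cont(7) e]
    ultimately have "\<forall>\<^sub>F w in nhds z0. w \<in> space_time \<and> \<bar>N1 w - N1 z0\<bar> < 1 \<and> \<bar>N2 w - N2 z0\<bar> < 1 \<and> \<bar>N3 w - N3 z0\<bar> < 1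
      \<and> \<bar>H1 w - H1 z0\<bar> < e \<and> \<bar>H2 w - H2 z0\<bar> < e \<and> \<bar>H3 w - H3 z0\<bar> < e \<and> \<bar>D3 w - D3 z0\<bar> < e"
      by eventually_elim simp
    then obtain r where r: "r > 0" "\<And>w. dist w z0 < r \<Longrightarrow> w \<in> space_time \<and> \<bar>N1 w - N1 z0\<bar> < 1 \<and> \<bar>N2 w - N2 z0\<bar> < 1 \<and> \<bar>N3 w - N3 z0\<bar> < 1
      \<and> \<bar>H1 w - H1 z0\<bar> < e \<and> \<bar>H2 w - H2 z0\<bar> < e \<and> \<bar>H3 w - H3 z0\<bar> < e \<and> \<bar>D3 w - D3 z0\<bar> < e"
      unfolding eventually_nhds_metric by metis
    show "\<exists>r>0. \<forall>x t y s. dist (x, t) z0 < r \<longrightarrow> dist (y, s) z0 < r \<longrightarrow>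
    (\<exists>h1 h2 h3 n1 n2 n3. \<bar>h1 - dir2 \<phi> X1 X1 z0\<bar> \<le> e \<and> \<bar>h2 - (dir2 \<phi> X1 X2 z0 + dir2 \<phi> X2 X1 z0)\<bar> \<le> e \<and> \<bar>h3 - dir2 \<phi> X2 X2 z0\<bar> \<le> e \<and>
       \<bar>n1\<bar> \<le> M \<and> \<bar>n2\<bar> \<le> M \<and> \<bar>n3\<bar> \<le> M \<and> \<bar>dir1 \<phi> X3 (x, t) - dir1 \<phi> X3 z0\<bar> \<le> e \<and>
       \<phi> (y, s) = \<phi> (x, t) + sgrad \<phi> (x, t) \<bullet> (y - x) + (s - t) * dir1 \<phi> X3 (x, t) + quad h1 h2 h3 ((y - x) $ 1) ((y - x) $ 2) / 2
         + (s - t) * ((y - x) $ 1 * n1 + (y - x) $ 2 * n2) / 2 + (s - t)\<^sup>2 * n3 / 2)"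
    proof (rule exI[of _ r], rule conjI, rule r(1), intro allI impI)
      fix x t y s assume a: "dist (x, t) z0 < r" "dist (y, s) z0 < r"
      have seg: "closed_segment (x, t) (y, s) \<subseteq> ball z0 r"
        using a by (intro closed_segment_subset convex_ball) (auto simp: dist_commute)
      then have "closed_segment (x, t) (y, s) \<subseteq> space_time" using r(2) by (auto simp: dist_commute)
      then obtain \<xi> where \<xi>: "\<xi> \<in> closed_segment (x, t) (y, s)"
        "\<phi> (y, s) = \<phi> (x, t) + dir1 \<phi> ((y, s) - (x, t)) (x, t) + dir2 \<phi> ((y, s) - (x, t)) ((y, s) - (x, t)) \<xi> / 2"
        by (rule C2_taylor[OF C2 open_space_time])
      have d: "dist \<xi> z0 < r" using seg \<xi>(1) by (auto simp: dist_commute)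
      note b = r(2)[OF d] and b' = r(2)[OF a(1)]
      have eq: "\<phi> (y, s) = \<phi> (x, t) + sgrad \<phi> (x, t) \<bullet> (y - x) + (s - t) * dir1 \<phi> X3 (x, t) + quad (H1 \<xi>) (H2 \<xi>) (H3 \<xi>) ((y - x) $ 1) ((y - x) $ 2) / 2
         + (s - t) * ((y - x) $ 1 * N1 \<xi> + (y - x) $ 2 * N2 \<xi>) / 2 + (s - t)\<^sup>2 * N3 \<xi> / 2"
      proof -
        have 1: "dir1 \<phi> (y - x, s - t) (x, t) = sgrad \<phi> (x, t) \<bullet> (y - x) + (s - t) * dir1 \<phi> X3 (x, t)"
          by (rule dir1_expand) (use b' in blast)
        have 2: "dir2 \<phi> (y - x, s - t) (y - x, s - t) \<xi> = quad (H1 \<xi>) (H2 \<xi>) (H3 \<xi>) ((y - x) $ 1) ((y - x) $ 2)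
          + (s - t) * ((y - x) $ 1 * N1 \<xi> + (y - x) $ 2 * N2 \<xi>) + (s - t)\<^sup>2 * N3 \<xi>"
          unfolding H1_def H2_def H3_def N1_def N2_def N3_def by (rule dir2_expand) (use b in blast)
        show ?thesis unfolding \<xi>(2) diff_Pair 1 2 by (simp only: add_divide_distrib add.assoc)
      qed
      show "\<exists>h1 h2 h3 n1 n2 n3. \<bar>h1 - dir2 \<phi> X1 X1 z0\<bar> \<le> e \<and> \<bar>h2 - (dir2 \<phi> X1 X2 z0 + dir2 \<phi> X2 X1 z0)\<bar> \<le> e \<and> \<bar>h3 - dir2 \<phi> X2 X2 z0\<bar> \<le> e \<and>
       \<bar>n1\<bar> \<le> M \<and> \<bar>n2\<bar> \<le> M \<and> \<bar>n3\<bar> \<le> M \<and> \<bar>dir1 \<phi> X3 (x, t) - dir1 \<phi> X3 z0\<bar> \<le> e \<and>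
       \<phi> (y, s) = \<phi> (x, t) + sgrad \<phi> (x, t) \<bullet> (y - x) + (s - t) * dir1 \<phi> X3 (x, t) + quad h1 h2 h3 ((y - x) $ 1) ((y - x) $ 2) / 2
         + (s - t) * ((y - x) $ 1 * n1 + (y - x) $ 2 * n2) / 2 + (s - t)\<^sup>2 * n3 / 2"
      proof (rule exI[of _ "H1 \<xi>"], rule exI[of _ "H2 \<xi>"], rule exI[of _ "H3 \<xi>"], rule exI[of _ "N1 \<xi>"], rule exI[of _ "N2 \<xi>"], rule exI[of _ "N3 \<xi>"], intro conjI)
        have n: "\<bar>N1 \<xi> - N1 z0\<bar> < 1" "\<bar>N2 \<xi> - N2 z0\<bar> < 1" "\<bar>N3 \<xi> - N3 z0\<bar> < 1" using b by blast+
        have g: "\<bar>p\<bar> \<le> \<bar>q\<bar> + 1" if "\<bar>p - q\<bar> < 1" for p q :: real using that by linarith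
        show "\<bar>N1 \<xi>\<bar> \<le> M" by (rule order_trans[OF g[OF n(1)]]) (simp add: M_def)
        show "\<bar>N2 \<xi>\<bar> \<le> M" by (rule order_trans[OF g[OF n(2)]]) (simp add: M_def)
        show "\<bar>N3 \<xi>\<bar> \<le> M" by (rule order_trans[OF g[OF n(3)]]) (simp add: M_def)
        show "\<bar>H1 \<xi> - dir2 \<phi> X1 X1 z0\<bar> \<le> e" using b unfolding H1_def by (blast intro: less_imp_le)
        show "\<bar>H2 \<xi> - (dir2 \<phi> X1 X2 z0 + dir2 \<phi> X2 X1 z0)\<bar> \<le> e" using b unfolding H2_def by (blast intro: less_imp_le)
        show "\<bar>H3 \<xi> - dir2 \<phi> X2 X2 z0\<bar> \<le> e" using b unfolding H3_def by (blast intro: less_imp_le)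
        show "\<bar>dir1 \<phi> X3 (x, t) - dir1 \<phi> X3 z0\<bar> \<le> e" using b' unfolding D3_def by (blast intro: less_imp_le)
      qed (rule eq)
    qed
  qed
qed

lemma second_order_at_C2:
  assumes z0: "z0 \<in> space_time"
  shows "second_order_at \<phi> (sgrad \<phi>) (dir1 \<phi> X3 z0) (dir2 \<phi> X1 X1 z0 / 2) ((dir2 \<phi> X1 X2 z0 + dir2 \<phi> X2 X1 z0) / 2) (dir2 \<phi> X2 X2 z0 / 2) z0"
  unfolding second_order_at_def
proof (intro conjI allI impI)
  show "isCont (sgrad \<phi>) z0" unfolding sgrad_def[abs_def] by (intro continuous_intros isCont_dir1 z0)
  fix \<epsilon> :: real assume \<epsilon>: "\<epsilon> > 0"
  obtain M where M: "M > 0" and ex: "\<And>e. e > 0 \<Longrightarrow> \<exists>r>0. \<forall>x t y s. dist (x, t) z0 < r \<longrightarrow> dist (y, s) z0 < r \<longrightarrow>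
    (\<exists>h1 h2 h3 n1 n2 n3. \<bar>h1 - dir2 \<phi> X1 X1 z0\<bar> \<le> e \<and> \<bar>h2 - (dir2 \<phi> X1 X2 z0 + dir2 \<phi> X2 X1 z0)\<bar> \<le> e \<and> \<bar>h3 - dir2 \<phi> X2 X2 z0\<bar> \<le> e \<and>
       \<bar>n1\<bar> \<le> M \<and> \<bar>n2\<bar> \<le> M \<and> \<bar>n3\<bar> \<le> M \<and> \<bar>dir1 \<phi> X3 (x, t) - dir1 \<phi> X3 z0\<bar> \<le> e \<and>
       \<phi> (y, s) = \<phi> (x, t) + sgrad \<phi> (x, t) \<bullet> (y - x) + (s - t) * dir1 \<phi> X3 (x, t) + quad h1 h2 h3 ((y - x) $ 1) ((y - x) $ 2) / 2
         + (s - t) * ((y - x) $ 1 * n1 + (y - x) $ 2 * n2) / 2 + (s - t)\<^sup>2 * n3 / 2)"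
    using C2_expansion[OF z0] by blast
  obtain r where r: "r > 0" "\<forall>x t y s. dist (x, t) z0 < r \<longrightarrow> dist (y, s) z0 < r \<longrightarrow>
    (\<exists>h1 h2 h3 n1 n2 n3. \<bar>h1 - dir2 \<phi> X1 X1 z0\<bar> \<le> \<epsilon> / 2 \<and> \<bar>h2 - (dir2 \<phi> X1 X2 z0 + dir2 \<phi> X2 X1 z0)\<bar> \<le> \<epsilon> / 2 \<and> \<bar>h3 - dir2 \<phi> X2 X2 z0\<bar> \<le> \<epsilon> / 2 \<and>
       \<bar>n1\<bar> \<le> M \<and> \<bar>n2\<bar> \<le> M \<and> \<bar>n3\<bar> \<le> M \<and> \<bar>dir1 \<phi> X3 (x, t) - dir1 \<phi> X3 z0\<bar> \<le> \<epsilon> / 2 \<and>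
       \<phi> (y, s) = \<phi> (x, t) + sgrad \<phi> (x, t) \<bullet> (y - x) + (s - t) * dir1 \<phi> X3 (x, t) + quad h1 h2 h3 ((y - x) $ 1) ((y - x) $ 2) / 2
         + (s - t) * ((y - x) $ 1 * n1 + (y - x) $ 2 * n2) / 2 + (s - t)\<^sup>2 * n3 / 2)"
    using ex[OF half_gt_zero[OF \<epsilon>]] by (elim exE conjE)
  \<comment> \<open>Increments are at most 2 \<rho>, so the three terms involving a time derivative
    of second order contribute at most 3 \<rho> M |s - t|.\<close>
  define \<rho> where "\<rho> = min r (\<epsilon> / (6 * M))"
  have \<rho>: "\<rho> > 0" "\<rho> \<le> r" "\<rho> \<le> \<epsilon> / (6 * M)" using r(1) \<epsilon> M by (simp_all add: \<rho>_def)
  have "\<rho> * (6 * M) \<le> \<epsilon>" using \<rho>(3) M by (subst (asm) pos_le_divide_eq) auto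
  then have \<rho>M: "3 * \<rho> * M \<le> \<epsilon> / 2" by linarith
  show "\<exists>r>0. \<forall>x t y s. dist (x, t) z0 < r \<and> dist (y, s) z0 < r \<longrightarrow>
     \<bar>\<phi> (y, s) - \<phi> (x, t) - sgrad \<phi> (x, t) \<bullet> (y - x) - dir1 \<phi> X3 z0 * (s - t) - quad (dir2 \<phi> X1 X1 z0 / 2) ((dir2 \<phi> X1 X2 z0 + dir2 \<phi> X2 X1 z0) / 2) (dir2 \<phi> X2 X2 z0 / 2) ((y - x) $ 1) ((y - x) $ 2)\<bar> \<le> \<epsilon> * (\<bar>s - t\<bar> + (norm (y - x))\<^sup>2)"
  proof (rule exI[of _ \<rho>], rule conjI, rule \<rho>(1), intro allI impI)
    fix x t y s assume a: "dist (x, t) z0 < \<rho> \<and> dist (y, s) z0 < \<rho>"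
    let ?v = "y - x"
    let ?K = "quad (dir2 \<phi> X1 X1 z0) (dir2 \<phi> X1 X2 z0 + dir2 \<phi> X2 X1 z0) (dir2 \<phi> X2 X2 z0) (?v $ 1) (?v $ 2) / 2"
    have dr: "dist (x, t) z0 < r" "dist (y, s) z0 < r" using a \<rho>(2) by auto
    from r(2)[rule_format, OF dr] obtain h1 h2 h3 n1 n2 n3 where h: "\<bar>h1 - dir2 \<phi> X1 X1 z0\<bar> \<le> \<epsilon> / 2" "\<bar>h2 - (dir2 \<phi> X1 X2 z0 + dir2 \<phi> X2 X1 z0)\<bar> \<le> \<epsilon> / 2" "\<bar>h3 - dir2 \<phi> X2 X2 z0\<bar> \<le> \<epsilon> / 2"
      and n: "\<bar>n1\<bar> \<le> M" "\<bar>n2\<bar> \<le> M" "\<bar>n3\<bar> \<le> M" and D: "\<bar>dir1 \<phi> X3 (x, t) - dir1 \<phi> X3 z0\<bar> \<le> \<epsilon> / 2"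
      and eq: "\<phi> (y, s) = \<phi> (x, t) + sgrad \<phi> (x, t) \<bullet> ?v + (s - t) * dir1 \<phi> X3 (x, t) + quad h1 h2 h3 (?v $ 1) (?v $ 2) / 2
         + (s - t) * (?v $ 1 * n1 + ?v $ 2 * n2) / 2 + (s - t)\<^sup>2 * n3 / 2"
      by (elim exE conjE) (rule that; assumption)
    have "dist (y, s) (x, t) \<le> dist (y, s) z0 + dist (x, t) z0" by (rule dist_triangle2)
    then have ds: "dist (y, s) (x, t) < 2 * \<rho>" using a by linarith
    have nv: "norm ?v \<le> 2 * \<rho>" "\<bar>s - t\<bar> \<le> 2 * \<rho>"
      using dist_fst_le[of "(y, s)" "(x, t)"] dist_snd_le[of "(y, s)" "(x, t)"] ds by (auto simp: dist_norm)
    have c: "\<bar>?v $ 1\<bar> \<le> 2 * \<rho>" "\<bar>?v $ 2\<bar> \<le> 2 * \<rho>"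
      using component_le_norm_cart[of ?v 1] component_le_norm_cart[of ?v 2] nv(1) by linarith+
    define A where "A = (s - t) * (dir1 \<phi> X3 (x, t) - dir1 \<phi> X3 z0)"
    define B where "B = quad h1 h2 h3 (?v $ 1) (?v $ 2) / 2 - ?K"
    define E where "E = ((?v $ 1 * n1 + ?v $ 2 * n2) + (s - t) * n3) / 2"
    have "\<bar>A\<bar> \<le> \<bar>s - t\<bar> * (\<epsilon> / 2)" unfolding A_def abs_mult by (intro mult_left_mono D) auto
    moreover have "\<bar>B\<bar> \<le> \<epsilon> / 2 * (norm ?v)\<^sup>2" unfolding B_def by (rule quad_perturbation[OF h])
    moreover have "\<bar>(s - t) * E\<bar> \<le> \<bar>s - t\<bar> * (\<epsilon> / 2)" unfolding abs_mult
    proof (rule mult_left_mono)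
      have k: "\<bar>a * b\<bar> \<le> 2 * (\<rho> * M)" if "\<bar>a\<bar> \<le> 2 * \<rho>" "\<bar>b\<bar> \<le> M" for a b
        using mult_mono[OF that] \<rho>(1) by (simp add: abs_mult)
      have gen: "\<bar>(a + b + c) / 2\<bar> \<le> 3 * k" if "\<bar>a\<bar> \<le> 2 * k" "\<bar>b\<bar> \<le> 2 * k" "\<bar>c\<bar> \<le> 2 * k" for a b c k :: real
        using that unfolding add_divide_distrib by linarith
      have "\<bar>E\<bar> \<le> 3 * (\<rho> * M)" unfolding E_def by (rule gen[OF k[OF c(1) n(1)] k[OF c(2) n(2)] k[OF nv(2) n(3)]])
      then have "\<bar>E\<bar> \<le> 3 * \<rho> * M" by simp
      then show "\<bar>E\<bar> \<le> \<epsilon> / 2" using \<rho>M by linarith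
    qed simp
    moreover have "\<bar>p + q + w\<bar> \<le> a + b + c" if "\<bar>p\<bar> \<le> a" "\<bar>q\<bar> \<le> b" "\<bar>w\<bar> \<le> c" for p q w a b c :: real using that by linarith
    ultimately have "\<bar>A + B + (s - t) * E\<bar> \<le> \<bar>s - t\<bar> * (\<epsilon> / 2) + \<epsilon> / 2 * (norm ?v)\<^sup>2 + \<bar>s - t\<bar> * (\<epsilon> / 2)" by blast
    also have "\<dots> \<le> \<epsilon> * (\<bar>s - t\<bar> + (norm ?v)\<^sup>2)" using \<epsilon> by (simp add: algebra_simps)
    also have "A + B + (s - t) * E = \<phi> (y, s) - \<phi> (x, t) - sgrad \<phi> (x, t) \<bullet> ?v - dir1 \<phi> X3 z0 * (s - t) - ?K"
    proof -
      have "\<sigma> * (D - D0) + (Q - K) + \<sigma> * ((N + \<sigma> * n) / 2) = (F + S + \<sigma> * D + Q + \<sigma> * N / 2 + \<sigma>\<^sup>2 * n / 2) - F - S - D0 * \<sigma> - K"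
        for \<sigma> D D0 Q K N n F S :: real by (simp add: field_simps power2_eq_square)
      then show ?thesis unfolding A_def B_def E_def eq by blast
    qed
    also have "?K = quad (dir2 \<phi> X1 X1 z0 / 2) ((dir2 \<phi> X1 X2 z0 + dir2 \<phi> X2 X1 z0) / 2) (dir2 \<phi> X2 X2 z0 / 2) (?v $ 1) (?v $ 2)"
      by (simp add: add_divide_distrib del: vector_minus_component)
    finally show "\<bar>\<phi> (y, s) - \<phi> (x, t) - sgrad \<phi> (x, t) \<bullet> (y - x) - dir1 \<phi> X3 z0 * (s - t) - quad (dir2 \<phi> X1 X1 z0 / 2) ((dir2 \<phi> X1 X2 z0 + dir2 \<phi> X2 X1 z0) / 2) (dir2 \<phi> X2 X2 z0 / 2) ((y - x) $ 1) ((y - x) $ 2)\<bar> \<le> \<epsilon> * (\<bar>s - t\<bar> + (norm (y - x))\<^sup>2)" .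
  qed
qed

text \<open>At a degenerate point the doubling needs a bound separated into space and time. The
  mixed term is split by Young's inequality, at the price of a small quadratic term in space and a
  large one in time.\<close>

lemma quadratic_upper_bound_C2:
  fixes x0 :: "real^2"
  assumes z0: "(x0, t0) \<in> space_time" and e: "e > 0"
  obtains r M where "r > 0" "M > 0" "\<And>y s. dist (y, s) (x0, t0) < r \<Longrightarrow> \<phi> (y, s) \<le> \<phi> (x0, t0) + sgrad \<phi> (x0, t0) \<bullet> (y - x0) + (s - t0) * dir1 \<phi> X3 (x0, t0)
     + quad (dir2 \<phi> X1 X1 (x0, t0)) (dir2 \<phi> X1 X2 (x0, t0) + dir2 \<phi> X2 X1 (x0, t0)) (dir2 \<phi> X2 X2 (x0, t0)) ((y - x0) $ 1) ((y - x0) $ 2) / 2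
     + e * (norm (y - x0))\<^sup>2 + M * (s - t0)\<^sup>2"
proof -
  let ?z = "(x0, t0)"
  let ?k1 = "dir2 \<phi> X1 X1 ?z" and ?k2 = "dir2 \<phi> X1 X2 ?z + dir2 \<phi> X2 X1 ?z" and ?k3 = "dir2 \<phi> X2 X2 ?z"
  obtain M where M: "M > 0" and ex: "\<And>e. e > 0 \<Longrightarrow> \<exists>r>0. \<forall>x t y s. dist (x, t) ?z < r \<longrightarrow> dist (y, s) ?z < r \<longrightarrow>
    (\<exists>h1 h2 h3 n1 n2 n3. \<bar>h1 - ?k1\<bar> \<le> e \<and> \<bar>h2 - ?k2\<bar> \<le> e \<and> \<bar>h3 - ?k3\<bar> \<le> e \<and>
       \<bar>n1\<bar> \<le> M \<and> \<bar>n2\<bar> \<le> M \<and> \<bar>n3\<bar> \<le> M \<and> \<bar>dir1 \<phi> X3 (x, t) - dir1 \<phi> X3 ?z\<bar> \<le> e \<and>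
       \<phi> (y, s) = \<phi> (x, t) + sgrad \<phi> (x, t) \<bullet> (y - x) + (s - t) * dir1 \<phi> X3 (x, t) + quad h1 h2 h3 ((y - x) $ 1) ((y - x) $ 2) / 2
         + (s - t) * ((y - x) $ 1 * n1 + (y - x) $ 2 * n2) / 2 + (s - t)\<^sup>2 * n3 / 2)"
    using C2_expansion[OF z0] by blast
  from ex[OF half_gt_zero[OF e]] obtain r where r: "r > 0" "\<forall>x t y s. dist (x, t) ?z < r \<longrightarrow> dist (y, s) ?z < r \<longrightarrow>
    (\<exists>h1 h2 h3 n1 n2 n3. \<bar>h1 - ?k1\<bar> \<le> e / 2 \<and> \<bar>h2 - ?k2\<bar> \<le> e / 2 \<and> \<bar>h3 - ?k3\<bar> \<le> e / 2 \<and>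
       \<bar>n1\<bar> \<le> M \<and> \<bar>n2\<bar> \<le> M \<and> \<bar>n3\<bar> \<le> M \<and> \<bar>dir1 \<phi> X3 (x, t) - dir1 \<phi> X3 ?z\<bar> \<le> e / 2 \<and>
       \<phi> (y, s) = \<phi> (x, t) + sgrad \<phi> (x, t) \<bullet> (y - x) + (s - t) * dir1 \<phi> X3 (x, t) + quad h1 h2 h3 ((y - x) $ 1) ((y - x) $ 2) / 2
         + (s - t) * ((y - x) $ 1 * n1 + (y - x) $ 2 * n2) / 2 + (s - t)\<^sup>2 * n3 / 2)"
    by (elim exE conjE)
  \<comment> \<open>The first summand is the cost of Young's inequality for the mixed term, the
    second bounds the pure time derivative.\<close>
  define M' where "M' = M\<^sup>2 / (2 * e) + M / 2"
  have M': "M' > 0" using M e by (simp add: M'_def add_pos_pos)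
  show ?thesis
  proof (rule that[OF r(1) M'])
    fix y s assume a: "dist (y, s) ?z < r"
    let ?v = "y - x0" and ?\<sigma> = "s - t0"
    have dr: "dist ?z ?z < r" using r(1) by simp
    from r(2)[rule_format, OF dr a] obtain h1 h2 h3 n1 n2 n3 where h: "\<bar>h1 - ?k1\<bar> \<le> e / 2" "\<bar>h2 - ?k2\<bar> \<le> e / 2" "\<bar>h3 - ?k3\<bar> \<le> e / 2"
      and n: "\<bar>n1\<bar> \<le> M" "\<bar>n2\<bar> \<le> M" "\<bar>n3\<bar> \<le> M"
      and eq: "\<phi> (y, s) = \<phi> ?z + sgrad \<phi> ?z \<bullet> ?v + ?\<sigma> * dir1 \<phi> X3 ?z + quad h1 h2 h3 (?v $ 1) (?v $ 2) / 2
         + ?\<sigma> * (?v $ 1 * n1 + ?v $ 2 * n2) / 2 + ?\<sigma>\<^sup>2 * n3 / 2"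
      by (elim exE conjE) (rule that; assumption)
    have B: "quad h1 h2 h3 (?v $ 1) (?v $ 2) / 2 \<le> quad ?k1 ?k2 ?k3 (?v $ 1) (?v $ 2) / 2 + e / 2 * (norm ?v)\<^sup>2"
      using quad_perturbation[OF h, of ?v] by linarith
    have k: "\<bar>a * b\<bar> \<le> norm ?v * M" if "\<bar>a\<bar> \<le> norm ?v" "\<bar>b\<bar> \<le> M" for a b
      using mult_mono[OF that] by (simp add: abs_mult)
    have gen: "\<bar>a + b\<bar> \<le> 2 * k" if "\<bar>a\<bar> \<le> k" "\<bar>b\<bar> \<le> k" for a b k :: real using that by linarith
    have "\<bar>?v $ 1 * n1 + ?v $ 2 * n2\<bar> \<le> 2 * (norm ?v * M)"
      by (rule gen[OF k[OF component_le_norm_cart n(1)] k[OF component_le_norm_cart n(2)]])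
    then have "\<bar>?\<sigma>\<bar> * \<bar>?v $ 1 * n1 + ?v $ 2 * n2\<bar> \<le> \<bar>?\<sigma>\<bar> * (2 * (norm ?v * M))" by (rule mult_left_mono) simp
    with abs_ge_self[of "?\<sigma> * (?v $ 1 * n1 + ?v $ 2 * n2)"] have "?\<sigma> * (?v $ 1 * n1 + ?v $ 2 * n2) \<le> \<bar>?\<sigma>\<bar> * (2 * (norm ?v * M))"
      unfolding abs_mult by (rule order_trans)
    moreover have "p / 2 \<le> a * q" if "p \<le> a * (2 * q)" for p q a :: real using that by simp
    ultimately have C: "?\<sigma> * (?v $ 1 * n1 + ?v $ 2 * n2) / 2 \<le> \<bar>?\<sigma>\<bar> * (norm ?v * M)" by blast
    have young: "\<sigma> * (a * M) \<le> e / 2 * a\<^sup>2 + M\<^sup>2 / (2 * e) * \<sigma>\<^sup>2" for \<sigma> a :: real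
    proof -
      have "2 * (e * a) * (M * \<sigma>) \<le> (e * a)\<^sup>2 + (M * \<sigma>)\<^sup>2" by (rule sum_squares_bound)
      then have "(2 * (e * a) * (M * \<sigma>)) / (2 * e) \<le> ((e * a)\<^sup>2 + (M * \<sigma>)\<^sup>2) / (2 * e)"
        using e by (intro divide_right_mono) auto
      then show ?thesis using e by (simp add: power_mult_distrib add_divide_distrib power2_eq_square mult_ac)
    qed
    have "\<bar>?\<sigma>\<bar> * (norm ?v * M) \<le> e / 2 * (norm ?v)\<^sup>2 + M\<^sup>2 / (2 * e) * ?\<sigma>\<^sup>2"
      using young[of "\<bar>?\<sigma>\<bar>" "norm ?v"] unfolding power2_abs .
    moreover have "?\<sigma>\<^sup>2 * n3 / 2 \<le> M / 2 * ?\<sigma>\<^sup>2"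
    proof -
      have "\<sigma> * n3 / 2 \<le> M / 2 * \<sigma>" if "0 \<le> \<sigma>" for \<sigma>
        using mult_left_mono[OF order_trans[OF abs_ge_self n(3)] that] by (simp add: mult.commute)
      then show ?thesis by simp
    qed
    ultimately have "?\<sigma> * (?v $ 1 * n1 + ?v $ 2 * n2) / 2 + ?\<sigma>\<^sup>2 * n3 / 2 \<le> e / 2 * (norm ?v)\<^sup>2 + M' * ?\<sigma>\<^sup>2"
      using C unfolding M'_def distrib_right by linarith
    then show "\<phi> (y, s) \<le> \<phi> ?z + sgrad \<phi> ?z \<bullet> ?v + ?\<sigma> * dir1 \<phi> X3 ?z + quad ?k1 ?k2 ?k3 (?v $ 1) (?v $ 2) / 2 + e * (norm ?v)\<^sup>2 + M' * ?\<sigma>\<^sup>2"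
      using B unfolding eq by linarith
  qed
qed

lemma space_grad_C2:
  assumes "t > 0" shows "space_grad \<phi> x t = sgrad \<phi> (x, t)"
proof -
  have z: "(x, t) \<in> space_time" using assms by (simp add: space_time_iff)
  have i: "((\<lambda>y. (y, t)) has_derivative (\<lambda>v. (v, 0))) (at x)"
    by (auto intro!: derivative_eq_intros)
  have "((\<lambda>y. \<phi> (y, t)) has_derivative (\<lambda>v. dir1 \<phi> (v, 0) (x, t))) (at x)"
    by (rule has_derivative_compose[OF i C2_d1[OF z]])
  also have "(\<lambda>v. dir1 \<phi> (v, 0) (x, t)) = (\<lambda>v. v \<bullet> sgrad \<phi> (x, t))"
  proof
    show "dir1 \<phi> (v, 0) (x, t) = v \<bullet> sgrad \<phi> (x, t)" for v
      using dir1_expand[OF z, of v 0] by (simp add: inner_commute)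
  qed
  finally have g: "GDERIV (\<lambda>y. \<phi> (y, t)) x :> sgrad \<phi> (x, t)" unfolding gderiv_def .
  show ?thesis unfolding space_grad_def grad_def
  proof (rule the_equality, rule g)
    fix D assume "GDERIV (\<lambda>y. \<phi> (y, t)) x :> D"
    then have "(\<lambda>v. v \<bullet> D) = (\<lambda>v. v \<bullet> sgrad \<phi> (x, t))"
      using g unfolding gderiv_def by (rule has_derivative_unique)
    then have "v \<bullet> D = v \<bullet> sgrad \<phi> (x, t)" for v by (rule fun_cong)
    then show "D = sgrad \<phi> (x, t)" by (metis vector_eq_ldot)
  qed
qed

lemma space_hessian_C2:
  assumes "t > 0"
  shows "space_hessian \<phi> x t $ 1 $ 1 = dir2 \<phi> X1 X1 (x, t)" "space_hessian \<phi> x t $ 1 $ 2 = dir2 \<phi> X2 X1 (x, t)"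
    "space_hessian \<phi> x t $ 2 $ 1 = dir2 \<phi> X1 X2 (x, t)" "space_hessian \<phi> x t $ 2 $ 2 = dir2 \<phi> X2 X2 (x, t)"
proof -
  have z: "(x, t) \<in> space_time" using assms by (simp add: space_time_iff)
  have i: "((\<lambda>y. (y, t)) has_derivative (\<lambda>v. (v, 0))) (at x)"
    by (auto intro!: derivative_eq_intros)
  have g: "grad (\<lambda>y. \<phi> (y, t)) = (\<lambda>y. sgrad \<phi> (y, t))"
    using space_grad_C2[OF assms] by (auto simp: space_grad_def)
  have "((\<lambda>y. dir1 \<phi> X1 (y, t) *\<^sub>R axis 1 1 + dir1 \<phi> X2 (y, t) *\<^sub>R axis 2 1) has_derivative
    (\<lambda>v. dir2 \<phi> (v, 0) X1 (x, t) *\<^sub>R axis 1 1 + dir2 \<phi> (v, 0) X2 (x, t) *\<^sub>R axis 2 1 :: real^2)) (at x)"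
    by (intro has_derivative_add has_derivative_scaleR_left has_derivative_compose[OF i C2_d2[OF z]])
  then have "((\<lambda>y. sgrad \<phi> (y, t)) has_derivative
    (\<lambda>v. dir2 \<phi> (v, 0) X1 (x, t) *\<^sub>R axis 1 1 + dir2 \<phi> (v, 0) X2 (x, t) *\<^sub>R axis 2 1)) (at x)"
    unfolding sgrad_def .
  from frechet_derivative_at[OF this]
  have "space_hessian \<phi> x t = matrix (\<lambda>v. dir2 \<phi> (v, 0) X1 (x, t) *\<^sub>R axis 1 1 + dir2 \<phi> (v, 0) X2 (x, t) *\<^sub>R axis 2 1)"
    unfolding space_hessian_def hessian_def jacobian_def g by simp
  then show "space_hessian \<phi> x t $ 1 $ 1 = dir2 \<phi> X1 X1 (x, t)" "space_hessian \<phi> x t $ 1 $ 2 = dir2 \<phi> X2 X1 (x, t)"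
    "space_hessian \<phi> x t $ 2 $ 1 = dir2 \<phi> X1 X2 (x, t)" "space_hessian \<phi> x t $ 2 $ 2 = dir2 \<phi> X2 X2 (x, t)"
    by (simp_all add: matrix_def axis_def[of _ "1::real"])
qed

lemma space_hessian_symmetric:
  assumes "t > 0" shows "space_hessian \<phi> x t $ 1 $ 2 = space_hessian \<phi> x t $ 2 $ 1"
  using C2_symmetric[OF C2 open_space_time, of "(x, t)" X1 X2] assms
  by (simp add: space_hessian_C2 space_time_iff)

lemma time_deriv_C2:
  assumes "t > 0" shows "time_deriv \<phi> x t = dir1 \<phi> X3 (x, t)"
proof -
  have z: "(x, t) \<in> space_time" using assms by (simp add: space_time_iff)
  have i: "((\<lambda>s. (x, s)) has_derivative (\<lambda>v. (0, v))) (at t)"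
    by (auto intro!: derivative_eq_intros)
  have "((\<lambda>s. \<phi> (x, s)) has_derivative (\<lambda>v. dir1 \<phi> (0, v) (x, t))) (at t)"
    by (rule has_derivative_compose[OF i C2_d1[OF z]])
  then have "((\<lambda>s. \<phi> (x, s)) has_real_derivative dir1 \<phi> X3 (x, t)) (at t)"
  proof (rule has_derivative_imp_has_field_derivative)
    show "r * dir1 \<phi> X3 (x, t) = dir1 \<phi> (0, r) (x, t)" for r
      using dir1_expand[OF z, of 0 r] by simp
  qed
  then show ?thesis unfolding time_deriv_def by (rule DERIV_imp_deriv)
qed

lemma C2_continuous_on: "continuous_on space_time \<phi>"
  using C2_d1 by (meson has_derivative_at_withinI has_derivative_continuous_on)

end

section \<open>Eigenvalues of symmetric matrices\<close>

lemma matrix_vector_2: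
  fixes A :: "real^2^2"
  shows "(A *v v) $ 1 = A $ 1 $ 1 * v $ 1 + A $ 1 $ 2 * v $ 2" "(A *v v) $ 2 = A $ 2 $ 1 * v $ 1 + A $ 2 $ 2 * v $ 2"
  by (simp_all add: matrix_vector_mult_def sum_2)

text \<open>The eigenvalues are the two explicit real roots of the characteristic polynomial. The
  equation for \<open>l2\<close> with both factors nonnegative is kept because it completes the
  square in the bound of the quadratic form.\<close>

lemma eigenvalues_symmetric_2:
  fixes A :: "real^2^2"
  assumes "A $ 1 $ 2 = A $ 2 $ 1"
  obtains l1 l2 where "eigenvalues A = {l1, l2}" "l1 \<le> l2" "l1 + l2 = trace A"
    "(l2 - A $ 1 $ 1) * (l2 - A $ 2 $ 2) = (A $ 1 $ 2)\<^sup>2" "A $ 1 $ 1 \<le> l2" "A $ 2 $ 2 \<le> l2"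
proof -
  define a b c where "a = A $ 1 $ 1" and "b = A $ 1 $ 2" and "c = A $ 2 $ 2"
  have b': "A $ 2 $ 1 = b" using assms by (simp add: b_def)
  have char: "l \<in> eigenvalues A \<longleftrightarrow> (l - a) * (l - c) = b\<^sup>2" for l
  proof
    assume "l \<in> eigenvalues A"
    then obtain v where v: "v \<noteq> 0" "A *v v = l *\<^sub>R v" by (auto simp: eigenvalues_def)
    then have e: "a * v $ 1 + b * v $ 2 = l * v $ 1" "b * v $ 1 + c * v $ 2 = l * v $ 2"
      using matrix_vector_2[of A v] by (auto simp: a_def b_def c_def b' assms[unfolded b_def[symmetric]])
    have "((l - a) * (l - c) - b\<^sup>2) * v $ 1 = 0" "((l - a) * (l - c) - b\<^sup>2) * v $ 2 = 0"
      using e by algebra+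
    moreover have "v $ 1 \<noteq> 0 \<or> v $ 2 \<noteq> 0" using v(1) by (auto simp: vec_eq_iff forall_2)
    ultimately show "(l - a) * (l - c) = b\<^sup>2" by auto
  next
    assume l: "(l - a) * (l - c) = b\<^sup>2"
    \<comment> \<open>The generic eigenvector (b, l - a) is zero only when b = 0 and l = a, and then
      the first basis vector is one.\<close>
    define v :: "real^2" where "v = (if b = 0 \<and> l = a then vector [1, 0] else vector [b, l - a])"
    have "v \<noteq> 0" by (auto simp: v_def vec_eq_iff forall_2)
    moreover have "A *v v = l *\<^sub>R v"
    proof (cases "b = 0 \<and> l = a")
      case True
      then show ?thesis using b' by (auto simp: vec_eq_iff forall_2 matrix_vector_2 v_def a_def b_def)
    next
      case False
      have "b * b + c * (l - a) = l * (l - a)" using l by algebra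
      then show ?thesis using False b'
        by (auto simp: vec_eq_iff forall_2 matrix_vector_2 v_def a_def[symmetric] b_def[symmetric] c_def[symmetric] algebra_simps)
    qed
    ultimately show "l \<in> eigenvalues A" by (auto simp: eigenvalues_def)
  qed
  define D where "D = sqrt (((a - c) / 2)\<^sup>2 + b\<^sup>2)"
  have D2: "D\<^sup>2 = ((a - c) / 2)\<^sup>2 + b\<^sup>2" by (simp add: D_def)
  have D: "D \<ge> \<bar>(a - c) / 2\<bar>" unfolding D_def by (rule real_le_rsqrt) (simp only: power2_abs, simp)
  have eq: "(l - a) * (l - c) = b\<^sup>2 \<longleftrightarrow> l = (a + c) / 2 - D \<or> l = (a + c) / 2 + D" for l
  proof -
    have "(l - a) * (l - c) - b\<^sup>2 = (l - ((a + c) / 2 - D)) * (l - ((a + c) / 2 + D))"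
      using D2 by (simp add: power2_eq_square field_simps)
    then show ?thesis by (metis eq_iff_diff_eq_0 mult_eq_0_iff)
  qed
  show ?thesis
  proof (rule that[of "(a + c) / 2 - D" "(a + c) / 2 + D"])
    show "eigenvalues A = {(a + c) / 2 - D, (a + c) / 2 + D}" using char eq by auto
    show "(a + c) / 2 - D + ((a + c) / 2 + D) = trace A" by (simp add: trace_def sum_2 a_def c_def)
    show "((a + c) / 2 + D - A $ 1 $ 1) * ((a + c) / 2 + D - A $ 2 $ 2) = (A $ 1 $ 2)\<^sup>2"
      using eq[of "(a + c) / 2 + D"] by (simp add: a_def b_def c_def)
  qed (use D in \<open>auto simp: a_def c_def abs_le_iff field_simps\<close>)
qed

text \<open>The matrix l2 I - A has diagonal entries p^2 and q^2 and off-diagonal entries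
  \<plusminus>p q, so its quadratic form is a perfect square.\<close>

lemma lambda_symmetric_2:
  fixes A :: "real^2^2"
  assumes sym: "A $ 1 $ 2 = A $ 2 $ 1"
  shows "lambda_min A + lambda_max A = trace A"
    and "quad (A $ 1 $ 1) (A $ 1 $ 2 + A $ 2 $ 1) (A $ 2 $ 2) x y \<le> lambda_max A * (x\<^sup>2 + y\<^sup>2)"
proof -
  obtain l1 l2 where l: "eigenvalues A = {l1, l2}" "l1 \<le> l2" "l1 + l2 = trace A"
    "(l2 - A $ 1 $ 1) * (l2 - A $ 2 $ 2) = (A $ 1 $ 2)\<^sup>2" "A $ 1 $ 1 \<le> l2" "A $ 2 $ 2 \<le> l2"
    by (rule eigenvalues_symmetric_2[OF sym])
  have m: "lambda_max A = l2" "lambda_min A = l1" using l(1,2) by (auto simp: lambda_max_def lambda_min_def)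
  then show "lambda_min A + lambda_max A = trace A" using l(3) by simp
  define p q where "p = sqrt (l2 - A $ 1 $ 1)" and "q = sqrt (l2 - A $ 2 $ 2)"
  have pq: "p\<^sup>2 = l2 - A $ 1 $ 1" "q\<^sup>2 = l2 - A $ 2 $ 2" using l by (auto simp: p_def q_def)
  have "(p * q)\<^sup>2 = (A $ 1 $ 2)\<^sup>2" unfolding power_mult_distrib pq using l(4) .
  then have pq': "p * q = A $ 1 $ 2 \<or> p * q = - (A $ 1 $ 2)" by (simp add: power2_eq_iff)
  have "l2 * (x\<^sup>2 + y\<^sup>2) - quad (A $ 1 $ 1) (A $ 1 $ 2 + A $ 2 $ 1) (A $ 2 $ 2) x y = p\<^sup>2 * x\<^sup>2 - 2 * (A $ 1 $ 2) * x * y + q\<^sup>2 * y\<^sup>2"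
    unfolding pq sym[symmetric] by (simp add: algebra_simps)
  also have "\<dots> \<ge> 0"
  proof -
    have "p\<^sup>2 * x\<^sup>2 - 2 * b * x * y + q\<^sup>2 * y\<^sup>2 = (p * x - q * y)\<^sup>2" if "p * q = b" for b
      unfolding that[symmetric] by (simp add: power2_eq_square algebra_simps)
    moreover have "p\<^sup>2 * x\<^sup>2 - 2 * b * x * y + q\<^sup>2 * y\<^sup>2 = (p * x + q * y)\<^sup>2" if "p * q = - b" for b
    proof -
      have "b = - (p * q)" using that by simp
      then show ?thesis by (simp add: power2_eq_square algebra_simps)
    qed
    ultimately show ?thesis using pq' zero_le_power2 by metis
  qed
  finally show "quad (A $ 1 $ 1) (A $ 1 $ 2 + A $ 2 $ 1) (A $ 2 $ 2) x y \<le> lambda_max A * (x\<^sup>2 + y\<^sup>2)" unfolding m by simp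
qed

section \<open>Test functions with vanishing gradient\<close>

lemma second_order_at_scale:
  assumes "second_order_at \<Psi> P b \<alpha> \<beta> \<gamma> z" "k > 0"
  shows "second_order_at (\<lambda>w. k * \<Psi> w) (\<lambda>w. k *\<^sub>R P w) (k * b) (k * \<alpha>) (k * \<beta>) (k * \<gamma>) z"
  unfolding second_order_at_def
proof (intro conjI allI impI)
  show "isCont (\<lambda>w. k *\<^sub>R P w) z" using assms(1) by (auto simp: second_order_at_def)
  fix \<epsilon> :: real assume "\<epsilon> > 0"
  then have e: "\<epsilon> / k > 0" using assms(2) by simp
  obtain r where r: "r > 0" "\<forall>x t y s. dist (x, t) z < r \<longrightarrow> dist (y, s) z < r \<longrightarrow>
     \<bar>\<Psi> (y, s) - \<Psi> (x, t) - P (x, t) \<bullet> (y - x) - b * (s - t) - quad \<alpha> \<beta> \<gamma> ((y - x) $ 1) ((y - x) $ 2)\<bar> \<le> \<epsilon> / k * (\<bar>s - t\<bar> + (norm (y - x))\<^sup>2)"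
    by (rule second_order_atE[OF assms(1) e])
  show "\<exists>r>0. \<forall>x t y s. dist (x, t) z < r \<and> dist (y, s) z < r \<longrightarrow>
     \<bar>k * \<Psi> (y, s) - k * \<Psi> (x, t) - (k *\<^sub>R P (x, t)) \<bullet> (y - x) - k * b * (s - t) - quad (k * \<alpha>) (k * \<beta>) (k * \<gamma>) ((y - x) $ 1) ((y - x) $ 2)\<bar> \<le> \<epsilon> * (\<bar>s - t\<bar> + (norm (y - x))\<^sup>2)"
  proof (rule exI[of _ r], rule conjI, rule r(1), intro allI impI)
    fix x t y s assume a: "dist (x, t) z < r \<and> dist (y, s) z < r"
    define A where "A = \<Psi> (y, s) - \<Psi> (x, t) - P (x, t) \<bullet> (y - x) - b * (s - t) - quad \<alpha> \<beta> \<gamma> ((y - x) $ 1) ((y - x) $ 2)"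
    define B where "B = \<bar>s - t\<bar> + (norm (y - x))\<^sup>2"
    have "\<bar>A\<bar> \<le> \<epsilon> / k * B" using r(2) a unfolding A_def B_def by blast
    then have "k * \<bar>A\<bar> \<le> k * (\<epsilon> / k * B)" using assms(2) by (intro mult_left_mono) auto
    also have "\<dots> = \<epsilon> * B" using assms(2) by simp
    also have "k * \<bar>A\<bar> = \<bar>k * A\<bar>" using assms(2) by (simp add: abs_mult)
    also have "k * A = k * \<Psi> (y, s) - k * \<Psi> (x, t) - (k *\<^sub>R P (x, t)) \<bullet> (y - x) - k * b * (s - t) - quad (k * \<alpha>) (k * \<beta>) (k * \<gamma>) ((y - x) $ 1) ((y - x) $ 2)"
      unfolding A_def inner_scaleR_left by (simp only: right_diff_distrib distrib_left mult.assoc)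
    finally show "\<bar>k * \<Psi> (y, s) - k * \<Psi> (x, t) - (k *\<^sub>R P (x, t)) \<bullet> (y - x) - k * b * (s - t) - quad (k * \<alpha>) (k * \<beta>) (k * \<gamma>) ((y - x) $ 1) ((y - x) $ 2)\<bar> \<le> \<epsilon> * (\<bar>s - t\<bar> + (norm (y - x))\<^sup>2)"
      unfolding B_def .
  qed
qed

lemma norm_sq_expand: "(norm (y - c))\<^sup>2 = (norm (x - c))\<^sup>2 + 2 * ((x - c) \<bullet> (y - x)) + (norm (y - x))\<^sup>2"
  for x y c :: "'a::real_inner"
  by (simp add: power2_norm_eq_inner inner_diff_left inner_diff_right inner_commute)

lemma norm_sq_vec2: "(norm v)\<^sup>2 = (v $ 1)\<^sup>2 + (v $ 2)\<^sup>2" for v :: "real^2"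
  by (simp only: power2_norm_eq_inner inner_vec_def sum_2) (simp add: power2_eq_square)

text \<open>The expansion is exact in space. Its only error comes from freezing the derivative of M
  (t - t0)^2 at t1.\<close>

lemma second_order_at_paraboloid:
  fixes c x1 :: "real^2"
  assumes "M \<ge> 0"
  shows "second_order_at (\<lambda>z. \<mu> / 2 * (norm (fst z - c))\<^sup>2 + b * (snd z - t0) + M * (snd z - t0)\<^sup>2) (\<lambda>z. \<mu> *\<^sub>R (fst z - c))
     (b + 2 * M * (t1 - t0)) (\<mu> / 2) 0 (\<mu> / 2) (x1, t1)"
  unfolding second_order_at_def
proof (intro conjI allI impI)
  show "isCont (\<lambda>z :: (real^2) \<times> real. \<mu> *\<^sub>R (fst z - c)) (x1, t1)" by (intro continuous_intros)
  fix \<epsilon> :: real assume \<epsilon>: "\<epsilon> > 0"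
  define r where "r = \<epsilon> / (2 * (M + 1))"
  have r: "r > 0" using \<epsilon> assms by (simp add: r_def)
  have "r * (2 * (M + 1)) = \<epsilon>" using assms by (simp add: r_def)
  then have rM: "M * (2 * r) \<le> \<epsilon>" using r by (simp add: algebra_simps)
  show "\<exists>r>0. \<forall>x t y s. dist (x, t) (x1, t1) < r \<and> dist (y, s) (x1, t1) < r \<longrightarrow>
     \<bar>\<mu> / 2 * (norm (fst (y, s) - c))\<^sup>2 + b * (snd (y, s) - t0) + M * (snd (y, s) - t0)\<^sup>2 - (\<mu> / 2 * (norm (fst (x, t) - c))\<^sup>2 + b * (snd (x, t) - t0) + M * (snd (x, t) - t0)\<^sup>2)
      - \<mu> *\<^sub>R (fst (x, t) - c) \<bullet> (y - x) - (b + 2 * M * (t1 - t0)) * (s - t) - quad (\<mu> / 2) 0 (\<mu> / 2) ((y - x) $ 1) ((y - x) $ 2)\<bar> \<le> \<epsilon> * (\<bar>s - t\<bar> + (norm (y - x))\<^sup>2)"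
  proof (rule exI[of _ r], rule conjI, rule r(1), intro allI impI)
    fix x t y s assume a: "dist (x, t) (x1, t1) < r \<and> dist (y, s) (x1, t1) < r"
    have ts: "\<bar>t - t1\<bar> < r" "\<bar>s - t1\<bar> < r"
      using dist_snd_le[of "(x, t)" "(x1, t1)"] dist_snd_le[of "(y, s)" "(x1, t1)"] a by (auto simp: dist_real_def)
    have q: "quad (\<mu> / 2) 0 (\<mu> / 2) ((y - x) $ 1) ((y - x) $ 2) = \<mu> / 2 * (norm (y - x))\<^sup>2"
      unfolding norm_sq_vec2 by (simp only: distrib_left mult_zero_left add_0_right)
    have t: "M * (s - t0)\<^sup>2 - M * (t - t0)\<^sup>2 - 2 * M * (t1 - t0) * (s - t) = M * ((s - t1) + (t - t1)) * (s - t)"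
      by (simp add: power2_eq_square algebra_simps)
    have "\<mu> / 2 * (norm (fst (y, s) - c))\<^sup>2 + b * (snd (y, s) - t0) + M * (snd (y, s) - t0)\<^sup>2 - (\<mu> / 2 * (norm (fst (x, t) - c))\<^sup>2 + b * (snd (x, t) - t0) + M * (snd (x, t) - t0)\<^sup>2)
      - \<mu> *\<^sub>R (fst (x, t) - c) \<bullet> (y - x) - (b + 2 * M * (t1 - t0)) * (s - t) - quad (\<mu> / 2) 0 (\<mu> / 2) ((y - x) $ 1) ((y - x) $ 2)
      = M * (s - t0)\<^sup>2 - M * (t - t0)\<^sup>2 - 2 * M * (t1 - t0) * (s - t)"
      unfolding q fst_conv snd_conv norm_sq_expand[of y c x] inner_scaleR_left by (simp add: algebra_simps)
    also have "\<dots> = M * ((s - t1) + (t - t1)) * (s - t)" by (rule t)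
    also have "\<bar>\<dots>\<bar> = M * \<bar>(s - t1) + (t - t1)\<bar> * \<bar>s - t\<bar>" using assms by (simp add: abs_mult)
    also have "\<dots> \<le> M * (2 * r) * \<bar>s - t\<bar>"
    proof (intro mult_right_mono mult_left_mono)
      show "\<bar>(s - t1) + (t - t1)\<bar> \<le> 2 * r" using ts by linarith
    qed (use assms in auto)
    also have "\<dots> \<le> \<epsilon> * \<bar>s - t\<bar>" using rM by (rule mult_right_mono) simp
    also have "\<dots> \<le> \<epsilon> * (\<bar>s - t\<bar> + (norm (y - x))\<^sup>2)" using \<epsilon> by (intro mult_left_mono) auto
    finally show "\<bar>\<mu> / 2 * (norm (fst (y, s) - c))\<^sup>2 + b * (snd (y, s) - t0) + M * (snd (y, s) - t0)\<^sup>2 - (\<mu> / 2 * (norm (fst (x, t) - c))\<^sup>2 + b * (snd (x, t) - t0) + M * (snd (x, t) - t0)\<^sup>2)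
      - \<mu> *\<^sub>R (fst (x, t) - c) \<bullet> (y - x) - (b + 2 * M * (t1 - t0)) * (s - t) - quad (\<mu> / 2) 0 (\<mu> / 2) ((y - x) $ 1) ((y - x) $ 2)\<bar> \<le> \<epsilon> * (\<bar>s - t\<bar> + (norm (y - x))\<^sup>2)" .
  qed
qed

text \<open>
  Near a point where the gradient vanishes the consistency estimate is only available for a
  vanishing Hessian. The variable is therefore doubled: \<open>\<lambda>/2 |x - x0|\<^sup>2\<close> is replaced by
  \<open>\<lambda>/2 |y - x0|\<^sup>2 + K |x - y|\<^sup>4\<close>, and at a minimum either \<open>y \<noteq> x0\<close>, and translating \<open>x\<close> and \<open>y\<close>
  together gives a test function with nonzero gradient, or \<open>x = y = x0\<close>, and keeping \<open>y\<close>
  fixed gives one with vanishing Hessian.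
\<close>

lemma minimum_of_doubling:
  fixes x x0 :: "real^2"
  assumes "K > 0" "R > 0" and min: "\<And>y. y \<in> cball x0 R \<Longrightarrow> K * norm (x - x0) ^ 4 \<le> \<mu> / 2 * (norm (y - x0))\<^sup>2 + K * norm (x - y) ^ 4"
  shows "x = x0" and "\<mu> \<ge> 0"
proof -
  show x: "x = x0"
  proof (rule ccontr)
    assume ne: "x \<noteq> x0"
    define d where "d = x - x0"
    have d: "norm d > 0" using ne by (simp add: d_def)
    define c where "c = \<bar>\<mu>\<bar> / 2 * (norm d)\<^sup>2"
    define k where "k = K * norm d ^ 4"
    have k: "k > 0" using d assms(1) by (simp add: k_def)
    have c: "c \<ge> 0" by (simp add: c_def)
    \<comment> \<open>Moving y from x0 a fraction s of the way to x costs at most s^2 c and saves at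
      least s k. For such an s the saving is larger.\<close>
    define s where "s = min (min 1 (R / norm d)) (k / (2 * (c + 1)))"
    have s: "s > 0" "s \<le> 1" "s \<le> R / norm d" "s \<le> k / (2 * (c + 1))"
      using d assms(2) k c by (auto simp: s_def intro!: divide_pos_pos)
    define y where "y = x0 + s *\<^sub>R d"
    have y0: "norm (y - x0) = s * norm d" using s by (simp add: y_def)
    have "s * norm d \<le> R" using s(3) d by (simp add: pos_le_divide_eq)
    then have "y \<in> cball x0 R" using y0 by (simp add: dist_norm norm_minus_commute)
    from min[OF this] have m: "K * norm d ^ 4 \<le> \<mu> / 2 * (s * norm d)\<^sup>2 + K * norm (x - y) ^ 4" by (simp add: y0 d_def)
    have "x - y = (1 - s) *\<^sub>R d" by (simp add: y_def d_def algebra_simps)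
    then have "norm (x - y) ^ 4 = (1 - s) ^ 4 * norm d ^ 4" using s by (simp add: power_mult_distrib)
    also have "\<dots> \<le> (1 - s) * norm d ^ 4"
    proof (rule mult_right_mono)
      have "(1 - s) ^ 4 \<le> (1 - s) ^ 1" using s by (intro power_decreasing) auto
      then show "(1 - s) ^ 4 \<le> 1 - s" by simp
    qed simp
    finally have "K * norm (x - y) ^ 4 \<le> K * ((1 - s) * norm d ^ 4)" using assms(1) by simp
    also have "\<dots> = k - s * k" by (simp add: k_def algebra_simps)
    finally have 1: "K * norm (x - y) ^ 4 \<le> k - s * k" .
    have "\<mu> / 2 * (s * norm d)\<^sup>2 \<le> \<bar>\<mu>\<bar> / 2 * (s * norm d)\<^sup>2" by (intro mult_right_mono) auto
    also have "\<dots> = s * (s * c)" by (simp add: c_def power2_eq_square)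
    finally have 2: "\<mu> / 2 * (s * norm d)\<^sup>2 \<le> s * (s * c)" .
    have "k \<le> s * (s * c) + (k - s * k)" using m 1 2 unfolding k_def[symmetric] by linarith
    then have "s * k \<le> s * (s * c)" by simp
    then have "k \<le> s * c" using s(1) by simp
    also have "\<dots> \<le> k / (2 * (c + 1)) * (c + 1)" using s c by (intro mult_mono) auto
    also have "\<dots> = k / 2"
    proof -
      have "k / (2 * q) * q = k / 2" if "q > 0" for q using that by simp
      from this[of "c + 1"] show ?thesis using c by linarith
    qed
    finally show False using k by simp
  qed
  show "\<mu> \<ge> 0"
  proof (rule ccontr)
    assume "\<not> \<mu> \<ge> 0"
    then have l: "\<mu> < 0" by simp
    \<comment> \<open>With x = x0 and \<mu> < 0, a displacement s with K s^2 at most -\<mu> / 4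
      leaves the value at most \<mu> s^2 / 4, which is negative.\<close>
    define s where "s = min R (sqrt (- \<mu> / (4 * K)))"
    have s: "s > 0" "s \<le> R" "s \<le> sqrt (- \<mu> / (4 * K))" using assms l by (auto simp: s_def divide_neg_pos)
    have "s\<^sup>2 \<le> (sqrt (- \<mu> / (4 * K)))\<^sup>2" using s by (intro power_mono) auto
    also have "\<dots> = - \<mu> / (4 * K)" using assms l by (intro real_sqrt_pow2) (auto intro: divide_nonpos_pos)
    finally have s2: "K * s\<^sup>2 \<le> - \<mu> / 4" using assms(1) by (simp add: field_simps)
    define y :: "real^2" where "y = x0 + s *\<^sub>R axis 1 1"
    have y: "norm (y - x0) = s" "norm (x0 - y) = s" using s by (simp_all add: y_def norm_axis_1)
    have "y \<in> cball x0 R" using s y by (simp add: dist_norm)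
    from min[OF this] have "0 \<le> \<mu> / 2 * s\<^sup>2 + K * s ^ 4" by (simp add: x y)
    also have "K * s ^ 4 = (K * s\<^sup>2) * s\<^sup>2" by (simp add: power2_eq_square power4_eq_xxxx)
    also have "\<dots> \<le> - \<mu> / 4 * s\<^sup>2" using s2 by (intro mult_right_mono) auto
    also have "\<mu> / 2 * s\<^sup>2 + - \<mu> / 4 * s\<^sup>2 = \<mu> / 4 * s\<^sup>2" by (simp add: field_simps)
    also have "\<dots> < 0" using l s by (intro mult_neg_pos) auto
    finally show False by simp
  qed
qed

text \<open>The two strict gaps have different uses. \<nu> < \<mu> makes the quadratic bound
  strictly positive on the boundary of the ball, which keeps the minimum interior; \<mu> < b is what
  the touching inequality at that minimum contradicts. \<mu> \<noteq> 0 makes the gradient of the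
  translated paraboloid nonzero.\<close>

lemma doubling_contradiction:
  fixes x0 :: "real^2"
  assumes fam: "threshold_family \<tau> U"
    and par: "C > 0" "\<gamma> > 1" and \<tau>: "\<And>h. h > 0 \<Longrightarrow> \<tau> h > 0 \<and> h = C * \<tau> h powr \<gamma>"
    and z0: "(x0, t0) \<in> limit_set \<tau> U" "t0 > 0"
    and r0: "r0 > 0" and M: "M \<ge> 0" and \<mu>: "\<nu> < \<mu>" "\<mu> < b" "\<mu> \<noteq> 0"
    and lower: "\<And>x t. (x, t) \<in> limit_set \<tau> U \<Longrightarrow> (x, t) \<in> cball (x0, t0) r0 \<Longrightarrow>
      0 \<le> b * (t - t0) + \<nu> / 2 * (norm (x - x0))\<^sup>2 + M * (t - t0)\<^sup>2"
  shows False
proof -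
  \<comment> \<open>The extra (t - t0)^2 provides strict positivity in the time direction.\<close>
  define M' where "M' = M + 1"
  have M': "M' > 0" using M by (simp add: M'_def)
  \<comment> \<open>The bound t0 / 2 keeps times positive. The last one keeps the time derivative b
    + 2 M' (t1 - t0) above \<mu>.\<close>
  define r where "r = min (min r0 (t0 / 2)) ((b - \<mu>) / (4 * M'))"
  have r: "r > 0" "r \<le> r0" "r \<le> t0 / 2" "r \<le> (b - \<mu>) / (4 * M')"
    using r0 z0(2) \<mu>(2) M' by (simp_all add: r_def)
  have "r * (4 * M') \<le> b - \<mu>" using r(4) M' by (subst (asm) pos_le_divide_eq) auto
  then have rM: "2 * (M' * r) < b - \<mu>" using \<mu>(2) by (simp add: algebra_simps)
  \<comment> \<open>A lower bound for the undoubled function on the sphere of radius r.\<close>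
  define m where "m = min ((\<mu> - \<nu>) / 2) 1 * r\<^sup>2"
  have m: "m > 0" using \<mu>(1) r(1) by (simp add: m_def)
  \<comment> \<open>The permitted distance between x and y: replacing one by the other changes the
    quadratic term by less than m, and y stays within 2 r of x0.\<close>
  define \<kappa> where "\<kappa> = min (r / 2) (m / (3 * r * (\<bar>\<mu>\<bar> + 1)))"
  have \<kappa>: "\<kappa> > 0" "\<kappa> \<le> r / 2" "\<kappa> \<le> m / (3 * r * (\<bar>\<mu>\<bar> + 1))"
    using r(1) m by (simp_all add: \<kappa>_def)
  have "3 * r * (\<bar>\<mu>\<bar> + 1) > 0" using r(1) by simp
  then have "\<kappa> * (3 * r * (\<bar>\<mu>\<bar> + 1)) \<le> m" using \<kappa>(3) by (subst (asm) pos_le_divide_eq)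
  then have \<kappa>m: "(\<bar>\<mu>\<bar> + 1) * (\<kappa> * (3 * r)) \<le> m" by (simp add: mult_ac)
  define C0 where "C0 = \<bar>b\<bar> * r + \<bar>\<mu>\<bar> / 2 * (2 * r)\<^sup>2"
  have C0: "C0 \<ge> 0" using r(1) by (simp add: C0_def)
  \<comment> \<open>C0 bounds the possibly negative terms of E. If |x - y| were at least \<kappa>,
    then E would be at least 1, whereas its minimum is at most 0.\<close>
  define K where "K = (C0 + 1) / \<kappa> ^ 4"
  have K: "K > 0" using C0 \<kappa>(1) by (simp add: K_def)
  define E :: "((real^2) \<times> real) \<times> (real^2) \<Rightarrow> real" where
    "E w = b * (snd (fst w) - t0) + \<mu> / 2 * (norm (snd w - x0))\<^sup>2 + K * norm (fst (fst w) - snd w) ^ 4 + M' * (snd (fst w) - t0)\<^sup>2" for w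
  let ?S = "limit_set \<tau> U \<inter> cball (x0, t0) r"
  have "compact (?S \<times> cball x0 (2 * r))"
    by (intro compact_Times compact_cball closed_Int_compact closed_limit_set)
  moreover have "?S \<times> cball x0 (2 * r) \<noteq> {}"
    using z0(1) r(1) by (auto intro!: exI[of _ x0] exI[of _ t0])
  moreover have "continuous_on (?S \<times> cball x0 (2 * r)) E"
    unfolding E_def by (intro continuous_intros)
  ultimately obtain w1 where w1: "w1 \<in> ?S \<times> cball x0 (2 * r)" "\<And>w. w \<in> ?S \<times> cball x0 (2 * r) \<Longrightarrow> E w1 \<le> E w"
    using continuous_attains_inf by metis
  obtain x1 t1 y1 where w1eq: "w1 = ((x1, t1), y1)" by (metis surj_pair)
  have mem: "(x1, t1) \<in> limit_set \<tau> U" "dist (x1, t1) (x0, t0) \<le> r" "norm (y1 - x0) \<le> 2 * r"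
    using w1(1) by (auto simp: w1eq dist_commute dist_norm norm_minus_commute)
  have xt: "norm (x1 - x0) \<le> r" "\<bar>t1 - t0\<bar> \<le> r"
    using dist_fst_le[of "(x1, t1)" "(x0, t0)"] dist_snd_le[of "(x1, t1)" "(x0, t0)"] mem(2) by (auto simp: dist_norm)
  have min: "E ((x1, t1), y1) \<le> E ((x, t), y)" if "(x, t) \<in> limit_set \<tau> U" "dist (x, t) (x0, t0) \<le> r" "norm (y - x0) \<le> 2 * r" for x t y
    using w1(2)[of "((x, t), y)"] that by (auto simp: w1eq dist_commute dist_norm norm_minus_commute)
  have E0: "E ((x1, t1), y1) \<le> 0"
    using min[of x0 t0 x0] z0(1) r(1) by (simp add: E_def)
  have close: "norm (x1 - y1) < \<kappa>"
  proof (rule ccontr)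
    assume "\<not> norm (x1 - y1) < \<kappa>"
    then have "\<kappa> ^ 4 \<le> norm (x1 - y1) ^ 4" using \<kappa>(1) by (intro power_mono) auto
    then have "K * \<kappa> ^ 4 \<le> K * norm (x1 - y1) ^ 4" using K by simp
    then have k: "C0 + 1 \<le> K * norm (x1 - y1) ^ 4" using \<kappa>(1) by (simp add: K_def)
    have "\<bar>b * (t1 - t0)\<bar> \<le> \<bar>b\<bar> * r" unfolding abs_mult by (intro mult_left_mono xt) simp
    then have p: "- (\<bar>b\<bar> * r) \<le> b * (t1 - t0)" unfolding abs_le_iff by linarith
    have "(norm (y1 - x0))\<^sup>2 \<le> (2 * r)\<^sup>2" by (intro power_mono mem) simp
    then have "\<bar>\<mu>\<bar> / 2 * (norm (y1 - x0))\<^sup>2 \<le> \<bar>\<mu>\<bar> / 2 * (2 * r)\<^sup>2" by (rule mult_left_mono) simp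
    then have "\<bar>\<mu> / 2 * (norm (y1 - x0))\<^sup>2\<bar> \<le> \<bar>\<mu>\<bar> / 2 * (2 * r)\<^sup>2"
      by (simp only: abs_mult abs_divide abs_numeral abs_power2)
    then have q: "- (\<bar>\<mu>\<bar> / 2 * (2 * r)\<^sup>2) \<le> \<mu> / 2 * (norm (y1 - x0))\<^sup>2" unfolding abs_le_iff by linarith
    have "0 \<le> M' * (t1 - t0)\<^sup>2" using M' by simp
    then have "1 \<le> E ((x1, t1), y1)" using k p q unfolding E_def C0_def fst_conv snd_conv by linarith
    then show False using E0 by linarith
  qed
  have y1r: "norm (y1 - x0) < 2 * r"
  proof -
    have "norm (y1 - x0) \<le> norm (y1 - x1) + norm (x1 - x0)" using norm_triangle_ineq[of "y1 - x1" "x1 - x0"] by simp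
    then show ?thesis using close xt(1) \<kappa>(2) r(1) by (simp add: norm_minus_commute)
  qed
  have inner: "dist (x1, t1) (x0, t0) < r"
  proof (rule ccontr)
    assume "\<not> dist (x1, t1) (x0, t0) < r"
    then have "dist (x1, t1) (x0, t0) = r" using mem(2) by simp
    then have rr: "(norm (x1 - x0))\<^sup>2 + (t1 - t0)\<^sup>2 = r\<^sup>2"
    proof -
      have "(dist (x1, t1) (x0, t0))\<^sup>2 = (dist x1 x0)\<^sup>2 + (dist t1 t0)\<^sup>2" by (simp add: dist_Pair_Pair)
      then show ?thesis unfolding \<open>dist (x1, t1) (x0, t0) = r\<close> dist_norm[of x1] dist_real_def by simp
    qed
    let ?c = "min ((\<mu> - \<nu>) / 2) 1"
    have "?c * (norm (x1 - x0))\<^sup>2 \<le> (\<mu> - \<nu>) / 2 * (norm (x1 - x0))\<^sup>2" by (intro mult_right_mono min.cobounded1) simp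
    moreover have "?c * (t1 - t0)\<^sup>2 \<le> 1 * (t1 - t0)\<^sup>2" by (intro mult_right_mono min.cobounded2) simp
    moreover have "m = ?c * (norm (x1 - x0))\<^sup>2 + ?c * (t1 - t0)\<^sup>2" unfolding m_def rr[symmetric] by (rule distrib_left)
    ultimately have "m \<le> (\<mu> - \<nu>) / 2 * (norm (x1 - x0))\<^sup>2 + (t1 - t0)\<^sup>2" by linarith
    moreover have "0 \<le> b * (t1 - t0) + \<nu> / 2 * (norm (x1 - x0))\<^sup>2 + M * (t1 - t0)\<^sup>2"
      using mem r(2) by (intro lower) (auto simp: dist_commute)
    moreover have "(\<mu> - \<nu>) / 2 * (norm (x1 - x0))\<^sup>2 = \<mu> / 2 * (norm (x1 - x0))\<^sup>2 - \<nu> / 2 * (norm (x1 - x0))\<^sup>2"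
      by (simp add: diff_divide_distrib left_diff_distrib)
    moreover have "M' * (t1 - t0)\<^sup>2 = M * (t1 - t0)\<^sup>2 + (t1 - t0)\<^sup>2" by (simp add: M'_def distrib_right)
    ultimately have Q: "m \<le> b * (t1 - t0) + \<mu> / 2 * (norm (x1 - x0))\<^sup>2 + M' * (t1 - t0)\<^sup>2" by linarith
    have "\<bar>(norm (x1 - x0))\<^sup>2 - (norm (y1 - x0))\<^sup>2\<bar> = \<bar>norm (x1 - x0) - norm (y1 - x0)\<bar> * (norm (x1 - x0) + norm (y1 - x0))"
      by (simp add: power2_eq_square square_diff_square_factored abs_mult)
    also have "\<dots> \<le> \<kappa> * (3 * r)"
    proof (rule mult_mono)
      have "\<bar>norm (x1 - x0) - norm (y1 - x0)\<bar> \<le> norm ((x1 - x0) - (y1 - x0))" by (rule norm_triangle_ineq3)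
      then show "\<bar>norm (x1 - x0) - norm (y1 - x0)\<bar> \<le> \<kappa>" using close by simp
      show "norm (x1 - x0) + norm (y1 - x0) \<le> 3 * r" using xt(1) y1r by linarith
    qed (use \<kappa> in auto)
    finally have d: "\<bar>(norm (x1 - x0))\<^sup>2 - (norm (y1 - x0))\<^sup>2\<bar> \<le> \<kappa> * (3 * r)" .
    have "\<bar>\<mu> / 2 * ((norm (x1 - x0))\<^sup>2 - (norm (y1 - x0))\<^sup>2)\<bar> \<le> \<bar>\<mu>\<bar> / 2 * (\<kappa> * (3 * r))"
      unfolding abs_mult using d by (intro mult_mono) auto
    also have "\<dots> < (\<bar>\<mu>\<bar> + 1) * (\<kappa> * (3 * r))" using \<kappa>(1) r(1) by (intro mult_strict_right_mono) auto
    finally have "\<mu> / 2 * (norm (x1 - x0))\<^sup>2 - \<mu> / 2 * (norm (y1 - x0))\<^sup>2 < m"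
      using \<kappa>m unfolding right_diff_distrib by linarith
    moreover have "0 \<le> K * norm (x1 - y1) ^ 4" using K by simp
    ultimately show False using Q E0 unfolding E_def fst_conv snd_conv by linarith
  qed
  \<comment> \<open>Room to move x alone, or x and y together, within the domain over which E was
    minimised.\<close>
  define \<rho> where "\<rho> = min (r - dist (x1, t1) (x0, t0)) (2 * r - norm (y1 - x0))"
  have \<rho>: "\<rho> > 0" using inner y1r by (simp add: \<rho>_def)
  have near: "dist w (x0, t0) \<le> r" "norm (fst w - x1) \<le> 2 * r - norm (y1 - x0)" if "w \<in> cball (x1, t1) \<rho>" for w
  proof -
    have d: "dist w (x1, t1) \<le> \<rho>" using that by (simp add: dist_commute)
    show "dist w (x0, t0) \<le> r" using dist_triangle[of w "(x0, t0)" "(x1, t1)"] d by (simp add: \<rho>_def)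
    have "dist (fst w) x1 \<le> dist w (x1, t1)" using dist_fst_le[of w "(x1, t1)"] by simp
    then show "norm (fst w - x1) \<le> 2 * r - norm (y1 - x0)" using d unfolding dist_norm \<rho>_def by simp
  qed
  have t1: "t1 > 0" using xt(2) r(3) z0(2) by linarith
  have "\<bar>M' * (t1 - t0)\<bar> \<le> M' * r" unfolding abs_mult using M' xt(2) by (intro mult_mono) auto
  then have "- (M' * r) \<le> M' * (t1 - t0)" unfolding abs_le_iff by linarith
  then have b1: "b + 2 * M' * (t1 - t0) > \<mu>" using rM by (simp only: mult.assoc)
  note touch = touching_test_function[OF fam par \<tau> mem(1) t1 \<rho>]
  show False
  proof (cases "y1 = x0")
    case False
    \<comment> \<open>Translating y along with x keeps the quartic term constant, so the remaining
      function of x is a paraboloid with centre c and gradient \<mu> (y1 - x0) at x1.\<close>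
    define c where "c = x0 + (x1 - y1)"
    define \<Psi> where "\<Psi> z = \<mu> / 2 * (norm (fst z - c))\<^sup>2 + b * (snd z - t0) + M' * (snd z - t0)\<^sup>2" for z :: "(real^2) \<times> real"
    have so: "second_order_at \<Psi> (\<lambda>z. \<mu> *\<^sub>R (fst z - c)) (b + 2 * M' * (t1 - t0)) (\<mu> / 2) 0 (\<mu> / 2) (x1, t1)"
      unfolding \<Psi>_def by (rule second_order_at_paraboloid) (use M' in simp)
    define p where "p = \<mu> *\<^sub>R (x1 - c)"
    have p: "p = (\<lambda>z. \<mu> *\<^sub>R (fst z - c)) (x1, t1)" by (simp add: p_def)
    have p0: "p \<noteq> 0" using False \<mu>(3) by (simp add: p_def c_def)
    have cont: "continuous_on (cball (x1, t1) \<rho>) \<Psi>" unfolding \<Psi>_def by (intro continuous_intros)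
    have tmin: "\<Psi> (x1, t1) \<le> \<Psi> w" if w: "w \<in> limit_set \<tau> U" "w \<in> cball (x1, t1) \<rho>" for w
    proof -
      obtain x t where xt: "w = (x, t)" by (cases w)
      have "norm ((x - (x1 - y1)) - x0) = norm ((x - x1) + (y1 - x0))" by (simp add: algebra_simps)
      also have "\<dots> \<le> norm (x - x1) + norm (y1 - x0)" by (rule norm_triangle_ineq)
      finally have "norm ((x - (x1 - y1)) - x0) \<le> 2 * r" using near(2)[OF w(2)] by (simp add: xt)
      then have "E ((x1, t1), y1) \<le> E ((x, t), x - (x1 - y1))"
        using w near(1)[OF w(2)] by (intro min) (auto simp: xt)
      moreover have "x - (x1 - y1) - x0 = x - c" "x1 - c = y1 - x0" by (simp_all add: c_def algebra_simps)
      ultimately show ?thesis unfolding E_def \<Psi>_def xt by simp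
    qed
    have "(b + 2 * M' * (t1 - t0)) * (norm p)\<^sup>2 \<le> 2 * (\<mu> / 2 * (p $ 2)\<^sup>2 - 0 * p $ 1 * p $ 2 + \<mu> / 2 * (p $ 1)\<^sup>2)"
      by (rule touch(1)[OF _ cont tmin so p p0])
    also have "\<dots> = \<mu> * (norm p)\<^sup>2" unfolding norm_sq_vec2 by (simp add: algebra_simps)
    finally have "b + 2 * M' * (t1 - t0) \<le> \<mu>" using p0 by simp
    then show False using b1 by simp
  next
    case True
    have dbl: "K * norm (x1 - x0) ^ 4 \<le> \<mu> / 2 * (norm (y - x0))\<^sup>2 + K * norm (x1 - y) ^ 4" if "y \<in> cball x0 (2 * r)" for y
      using min[of x1 t1 y] mem that by (simp add: E_def True dist_norm norm_minus_commute)
    have x1: "x1 = x0" and "\<mu> \<ge> 0"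
      using minimum_of_doubling[where x = x1 and ?x0.0 = x0 and R = "2 * r" and \<mu> = \<mu>, OF K _ dbl] r(1) by auto
    then have \<mu>0: "\<mu> > 0" using \<mu>(3) by simp
    \<comment> \<open>The term K (t - t1)^2 is absent from E; it is harmless because it is
      nonnegative and vanishes at t1, and it completes the penalty function. The paraboloid with
      coefficient 0 carries the time dependence.\<close>
    define \<Psi> where "\<Psi> z = K * (norm (fst z - x0) ^ 4 + (snd z - t1)\<^sup>2) + (0 / 2 * (norm (fst z - x0))\<^sup>2 + b * (snd z - t0) + M' * (snd z - t0)\<^sup>2)" for z :: "(real^2) \<times> real"
    define P where "P z = K *\<^sub>R ((4 * (norm (fst z - x0))\<^sup>2) *\<^sub>R (fst z - x0)) + 0 *\<^sub>R (fst z - x0)" for z :: "(real^2) \<times> real"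
    have so: "second_order_at \<Psi> P (K * 0 + (b + 2 * M' * (t1 - t0))) (K * 0 + 0 / 2) (K * 0 + 0) (K * 0 + 0 / 2) (x1, t1)"
      unfolding \<Psi>_def P_def x1
      by (intro second_order_at_add second_order_at_scale second_order_at_penalty second_order_at_paraboloid K) (use M' in simp)
    have cont: "continuous_on (cball (x1, t1) \<rho>) \<Psi>" unfolding \<Psi>_def by (intro continuous_intros)
    have tmin: "\<Psi> (x1, t1) \<le> \<Psi> w" if w: "w \<in> limit_set \<tau> U" "w \<in> cball (x1, t1) \<rho>" for w
    proof -
      obtain x t where xt: "w = (x, t)" by (cases w)
      have "E ((x1, t1), y1) \<le> E ((x, t), x0)"
        using w near(1)[OF w(2)] r(1) by (intro min) (auto simp: xt)
      moreover have "0 \<le> K * (t - t1)\<^sup>2" using K by simp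
      ultimately show ?thesis unfolding E_def \<Psi>_def xt True x1 by (simp add: distrib_left)
    qed
    have "K * 0 + (b + 2 * M' * (t1 - t0)) \<le> 0"
      by (rule touch(2)[OF _ cont tmin so refl]) (simp_all add: P_def x1)
    then show False using b1 \<mu>0 by simp
  qed
qed

section \<open>The viscosity inequalities\<close>

text \<open>For a nonzero gradient the claim is the touching inequality applied to the test function
  itself. For a zero gradient, trace minus least eigenvalue is the largest eigenvalue, so the claim
  reads b \<le> \<open>lambda_max H\<close>; its failure leaves a gap in which to place the
  constants of the doubling argument.\<close>

lemma limit_set_viscosity:
  fixes x :: "real^2"
  assumes fam: "threshold_family \<tau> U"
    and par: "C > 0" "\<gamma> > 1" and \<tau>: "\<And>h. h > 0 \<Longrightarrow> \<tau> h > 0 \<and> h = C * \<tau> h powr \<gamma>"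
    and C2: "Ck_on 2 space_time \<phi>" and t: "t > 0" and z: "(x, t) \<in> limit_set \<tau> U"
    and min: "\<forall>\<^sub>F w in nhds (x, t). w \<in> limit_set \<tau> U \<longrightarrow> \<phi> (x, t) \<le> \<phi> w"
  shows "space_grad \<phi> x t \<noteq> 0 \<Longrightarrow> time_deriv \<phi> x t - space_laplacian \<phi> x t +
      ((space_hessian \<phi> x t *v space_grad \<phi> x t) \<bullet> space_grad \<phi> x t) / (norm (space_grad \<phi> x t))\<^sup>2 \<le> 0"
    and "space_grad \<phi> x t = 0 \<Longrightarrow> time_deriv \<phi> x t - space_laplacian \<phi> x t + lambda_min (space_hessian \<phi> x t) \<le> 0"
proof -
  define H where "H = space_hessian \<phi> x t"
  define b where "b = time_deriv \<phi> x t"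
  have st: "(x, t) \<in> space_time" using t by (simp add: space_time_iff)
  note Hd = space_hessian_C2[OF C2 t, of x, folded H_def]
  have bd: "b = dir1 \<phi> X3 (x, t)" unfolding b_def by (rule time_deriv_C2[OF C2 t])
  have tr: "space_laplacian \<phi> x t = H $ 1 $ 1 + H $ 2 $ 2"
    by (simp add: space_laplacian_def laplacian_def H_def space_hessian_def trace_def sum_2)
  have "\<forall>\<^sub>F w in nhds (x, t). w \<in> space_time"
    using open_space_time st by (rule eventually_nhds_in_open)
  with min have "\<forall>\<^sub>F w in nhds (x, t). (w \<in> limit_set \<tau> U \<longrightarrow> \<phi> (x, t) \<le> \<phi> w) \<and> w \<in> space_time"
    by (rule eventually_conj)
  then obtain d where d: "d > 0" "\<And>w. dist w (x, t) < d \<Longrightarrow> (w \<in> limit_set \<tau> U \<longrightarrow> \<phi> (x, t) \<le> \<phi> w) \<and> w \<in> space_time"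
    unfolding eventually_nhds_metric by blast
  define r where "r = d / 2"
  have r: "r > 0" using d(1) by (simp add: r_def)
  have dr: "(w \<in> limit_set \<tau> U \<longrightarrow> \<phi> (x, t) \<le> \<phi> w) \<and> w \<in> space_time" if "w \<in> cball (x, t) r" for w
    using that d(1) by (intro d(2)) (auto simp: r_def dist_commute)
  have "cball (x, t) r \<subseteq> space_time" using dr by blast
  then have cont: "continuous_on (cball (x, t) r) \<phi>"
    by (rule continuous_on_subset[OF C2_continuous_on[OF C2]])
  have tmin: "\<phi> (x, t) \<le> \<phi> w" if "w \<in> limit_set \<tau> U" "w \<in> cball (x, t) r" for w using dr that by blast
  define p where "p = sgrad \<phi> (x, t)"
  have p: "space_grad \<phi> x t = p" unfolding p_def by (rule space_grad_C2[OF C2 t])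
  note touch = touching_test_function[OF fam par \<tau> z t r cont tmin second_order_at_C2[OF C2 st] p_def]
  show "time_deriv \<phi> x t - space_laplacian \<phi> x t + ((space_hessian \<phi> x t *v space_grad \<phi> x t) \<bullet> space_grad \<phi> x t) / (norm (space_grad \<phi> x t))\<^sup>2 \<le> 0"
    if "space_grad \<phi> x t \<noteq> 0"
  proof -
    have p0: "p \<noteq> 0" using that by (simp add: p)
    have N: "(norm p)\<^sup>2 > 0" using p0 by simp
    have "b * (norm p)\<^sup>2 \<le> 2 * (H $ 1 $ 1 / 2 * (p $ 2)\<^sup>2 - (H $ 2 $ 1 + H $ 1 $ 2) / 2 * p $ 1 * p $ 2 + H $ 2 $ 2 / 2 * (p $ 1)\<^sup>2)"
      unfolding bd Hd by (rule touch(1)) (use p0 in auto)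
    also have "\<dots> = H $ 1 $ 1 * (p $ 2)\<^sup>2 - (H $ 2 $ 1 + H $ 1 $ 2) * p $ 1 * p $ 2 + H $ 2 $ 2 * (p $ 1)\<^sup>2"
      by (simp add: algebra_simps)
    \<comment> \<open>In the plane, the Hessian applied to the rotated gradient equals trace times
      |p|^2 minus the Hessian applied to the gradient.\<close>
    also have "\<dots> = (H $ 1 $ 1 + H $ 2 $ 2) * (norm p)\<^sup>2 - (H *v p) \<bullet> p"
      unfolding norm_sq_vec2 inner_vec_def sum_2 matrix_vector_2 by (simp add: power2_eq_square algebra_simps)
    finally have "b * (norm p)\<^sup>2 - (H $ 1 $ 1 + H $ 2 $ 2) * (norm p)\<^sup>2 + (H *v p) \<bullet> p \<le> 0" by simp
    then have "(b * (norm p)\<^sup>2 - (H $ 1 $ 1 + H $ 2 $ 2) * (norm p)\<^sup>2 + (H *v p) \<bullet> p) / (norm p)\<^sup>2 \<le> 0"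
      using N by (intro divide_nonpos_pos)
    also have "(b * (norm p)\<^sup>2 - (H $ 1 $ 1 + H $ 2 $ 2) * (norm p)\<^sup>2 + (H *v p) \<bullet> p) / (norm p)\<^sup>2
        = b - (H $ 1 $ 1 + H $ 2 $ 2) + ((H *v p) \<bullet> p) / (norm p)\<^sup>2"
    proof -
      have "(b * k - h * k + q) / k = b - h + q / k" if "k > 0" for k h q :: real
        using that by (simp add: add_divide_distrib diff_divide_distrib)
      from this[OF N] show ?thesis .
    qed
    finally show ?thesis by (simp add: p tr b_def H_def)
  qed
  show "time_deriv \<phi> x t - space_laplacian \<phi> x t + lambda_min (space_hessian \<phi> x t) \<le> 0" if "space_grad \<phi> x t = 0"
  proof (rule ccontr)
    assume "\<not> ?thesis"
    moreover have sym: "H $ 1 $ 2 = H $ 2 $ 1" unfolding H_def by (rule space_hessian_symmetric[OF C2 t])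
    moreover have "lambda_min H + lambda_max H = H $ 1 $ 1 + H $ 2 $ 2"
      using lambda_symmetric_2(1)[OF sym] by (simp add: trace_def sum_2)
    ultimately have bl: "lambda_max H < b" unfolding tr b_def H_def by linarith
    \<comment> \<open>Strictly between \<open>lambda_max H\<close> and b, and nonzero: positive if b
      is positive, and otherwise negative because both ends are at most 0.\<close>
    define \<mu> where "\<mu> = (if b > 0 then (max (lambda_max H) 0 + b) / 2 else (lambda_max H + b) / 2)"
    have \<mu>: "lambda_max H < \<mu>" "\<mu> < b" "\<mu> \<noteq> 0" using bl by (auto simp: \<mu>_def max_def)
    define \<nu> where "\<nu> = (lambda_max H + \<mu>) / 2"
    have \<nu>: "\<nu> < \<mu>" "lambda_max H < \<nu>" using \<mu>(1) by (auto simp: \<nu>_def)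
    have e: "(\<nu> - lambda_max H) / 2 > 0" using \<nu>(2) by simp
    obtain r2 M where r2: "r2 > 0" "M > 0" "\<And>y s. dist (y, s) (x, t) < r2 \<Longrightarrow> \<phi> (y, s) \<le> \<phi> (x, t) + sgrad \<phi> (x, t) \<bullet> (y - x) + (s - t) * dir1 \<phi> X3 (x, t)
     + quad (dir2 \<phi> X1 X1 (x, t)) (dir2 \<phi> X1 X2 (x, t) + dir2 \<phi> X2 X1 (x, t)) (dir2 \<phi> X2 X2 (x, t)) ((y - x) $ 1) ((y - x) $ 2) / 2
     + (\<nu> - lambda_max H) / 2 * (norm (y - x))\<^sup>2 + M * (s - t)\<^sup>2"
      using quadratic_upper_bound_C2[OF C2 st e] by blast
    define r0 where "r0 = min r (r2 / 2)"
    have r0: "r0 > 0" using r r2(1) by (simp add: r0_def)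
    show False
    proof (rule doubling_contradiction[OF fam par \<tau> z t r0 less_imp_le[OF r2(2)] \<nu>(1) \<mu>(2,3)])
      fix y s assume l: "(y, s) \<in> limit_set \<tau> U" "(y, s) \<in> cball (x, t) r0"
      have "(y, s) \<in> cball (x, t) r" using l(2) by (simp add: r0_def)
      from tmin[OF l(1) this] have "\<phi> (x, t) \<le> \<phi> (y, s)" .
      also have "dist (y, s) (x, t) < r2" using l(2) r2(1) by (simp add: r0_def dist_commute)
      note r2(3)[OF this]
      finally have 1: "0 \<le> sgrad \<phi> (x, t) \<bullet> (y - x) + (s - t) * b
        + quad (H $ 1 $ 1) (H $ 2 $ 1 + H $ 1 $ 2) (H $ 2 $ 2) ((y - x) $ 1) ((y - x) $ 2) / 2
        + (\<nu> - lambda_max H) / 2 * (norm (y - x))\<^sup>2 + M * (s - t)\<^sup>2"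
        unfolding bd Hd by linarith
      have 2: "sgrad \<phi> (x, t) = 0" using that p by (simp add: p_def)
      have 3: "quad (H $ 1 $ 1) (H $ 2 $ 1 + H $ 1 $ 2) (H $ 2 $ 2) ((y - x) $ 1) ((y - x) $ 2) / 2 \<le> lambda_max H / 2 * (norm (y - x))\<^sup>2"
      proof -
        have "quad (H $ 1 $ 1) (H $ 2 $ 1 + H $ 1 $ 2) (H $ 2 $ 2) ((y - x) $ 1) ((y - x) $ 2) \<le> lambda_max H * (norm (y - x))\<^sup>2"
          unfolding norm_sq_vec2 using lambda_symmetric_2(2)[OF sym, of "(y - x) $ 1" "(y - x) $ 2"] by (simp only: add.commute[of "H $ 2 $ 1"])
        moreover have "p / 2 \<le> l / 2 * q" if "p \<le> l * q" for p l q :: real using that by simp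
        ultimately show ?thesis by blast
      qed
      have 4: "(\<nu> - lambda_max H) / 2 * N + lambda_max H / 2 * N = \<nu> / 2 * N" for N
        by (simp add: field_simps)
      show "0 \<le> b * (s - t) + \<nu> / 2 * (norm (y - x))\<^sup>2 + M * (s - t)\<^sup>2"
        using 1 3 4[of "(norm (y - x))\<^sup>2"] unfolding 2 inner_zero_left mult.commute[of "s - t" b] by linarith
    qed
  qed
qed

text \<open>The Limsup along the trivial filter would be minus infinity, so this is what makes the
  upper limit equal to -1 off the limit set.\<close>

lemma grid_filter_neq_bot:
  fixes \<tau> :: "real \<Rightarrow> real"
  assumes par: "C > 0" "\<gamma> > 1" and \<tau>: "\<And>h. h > 0 \<Longrightarrow> \<tau> h > 0 \<and> h = C * \<tau> h powr \<gamma>" and "t > 0"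
  shows "grid_filter \<tau> x t \<noteq> bot"
proof
  assume "grid_filter \<tau> x t = bot"
  then have "eventually (\<lambda>_. False) (grid_filter \<tau> x t)" by simp
  then obtain \<delta> where \<delta>: "\<delta> > 0" "\<And>h k m n. 0 < h \<Longrightarrow> h < \<delta> \<Longrightarrow> \<not> dist (grid_event \<tau> h k m n) (x, t) < \<delta>"
    unfolding eventually_grid_filter by blast
  have "\<forall>\<^sub>F h in at_right 0. dist (\<tau> h) 0 < \<delta> / 3"
    using time_step_asymptotics(1)[OF par \<tau>] \<delta>(1) by (intro tendstoD) auto
  then obtain d where d: "d > 0" "\<And>h. 0 < h \<Longrightarrow> h < d \<Longrightarrow> dist (\<tau> h) 0 < \<delta> / 3"
    unfolding eventually_at_right_field by auto
  \<comment> \<open>Rounding down costs at most h in each space coordinate and \<tau> h in time;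
    each of the three is at most \<delta> / 3, the last one strictly less.\<close>
  define h where "h = min (d / 2) (\<delta> / 3)"
  have h: "0 < h" "h < d" "h \<le> \<delta> / 3" using d(1) \<delta>(1) by (auto simp: h_def)
  have T: "\<tau> h > 0" "\<tau> h < \<delta> / 3" using \<tau>[OF h(1)] d(2)[OF h(1,2)] by auto
  define k m n where "k = nat \<lfloor>t / \<tau> h\<rfloor>" and "m = \<lfloor>x $ 1 / h\<rfloor>" and "n = \<lfloor>x $ 2 / h\<rfloor>"
  have floor: "\<bar>of_int \<lfloor>a / c\<rfloor> * c - a\<bar> \<le> c" if "c > 0" for a c :: real
  proof -
    have "of_int \<lfloor>a / c\<rfloor> * c \<le> a / c * c" using that by (intro mult_right_mono) auto
    moreover have "(a / c - 1) * c \<le> of_int \<lfloor>a / c\<rfloor> * c" using that by (intro mult_right_mono) linarith+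
    ultimately show ?thesis using that by (simp add: left_diff_distrib abs_le_iff)
  qed
  have "0 \<le> \<lfloor>t / \<tau> h\<rfloor>" using assms(4) T(1) by simp
  then have "of_nat k = (of_int \<lfloor>t / \<tau> h\<rfloor> :: real)" by (simp add: k_def)
  then have k: "dist (of_nat k * \<tau> h) t \<le> \<tau> h" using floor[OF T(1), of t] by (simp add: dist_real_def)
  have "dist (grid_point h m n) x \<le> \<bar>(grid_point h m n - x) $ 1\<bar> + \<bar>(grid_point h m n - x) $ 2\<bar>"
    unfolding dist_norm using norm_le_l1_cart[of "grid_point h m n - x"] by (simp only: sum_2)
  also have "\<dots> \<le> h + h" using floor[OF h(1), of "x $ 1"] floor[OF h(1), of "x $ 2"] by (intro add_mono) (simp_all add: m_def n_def)
  finally have "dist (grid_point h m n) x \<le> h + h" .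
  moreover have "dist (grid_event \<tau> h k m n) (x, t) \<le> dist (grid_point h m n) x + dist (of_nat k * \<tau> h) t"
    unfolding dist_Pair_Pair by (rule sqrt_sum_squares_le_sum) auto
  ultimately have "dist (grid_event \<tau> h k m n) (x, t) < \<delta>" using k T(2) h(3) by linarith
  then show False using \<delta>(2)[OF h(1), of m n k] h(3) \<delta>(1) by simp
qed

lemma upper_limit_eq:
  fixes u :: "real \<Rightarrow> nat \<Rightarrow> int \<Rightarrow> int \<Rightarrow> real"
  assumes u: "\<And>h k m n. h > 0 \<Longrightarrow> u h k m n \<in> {-1, 1}" and nb: "grid_filter \<tau> x t \<noteq> bot"
  shows "upper_limit \<tau> u (x, t) = (if (x, t) \<in> limit_set \<tau> (\<lambda>h k m n. u h k m n = 1) then 1 else -1)"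
proof -
  let ?F = "grid_filter \<tau> x t" and ?f = "\<lambda>(h, k, m, n). ereal (u h k m n)"
  have pos: "eventually (\<lambda>(h, k, m, n). h > 0) ?F"
    unfolding eventually_grid_filter by (auto intro!: exI[of _ 1])
  have "Limsup ?F ?f = (if (x, t) \<in> limit_set \<tau> (\<lambda>h k m n. u h k m n = 1) then 1 else -1)"
  proof (cases "(x, t) \<in> limit_set \<tau> (\<lambda>h k m n. u h k m n = 1)")
    case True
    have "Limsup ?F ?f \<le> 1"
    proof (rule Limsup_bounded)
      show "\<forall>\<^sub>F z in ?F. ?f z \<le> 1"
        using pos
      proof eventually_elim
        case (elim z)
        obtain h k m n where z: "z = (h, k, m, n)" by (cases z)
        show ?case using elim u[of h k m n] by (auto simp: z one_ereal_def)
      qed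
    qed
    moreover have "\<not> Limsup ?F ?f < 1"
    proof
      assume "Limsup ?F ?f < 1"
      then have "\<forall>\<^sub>F z in ?F. ?f z < 1" by (rule Limsup_lessD)
      then have "\<forall>\<^sub>F z in ?F. \<not> (case z of (h, k, m, n) \<Rightarrow> u h k m n = 1)"
        by eventually_elim (auto simp: one_ereal_def)
      then show False using True by (simp add: limit_set_def frequently_def)
    qed
    ultimately have "Limsup ?F ?f = 1" by simp
    then show ?thesis using True by simp
  next
    case False
    then have "\<forall>\<^sub>F z in ?F. \<not> (case z of (h, k, m, n) \<Rightarrow> u h k m n = 1)"
      by (simp add: limit_set_def frequently_def)
    then have "\<forall>\<^sub>F z in ?F. ?f z = -1"
      using pos
    proof eventually_elim
      case (elim z)
      obtain h k m n where z: "z = (h, k, m, n)" by (cases z)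
      show ?case using elim u[of h k m n] by (auto simp: z one_ereal_def)
    qed
    then have "Limsup ?F ?f = Limsup ?F (\<lambda>_. -1)" by (rule Limsup_eq)
    also have "\<dots> = -1" using nb by (rule Limsup_const)
    finally show ?thesis using False by simp
  qed
  then show ?thesis unfolding upper_limit_def by simp
qed

text \<open>The upper limit takes the value 1 on the closed limit set and -1 off it. On the set, a
  maximum of the limit minus \<phi> makes \<phi> minimal relative to the set; off it the limit is
  locally constant and \<phi> has an ordinary local minimum.\<close>

lemma upper_limit_subsolution:
  fixes u :: "real \<Rightarrow> nat \<Rightarrow> int \<Rightarrow> int \<Rightarrow> real"
  assumes par: "C > 0" "\<gamma> > 1" and \<tau>: "\<And>h. h > 0 \<Longrightarrow> \<tau> h > 0 \<and> h = C * \<tau> h powr \<gamma>"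
    and u: "\<And>h k m n. h > 0 \<Longrightarrow> u h k m n \<in> {-1, 1}"
    and fam: "threshold_family \<tau> (\<lambda>h k m n. u h k m n = 1)"
  shows "viscosity_subsolution (upper_limit \<tau> u)"
proof -
  let ?S = "limit_set \<tau> (\<lambda>h k m n. u h k m n = 1)"
  have val: "upper_limit \<tau> u w = (if w \<in> ?S then 1 else -1)" if "w \<in> space_time" for w
  proof -
    obtain x t where w: "w = (x, t)" by (cases w)
    have "t > 0" using that by (simp add: w space_time_iff)
    from upper_limit_eq[OF u grid_filter_neq_bot[OF par \<tau> this]] show ?thesis by (simp add: w)
  qed
  have out: "\<forall>\<^sub>F w in nhds z. w \<notin> ?S" if "z \<notin> ?S" for z
    using eventually_nhds_in_open[of "- ?S" z] closed_limit_set[of \<tau>] that by (simp add: open_Compl)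
  have "locally_bounded_on space_time (upper_limit \<tau> u)"
    unfolding locally_bounded_on_def by (intro ballI exI[of _ 1] always_eventually) (auto simp: val)
  moreover have "usc_on space_time (upper_limit \<tau> u)"
    unfolding usc_on_def
  proof (intro ballI allI impI)
    fix z c assume z: "z \<in> space_time" and c: "upper_limit \<tau> u z < c"
    show "\<forall>\<^sub>F y in at z within space_time. upper_limit \<tau> u y < c"
    proof (cases "z \<in> ?S")
      case True
      then have "1 < c" using c val[OF z] by simp
      then show ?thesis unfolding eventually_at_filter by (intro always_eventually) (auto simp: val)
    next
      case False
      then have "-1 < c" using c val[OF z] by simp
      then show ?thesis unfolding eventually_at_filter
        using out[OF False] by (auto simp: val elim!: eventually_mono)
    qed
  qed
  moreover have "let p = space_grad \<phi> x t; H = space_hessian \<phi> x t in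
          (p \<noteq> 0 \<longrightarrow> time_deriv \<phi> x t - space_laplacian \<phi> x t + ((H *v p) \<bullet> p) / (norm p)\<^sup>2 \<le> 0) \<and>
          (p = 0 \<longrightarrow> time_deriv \<phi> x t - space_laplacian \<phi> x t + lambda_min H \<le> 0)"
    if \<phi>: "Ck_on 2 space_time \<phi>" and t: "t > 0"
      and max: "\<forall>\<^sub>F z in nhds (x, t). upper_limit \<tau> u z - \<phi> z \<le> upper_limit \<tau> u (x, t) - \<phi> (x, t)" for \<phi> x t
  proof -
    have z: "(x, t) \<in> space_time" using t by (simp add: space_time_iff)
    have st: "\<forall>\<^sub>F w in nhds (x, t). w \<in> space_time"
      using open_space_time z by (rule eventually_nhds_in_open)
    obtain U where U: "threshold_family \<tau> U" "(x, t) \<in> limit_set \<tau> U"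
      "\<forall>\<^sub>F w in nhds (x, t). w \<in> limit_set \<tau> U \<longrightarrow> \<phi> (x, t) \<le> \<phi> w"
    proof (cases "(x, t) \<in> ?S")
      case True
      have "\<forall>\<^sub>F w in nhds (x, t). w \<in> ?S \<longrightarrow> \<phi> (x, t) \<le> \<phi> w"
        using max st by eventually_elim (use True z in \<open>auto simp: val\<close>)
      then show ?thesis using that[of "\<lambda>h k m n. u h k m n = 1"] fam True by blast
    next
      case False
      \<comment> \<open>The full family has every point of positive time in its limit set, so an
        ordinary local minimum of \<phi> is the same touching situation and needs no separate
        argument.\<close>
      let ?T = "\<lambda>h k m n. True"
      have "threshold_family \<tau> ?T" by (simp add: threshold_family_def)
      moreover have "(x, t) \<in> limit_set \<tau> ?T"
        using grid_filter_neq_bot[OF par \<tau> t] by (simp add: limit_set_def frequently_def)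
      moreover have "\<forall>\<^sub>F w in nhds (x, t). w \<in> limit_set \<tau> ?T \<longrightarrow> \<phi> (x, t) \<le> \<phi> w"
        using max st out[OF False] by eventually_elim (use False z in \<open>auto simp: val\<close>)
      ultimately show ?thesis using that[of ?T] by blast
    qed
    show ?thesis
      using limit_set_viscosity[OF U(1) par \<tau> \<phi> t U(2,3)] by (simp add: Let_def)
  qed
  ultimately show ?thesis unfolding viscosity_subsolution_def by blast
qed

section \<open>Reflection\<close>

lemma Ck_on_cong:
  assumes "open S" "Ck_on k S f" "\<And>x. x \<in> S \<Longrightarrow> f x = g x"
  shows "Ck_on k S g"
  using assms(2,3)
proof (induction k arbitrary: f g)
  case 0
  then show ?case using continuous_on_cong[of S S f g] by simp
next
  case (Suc k)
  have d: "(g has_derivative frechet_derivative f (at x)) (at x)" if "x \<in> S" for x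
    by (rule has_derivative_transform_within_open[OF _ assms(1) that Suc.prems(2)])
      (use Suc.prems(1) that in \<open>auto simp: frechet_derivative_works[symmetric]\<close>)
  have "g differentiable (at x)" if "x \<in> S" for x using d[OF that] by (rule differentiableI)
  moreover have "frechet_derivative f (at x) v = frechet_derivative g (at x) v" if "x \<in> S" for x v
    by (rule fun_cong[OF frechet_derivative_at[OF d[OF that]]])
  then have "Ck_on k S (\<lambda>x. frechet_derivative g (at x) v)" for v
  proof (rule Suc.IH[rotated])
    show "Ck_on k S (\<lambda>x. frechet_derivative f (at x) v)" using Suc.prems(1) by simp
  qed
  ultimately show ?case by simp
qed

text \<open>The derivative of -f is known to be minus that of f only on S, so the induction step
  passes through \<open>Ck_on_cong\<close>.\<close>

lemma Ck_on_uminus: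
  assumes "open S" "Ck_on k S f"
  shows "Ck_on k S (\<lambda>x. - f x)"
  using assms(2)
proof (induction k arbitrary: f)
  case 0
  then show ?case by (auto intro: continuous_on_minus)
next
  case (Suc k)
  have d: "((\<lambda>x. - f x) has_derivative (\<lambda>v. - frechet_derivative f (at x) v)) (at x)" if "x \<in> S" for x
    using Suc.prems that by (intro has_derivative_minus) (auto simp: frechet_derivative_works[symmetric])
  have "(\<lambda>x. - f x) differentiable (at x)" if "x \<in> S" for x using d[OF that] by (rule differentiableI)
  moreover have "Ck_on k S (\<lambda>x. frechet_derivative (\<lambda>x. - f x) (at x) v)" for v
  proof (rule Ck_on_cong[OF assms(1) Suc.IH])
    show "Ck_on k S (\<lambda>x. frechet_derivative f (at x) v)" using Suc.prems by simp
    show "- frechet_derivative f (at x) v = frechet_derivative (\<lambda>x. - f x) (at x) v" if "x \<in> S" for x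
      using fun_cong[OF frechet_derivative_at[OF d[OF that]], of v] by simp
  qed
  ultimately show ?case by simp
qed

lemma uminus_derivatives:
  fixes \<phi> :: "(real^2) \<times> real \<Rightarrow> real"
  assumes C2: "Ck_on 2 space_time \<phi>" and t: "t > 0"
  defines "\<psi> \<equiv> \<lambda>z. - \<phi> z"
  shows "space_grad \<psi> x t = - space_grad \<phi> x t" "time_deriv \<psi> x t = - time_deriv \<phi> x t"
    "space_hessian \<psi> x t = - space_hessian \<phi> x t" "space_laplacian \<psi> x t = - space_laplacian \<phi> x t"
    "lambda_min (space_hessian \<psi> x t) = - lambda_max (space_hessian \<phi> x t)"
proof -
  have C2': "Ck_on 2 space_time \<psi>" unfolding \<psi>_def by (rule Ck_on_uminus[OF open_space_time C2])
  have z: "(x, t) \<in> space_time" using t by (simp add: space_time_iff)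
  have d1: "dir1 \<psi> v w = - dir1 \<phi> v w" if "w \<in> space_time" for v w
    using fun_cong[OF has_derivative_unique[OF C2_d1[OF C2' that] has_derivative_minus[OF C2_d1[OF C2 that], folded \<psi>_def]], of v] .
  have d2: "dir2 \<psi> v w (x, t) = - dir2 \<phi> v w (x, t)" for v w
  proof -
    have "(dir1 \<psi> w has_derivative (\<lambda>v. - dir2 \<phi> v w (x, t))) (at (x, t))"
      by (rule has_derivative_transform_within_open[OF has_derivative_minus[OF C2_d2[OF C2 z]] open_space_time z]) (simp add: d1)
    from fun_cong[OF has_derivative_unique[OF C2_d2[OF C2' z] this], of v] show ?thesis .
  qed
  show "space_grad \<psi> x t = - space_grad \<phi> x t"
    unfolding space_grad_C2[OF C2' t] space_grad_C2[OF C2 t] by (simp add: vec_eq_iff forall_2 d1[OF z])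
  show "time_deriv \<psi> x t = - time_deriv \<phi> x t"
    unfolding time_deriv_C2[OF C2' t] time_deriv_C2[OF C2 t] by (rule d1[OF z])
  show H: "space_hessian \<psi> x t = - space_hessian \<phi> x t"
    by (simp add: vec_eq_iff forall_2 space_hessian_C2[OF C2' t] space_hessian_C2[OF C2 t] d2)
  then show "space_laplacian \<psi> x t = - space_laplacian \<phi> x t"
    by (simp add: space_laplacian_def laplacian_def space_hessian_def[symmetric] trace_def sum_2)
  have eig: "eigenvalues (- A) = uminus ` eigenvalues A" for A :: "real^2^2"
  proof -
    have mv: "(- A) *v v = - (A *v v)" for v by (simp add: vec_eq_iff forall_2 matrix_vector_2)
    have eq: "- (A *v v) = l *\<^sub>R v \<longleftrightarrow> A *v v = (- l) *\<^sub>R v" for l v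
      by (metis minus_equation_iff scaleR_minus_left)
    have "l \<in> eigenvalues (- A) \<longleftrightarrow> - l \<in> eigenvalues A" for l
      unfolding eigenvalues_def mem_Collect_eq mv eq ..
    moreover have "- l \<in> E \<longleftrightarrow> l \<in> uminus ` E" for l and E :: "real set"
      by (auto intro: image_eqI[of l uminus "- l"])
    ultimately show ?thesis by (intro set_eqI) simp
  qed
  obtain l1 l2 where l: "eigenvalues (space_hessian \<phi> x t) = {l1, l2}" "l1 \<le> l2"
    using eigenvalues_symmetric_2[OF space_hessian_symmetric[OF C2 t, of x]] by metis
  then show "lambda_min (space_hessian \<psi> x t) = - lambda_max (space_hessian \<phi> x t)"
    unfolding H lambda_min_def lambda_max_def eig by simp
qed

text \<open>The operator is odd under reflection of the function, and least and largest eigenvalues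
  are exchanged.\<close>

lemma viscosity_supersolution_uminus:
  assumes "viscosity_subsolution v"
  shows "viscosity_supersolution (\<lambda>z. - v z)"
proof -
  have lb: "locally_bounded_on space_time v" and us: "usc_on space_time v"
    using assms by (auto simp: viscosity_subsolution_def)
  have "locally_bounded_on space_time (\<lambda>z. - v z)" using lb by (simp add: locally_bounded_on_def)
  moreover have "lsc_on space_time (\<lambda>z. - v z)"
    unfolding lsc_on_def
  proof (intro ballI allI impI)
    fix z c assume "z \<in> space_time" "c < - v z"
    then have "\<forall>\<^sub>F y in at z within space_time. v y < - c" using us by (simp add: usc_on_def)
    then show "\<forall>\<^sub>F y in at z within space_time. c < - v y" by eventually_elim simp
  qed
  moreover have "let p = space_grad \<phi> x t; H = space_hessian \<phi> x t in
          (p \<noteq> 0 \<longrightarrow> time_deriv \<phi> x t - space_laplacian \<phi> x t + ((H *v p) \<bullet> p) / (norm p)\<^sup>2 \<ge> 0) \<and>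
          (p = 0 \<longrightarrow> time_deriv \<phi> x t - space_laplacian \<phi> x t + lambda_max H \<ge> 0)"
    if \<phi>: "Ck_on 2 space_time \<phi>" and t: "t > 0"
      and min: "\<forall>\<^sub>F z in nhds (x, t). - v z - \<phi> z \<ge> - v (x, t) - \<phi> (x, t)" for \<phi> x t
  proof -
    have "Ck_on 2 space_time (\<lambda>z. - \<phi> z)" by (rule Ck_on_uminus[OF open_space_time \<phi>])
    moreover have "\<forall>\<^sub>F z in nhds (x, t). v z - (- \<phi> z) \<le> v (x, t) - (- \<phi> (x, t))"
      using min by eventually_elim simp
    ultimately have "let p = space_grad (\<lambda>z. - \<phi> z) x t; H = space_hessian (\<lambda>z. - \<phi> z) x t in
          (p \<noteq> 0 \<longrightarrow> time_deriv (\<lambda>z. - \<phi> z) x t - space_laplacian (\<lambda>z. - \<phi> z) x t + ((H *v p) \<bullet> p) / (norm p)\<^sup>2 \<le> 0) \<and>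
          (p = 0 \<longrightarrow> time_deriv (\<lambda>z. - \<phi> z) x t - space_laplacian (\<lambda>z. - \<phi> z) x t + lambda_min H \<le> 0)"
      using assms t unfolding viscosity_subsolution_def by blast
    moreover have "(- H) *v (- p) = H *v p" for H :: "real^2^2" and p
      by (simp add: vec_eq_iff forall_2 matrix_vector_2)
    ultimately show ?thesis
      unfolding Let_def uminus_derivatives(5)[OF \<phi> t] unfolding uminus_derivatives[OF \<phi> t] by (auto simp: algebra_simps)
  qed
  ultimately show ?thesis unfolding viscosity_supersolution_def by blast
qed

lemma lower_limit_uminus: "lower_limit \<tau> u z = - upper_limit \<tau> (\<lambda>h k m n. - u h k m n) z"
proof -
  obtain x t where z: "z = (x, t)" by (cases z)
  have "(\<lambda>(h, k, m, n). ereal (- u h k m n)) = (\<lambda>y. - (case y of (h, k, m, n) \<Rightarrow> ereal (u h k m n)))"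
    by (auto simp: fun_eq_iff)
  then show ?thesis by (simp add: z lower_limit_def upper_limit_def ereal_Limsup_uminus)
qed

section \<open>The thresholding scheme\<close>

lemma thresholding_scheme_values:
  assumes "thresholding_scheme s0 \<Omega> h \<tau> u" "s0 \<in> {-1, 1}"
  shows "u k m n \<in> {-1, 1}"
proof (cases k)
  case 0
  then show ?thesis using assms(1) by (simp add: thresholding_scheme_def)
next
  case (Suc j)
  then obtain w where "u k m n = sign_conv s0 (w m n \<tau>)"
    using assms(1) unfolding thresholding_scheme_def by blast
  then show ?thesis using assms(2) by (auto simp: sign_conv_def sgn_if)
qed

lemma expectation_sign_nonneg:
  fixes f :: "'a \<Rightarrow> real"
  assumes "\<And>x. f x \<in> {-1, 1}" "0 \<le> measure_pmf.expectation M f"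
  shows "1 / 2 \<le> measure_pmf.prob M {x. f x = 1}"
proof -
  have "f = (\<lambda>x. 2 * indicator {x. f x = 1} x - 1)" using assms(1) by (auto simp: fun_eq_iff indicator_def)
  then have "measure_pmf.expectation M f = measure_pmf.expectation M (\<lambda>x. 2 * indicator {x. f x = 1} x - 1)" by simp
  also have "\<dots> = 2 * measure_pmf.prob M {x. f x = 1} - 1"
  proof (subst Bochner_Integration.integral_diff)
    show "integrable M (\<lambda>x. 2 * indicator {x. f x = 1} x :: real)"
      by (rule integrable_measure_pmf_bounded[where B = 2]) (simp add: indicator_def)
  qed simp_all
  finally show ?thesis using assms(2) by simp
qed

text \<open>Multiplying by \<sigma> treats both phases at once. In a tie, w = 0 and \<sigma> w is
  still nonnegative, so the bound does not depend on the sign convention.\<close>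

lemma thresholding_scheme_step:
  assumes "thresholding_scheme s0 \<Omega> h \<tau> u" "s0 \<in> {-1, 1}" "h > 0" "\<tau> > 0" "\<sigma> \<in> {-1, 1 :: real}" "u (Suc k) m n = \<sigma>"
  shows "1 / 2 \<le> measure_pmf.prob (heat_pmf (\<tau> / h\<^sup>2)) {(i, j). u k (m + i) (n + j) = \<sigma>}"
proof -
  note val = thresholding_scheme_values[OF assms(1,2)]
  obtain w where w: "bounded_heat_solution h \<tau> (u k) w" "\<And>m n. u (Suc k) m n = sign_conv s0 (w m n \<tau>)"
    using assms(1) unfolding thresholding_scheme_def by blast
  let ?M = "heat_pmf (\<tau> / h\<^sup>2)"
  have "w m n \<tau> = measure_pmf.expectation ?M (\<lambda>(i, j). u k (m + i) (n + j))"
  proof (rule bounded_heat_solution_expectation[OF w(1) _ assms(3,4)])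
    show "\<bar>u k m n\<bar> \<le> 1" for m n using val[of k m n] by auto
  qed
  then have E: "\<sigma> * w m n \<tau> = measure_pmf.expectation ?M (\<lambda>e. \<sigma> * u k (m + fst e) (n + snd e))"
    by (simp add: case_prod_unfold)
  have "0 \<le> \<sigma> * w m n \<tau>"
    using w(2)[of m n] assms(5,6) by (auto simp: sign_conv_def sgn_if split: if_splits)
  then have "1 / 2 \<le> measure_pmf.prob ?M {e. \<sigma> * u k (m + fst e) (n + snd e) = 1}"
    unfolding E using val[of k] assms(5) by (intro expectation_sign_nonneg) force+
  also have "{e. \<sigma> * u k (m + fst e) (n + snd e) = 1} = {(i, j). u k (m + i) (n + j) = \<sigma>}"
    using val[of k] assms(5) by force
  finally show ?thesis .
qed

theorem theorem1:
  fixes \<Omega>0 :: "(real^2) set"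
    and C \<gamma> s0 :: real
    and \<tau> :: "real \<Rightarrow> real"
    and u :: "real \<Rightarrow> nat \<Rightarrow> int \<Rightarrow> int \<Rightarrow> real"
  assumes "smooth_bounded_domain \<Omega>0"
    and "C > 0" and "\<gamma> > 1" and "s0 \<in> {-1, 1}"
    and "\<And>h. h > 0 \<Longrightarrow> \<tau> h > 0 \<and> h = C * \<tau> h powr \<gamma>"
    and "\<And>h. h > 0 \<Longrightarrow> thresholding_scheme s0 \<Omega>0 h (\<tau> h) (u h)"
  shows "viscosity_subsolution (upper_limit \<tau> u) \<and> viscosity_supersolution (lower_limit \<tau> u)"
proof
  have val: "u h k m n \<in> {-1, 1}" if "h > 0" for h k m n
    by (rule thresholding_scheme_values[OF assms(6)[OF that] assms(4)])
  have fam: "threshold_family \<tau> (\<lambda>h k m n. u h k m n = \<sigma>)" if "\<sigma> \<in> {-1, 1}" for \<sigma>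
    unfolding threshold_family_def
    using thresholding_scheme_step[OF assms(6) assms(4) _ _ that] assms(5) by blast
  show "viscosity_subsolution (upper_limit \<tau> u)"
    by (rule upper_limit_subsolution[OF assms(2,3,5) val fam]) simp_all
  \<comment> \<open>The reflected data are handled directly through the threshold property of the
    phase u = -1; -u need not be a scheme started from a domain.\<close>
  have "viscosity_subsolution (upper_limit \<tau> (\<lambda>h k m n. - u h k m n))"
  proof (rule upper_limit_subsolution[OF assms(2,3,5)])
    show "- u h k m n \<in> {-1, 1}" if "h > 0" for h k m n using val[OF that, of k m n] by auto
    have "(\<lambda>h k m n. - u h k m n = 1) = (\<lambda>h k m n. u h k m n = -1)" by (auto simp: fun_eq_iff)
    then show "threshold_family \<tau> (\<lambda>h k m n. - u h k m n = 1)" using fam[of "-1"] by simp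
  qed
  from viscosity_supersolution_uminus[OF this] show "viscosity_supersolution (lower_limit \<tau> u)"
    by (simp add: lower_limit_uminus[symmetric])
qed

end
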